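(* Let $\gamma\in V_{\mathbb C}^*$, $\mu\in T^\vee$, let $\bar\mu\in U^\vee$ be the restriction of $\mu$ to $U$, and $\bar\gamma=\gamma\otimes\bar\mu$. Let $i,\sigma,R_i^+$ be attached to $\mu$ as in the context, and for $\nu\in V_{\mathbb C}^*$ put $P_i(\nu)=\{\alpha\in R_i^+:\nu(\alpha)=\pm2k\}$. (a) If $W_A(\mu)=W_A(\bar\mu)$, then $N(\bar\gamma)$ is a simple $\mathbb H_D$-module if and only if $P_i({}^\sigma\gamma)=\emptyset$. (b) If $W_A(\mu)\ne W_A(\bar\mu)$, then $n=2m$ is even, $i=m$, and $N(\bar\gamma)$ is a simple $\mathbb H_D$-module if and only if $P_m({}^\sigma\gamma)=\emptyset$ and ${}^{\tau}\gamma\notin W_m\cdot{}^\sigma\gamma$, where $W_m=W(R_m)$, $W_m\cdot\lambda=\{{}^w\lambda:w\in W_m\}$ for $\lambda\in V_{\mathbb C}^*$, $\tau\in GL(V_{\mathbb C})$ is the involution exchanging $\epsilon_j$ and $\epsilon_{m+j}$ for $1\le j\le m$, and ${}^\tau\gamma(\xi)=\gamma(\tau(\xi))$ for $\xi\in V_{\mathbb C}$.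
   Context: Let $n\ge 2$ and let $V$ be a real Euclidean space with orthonormal basis $\epsilon_1,\dots,\epsilon_n$; $V_{\mathbb C}$ is its complexification, $V_{\mathbb C}^*$ the dual of $V_{\mathbb C}$, $S(V_{\mathbb C})$ the symmetric algebra. Let $R_B=\{\pm\epsilon_i\pm\epsilon_j\ (i<j),\ \pm\epsilon_l\}$ be the root system of type $B_n$, with Weyl group $W_B\subset GL(V)$. For a root $\alpha$, $s_\alpha$ is the reflection and $\alpha^\vee\in V^*$ the coroot, so $s_\alpha(v)=v-\langle\alpha^\vee,v\rangle\alpha$. Put $\alpha_{i,j}=\epsilon_i-\epsilon_j$, $R_A=\{\alpha_{i,j}:i\ne j\}$, $R_A^+=\{\alpha_{i,j}:i<j\}$, $S_A=\{\alpha_i=\epsilon_i-\epsilon_{i+1}:1\le i\le n-1\}$; $W_A\cong\mathfrak S_n$ is the Weyl group of $R_A$ (permuting the $\epsilon_i$), and $T\cong\{\pm1\}^n$ is the subgroup of $W_B$ generated by the $s_{\epsilon_i}$; $W_B=T\rtimes W_A$. Let $t_w$ ($w\in W_B$) be the standard basis of $\mathbb C W_B$, $t_i=t_{s_{\epsilon_i}}$. Fix $k\in\mathbb C$, $k\neq0$, and put $\tilde k_{\alpha_{i,j}}=k(1+t_it_j)\in\mathbb C T$ for $i\neq j$. $\mathbb H_B$ is the unital associative $\mathbb C$-algebra generated by $S(V_{\mathbb C})$ and $\mathbb C W_B$ (each with its own multiplication) subject to: $t_x\zeta=\zeta t_x$ for $x\in T$, $\zeta\in V$; and $t_{s_\alpha}\zeta=s_\alpha(\zeta)t_{s_\alpha}+\langle\alpha^\vee,s_\alpha(\zeta)\rangle\tilde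 k_\alpha$ for $\alpha\in S_A$, $\zeta\in V$. Let $\delta$ be the automorphism of $\mathbb H_B$ with $\delta(\xi)=\xi$ ($\xi\in V$), $\delta(t_x)=\det(x)t_x$ ($x\in T$), $\delta(t_w)=t_w$ ($w\in W_A$), and $\mathbb H_D=\{h\in\mathbb H_B:\delta(h)=h\}$. Let $U\subset T$ be the subgroup generated by the $s_{\epsilon_i}s_{\epsilon_{i+1}}$, $1\le i\le n-1$; then $\mathbb H_D$ is the subalgebra generated by $V$ and the $t_w$, $w\in U\rtimes W_A$ (the Weyl group of type $D_n$), and $\mathbb H_D=S(V_{\mathbb C})\otimes\mathbb C W_A\otimes\mathbb C U$ as a vector space. $T^\vee,U^\vee$ are the character groups of $T,U$. For $w\in W_A$: ${}^w\mu(x)=\mu(w^{-1}xw)$ for $\mu$ in $T^\vee$ or $U^\vee$; ${}^w\gamma(\zeta)=\gamma(w^{-1}(\zeta))$ for $\gamma\in V_{\mathbb C}^*$. $W_A(\mu)$ and $W_A(\bar\mu)$ are the stabilizers in $W_A$. For $\bar\gamma=\gamma\otimes\bar\mu$, a character of the commutative algebra $S(V_{\mathbb C})\otimes\mathbb C U$ with one-dimensional module $\mathbb C v_{\bar\gamma}$, the principal series module is $N(\bar\gamma)=\mathbb H_D\otimes_{S(V_{\mathbb C})\otimes\mathbb C U}\mathbb C v_{\bar\gamma}$. Given $\mu\in T^\vee$, let $i$ be the number of $j$ with $\mu(t_j)=1$; write $j_1<\dots<j_i$ for the indices with $\mu(t_j)=1$ and $j_{i+1}<\dots<j_n$ for those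 with $\mu(t_j)=-1$. Let $\sigma\in W_A$ be the element with $\sigma(\epsilon_{j_p})=\epsilon_p$ for all $p$. Let $R_i=\{\pm\alpha_{p,q}: 1\le p<q\le i \text{ or } i<p<q\le n\}$ (type $A_{i-1}\times A_{n-i-1}$), $R_i^+=R_i\cap R_A^+$, and $W(R_i)\subset W_A$ its Weyl group.
   Formalization: In (b) the condition is stated as τ(σγ) ∉ W_m·σγ instead of τγ ∉ W_m·σγ; the printed form fails, e.g. for n=2, μ(t_1)=−1, μ(t_2)=1, γ(ε_1)=0, γ(ε_2)=1, where τγ=σγ yet N is simple. *)

theory Defs
  imports "HOL-Algebra.Algebra" "HOL-Library.Poly_Mapping" "Jordan_Normal_Form.Determinant"
begin

section \<open>The root system of type B and its Weyl group\<close>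

text \<open>
  A vector with coordinates indexed by 1, ..., n is a function on the natural numbers that vanishes
  outside {1..n}; the real such functions form V, the complex ones its complexification.
\<close>

type_synonym rvec = "nat \<Rightarrow> real"
type_synonym cvec = "nat \<Rightarrow> complex"
type_synonym endo = "rvec \<Rightarrow> rvec"

definition VR :: "nat \<Rightarrow> rvec set" where
  "VR n = {v. \<forall>j. j \<notin> {1..n} \<longrightarrow> v j = 0}"

definition VC :: "nat \<Rightarrow> cvec set" where
  "VC n = {v. \<forall>j. j \<notin> {1..n} \<longrightarrow> v j = 0}"

definition eps :: "nat \<Rightarrow> rvec" where
  "eps j = (\<lambda>l. if l = j then 1 else 0)"

definition complexify :: "rvec \<Rightarrow> cvec" where
  "complexify v = (\<lambda>l. complex_of_real (v l))"

definition extendC :: "endo \<Rightarrow> cvec \<Rightarrow> cvec" where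
  "extendC w v = (\<lambda>l. Complex (w (\<lambda>j. Re (v j)) l) (w (\<lambda>j. Im (v j)) l))"

definition inner_n :: "nat \<Rightarrow> rvec \<Rightarrow> rvec \<Rightarrow> real" where
  "inner_n n u v = (\<Sum>j=1..n. u j * v j)"

definition coroot :: "nat \<Rightarrow> rvec \<Rightarrow> rvec \<Rightarrow> real" where
  "coroot n \<alpha> v = 2 * inner_n n \<alpha> v / inner_n n \<alpha> \<alpha>"

text \<open>
  Reflections are total functions on real sequences; they fix all coordinates outside {1..n}.
  Hence two elements of a group generated by them are equal as soon as they agree on V, and such a
  group is identified with a subgroup of GL(V).
\<close>

definition reflect :: "nat \<Rightarrow> rvec \<Rightarrow> endo" where
  "reflect n \<alpha> v = (\<lambda>l. v l - coroot n \<alpha> v * \<alpha> l)"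

definition group_gen :: "endo set \<Rightarrow> endo set" where
  "group_gen S = generate (BijGroup UNIV) S"

definition Weyl :: "nat \<Rightarrow> rvec set \<Rightarrow> endo set" where
  "Weyl n R = group_gen (reflect n ` R)"

definition rootA :: "nat \<Rightarrow> nat \<Rightarrow> rvec" where
  "rootA i j = (\<lambda>l. eps i l - eps j l)"

definition R_B :: "nat \<Rightarrow> rvec set" where
  "R_B n = {\<lambda>l. a * eps i l + b * eps j l | a b i j. a \<in> {1, -1} \<and> b \<in> {1, -1} \<and> 1 \<le> i \<and> i < j \<and> j \<le> n}
         \<union> {\<lambda>l. a * eps i l | a i. a \<in> {1, -1} \<and> i \<in> {1..n}}"

definition R_A :: "nat \<Rightarrow> rvec set" where
  "R_A n = {rootA i j | i j. i \<in> {1..n} \<and> j \<in> {1..n} \<and> i \<noteq> j}"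

definition R_A_pos :: "nat \<Rightarrow> rvec set" where
  "R_A_pos n = {rootA i j | i j. 1 \<le> i \<and> i < j \<and> j \<le> n}"

definition W_B :: "nat \<Rightarrow> endo set" where "W_B n = Weyl n (R_B n)"

definition W_A :: "nat \<Rightarrow> endo set" where "W_A n = Weyl n (R_A n)"

definition T_B :: "nat \<Rightarrow> endo set" where "T_B n = Weyl n (eps ` {1..n})"

definition U_D :: "nat \<Rightarrow> endo set" where
  "U_D n = group_gen {reflect n (eps i) \<circ> reflect n (eps (i + 1)) | i. 1 \<le> i \<and> i < n}"

definition det_n :: "nat \<Rightarrow> endo \<Rightarrow> real" where
  "det_n n w = det (mat n n (\<lambda>(i, j). w (eps (j + 1)) (i + 1)))"


section \<open>Algebras by generators and relations\<close>

text \<open>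
  The free associative complex algebra on 'g is the monoid algebra of the free monoid on 'g, with
  empty word 0 and concatenation written additively, as the convolution product of the library requires.
\<close>

datatype 'g fmon = Word (letters: "'g list")

instantiation fmon :: (type) monoid_add
begin
definition zero_fmon :: "'a fmon" where "zero_fmon = Word []"
definition plus_fmon :: "'a fmon \<Rightarrow> 'a fmon \<Rightarrow> 'a fmon" where
  "plus_fmon u v = Word (letters u @ letters v)"
instance by standard (auto simp: zero_fmon_def plus_fmon_def)
end

type_synonym 'g free_alg = "'g fmon \<Rightarrow>\<^sub>0 complex"

definition gen :: "'g \<Rightarrow> 'g free_alg" where
  "gen g = Poly_Mapping.single (Word [g]) 1"

definition scal :: "complex \<Rightarrow> 'g free_alg" where
  "scal c = Poly_Mapping.single 0 c"

definition free_ring :: "'g set \<Rightarrow> 'g free_alg ring" where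
  "free_ring A = \<lparr>carrier = {f. \<forall>u \<in> Poly_Mapping.keys f. set (letters u) \<subseteq> A},
     monoid.mult = (*), monoid.one = 1, ring.zero = 0, ring.add = (+)\<rparr>"


section \<open>The algebra of type B\<close>

datatype gensym = Vec cvec | Grp endo

definition gensB :: "nat \<Rightarrow> gensym set" where
  "gensB n = Vec ` VC n \<union> Grp ` W_B n"

definition ktilde :: "nat \<Rightarrow> complex \<Rightarrow> nat \<Rightarrow> gensym free_alg" where
  "ktilde n k i = scal k * (1 + gen (Grp (reflect n (eps i))) * gen (Grp (reflect n (eps (i + 1)))))"

text \<open>
  The rules lin and comm present the symmetric algebra of the complexification of V; one and mult
  present the group algebra of the Weyl group.
\<close>

inductive_set relsB :: "nat \<Rightarrow> complex \<Rightarrow> gensym free_alg set" for n k where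
  lin: "\<lbrakk>u \<in> VC n; v \<in> VC n\<rbrakk> \<Longrightarrow>
    gen (Vec (\<lambda>l. a * u l + b * v l)) - (scal a * gen (Vec u) + scal b * gen (Vec v)) \<in> relsB n k"
| comm: "\<lbrakk>u \<in> VC n; v \<in> VC n\<rbrakk> \<Longrightarrow>
    gen (Vec u) * gen (Vec v) - gen (Vec v) * gen (Vec u) \<in> relsB n k"
| one: "gen (Grp id) - 1 \<in> relsB n k"
| mult: "\<lbrakk>w \<in> W_B n; w' \<in> W_B n\<rbrakk> \<Longrightarrow>
    gen (Grp w) * gen (Grp w') - gen (Grp (w \<circ> w')) \<in> relsB n k"
| torus: "\<lbrakk>x \<in> T_B n; \<zeta> \<in> VR n\<rbrakk> \<Longrightarrow>
    gen (Grp x) * gen (Vec (complexify \<zeta>)) - gen (Vec (complexify \<zeta>)) * gen (Grp x) \<in> relsB n k"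
| cross: "\<lbrakk>1 \<le> i; i < n; \<alpha> = rootA i (i + 1); \<zeta> \<in> VR n\<rbrakk> \<Longrightarrow>
    gen (Grp (reflect n \<alpha>)) * gen (Vec (complexify \<zeta>))
    - (gen (Vec (complexify (reflect n \<alpha> \<zeta>))) * gen (Grp (reflect n \<alpha>))
       + scal (complex_of_real (coroot n \<alpha> (reflect n \<alpha> \<zeta>))) * ktilde n k i) \<in> relsB n k"

definition idealB :: "nat \<Rightarrow> complex \<Rightarrow> gensym free_alg set" where
  "idealB n k = genideal (free_ring (gensB n)) (relsB n k)"

definition H_B :: "nat \<Rightarrow> complex \<Rightarrow> gensym free_alg set ring" where
  "H_B n k = free_ring (gensB n) Quot idealB n k"

definition clsB :: "nat \<Rightarrow> complex \<Rightarrow> gensym free_alg \<Rightarrow> gensym free_alg set" where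
  "clsB n k f = idealB n k +>\<^bsub>free_ring (gensB n)\<^esub> f"

definition scalB :: "nat \<Rightarrow> complex \<Rightarrow> complex \<Rightarrow> gensym free_alg set" where
  "scalB n k c = clsB n k (scal c)"

definition vecB :: "nat \<Rightarrow> complex \<Rightarrow> cvec \<Rightarrow> gensym free_alg set" where
  "vecB n k \<xi> = clsB n k (gen (Vec \<xi>))"

definition tB :: "nat \<Rightarrow> complex \<Rightarrow> endo \<Rightarrow> gensym free_alg set" where
  "tB n k w = clsB n k (gen (Grp w))"


section \<open>The algebra of type D\<close>

definition delta :: "nat \<Rightarrow> complex \<Rightarrow> gensym free_alg set \<Rightarrow> gensym free_alg set" where
  "delta n k = (THE d. d \<in> ring_iso (H_B n k) (H_B n k) \<and> d \<in> extensional (carrier (H_B n k)) \<and>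
     (\<forall>c. d (scalB n k c) = scalB n k c) \<and>
     (\<forall>\<xi> \<in> VR n. d (vecB n k (complexify \<xi>)) = vecB n k (complexify \<xi>)) \<and>
     (\<forall>x \<in> T_B n. d (tB n k x) = scalB n k (complex_of_real (det_n n x)) \<otimes>\<^bsub>H_B n k\<^esub> tB n k x) \<and>
     (\<forall>w \<in> W_A n. d (tB n k w) = tB n k w))"

definition H_D :: "nat \<Rightarrow> complex \<Rightarrow> gensym free_alg set ring" where
  "H_D n k = (H_B n k)\<lparr>carrier := {h \<in> carrier (H_B n k). delta n k h = h}\<rparr>"

text \<open>
  The commutative algebra that is the tensor product of the symmetric algebra and the group algebra
  of U, realised inside the algebra of type D by multiplication.
\<close>

definition SU :: "nat \<Rightarrow> complex \<Rightarrow> gensym free_alg set set" where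
  "SU n k = generate_ring (H_D n k) (range (scalB n k) \<union> vecB n k ` VC n \<union> tB n k ` U_D n)"


section \<open>Modules over noncommutative rings\<close>

text \<open>The locale module of HOL-Algebra requires a commutative ring.\<close>

locale left_module = R?: ring R + M?: abelian_group M
  for R :: "('a, 'r) ring_scheme" (structure) and M :: "('a, 'b, 'm) module_scheme" (structure) +
  assumes smult_closed: "\<lbrakk>a \<in> carrier R; x \<in> carrier M\<rbrakk> \<Longrightarrow> a \<odot>\<^bsub>M\<^esub> x \<in> carrier M"
    and smult_l_distr: "\<lbrakk>a \<in> carrier R; b \<in> carrier R; x \<in> carrier M\<rbrakk> \<Longrightarrow>
      (a \<oplus>\<^bsub>R\<^esub> b) \<odot>\<^bsub>M\<^esub> x = (a \<odot>\<^bsub>M\<^esub> x) \<oplus>\<^bsub>M\<^esub> (b \<odot>\<^bsub>M\<^esub> x)"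
    and smult_r_distr: "\<lbrakk>a \<in> carrier R; x \<in> carrier M; y \<in> carrier M\<rbrakk> \<Longrightarrow>
      a \<odot>\<^bsub>M\<^esub> (x \<oplus>\<^bsub>M\<^esub> y) = (a \<odot>\<^bsub>M\<^esub> x) \<oplus>\<^bsub>M\<^esub> (a \<odot>\<^bsub>M\<^esub> y)"
    and smult_assoc: "\<lbrakk>a \<in> carrier R; b \<in> carrier R; x \<in> carrier M\<rbrakk> \<Longrightarrow>
      (a \<otimes>\<^bsub>R\<^esub> b) \<odot>\<^bsub>M\<^esub> x = a \<odot>\<^bsub>M\<^esub> (b \<odot>\<^bsub>M\<^esub> x)"
    and smult_one: "x \<in> carrier M \<Longrightarrow> \<one>\<^bsub>R\<^esub> \<odot>\<^bsub>M\<^esub> x = x"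

definition simple_module :: "('a, 'r) ring_scheme \<Rightarrow> ('a, 'b, 'm) module_scheme \<Rightarrow> bool" where
  "simple_module R M \<longleftrightarrow> left_module R M \<and> carrier M \<noteq> {\<zero>\<^bsub>M\<^esub>} \<and>
     (\<forall>L. submodule L R M \<longrightarrow> L = {\<zero>\<^bsub>M\<^esub>} \<or> L = carrier M)"

text \<open>
  The tensor product of R with a left module M over a subring A of R: the free abelian group on
  pairs (r, m) modulo biadditivity and A-balancedness. R acts by r (s, m) = (r s, m). The fields
  mult and one of the module record are not part of a module structure.
\<close>

definition tensor_rels :: "('a, 'r) ring_scheme \<Rightarrow> 'a set \<Rightarrow> ('a, 'b, 'm) module_scheme
    \<Rightarrow> ('a \<times> 'b \<Rightarrow>\<^sub>0 int) set" where
  "tensor_rels R A M =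
     {frag_of (r \<oplus>\<^bsub>R\<^esub> s, m) - (frag_of (r, m) + frag_of (s, m))
       | r s m. r \<in> carrier R \<and> s \<in> carrier R \<and> m \<in> carrier M}
   \<union> {frag_of (r, m \<oplus>\<^bsub>M\<^esub> m') - (frag_of (r, m) + frag_of (r, m'))
       | r m m'. r \<in> carrier R \<and> m \<in> carrier M \<and> m' \<in> carrier M}
   \<union> {frag_of (r \<otimes>\<^bsub>R\<^esub> a, m) - frag_of (r, a \<odot>\<^bsub>M\<^esub> m)
       | r a m. r \<in> carrier R \<and> a \<in> A \<and> m \<in> carrier M}"

definition tensor_module :: "('a, 'r) ring_scheme \<Rightarrow> 'a set \<Rightarrow> ('a, 'b, 'm) module_scheme
    \<Rightarrow> ('a, ('a \<times> 'b \<Rightarrow>\<^sub>0 int) set) module" where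
  "tensor_module R A M =
     (let F = free_Abelian_group (carrier R \<times> carrier M);
          K = generate F (tensor_rels R A M)
      in \<lparr>carrier = carrier (F Mod K), monoid.mult = undefined, monoid.one = undefined,
          ring.zero = \<one>\<^bsub>F Mod K\<^esub>, ring.add = monoid.mult (F Mod K),
          module.smult = (\<lambda>r C. \<Union>x \<in> C. K #>\<^bsub>F\<^esub> frag_extend (\<lambda>(s, m). frag_of (r \<otimes>\<^bsub>R\<^esub> s, m)) x)\<rparr>)"


section \<open>Characters, stabilisers and principal series\<close>

definition char_group :: "endo set \<Rightarrow> (endo \<Rightarrow> complex) set" where
  "char_group G = {\<chi> \<in> G \<rightarrow>\<^sub>E (UNIV - {0}). \<forall>x\<in>G. \<forall>y\<in>G. \<chi> (x \<circ> y) = \<chi> x * \<chi> y}"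

definition act_char :: "endo set \<Rightarrow> endo \<Rightarrow> (endo \<Rightarrow> complex) \<Rightarrow> endo \<Rightarrow> complex" where
  "act_char G w \<chi> = (\<lambda>x\<in>G. \<chi> (inv_into UNIV w \<circ> x \<circ> w))"

definition stabA :: "nat \<Rightarrow> endo set \<Rightarrow> (endo \<Rightarrow> complex) \<Rightarrow> endo set" where
  "stabA n G \<chi> = {w \<in> W_A n. act_char G w \<chi> = \<chi>}"

definition dualVC :: "nat \<Rightarrow> (cvec \<Rightarrow> complex) set" where
  "dualVC n = {\<gamma> \<in> VC n \<rightarrow>\<^sub>E UNIV. \<forall>u \<in> VC n. \<forall>v \<in> VC n. \<forall>a b.
     \<gamma> (\<lambda>l. a * u l + b * v l) = a * \<gamma> u + b * \<gamma> v}"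

definition act_dual :: "nat \<Rightarrow> endo \<Rightarrow> (cvec \<Rightarrow> complex) \<Rightarrow> cvec \<Rightarrow> complex" where
  "act_dual n w \<gamma> = (\<lambda>\<xi>\<in>VC n. \<gamma> (extendC (inv_into UNIV w) \<xi>))"

definition charSU :: "nat \<Rightarrow> complex \<Rightarrow> (cvec \<Rightarrow> complex) \<Rightarrow> (endo \<Rightarrow> complex)
    \<Rightarrow> gensym free_alg set \<Rightarrow> complex" where
  "charSU n k \<gamma> \<chi> = (THE f. f \<in> extensional (SU n k) \<and>
     f \<in> Ring.ring_hom ((H_D n k)\<lparr>carrier := SU n k\<rparr>)
           \<lparr>carrier = UNIV, monoid.mult = (*), monoid.one = 1, ring.zero = 0, ring.add = (+)\<rparr> \<and>
     (\<forall>c. f (scalB n k c) = c) \<and>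
     (\<forall>\<xi> \<in> VC n. f (vecB n k \<xi>) = \<gamma> \<xi>) \<and>
     (\<forall>x \<in> U_D n. f (tB n k x) = \<chi> x))"

definition one_dim :: "('a \<Rightarrow> complex) \<Rightarrow> ('a, complex) module" where
  "one_dim f = \<lparr>carrier = UNIV, monoid.mult = (*), monoid.one = 1, ring.zero = 0, ring.add = (+),
     module.smult = (\<lambda>a z. f a * z)\<rparr>"

definition principal_series :: "nat \<Rightarrow> complex \<Rightarrow> (cvec \<Rightarrow> complex) \<Rightarrow> (endo \<Rightarrow> complex)
    \<Rightarrow> (gensym free_alg set, (gensym free_alg set \<times> complex \<Rightarrow>\<^sub>0 int) set) module" where
  "principal_series n k \<gamma> \<chi> = tensor_module (H_D n k) (SU n k) (one_dim (charSU n k \<gamma> \<chi>))"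


section \<open>Combinatorial data attached to a character of T\<close>

definition plus_set :: "nat \<Rightarrow> (endo \<Rightarrow> complex) \<Rightarrow> nat set" where
  "plus_set n \<mu> = {j \<in> {1..n}. \<mu> (reflect n (eps j)) = 1}"

definition minus_set :: "nat \<Rightarrow> (endo \<Rightarrow> complex) \<Rightarrow> nat set" where
  "minus_set n \<mu> = {j \<in> {1..n}. \<mu> (reflect n (eps j)) = -1}"

text \<open>The list of the indices j(1), ..., j(n); list positions start at 0.\<close>

definition jlist :: "nat \<Rightarrow> (endo \<Rightarrow> complex) \<Rightarrow> nat list" where
  "jlist n \<mu> = sorted_list_of_set (plus_set n \<mu>) @ sorted_list_of_set (minus_set n \<mu>)"

definition sigma :: "nat \<Rightarrow> (endo \<Rightarrow> complex) \<Rightarrow> endo" where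
  "sigma n \<mu> = (THE w. w \<in> W_A n \<and> (\<forall>p \<in> {1..n}. w (eps (jlist n \<mu> ! (p - 1))) = eps p))"

definition R_sub :: "nat \<Rightarrow> nat \<Rightarrow> rvec set" where
  "R_sub n i = {\<lambda>l. a * rootA p q l | a p q. a \<in> {1, -1} \<and>
     (1 \<le> p \<and> p < q \<and> q \<le> i \<or> i < p \<and> p < q \<and> q \<le> n)}"

definition P_set :: "nat \<Rightarrow> complex \<Rightarrow> nat \<Rightarrow> (cvec \<Rightarrow> complex) \<Rightarrow> rvec set" where
  "P_set n k i \<nu> = {\<alpha> \<in> R_sub n i \<inter> R_A_pos n.
     \<nu> (complexify \<alpha>) = 2 * k \<or> \<nu> (complexify \<alpha>) = - 2 * k}"

definition tau :: "nat \<Rightarrow> cvec \<Rightarrow> cvec" where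
  "tau m v = (\<lambda>l. if l \<in> {1..m} then v (m + l) else if l \<in> {m + 1..2 * m} then v (l - m) else v l)"

text \<open>
  In the criterion for the case of different stabilisers, the involution tau is applied to the
  sigma-translate of \<gamma>, not to \<gamma>: tau is the non-trivial symmetry of the arrangement in which the
  indices with \<mu>-value 1 come first, and \<gamma> has been moved to this arrangement by sigma.
\<close>

definition act_tau :: "nat \<Rightarrow> nat \<Rightarrow> (cvec \<Rightarrow> complex) \<Rightarrow> cvec \<Rightarrow> complex" where
  "act_tau n m \<gamma> = (\<lambda>\<xi>\<in>VC n. \<gamma> (tau m \<xi>))"

end

theory Submission
  imports Defs "HOL-Combinatorics.Permutations"
begin

text \<open>
  The principal series has a basis indexed by permutations. There U acts diagonally, W_A by
  translation, and V by operators that are triangular for the Bruhat order with diagonal entries the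
  translates of the weight. The coupling between the positions j and l is k (1 + \<mu>(j) \<mu>(l)), so only
  positions of equal sign interact. The pair of weight and sign vector is visible to the algebra of
  type D only up to a global change of the sign vector.

  If two positions of equal sign have weights differing by 2k or -2k, they can be made adjacent by
  invertible intertwiners, and then the intertwiner at that place is nonzero but not invertible. If a
  permutation fixes the weight and reverses all signs, its translate of the generator is a second
  vector of the same weight and yields a nontrivial endomorphism, which is not a scalar.

  Conversely, if neither happens, the weight can be permuted so that positions with the same weight
  and sign are adjacent. A nonzero submodule contains a weight vector, moved to the weight of the
  generator by intertwiners and then supported on the stabiliser of the weight, which is now a
  parabolic subgroup. Applying the operators of V, one block position at a time, pushes the support
  to the longest element and finally isolates the generator.
\<close>

section \<open>Operators on functions of permutations\<close>

text \<open>Two inputs of different nature fix the size of the induced module. The operators below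
  satisfy every defining relation of the algebra, which keeps the translates of the generator
  linearly independent; straightening of words shows that they span. The obstacle is that the
  operators of V do not visibly commute: their closed formula is known, but a product of two of them
  is not easily compared term by term. The constant 2k is the coupling on equal signs. The
  intertwiner of two adjacent positions is T + z, with z the coupling divided by the difference of
  the weights, and (T + z)(T - z) = 1 - z^2, so it fails to be invertible exactly when that
  difference is 2k or -2k. Signs enter only through products of two of them, because U contains no
  single reflection; a permutation that reverses all signs therefore counts as fixing them. Both
  \<open>delta\<close> and the character of the commutative subalgebra are given by definite
  descriptions, so existence and uniqueness of each have to be established before anything can be
  computed with them.\<close>

declare One_nat_def [simp del]

abbreviation tr :: "nat \<Rightarrow> nat \<Rightarrow> nat \<Rightarrow> nat" where
  "tr \<equiv> Transposition.transpose"

section \<open>Transpositions and induction along adjacent swaps\<close>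

lemma comp_transpose_inj:
  assumes "inj f"
  shows "f \<circ> tr a b = tr (f a) (f b) \<circ> f"
  using assms by (auto simp: fun_eq_iff Transposition.transpose_def inj_eq)

lemma transpose_permutes_Icc:
  "1 \<le> a \<Longrightarrow> a \<le> n \<Longrightarrow> 1 \<le> b \<Longrightarrow> b \<le> n \<Longrightarrow> tr a b permutes {1..n}"
  by (simp add: permutes_swap_id)

lemma permutes_comp_right_iff:
  assumes "g permutes S"
  shows "\<rho> \<circ> g permutes S \<longleftrightarrow> \<rho> permutes S"
proof
  assume "\<rho> \<circ> g permutes S"
  then have "\<rho> \<circ> g \<circ> inv_into UNIV g permutes S"
    using permutes_compose[OF permutes_inv[OF assms]] by blast
  then show "\<rho> permutes S"
    by (simp add: comp_assoc permutes_inv_o[OF assms])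
qed (rule permutes_compose[OF assms])

text \<open>The cross relation of the algebra exists only for simple reflections, so facts about all
  permutations are reached by appending adjacent transpositions on the right. A transposition at
  larger distance is a shorter one conjugated by an adjacent one.\<close>

lemma permutes_adjacent_induct [consumes 1, case_names id swap]:
  fixes \<rho> :: "nat \<Rightarrow> nat"
  assumes "\<rho> permutes {1..n}"
    and "P id"
    and step: "\<And>\<rho> i. \<rho> permutes {1..n} \<Longrightarrow> P \<rho> \<Longrightarrow> 1 \<le> i \<Longrightarrow> i < n \<Longrightarrow> P (\<rho> \<circ> tr i (i + 1))"
  shows "P \<rho>"
proof -
  have adj: "P (\<rho> \<circ> tr a (a + Suc d))"
    if "\<rho> permutes {1..n}" "P \<rho>" "1 \<le> a" "a + Suc d \<le> n" for \<rho> a d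
    using that
  proof (induction d arbitrary: \<rho>)
    case 0
    then show ?case using step[of \<rho> a] by (simp only: Suc_eq_plus1 add_0)
  next
    case (Suc d)
    let ?t = "tr (a + Suc d) (a + Suc d + 1)"
    have t: "?t permutes {1..n}" using Suc.prems by (intro transpose_permutes_Icc) auto
    have 1: "P (\<rho> \<circ> ?t)" using Suc.prems by (intro step) auto
    have p1: "\<rho> \<circ> ?t permutes {1..n}" by (rule permutes_compose[OF t Suc.prems(1)])
    have 2: "P (\<rho> \<circ> ?t \<circ> tr a (a + Suc d))"
      by (rule Suc.IH[OF p1 1]) (use Suc.prems in auto)
    have p2: "\<rho> \<circ> ?t \<circ> tr a (a + Suc d) permutes {1..n}"
      by (rule permutes_compose[OF _ p1]) (use Suc.prems in \<open>auto intro!: transpose_permutes_Icc\<close>)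
    have 3: "P (\<rho> \<circ> ?t \<circ> tr a (a + Suc d) \<circ> ?t)"
      using step[OF p2 2, of "a + Suc d"] Suc.prems by simp
    have "?t \<circ> tr a (a + Suc d) \<circ> ?t = tr a (a + Suc (Suc d))"
      by (auto simp: fun_eq_iff Transposition.transpose_def)
    with 3 show ?case by (metis comp_assoc)
  qed
  have tra: "P (\<rho> \<circ> tr a b)"
    if "\<rho> permutes {1..n}" "P \<rho>" "a \<in> {1..n}" "b \<in> {1..n}" "a \<noteq> b" for \<rho> a b
  proof (cases "a < b")
    case True
    then show ?thesis using adj[of \<rho> a "b - Suc a"] that by simp
  next
    case False
    then show ?thesis using adj[of \<rho> b "a - Suc b"] that
      by (simp add: transpose_commute)
  qed
  show ?thesis
    using finite_atLeastAtMost assms(1)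
    by (induction rule: permutes_rev_induct) (use assms(2) tra in \<open>auto simp: comp_def id_def\<close>)
qed

text \<open>Index pairs standing for the positive roots of type A.\<close>

definition pairs :: "nat \<Rightarrow> (nat \<times> nat) set" where
  "pairs n = {(j, l). 1 \<le> j \<and> j < l \<and> l \<le> n}"

lemma finite_pairs [simp]: "finite (pairs n)"
  by (rule finite_subset[of _ "{..n} \<times> {..n}"]) (auto simp: pairs_def)

text \<open>A function f on permutations stands for the sum of f(\<open>\<rho>\<close>) t_w \<otimes> v over all \<open>\<rho>\<close>, with w inverse to \<open>\<rho>\<close>.\<close>

type_synonym pfun = "(nat \<Rightarrow> nat) \<Rightarrow> complex"

text \<open>Indexing by inverses turns left multiplication by t_g into right translation of the
  argument, and \<open>g \<mapsto> Tr g\<close> becomes multiplicative in the given order.\<close>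

definition Tr :: "(nat \<Rightarrow> nat) \<Rightarrow> pfun \<Rightarrow> pfun" where
  "Tr g f = (\<lambda>\<rho>. f (\<rho> \<circ> g))"

text \<open>The action of t_j t_l: moving this element past t_w, with w inverse to \<rho>, replaces
  the indices j and l by their images under \<rho>.\<close>

definition Dop :: "(nat \<Rightarrow> complex) \<Rightarrow> nat \<Rightarrow> nat \<Rightarrow> pfun \<Rightarrow> pfun" where
  "Dop \<mu> j l f = (\<lambda>\<rho>. \<mu> (\<rho> j) * \<mu> (\<rho> l) * f \<rho>)"

definition vac :: pfun where
  "vac = (\<lambda>\<rho>. if \<rho> = id then 1 else 0)"

lemma Tr_Tr: "Tr g (Tr h f) = Tr (g \<circ> h) f"
  by (simp add: Tr_def comp_assoc)

lemma Tr_id [simp]: "Tr id f = f"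
  by (simp add: Tr_def)

section \<open>The operators of the principal series on functions of permutations\<close>

locale hecke_model =
  fixes n :: nat and k :: complex
begin

definition Fn :: "pfun set" where
  "Fn = {f. \<forall>\<rho>. \<not> \<rho> permutes {1..n} \<longrightarrow> f \<rho> = 0}"

text \<open>The closed form of the iterated cross relation for the vector with coordinates
  \<open>a\<close>. Moving it past t_w leaves one correction for every pair j < l on which \<rho> is
  increasing. The value of \<open>f\<close> is then taken at \<rho> with these two entries
  exchanged, which is longer in the Bruhat order; so a value of \<open>f\<close> is carried only to
  the same or to shorter permutations.\<close>

definition Xop :: "(nat \<Rightarrow> complex) \<Rightarrow> (nat \<Rightarrow> complex) \<Rightarrow> (nat \<Rightarrow> complex) \<Rightarrow> pfun \<Rightarrow> pfun" where
  "Xop \<gamma> \<mu> a f = (\<lambda>\<rho>. (\<Sum>j\<in>{1..n}. a j * \<gamma> (\<rho> j)) * f \<rho>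
     + (\<Sum>(j, l)\<in>pairs n. if \<rho> j < \<rho> l
          then (a l - a j) * (k * (1 + \<mu> (\<rho> j) * \<mu> (\<rho> l))) * f (\<rho> \<circ> tr j l) else 0))"

lemma FnD: "f \<in> Fn \<Longrightarrow> \<not> \<rho> permutes {1..n} \<Longrightarrow> f \<rho> = 0"
  by (simp add: Fn_def)

lemma Fn_eqI:
  assumes "f \<in> Fn" "g \<in> Fn" "\<And>\<rho>. \<rho> permutes {1..n} \<Longrightarrow> f \<rho> = g \<rho>"
  shows "f = g"
proof (rule ext)
  fix \<rho> show "f \<rho> = g \<rho>" by (cases "\<rho> permutes {1..n}") (use assms in \<open>auto simp: Fn_def\<close>)
qed

lemma Fn_add [intro]: "f \<in> Fn \<Longrightarrow> g \<in> Fn \<Longrightarrow> (\<lambda>\<rho>. f \<rho> + g \<rho>) \<in> Fn"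
  by (simp add: Fn_def)

lemma Fn_scale [intro]: "f \<in> Fn \<Longrightarrow> (\<lambda>\<rho>. c * f \<rho>) \<in> Fn"
  by (simp add: Fn_def)

lemma Fn_zero [intro]: "(\<lambda>\<rho>. 0) \<in> Fn"
  by (simp add: Fn_def)

lemma Fn_sum: "(\<And>i. i \<in> I \<Longrightarrow> f i \<in> Fn) \<Longrightarrow> (\<lambda>\<rho>. \<Sum>i\<in>I. f i \<rho>) \<in> Fn"
  by (simp add: Fn_def)

lemma Tr_Fn [intro]: "g permutes {1..n} \<Longrightarrow> f \<in> Fn \<Longrightarrow> Tr g f \<in> Fn"
  by (auto simp: Fn_def Tr_def permutes_comp_right_iff)

lemma Dop_Fn [intro]: "f \<in> Fn \<Longrightarrow> Dop \<mu> j l f \<in> Fn"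
  by (auto simp: Fn_def Dop_def)

lemma vac_Fn [intro]: "vac \<in> Fn"
  by (auto simp: Fn_def vac_def permutes_id)

lemma pairs_permutes: "(j, l) \<in> pairs n \<Longrightarrow> tr j l permutes {1..n}"
  by (auto simp: pairs_def intro!: transpose_permutes_Icc)

lemma Xop_Fn [intro]: "f \<in> Fn \<Longrightarrow> Xop \<gamma> \<mu> a f \<in> Fn"
  unfolding Fn_def Xop_def
  by (auto intro!: sum.neutral simp: permutes_comp_right_iff[OF pairs_permutes])

lemma Xop_add: "Xop \<gamma> \<mu> a (\<lambda>\<rho>. f \<rho> + g \<rho>) = (\<lambda>\<rho>. Xop \<gamma> \<mu> a f \<rho> + Xop \<gamma> \<mu> a g \<rho>)"
  by (rule ext) (auto simp: Xop_def distrib_left sum.distrib[symmetric] intro!: sum.cong)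

lemma Xop_scale: "Xop \<gamma> \<mu> a (\<lambda>\<rho>. c * f \<rho>) = (\<lambda>\<rho>. c * Xop \<gamma> \<mu> a f \<rho>)"
  by (rule ext) (auto simp: Xop_def distrib_left sum_distrib_left intro!: sum.cong)

lemma Xop_lin: "Xop \<gamma> \<mu> (\<lambda>j. c * a j + d * b j) f = (\<lambda>\<rho>. c * Xop \<gamma> \<mu> a f \<rho> + d * Xop \<gamma> \<mu> b f \<rho>)"
proof (rule ext)
  fix \<rho>
  have 1: "(\<Sum>j\<in>{1..n}. (c * a j + d * b j) * \<gamma> (\<rho> j)) =
    c * (\<Sum>j\<in>{1..n}. a j * \<gamma> (\<rho> j)) + d * (\<Sum>j\<in>{1..n}. b j * \<gamma> (\<rho> j))"
    by (simp add: sum_distrib_left sum.distrib[symmetric] algebra_simps)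
  have 2: "(\<Sum>(j, l)\<in>pairs n. if \<rho> j < \<rho> l then (c * a l + d * b l - (c * a j + d * b j)) *
        (k * (1 + \<mu> (\<rho> j) * \<mu> (\<rho> l))) * f (\<rho> \<circ> tr j l) else 0)
     = c * (\<Sum>(j, l)\<in>pairs n. if \<rho> j < \<rho> l then (a l - a j) * (k * (1 + \<mu> (\<rho> j) * \<mu> (\<rho> l))) * f (\<rho> \<circ> tr j l) else 0)
     + d * (\<Sum>(j, l)\<in>pairs n. if \<rho> j < \<rho> l then (b l - b j) * (k * (1 + \<mu> (\<rho> j) * \<mu> (\<rho> l))) * f (\<rho> \<circ> tr j l) else 0)"
    unfolding sum_distrib_left sum.distrib[symmetric]
    by (rule sum.cong) (auto simp: algebra_simps)
  show "Xop \<gamma> \<mu> (\<lambda>j. c * a j + d * b j) f \<rho> = c * Xop \<gamma> \<mu> a f \<rho> + d * Xop \<gamma> \<mu> b f \<rho>"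
    unfolding Xop_def 1 2 by (simp add: algebra_simps)
qed

lemma Xop_cong: "(\<And>j. j \<in> {1..n} \<Longrightarrow> a j = b j) \<Longrightarrow> Xop \<gamma> \<mu> a f = Xop \<gamma> \<mu> b f"
  unfolding Xop_def by (rule ext) (auto intro!: arg_cong2[of _ _ _ _ "(+)"] sum.cong simp: pairs_def)

text \<open>Conjugation by the simple transposition permutes the pairs other than
  \<open>(i, i + 1)\<close> among themselves, so their contributions match term by term. On the
  exceptional pair exactly one of the two sides sees an increase, and in either case the difference
  is the correction term.\<close>

lemma Tr_Xop:
  assumes i: "1 \<le> i" "i < n" and inj: "inj \<rho>"
  shows "Tr (tr i (i + 1)) (Xop \<gamma> \<mu> a f) \<rho> = Xop \<gamma> \<mu> (a \<circ> tr i (i + 1)) (Tr (tr i (i + 1)) f) \<rho>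
     + (a (i + 1) - a i) * (k * (1 + \<mu> (\<rho> i) * \<mu> (\<rho> (i + 1)))) * f \<rho>"
proof -
  let ?s = "tr i (i + 1)"
  let ?P = "pairs n - {(i, i + 1)}"
  define g1 where "g1 = (\<lambda>(j, l). if \<rho> (?s j) < \<rho> (?s l)
    then (a l - a j) * (k * (1 + \<mu> (\<rho> (?s j)) * \<mu> (\<rho> (?s l)))) * f (\<rho> \<circ> ?s \<circ> tr j l) else 0)"
  define g2 where "g2 = (\<lambda>(j, l). if \<rho> j < \<rho> l
    then (a (?s l) - a (?s j)) * (k * (1 + \<mu> (\<rho> j) * \<mu> (\<rho> l))) * f (\<rho> \<circ> tr j l \<circ> ?s) else 0)"
  have mem: "(i, i + 1) \<in> pairs n" using i by (simp add: pairs_def)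
  have d: "(\<Sum>j\<in>{1..n}. a j * \<gamma> (\<rho> (?s j))) = (\<Sum>j\<in>{1..n}. a (?s j) * \<gamma> (\<rho> j))"
    by (rule sum.reindex_bij_witness[of _ ?s ?s]) (use i in \<open>auto simp: Transposition.transpose_def\<close>)
  have mem_P: "(?s j, ?s l) \<in> ?P" if "(j, l) \<in> ?P" for j l
    using that i by (auto simp: pairs_def Transposition.transpose_def split: if_splits)
  have s: "sum g1 ?P = sum g2 ?P"
  proof (rule sum.reindex_bij_witness[of _ "\<lambda>(j, l). (?s j, ?s l)" "\<lambda>(j, l). (?s j, ?s l)"])
    fix x assume x: "x \<in> ?P"
    obtain j l where [simp]: "x = (j, l)" by (cases x)
    have "tr (?s j) (?s l) \<circ> ?s = ?s \<circ> tr j l"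
      by (rule comp_transpose_inj[symmetric]) simp
    then have "\<rho> \<circ> tr (?s j) (?s l) \<circ> ?s = \<rho> \<circ> ?s \<circ> tr j l" by (simp add: comp_assoc)
    then show "g2 (case x of (j, l) \<Rightarrow> (?s j, ?s l)) = g1 x"
      by (simp add: g1_def g2_def)
  qed (use mem_P in auto)
  have e1: "sum g1 (pairs n) = g1 (i, i + 1) + sum g1 ?P"
    using sum.remove[OF finite_pairs mem] .
  have e2: "sum g2 (pairs n) = g2 (i, i + 1) + sum g2 ?P"
    using sum.remove[OF finite_pairs mem] .
  have ne: "\<rho> i \<noteq> \<rho> (i + 1)" using inj by (simp add: inj_eq)
  have g: "g1 (i, i + 1) = g2 (i, i + 1) + (a (i + 1) - a i) * (k * (1 + \<mu> (\<rho> i) * \<mu> (\<rho> (i + 1)))) * f \<rho>"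
  proof (cases "\<rho> i < \<rho> (i + 1)")
    case True
    then have "\<not> \<rho> (i + 1) < \<rho> i" by simp
    then show ?thesis using True by (simp add: g1_def g2_def comp_assoc algebra_simps)
  next
    case False
    then have "\<rho> (i + 1) < \<rho> i" using ne by simp
    then show ?thesis using False by (simp add: g1_def g2_def comp_assoc algebra_simps)
  qed
  have l: "Tr ?s (Xop \<gamma> \<mu> a f) \<rho> = (\<Sum>j\<in>{1..n}. a j * \<gamma> (\<rho> (?s j))) * f (\<rho> \<circ> ?s) + sum g1 (pairs n)"
    unfolding Tr_def Xop_def g1_def comp_apply ..
  have r: "Xop \<gamma> \<mu> (a \<circ> ?s) (Tr ?s f) \<rho> = (\<Sum>j\<in>{1..n}. a (?s j) * \<gamma> (\<rho> j)) * f (\<rho> \<circ> ?s) + sum g2 (pairs n)"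
    unfolding Tr_def Xop_def g2_def comp_apply ..
  show ?thesis unfolding l r d e1 e2 g s by simp
qed

text \<open>
  At the longest permutation no pair is increasing, so the operators of V act there by a scalar;
  a relation among them has only to be checked at this point and transported by translations.
\<close>

definition rev_perm :: "nat \<Rightarrow> nat" where
  "rev_perm j = (if j \<in> {1..n} then n + 1 - j else j)"

lemma rev_perm_permutes: "rev_perm permutes {1..n}"
  by (rule bij_imp_permutes[OF bij_betw_byWitness[of _ rev_perm]]) (auto simp: rev_perm_def)

lemma Xop_rev_perm: "Xop \<gamma> \<mu> a f rev_perm = (\<Sum>j\<in>{1..n}. a j * \<gamma> (rev_perm j)) * f rev_perm"
proof -
  have "(\<Sum>(j, l)\<in>pairs n. if rev_perm j < rev_perm l
     then (a l - a j) * (k * (1 + \<mu> (rev_perm j) * \<mu> (rev_perm l))) * f (rev_perm \<circ> tr j l) else 0) = 0"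
    by (rule sum.neutral) (auto simp: pairs_def rev_perm_def)
  then show ?thesis by (simp add: Xop_def)
qed

text \<open>The action of \<open>ktilde\<close>, that is of k (1 + t_i t_(i+1)).\<close>

definition Kop :: "(nat \<Rightarrow> complex) \<Rightarrow> nat \<Rightarrow> pfun \<Rightarrow> pfun" where
  "Kop \<mu> i f = (\<lambda>\<rho>. k * (1 + \<mu> (\<rho> i) * \<mu> (\<rho> (i + 1))) * f \<rho>)"

text \<open>The test for a multiplication operator to commute with the vectors: off the diagonal,
  \<phi> is compared only at \<rho> and at \<rho> with two entries exchanged, and only where the
  coupling is nonzero.\<close>

lemma Xop_mult:
  assumes "\<And>j l. (j, l) \<in> pairs n \<Longrightarrow>
    (1 + \<mu> (\<rho> j) * \<mu> (\<rho> l)) * \<phi> (\<rho> \<circ> tr j l) = (1 + \<mu> (\<rho> j) * \<mu> (\<rho> l)) * \<phi> \<rho>"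
  shows "Xop \<gamma> \<mu> a (\<lambda>\<rho>. \<phi> \<rho> * f \<rho>) \<rho> = \<phi> \<rho> * Xop \<gamma> \<mu> a f \<rho>"
proof -
  have *: "c * (k * (1 + \<mu> (\<rho> j) * \<mu> (\<rho> l))) * (\<phi> (\<rho> \<circ> tr j l) * z)
     = \<phi> \<rho> * (c * (k * (1 + \<mu> (\<rho> j) * \<mu> (\<rho> l))) * z)" if "(j, l) \<in> pairs n" for j l c z
  proof -
    have "c * (k * (1 + \<mu> (\<rho> j) * \<mu> (\<rho> l))) * (\<phi> (\<rho> \<circ> tr j l) * z)
      = c * k * z * ((1 + \<mu> (\<rho> j) * \<mu> (\<rho> l)) * \<phi> (\<rho> \<circ> tr j l))" by (simp only: mult_ac)
    also have "\<dots> = \<phi> \<rho> * (c * (k * (1 + \<mu> (\<rho> j) * \<mu> (\<rho> l))) * z)"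
      unfolding assms[OF that] by (simp only: mult_ac)
    finally show ?thesis .
  qed
  show ?thesis
    unfolding Xop_def distrib_left[of "\<phi> \<rho>"] sum_distrib_left
  proof (rule arg_cong2[of _ _ _ _ "(+)"])
    show "(\<Sum>x\<in>pairs n. case x of (j, l) \<Rightarrow> if \<rho> j < \<rho> l then (a l - a j) *
          (k * (1 + \<mu> (\<rho> j) * \<mu> (\<rho> l))) * (\<phi> (\<rho> \<circ> tr j l) * f (\<rho> \<circ> tr j l)) else 0)
      = (\<Sum>x\<in>pairs n. \<phi> \<rho> * (case x of (j, l) \<Rightarrow> if \<rho> j < \<rho> l then (a l - a j) *
          (k * (1 + \<mu> (\<rho> j) * \<mu> (\<rho> l))) * f (\<rho> \<circ> tr j l) else 0))"
    proof (rule sum.cong[OF refl], clarify)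
      fix j l assume "(j, l) \<in> pairs n"
      then show "(if \<rho> j < \<rho> l then (a l - a j) *
          (k * (1 + \<mu> (\<rho> j) * \<mu> (\<rho> l))) * (\<phi> (\<rho> \<circ> tr j l) * f (\<rho> \<circ> tr j l)) else 0)
        = \<phi> \<rho> * (if \<rho> j < \<rho> l then (a l - a j) *
          (k * (1 + \<mu> (\<rho> j) * \<mu> (\<rho> l))) * f (\<rho> \<circ> tr j l) else 0)"
        by (cases "\<rho> j < \<rho> l") (simp_all only: if_True if_False * mult_zero_right)
    qed
  qed (simp only: mult_ac)
qed

text \<open>For signs x and y one has (1 + x y) x = (1 + x y) y: a nonzero coupling forces equal
  signs, and exchanging equal signs changes nothing.\<close>

lemma one_plus_mult_transpose:
  fixes \<mu> :: "nat \<Rightarrow> complex"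
  assumes "\<And>j. \<mu> j * \<mu> j = 1"
  shows "(1 + \<mu> (\<rho> j) * \<mu> (\<rho> l)) * \<mu> (\<rho> (tr j l p)) = (1 + \<mu> (\<rho> j) * \<mu> (\<rho> l)) * \<mu> (\<rho> p)"
proof -
  have *: "(1 + \<mu> u * \<mu> v) * \<mu> v = (1 + \<mu> u * \<mu> v) * \<mu> u" for u v
  proof -
    have "(1 + \<mu> u * \<mu> v) * \<mu> v = \<mu> v + \<mu> u * (\<mu> v * \<mu> v)" by (simp add: algebra_simps)
    also have "\<dots> = \<mu> v * (\<mu> u * \<mu> u) + \<mu> u" by (simp add: assms)
    also have "\<dots> = (1 + \<mu> u * \<mu> v) * \<mu> u" by (simp add: algebra_simps)
    finally show ?thesis .
  qed
  show ?thesis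
    using *[of "\<rho> j" "\<rho> l"] by (auto simp: Transposition.transpose_def mult.commute)
qed

lemma Xop_Dop:
  assumes "\<And>j. \<mu> j * \<mu> j = 1"
  shows "Xop \<gamma> \<mu> a (Dop \<mu> p q f) = Dop \<mu> p q (Xop \<gamma> \<mu> a f)"
proof (rule ext)
  fix \<rho>
  have "(1 + \<mu> (\<rho> j) * \<mu> (\<rho> l)) * (\<mu> (\<rho> (tr j l p)) * \<mu> (\<rho> (tr j l q)))
      = (1 + \<mu> (\<rho> j) * \<mu> (\<rho> l)) * (\<mu> (\<rho> p) * \<mu> (\<rho> q))" for j l
    by (metis (no_types, lifting) one_plus_mult_transpose[of \<mu> \<rho> j l, OF assms] mult.assoc mult.commute)
  then show "Xop \<gamma> \<mu> a (Dop \<mu> p q f) \<rho> = Dop \<mu> p q (Xop \<gamma> \<mu> a f) \<rho>"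
    using Xop_mult[of \<mu> \<rho> "\<lambda>\<rho>. \<mu> (\<rho> p) * \<mu> (\<rho> q)" \<gamma> a f] by (simp add: Dop_def)
qed

lemma Xop_Kop:
  assumes "\<And>j. \<mu> j * \<mu> j = 1"
  shows "Xop \<gamma> \<mu> a (Kop \<mu> i f) = Kop \<mu> i (Xop \<gamma> \<mu> a f)"
proof -
  have "Kop \<mu> i f = (\<lambda>\<rho>. k * f \<rho> + k * Dop \<mu> i (i + 1) f \<rho>)" for f
    by (auto simp: Kop_def Dop_def algebra_simps)
  then show ?thesis by (simp only: Xop_add Xop_scale Xop_Dop[OF assms])
qed

lemma Kop_Fn [intro]: "f \<in> Fn \<Longrightarrow> Kop \<mu> i f \<in> Fn"
  by (auto simp: Fn_def Kop_def)

lemma Tr_Xop_eq: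
  assumes i: "1 \<le> i" "i < n" and f: "f \<in> Fn"
  shows "Tr (tr i (i + 1)) (Xop \<gamma> \<mu> a f) = (\<lambda>\<rho>. Xop \<gamma> \<mu> (a \<circ> tr i (i + 1)) (Tr (tr i (i + 1)) f) \<rho>
     + (a (i + 1) - a i) * Kop \<mu> i f \<rho>)"
proof (rule Fn_eqI)
  have s: "tr i (i + 1) permutes {1..n}" using i by (intro transpose_permutes_Icc) auto
  show "Tr (tr i (i + 1)) (Xop \<gamma> \<mu> a f) \<in> Fn" using s f by blast
  show "(\<lambda>\<rho>. Xop \<gamma> \<mu> (a \<circ> tr i (i + 1)) (Tr (tr i (i + 1)) f) \<rho>
     + (a (i + 1) - a i) * Kop \<mu> i f \<rho>) \<in> Fn" using s f by (intro Fn_add Fn_scale Xop_Fn Tr_Fn Kop_Fn)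
  fix \<rho> assume "\<rho> permutes {1..n}"
  then have "inj \<rho>" by (rule permutes_inj)
  from Tr_Xop[OF i this, of \<gamma> \<mu> a f]
  show "Tr (tr i (i + 1)) (Xop \<gamma> \<mu> a f) \<rho> = Xop \<gamma> \<mu> (a \<circ> tr i (i + 1)) (Tr (tr i (i + 1)) f) \<rho>
     + (a (i + 1) - a i) * Kop \<mu> i f \<rho>" by (simp add: Kop_def)
qed

lemma Xop_commute:
  assumes f: "f \<in> Fn" and sgn: "\<And>j. \<mu> j * \<mu> j = 1"
  shows "Xop \<gamma> \<mu> a (Xop \<gamma> \<mu> b f) = Xop \<gamma> \<mu> b (Xop \<gamma> \<mu> a f)"
proof (rule Fn_eqI)
  let ?P = "\<lambda>\<rho>. \<forall>a b. \<forall>f\<in>Fn. Xop \<gamma> \<mu> a (Xop \<gamma> \<mu> b f) \<rho> = Xop \<gamma> \<mu> b (Xop \<gamma> \<mu> a f) \<rho>"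
  fix \<rho> assume \<rho>: "\<rho> permutes {1..n}"
  \<comment> \<open>Factoring \<rho> through \<open>rev_perm\<close> on the left makes the adjacent
    induction start at \<open>rev_perm\<close> instead of the identity.\<close>
  have "?P (rev_perm \<circ> (inv_into UNIV rev_perm \<circ> \<rho>))"
  proof (rule permutes_adjacent_induct[where P = "\<lambda>\<rho>. ?P (rev_perm \<circ> \<rho>)"])
    show "inv_into UNIV rev_perm \<circ> \<rho> permutes {1..n}"
      by (rule permutes_compose[OF \<rho> permutes_inv[OF rev_perm_permutes]])
    show "?P (rev_perm \<circ> id)" by (simp add: Xop_rev_perm)
  next
    fix \<rho> i assume IH: "?P (rev_perm \<circ> \<rho>)" and i: "1 \<le> i" "i < n"
    let ?s = "tr i (i + 1)"
    let ?r = "rev_perm \<circ> \<rho>"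
    have s: "?s permutes {1..n}" using i by (intro transpose_permutes_Icc) auto
    have key: "Xop \<gamma> \<mu> a (Xop \<gamma> \<mu> b f) (?r \<circ> ?s) =
        Xop \<gamma> \<mu> (a \<circ> ?s) (Xop \<gamma> \<mu> (b \<circ> ?s) (Tr ?s f)) ?r
        + (b (i + 1) - b i) * Kop \<mu> i (Xop \<gamma> \<mu> (a \<circ> ?s) f) ?r
        + (a (i + 1) - a i) * Kop \<mu> i (Xop \<gamma> \<mu> b f) ?r" if f: "f \<in> Fn" for a b f
    proof -
      have "Xop \<gamma> \<mu> a (Xop \<gamma> \<mu> b f) (?r \<circ> ?s) = Tr ?s (Xop \<gamma> \<mu> a (Xop \<gamma> \<mu> b f)) ?r" by (simp add: Tr_def)
      also have "\<dots> = Xop \<gamma> \<mu> (a \<circ> ?s) (Tr ?s (Xop \<gamma> \<mu> b f)) ?r + (a (i + 1) - a i) * Kop \<mu> i (Xop \<gamma> \<mu> b f) ?r"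
        using Tr_Xop_eq[OF i Xop_Fn[OF f]] by simp
      also have "Xop \<gamma> \<mu> (a \<circ> ?s) (Tr ?s (Xop \<gamma> \<mu> b f)) = (\<lambda>\<rho>. Xop \<gamma> \<mu> (a \<circ> ?s) (Xop \<gamma> \<mu> (b \<circ> ?s) (Tr ?s f)) \<rho>
         + (b (i + 1) - b i) * Kop \<mu> i (Xop \<gamma> \<mu> (a \<circ> ?s) f) \<rho>)"
        unfolding Tr_Xop_eq[OF i f] by (simp only: Xop_add Xop_scale Xop_Kop[OF sgn])
      finally show ?thesis .
    qed
    \<comment> \<open>The vector \<open>a \<circ> ?s\<close> is \<open>a\<close> plus a multiple of
      the simple root. After this substitution the correction terms of \<open>key\<close> are
      symmetric in \<open>a\<close> and \<open>b\<close>.\<close>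
    have sub: "Xop \<gamma> \<mu> (a \<circ> ?s) f ?r = Xop \<gamma> \<mu> a f ?r + (a (i + 1) - a i) * Xop \<gamma> \<mu> (\<lambda>j. if j = i then 1 else if j = i + 1 then -1 else 0) f ?r" for a f
    proof -
      have "a \<circ> ?s = (\<lambda>j. 1 * a j + (a (i + 1) - a i) * (if j = i then 1 else if j = i + 1 then -1 else 0))"
        by (auto simp: fun_eq_iff Transposition.transpose_def)
      then show ?thesis using Xop_lin[of \<gamma> \<mu> 1 a "a (i + 1) - a i" "\<lambda>j. if j = i then 1 else if j = i + 1 then -1 else 0" f]
        by (simp only: mult_1)
    qed
    show "?P (rev_perm \<circ> (\<rho> \<circ> ?s))"
    proof (intro allI ballI)
      fix a b f assume f: "f \<in> Fn"
      have 1: "Xop \<gamma> \<mu> (a \<circ> ?s) (Xop \<gamma> \<mu> (b \<circ> ?s) (Tr ?s f)) ?r = Xop \<gamma> \<mu> (b \<circ> ?s) (Xop \<gamma> \<mu> (a \<circ> ?s) (Tr ?s f)) ?r"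
        using IH Tr_Fn[OF s f] by blast
      have "Xop \<gamma> \<mu> a (Xop \<gamma> \<mu> b f) (?r \<circ> ?s) = Xop \<gamma> \<mu> b (Xop \<gamma> \<mu> a f) (?r \<circ> ?s)"
        unfolding key[OF f] 1 Kop_def sub[of a f] sub[of b f] by (simp add: algebra_simps)
      then show "Xop \<gamma> \<mu> a (Xop \<gamma> \<mu> b f) (rev_perm \<circ> (\<rho> \<circ> ?s)) = Xop \<gamma> \<mu> b (Xop \<gamma> \<mu> a f) (rev_perm \<circ> (\<rho> \<circ> ?s))"
        by (simp add: comp_assoc)
    qed
  qed
  moreover have "rev_perm \<circ> (inv_into UNIV rev_perm \<circ> \<rho>) = \<rho>"
    using permutes_inv_o(1)[OF rev_perm_permutes] by (simp add: comp_assoc[symmetric])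
  ultimately show "Xop \<gamma> \<mu> a (Xop \<gamma> \<mu> b f) \<rho> = Xop \<gamma> \<mu> b (Xop \<gamma> \<mu> a f) \<rho>" using f by auto
qed (use f in blast)+

end

section \<open>Weight vectors and intertwiners\<close>

lemma sign_eq:
  fixes x y :: complex
  assumes "x * x = 1" "y * y = 1" "1 + x * y \<noteq> 0"
  shows "x = y"
proof -
  have "(x - y) * (1 + x * y) = x - y + (x * x) * y - x * (y * y)" by (simp add: algebra_simps)
  also have "\<dots> = 0" by (simp add: assms)
  finally show ?thesis using assms(3) by simp
qed

context hecke_model
begin

lemma adj_permutes: "1 \<le> i \<Longrightarrow> i < n \<Longrightarrow> tr i (i + 1) permutes {1..n}"
  by (intro transpose_permutes_Icc) auto

text \<open>The function concentrated at \<pi> is the translate of \<open>vac\<close> by the inverse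
  of \<pi>, so \<open>vac\<close> generates \<open>Fn\<close> under W_A alone. A linear identity
  then has to be checked at \<open>vac\<close> and shown to survive adjacent translations.\<close>

lemma Fn_induct [consumes 1, case_names zero vac add scale swap]:
  assumes c: "c \<in> Fn"
    and zero: "P (\<lambda>\<rho>. 0)"
    and vac: "P vac"
    and add: "\<And>f g. f \<in> Fn \<Longrightarrow> g \<in> Fn \<Longrightarrow> P f \<Longrightarrow> P g \<Longrightarrow> P (\<lambda>\<rho>. f \<rho> + g \<rho>)"
    and scale: "\<And>f z. f \<in> Fn \<Longrightarrow> P f \<Longrightarrow> P (\<lambda>\<rho>. z * f \<rho>)"
    and swap: "\<And>f i. f \<in> Fn \<Longrightarrow> P f \<Longrightarrow> 1 \<le> i \<Longrightarrow> i < n \<Longrightarrow> P (Tr (tr i (i + 1)) f)"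
  shows "P c"
proof -
  have d: "P (Tr (inv_into UNIV \<pi>) vac)" if "\<pi> permutes {1..n}" for \<pi>
    using that
  proof (induction rule: permutes_adjacent_induct)
    case id
    then show ?case using vac by (simp only: inv_id Tr_id)
  next
    case (swap \<rho> i)
    have "inv_into UNIV (\<rho> \<circ> tr i (i + 1)) = tr i (i + 1) \<circ> inv_into UNIV \<rho>"
      using permutes_bij[OF swap.hyps(1)] by (subst o_inv_distrib) auto
    then show ?case
      using assms(6)[OF Tr_Fn[OF permutes_inv[OF swap.hyps(1)] vac_Fn] swap.IH swap.hyps(2,3)]
      by (simp only: Tr_Tr)
  qed
  have fin: "finite {\<pi>. \<pi> permutes {1..n}}" by (rule finite_permutations) simp
  have "P (\<lambda>\<rho>. \<Sum>\<pi>\<in>A. c \<pi> * Tr (inv_into UNIV \<pi>) vac \<rho>)" if "A \<subseteq> {\<pi>. \<pi> permutes {1..n}}" for A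
    using finite_subset[OF that fin] that
  proof (induction rule: finite_induct)
    case empty
    then show ?case using zero by simp
  next
    case (insert \<pi> A)
    then have \<pi>: "\<pi> permutes {1..n}" by auto
    have 1: "P (\<lambda>\<rho>. c \<pi> * Tr (inv_into UNIV \<pi>) vac \<rho>)"
      by (rule scale[OF Tr_Fn[OF permutes_inv[OF \<pi>] vac_Fn] d[OF \<pi>]])
    have "P (\<lambda>\<rho>. c \<pi> * Tr (inv_into UNIV \<pi>) vac \<rho> + (\<Sum>\<pi>\<in>A. c \<pi> * Tr (inv_into UNIV \<pi>) vac \<rho>))"
      by (rule add[OF _ _ 1]) (use insert \<pi> in \<open>auto intro!: Fn_scale Fn_sum Tr_Fn permutes_inv vac_Fn\<close>)
    then show ?case using insert by simp
  qed
  note this[OF subset_refl]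
  moreover have "c = (\<lambda>\<rho>. \<Sum>\<pi>\<in>{\<pi>. \<pi> permutes {1..n}}. c \<pi> * Tr (inv_into UNIV \<pi>) vac \<rho>)"
  proof (rule Fn_eqI[OF c])
    show "(\<lambda>\<rho>. \<Sum>\<pi>\<in>{\<pi>. \<pi> permutes {1..n}}. c \<pi> * Tr (inv_into UNIV \<pi>) vac \<rho>) \<in> Fn"
      by (intro Fn_sum Fn_scale Tr_Fn permutes_inv vac_Fn) auto
    fix \<rho> assume \<rho>: "\<rho> permutes {1..n}"
    have "Tr (inv_into UNIV \<pi>) vac \<rho> = (if \<pi> = \<rho> then 1 else 0)" if "\<pi> permutes {1..n}" for \<pi>
    proof -
      have "\<rho> \<circ> inv_into UNIV \<pi> = id \<longleftrightarrow> \<pi> = \<rho>"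
        using permutes_inv_o[OF that] by (metis comp_assoc comp_id id_comp)
      then show ?thesis unfolding Tr_def vac_def by simp
    qed
    then have "(\<Sum>\<pi>\<in>{\<pi>. \<pi> permutes {1..n}}. c \<pi> * Tr (inv_into UNIV \<pi>) vac \<rho>)
       = (\<Sum>\<pi>\<in>{\<pi>. \<pi> permutes {1..n}}. if \<pi> = \<rho> then c \<pi> else 0)"
      by (intro sum.cong) auto
    then show "c \<rho> = (\<Sum>\<pi>\<in>{\<pi>. \<pi> permutes {1..n}}. c \<pi> * Tr (inv_into UNIV \<pi>) vac \<rho>)"
      using fin \<rho> by simp
  qed
  ultimately show ?thesis by simp
qed

text \<open>A joint eigenvector of V, with \<kappa> the coordinates of the weight, and of the
  products t_p t_q. Only products of two signs occur, so \<nu> is determined up to a global sign at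
  best.\<close>

definition eig :: "(nat \<Rightarrow> complex) \<Rightarrow> (nat \<Rightarrow> complex) \<Rightarrow> (nat \<Rightarrow> complex) \<Rightarrow> (nat \<Rightarrow> complex) \<Rightarrow> pfun \<Rightarrow> bool" where
  "eig \<gamma> \<mu> \<kappa> \<nu> u \<longleftrightarrow> u \<in> Fn \<and>
     (\<forall>a. Xop \<gamma> \<mu> a u = (\<lambda>\<rho>. (\<Sum>j\<in>{1..n}. a j * \<kappa> j) * u \<rho>)) \<and>
     (\<forall>p\<in>{1..n}. \<forall>q\<in>{1..n}. Dop \<mu> p q u = (\<lambda>\<rho>. \<nu> p * \<nu> q * u \<rho>))"

text \<open>The submodules of the model: closed under scalars and under the operators attached to V,
  to W_A and to the products t_p t_q, which together generate the algebra of type D.\<close>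

definition stable :: "(nat \<Rightarrow> complex) \<Rightarrow> (nat \<Rightarrow> complex) \<Rightarrow> pfun set \<Rightarrow> bool" where
  "stable \<gamma> \<mu> L \<longleftrightarrow> L \<subseteq> Fn \<and> (\<lambda>\<rho>. 0) \<in> L \<and> (\<forall>f\<in>L. \<forall>g\<in>L. (\<lambda>\<rho>. f \<rho> + g \<rho>) \<in> L) \<and>
     (\<forall>f\<in>L. \<forall>c. (\<lambda>\<rho>. c * f \<rho>) \<in> L) \<and> (\<forall>f\<in>L. \<forall>a. Xop \<gamma> \<mu> a f \<in> L) \<and>
     (\<forall>f\<in>L. \<forall>g. g permutes {1..n} \<longrightarrow> Tr g f \<in> L) \<and>
     (\<forall>f\<in>L. \<forall>p\<in>{1..n}. \<forall>q\<in>{1..n}. Dop \<mu> p q f \<in> L)"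

definition irred :: "(nat \<Rightarrow> complex) \<Rightarrow> (nat \<Rightarrow> complex) \<Rightarrow> bool" where
  "irred \<gamma> \<mu> \<longleftrightarrow> (\<forall>L. stable \<gamma> \<mu> L \<longrightarrow> L = {\<lambda>\<rho>. 0} \<or> L = Fn)"

lemma eigD:
  assumes "eig \<gamma> \<mu> \<kappa> \<nu> u"
  shows "u \<in> Fn" "Xop \<gamma> \<mu> a u = (\<lambda>\<rho>. (\<Sum>j\<in>{1..n}. a j * \<kappa> j) * u \<rho>)"
    "p \<in> {1..n} \<Longrightarrow> q \<in> {1..n} \<Longrightarrow> Dop \<mu> p q u = (\<lambda>\<rho>. \<nu> p * \<nu> q * u \<rho>)"
    "p \<in> {1..n} \<Longrightarrow> q \<in> {1..n} \<Longrightarrow> \<mu> (\<rho> p) * \<mu> (\<rho> q) * u \<rho> = \<nu> p * \<nu> q * u \<rho>"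
  using assms by (auto simp: eig_def Dop_def fun_eq_iff)

lemma stableD:
  assumes "stable \<gamma> \<mu> L"
  shows "L \<subseteq> Fn" "(\<lambda>\<rho>. 0) \<in> L" "f \<in> L \<Longrightarrow> g \<in> L \<Longrightarrow> (\<lambda>\<rho>. f \<rho> + g \<rho>) \<in> L"
    "f \<in> L \<Longrightarrow> (\<lambda>\<rho>. c * f \<rho>) \<in> L" "f \<in> L \<Longrightarrow> Xop \<gamma> \<mu> a f \<in> L"
    "f \<in> L \<Longrightarrow> h permutes {1..n} \<Longrightarrow> Tr h f \<in> L"
    "f \<in> L \<Longrightarrow> p \<in> {1..n} \<Longrightarrow> q \<in> {1..n} \<Longrightarrow> Dop \<mu> p q f \<in> L"
  using assms unfolding stable_def by blast+

lemma stable_vac: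
  assumes "stable \<gamma> \<mu> L" "vac \<in> L"
  shows "L = Fn"
proof
  show "Fn \<subseteq> L"
  proof
    fix c assume "c \<in> Fn"
    then show "c \<in> L"
      by (induction rule: Fn_induct) (use stableD[OF assms(1)] adj_permutes assms(2) in auto)
  qed
qed (use stableD(1)[OF assms(1)] in auto)

text \<open>The universal map out of the principal series attached to a weight vector \<open>u\<close>.\<close>

definition Hm :: "pfun \<Rightarrow> pfun \<Rightarrow> pfun" where
  "Hm u c = (\<lambda>\<rho>. \<Sum>\<pi>\<in>{\<pi>. \<pi> permutes {1..n}}. c \<pi> * u (\<rho> \<circ> inv_into UNIV \<pi>))"

lemma Hm_add: "Hm u (\<lambda>\<rho>. f \<rho> + g \<rho>) = (\<lambda>\<rho>. Hm u f \<rho> + Hm u g \<rho>)"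
  by (simp add: Hm_def distrib_right sum.distrib)

lemma Hm_scale: "Hm u (\<lambda>\<rho>. z * f \<rho>) = (\<lambda>\<rho>. z * Hm u f \<rho>)"
  by (simp add: Hm_def sum_distrib_left mult.assoc)

lemma Hm_zero: "Hm u (\<lambda>\<rho>. 0) = (\<lambda>\<rho>. 0)"
  by (simp add: Hm_def)

lemma Hm_Fn [intro]: "u \<in> Fn \<Longrightarrow> Hm u c \<in> Fn"
  unfolding Fn_def Hm_def
  by (auto intro!: sum.neutral simp: permutes_comp_right_iff[OF permutes_inv])

lemma Hm_vac: "Hm u vac = u"
proof (rule ext)
  fix \<rho>
  have "Hm u vac \<rho> = (\<Sum>\<pi>\<in>{\<pi>. \<pi> permutes {1..n}}. if \<pi> = id then u \<rho> else 0)"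
    unfolding Hm_def vac_def by (rule sum.cong) (auto simp: comp_def)
  then show "Hm u vac \<rho> = u \<rho>"
    by (simp add: finite_permutations permutes_id)
qed

lemma Hm_Tr:
  assumes g: "g permutes {1..n}"
  shows "Hm u (Tr g c) = Tr g (Hm u c)"
proof (rule ext)
  fix \<rho>
  show "Hm u (Tr g c) \<rho> = Tr g (Hm u c) \<rho>"
    unfolding Hm_def Tr_def
  proof (rule sum.reindex_bij_witness[of _ "\<lambda>\<pi>. \<pi> \<circ> inv_into UNIV g" "\<lambda>\<pi>. \<pi> \<circ> g"])
    fix \<pi> assume "\<pi> \<in> {\<pi>. \<pi> permutes {1..n}}"
    then have \<pi>: "\<pi> permutes {1..n}" by simp
    show "\<pi> \<circ> g \<circ> inv_into UNIV g = \<pi>" "\<pi> \<circ> inv_into UNIV g \<circ> g = \<pi>"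
      by (simp_all only: comp_assoc permutes_inv_o[OF g] comp_id)
    show "\<pi> \<circ> g \<in> {\<pi>. \<pi> permutes {1..n}}" "\<pi> \<circ> inv_into UNIV g \<in> {\<pi>. \<pi> permutes {1..n}}"
      using \<pi> g by (simp_all add: permutes_compose permutes_inv)
    have "inv_into UNIV (\<pi> \<circ> g) = inv_into UNIV g \<circ> inv_into UNIV \<pi>"
      using permutes_bij[OF \<pi>] permutes_bij[OF g] by (rule o_inv_distrib)
    then have "\<rho> \<circ> g \<circ> inv_into UNIV (\<pi> \<circ> g) = \<rho> \<circ> inv_into UNIV \<pi>"
      using permutes_inv_o[OF g] by (metis comp_assoc comp_id)
    then show "c (\<pi> \<circ> g) * u (\<rho> \<circ> g \<circ> inv_into UNIV (\<pi> \<circ> g)) = c (\<pi> \<circ> g) * u (\<rho> \<circ> inv_into UNIV \<pi>)"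
      by simp
  qed
qed

text \<open>The source carries the signs \<nu>, the target the signs \<mu>. The sign condition on
  \<open>u\<close>, used at the positions \<open>\<pi> p\<close> and \<open>\<pi> q\<close>,
  converts one into the other.\<close>

lemma Hm_Dop:
  assumes e: "eig \<gamma> \<mu> \<kappa> \<nu> u" and pq: "p \<in> {1..n}" "q \<in> {1..n}"
  shows "Hm u (Dop \<nu> p q c) = Dop \<mu> p q (Hm u c)"
proof (rule ext)
  fix \<rho>
  have *: "\<nu> (\<pi> p) * \<nu> (\<pi> q) * c \<pi> * u (\<rho> \<circ> inv_into UNIV \<pi>) =
      \<mu> (\<rho> p) * \<mu> (\<rho> q) * (c \<pi> * u (\<rho> \<circ> inv_into UNIV \<pi>))" if \<pi>: "\<pi> permutes {1..n}" for \<pi>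
  proof -
    have "\<pi> p \<in> {1..n}" "\<pi> q \<in> {1..n}" using permutes_in_image[OF \<pi>] pq by auto
    from eigD(4)[OF e this, of "\<rho> \<circ> inv_into UNIV \<pi>"]
    have "\<mu> (\<rho> p) * \<mu> (\<rho> q) * u (\<rho> \<circ> inv_into UNIV \<pi>) = \<nu> (\<pi> p) * \<nu> (\<pi> q) * u (\<rho> \<circ> inv_into UNIV \<pi>)"
      using permutes_inverses(2)[OF \<pi>] by simp
    then have "c \<pi> * (\<mu> (\<rho> p) * \<mu> (\<rho> q) * u (\<rho> \<circ> inv_into UNIV \<pi>)) = c \<pi> * (\<nu> (\<pi> p) * \<nu> (\<pi> q) * u (\<rho> \<circ> inv_into UNIV \<pi>))"
      by (simp only:)
    then show ?thesis by (simp only: mult_ac)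
  qed
  show "Hm u (Dop \<nu> p q c) \<rho> = Dop \<mu> p q (Hm u c) \<rho>"
    unfolding Hm_def Dop_def sum_distrib_left by (rule sum.cong) (use * in auto)
qed

lemma Kop_Dop: "Kop \<mu> i f = (\<lambda>\<rho>. k * f \<rho> + k * Dop \<mu> i (i + 1) f \<rho>)"
  by (auto simp: Kop_def Dop_def algebra_simps)

lemma Hm_Kop:
  assumes e: "eig \<gamma> \<mu> \<kappa> \<nu> u" and i: "1 \<le> i" "i < n"
  shows "Hm u (Kop \<nu> i c) = Kop \<mu> i (Hm u c)"
  using Hm_Dop[OF e, of i "i + 1"] i by (simp add: Kop_Dop Hm_add Hm_scale)

lemma Xop_zero: "Xop \<gamma> \<mu> a (\<lambda>\<rho>. 0) = (\<lambda>\<rho>. 0)"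
  using Xop_scale[of \<gamma> \<mu> a 0 "\<lambda>\<rho>. 0"] by simp

lemma Tr_add: "Tr g (\<lambda>\<rho>. f \<rho> + h \<rho>) = (\<lambda>\<rho>. Tr g f \<rho> + Tr g h \<rho>)"
  by (simp add: Tr_def)

lemma Tr_scale: "Tr g (\<lambda>\<rho>. c * f \<rho>) = (\<lambda>\<rho>. c * Tr g f \<rho>)"
  by (simp add: Tr_def)

text \<open>If \<rho> becomes the identity after exchanging its entries at j < l, then \<rho>
  inverts this pair, so no off-diagonal term of \<open>vac\<close> occurs.\<close>

lemma Xop_vac: "Xop \<gamma> \<mu> a vac = (\<lambda>\<rho>. (\<Sum>j\<in>{1..n}. a j * \<gamma> j) * vac \<rho>)"
proof (rule ext)
  fix \<rho>
  have "(\<Sum>(j, l)\<in>pairs n. if \<rho> j < \<rho> l then (a l - a j) * (k * (1 + \<mu> (\<rho> j) * \<mu> (\<rho> l))) * vac (\<rho> \<circ> tr j l) else 0) = 0"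
  proof (rule sum.neutral, clarify)
    fix j l assume jl: "(j, l) \<in> pairs n"
    have "\<not> \<rho> j < \<rho> l" if "\<rho> \<circ> tr j l = id"
    proof -
      have "\<rho> j = l" "\<rho> l = j"
        using fun_cong[OF that, of l] fun_cong[OF that, of j] by simp_all
      then show ?thesis using jl by (simp add: pairs_def)
    qed
    then show "(if \<rho> j < \<rho> l then (a l - a j) * (k * (1 + \<mu> (\<rho> j) * \<mu> (\<rho> l))) * vac (\<rho> \<circ> tr j l) else 0) = 0"
      unfolding vac_def by auto
  qed
  then show "Xop \<gamma> \<mu> a vac \<rho> = (\<Sum>j\<in>{1..n}. a j * \<gamma> j) * vac \<rho>"
    unfolding Xop_def by (auto simp: vac_def id_def)
qed

lemma eig_vac: "eig \<gamma> \<mu> \<gamma> \<mu> vac"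
  by (auto simp: eig_def Xop_vac vac_Fn) (auto simp: Dop_def vac_def fun_eq_iff)

text \<open>Both sides satisfy the same cross relation, and they agree on the generator.\<close>

lemma Hm_Xop:
  assumes e: "eig \<gamma> \<mu> \<kappa> \<nu> u" and c: "c \<in> Fn"
  shows "Hm u (Xop \<kappa> \<nu> a c) = Xop \<gamma> \<mu> a (Hm u c)"
proof -
  have u: "u \<in> Fn" by (rule eigD(1)[OF e])
  have "\<forall>a. Hm u (Xop \<kappa> \<nu> a c) = Xop \<gamma> \<mu> a (Hm u c)"
    using c
  proof (induction rule: Fn_induct)
    case zero
    then show ?case by (simp add: Xop_zero Hm_zero)
  next
    case vac
    then show ?case by (simp add: Xop_vac Hm_scale Hm_vac eigD(2)[OF e])
  next
    case (add f g)
    then show ?case by (simp add: Xop_add Hm_add)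
  next
    case (scale f z)
    then show ?case by (simp add: Xop_scale Hm_scale)
  next
    case (swap f i)
    let ?s = "tr i (i + 1)"
    note s = adj_permutes[OF swap.hyps(2,3)]
    show ?case
    proof
      fix a
      have eq: "Xop \<gamma>' \<mu>' a (Tr ?s f') = (\<lambda>\<rho>. Tr ?s (Xop \<gamma>' \<mu>' (a \<circ> ?s) f') \<rho> + (a (i + 1) - a i) * Kop \<mu>' i f' \<rho>)"
        if "f' \<in> Fn" for \<gamma>' \<mu>' f'
      proof -
        have ass: "a \<circ> ?s \<circ> ?s = a" by (simp add: comp_assoc)
        show ?thesis
          unfolding Tr_Xop_eq[OF swap.hyps(2,3) that] ass by (simp add: algebra_simps)
      qed
      show "Hm u (Xop \<kappa> \<nu> a (Tr ?s f)) = Xop \<gamma> \<mu> a (Hm u (Tr ?s f))"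
        unfolding Hm_Tr[OF s] eq[OF swap.hyps(1)] eq[OF Hm_Fn[OF u]] Hm_add Hm_scale Hm_Kop[OF e swap.hyps(2,3)]
          swap.IH[rule_format] ..
    qed
  qed
  then show ?thesis by blast
qed

lemma stable_Fn: "stable \<gamma> \<mu> Fn"
  unfolding stable_def by blast

lemma stable_image:
  assumes e: "eig \<gamma> \<mu> \<kappa> \<nu> u" and L: "stable \<kappa> \<nu> L"
  shows "stable \<gamma> \<mu> (Hm u ` L)"
  unfolding stable_def
proof (intro conjI ballI allI impI; (elim imageE)?)
  note S = stableD[OF L]
  show "Hm u ` L \<subseteq> Fn" using eigD(1)[OF e] by auto
  show "(\<lambda>\<rho>. 0) \<in> Hm u ` L" using S(2) Hm_zero by (metis imageI)
  fix f' f assume [simp]: "f' = Hm u f" and f: "f \<in> L"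
  then have fF: "f \<in> Fn" using S(1) by auto
  show "(\<lambda>\<rho>. f' \<rho> + g' \<rho>) \<in> Hm u ` L" if "g' = Hm u g" "g \<in> L" for g' g
    using imageI[OF S(3)[OF f that(2)], of "Hm u"] that(1) by (simp only: Hm_add \<open>f' = Hm u f\<close>)
  show "(\<lambda>\<rho>. c * f' \<rho>) \<in> Hm u ` L" for c
    using imageI[OF S(4)[OF f], of "Hm u"] by (simp only: Hm_scale \<open>f' = Hm u f\<close>)
  show "Xop \<gamma> \<mu> a f' \<in> Hm u ` L" for a
    using imageI[OF S(5)[OF f], of "Hm u"] by (simp only: Hm_Xop[OF e fF] \<open>f' = Hm u f\<close>)
  show "Tr g f' \<in> Hm u ` L" if "g permutes {1..n}" for g
    using imageI[OF S(6)[OF f that], of "Hm u"] by (simp only: Hm_Tr[OF that] \<open>f' = Hm u f\<close>)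
  show "Dop \<mu> p q f' \<in> Hm u ` L" if "p \<in> {1..n}" "q \<in> {1..n}" for p q
    using imageI[OF S(7)[OF f that], of "Hm u"] by (simp only: Hm_Dop[OF e that] \<open>f' = Hm u f\<close>)
qed

lemma stable_vimage:
  assumes e: "eig \<gamma> \<mu> \<kappa> \<nu> u" and L: "stable \<gamma> \<mu> L"
  shows "stable \<kappa> \<nu> {c \<in> Fn. Hm u c \<in> L}"
  unfolding stable_def
proof (intro conjI ballI allI impI)
  note S = stableD[OF L]
  show "(\<lambda>\<rho>. 0) \<in> {c \<in> Fn. Hm u c \<in> L}" using S(2) Fn_zero by (simp add: Hm_zero)
  fix f assume "f \<in> {c \<in> Fn. Hm u c \<in> L}"
  then have fF: "f \<in> Fn" and f: "Hm u f \<in> L" by simp_all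
  show "(\<lambda>\<rho>. f \<rho> + g \<rho>) \<in> {c \<in> Fn. Hm u c \<in> L}" if "g \<in> {c \<in> Fn. Hm u c \<in> L}" for g
    using S(3)[OF f] that fF by (simp add: Hm_add Fn_add)
  show "(\<lambda>\<rho>. c * f \<rho>) \<in> {c \<in> Fn. Hm u c \<in> L}" for c
    using S(4)[OF f] fF by (simp add: Hm_scale Fn_scale)
  show "Xop \<kappa> \<nu> a f \<in> {c \<in> Fn. Hm u c \<in> L}" for a
    using S(5)[OF f] fF by (simp add: Hm_Xop[OF e] Xop_Fn)
  show "Tr g f \<in> {c \<in> Fn. Hm u c \<in> L}" if "g permutes {1..n}" for g
    using S(6)[OF f that] fF that by (simp add: Hm_Tr Tr_Fn)
  show "Dop \<nu> p q f \<in> {c \<in> Fn. Hm u c \<in> L}" if "p \<in> {1..n}" "q \<in> {1..n}" for p q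
    using S(7)[OF f that] fF that by (simp add: Hm_Dop[OF e] Dop_Fn)
qed auto

text \<open>Hitting \<open>vac\<close> makes the map onto. The preimage of a stable subspace is zero
  or everything, and by surjectivity so is the subspace.\<close>

lemma irred_image:
  assumes "irred \<kappa> \<nu>" and e: "eig \<gamma> \<mu> \<kappa> \<nu> u" and v: "vac \<in> Hm u ` Fn"
  shows "irred \<gamma> \<mu>"
  unfolding irred_def
proof (intro allI impI)
  fix L assume L: "stable \<gamma> \<mu> L"
  let ?L = "{c \<in> Fn. Hm u c \<in> L}"
  have im: "Hm u ` Fn = Fn"
    by (rule stable_vac[OF stable_image[OF e stable_Fn] v])
  have "?L = {\<lambda>\<rho>. 0} \<or> ?L = Fn"
    using assms(1) stable_vimage[OF e L] by (simp add: irred_def)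
  then show "L = {\<lambda>\<rho>. 0} \<or> L = Fn"
  proof
    assume 0: "?L = {\<lambda>\<rho>. 0}"
    have "f = (\<lambda>\<rho>. 0)" if "f \<in> L" for f
    proof -
      have "f \<in> Hm u ` Fn" unfolding im using that stableD(1)[OF L] by auto
      then obtain c where c: "c \<in> Fn" "f = Hm u c" by auto
      then have "c \<in> ?L" using that by simp
      then have "c = (\<lambda>\<rho>. 0)" unfolding 0 by simp
      then show ?thesis using c Hm_zero by simp
    qed
    then show ?thesis using stableD(2)[OF L] by blast
  next
    assume "?L = Fn"
    then have "Hm u ` Fn \<subseteq> L" by blast
    then show ?thesis using im stableD(1)[OF L] by blast
  qed
qed

section \<open>Intertwiners of simple reflections\<close>

lemma sum_adjacent_swap:
  fixes a l :: "nat \<Rightarrow> complex"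
  assumes "1 \<le> i" "i < n"
  shows "(\<Sum>j\<in>{1..n}. a j * l (tr i (i + 1) j)) = (\<Sum>j\<in>{1..n}. a j * l j) - (a i - a (i + 1)) * (l i - l (i + 1))"
proof -
  have *: "(\<Sum>j\<in>{1..n}. f j) = f i + f (i + 1) + (\<Sum>j\<in>{1..n} - {i, i + 1}. f j)" for f :: "nat \<Rightarrow> complex"
  proof -
    have "{1..n} = insert i (insert (i + 1) ({1..n} - {i, i + 1}))" using assms by auto
    then have "(\<Sum>j\<in>{1..n}. f j) = (\<Sum>j\<in>insert i (insert (i + 1) ({1..n} - {i, i + 1})). f j)" by simp
    then show ?thesis by simp
  qed
  have "(\<Sum>j\<in>{1..n} - {i, i + 1}. a j * l (tr i (i + 1) j)) = (\<Sum>j\<in>{1..n} - {i, i + 1}. a j * l j)"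
    by (rule sum.cong) (auto simp: Transposition.transpose_def)
  then show ?thesis unfolding * by (simp add: algebra_simps)
qed

text \<open>The intertwiner of a simple reflection. On the translate of \<open>u\<close> the vectors
  act by the exchanged weight up to a multiple of \<open>c * u\<close>; adding \<open>z * u\<close>
  removes this defect precisely when \<open>z * d = c\<close>.\<close>

lemma eig_swap:
  assumes e: "eig \<gamma> \<mu> \<kappa> \<nu> u" and i: "1 \<le> i" "i < n" and sgn: "\<And>j. \<nu> j * \<nu> j = 1"
  defines "c \<equiv> k * (1 + \<nu> i * \<nu> (i + 1))" and "d \<equiv> \<kappa> i - \<kappa> (i + 1)"
  assumes cd: "d \<noteq> 0 \<or> c = 0"
  shows "eig \<gamma> \<mu> (\<kappa> \<circ> tr i (i + 1)) (\<nu> \<circ> tr i (i + 1)) (\<lambda>\<rho>. Tr (tr i (i + 1)) u \<rho> + c / d * u \<rho>)"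
  unfolding eig_def
proof (intro conjI allI ballI)
  let ?s = "tr i (i + 1)"
  note u = eigD(1)[OF e]
  note s = adj_permutes[OF i]
  show "(\<lambda>\<rho>. Tr ?s u \<rho> + c / d * u \<rho>) \<in> Fn" using s u by (intro Fn_add Fn_scale Tr_Fn)
  fix a :: "nat \<Rightarrow> complex"
  have K: "Kop \<mu> i u = (\<lambda>\<rho>. c * u \<rho>)"
    using i by (simp add: Kop_Dop eigD(3)[OF e] c_def algebra_simps)
  have ass: "a \<circ> ?s \<circ> ?s = a" by (simp add: comp_assoc)
  have sm: "(\<Sum>j\<in>{1..n}. a (?s j) * \<kappa> j) = (\<Sum>j\<in>{1..n}. a j * \<kappa> j) - (a i - a (i + 1)) * d"
    using sum_adjacent_swap[OF i, of \<kappa> a] by (simp add: d_def algebra_simps)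
  have sm': "(\<Sum>j\<in>{1..n}. a j * \<kappa> (?s j)) = (\<Sum>j\<in>{1..n}. a j * \<kappa> j) - (a i - a (i + 1)) * d"
    using sum_adjacent_swap[OF i, of a \<kappa>] by (simp add: d_def)
  have T: "Xop \<gamma> \<mu> a (Tr ?s u) \<rho> = (\<Sum>j\<in>{1..n}. a (?s j) * \<kappa> j) * Tr ?s u \<rho> - (a i - a (i + 1)) * (c * u \<rho>)" for \<rho>
    using fun_cong[OF Tr_Xop_eq[OF i u, of \<gamma> \<mu> "a \<circ> ?s"], of \<rho>]
    unfolding ass K eigD(2)[OF e] Tr_scale by (simp add: algebra_simps)
  \<comment> \<open>If \<open>d\<close> vanishes then so does \<open>c\<close>; division by zero
    yields zero, which is the right coefficient in that case.\<close>
  have cd': "c = c / d * d" using cd by auto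
  show "Xop \<gamma> \<mu> a (\<lambda>\<rho>. Tr ?s u \<rho> + c / d * u \<rho>) =
     (\<lambda>\<rho>. (\<Sum>j\<in>{1..n}. a j * (\<kappa> \<circ> ?s) j) * (Tr ?s u \<rho> + c / d * u \<rho>))"
  proof (rule ext)
    fix \<rho>
    let ?S = "\<Sum>j\<in>{1..n}. a j * \<kappa> j"
    have "(?S - (a i - a (i + 1)) * d) * Tr ?s u \<rho> - (a i - a (i + 1)) * (c / d * d * u \<rho>) + c / d * (?S * u \<rho>)
       = (?S - (a i - a (i + 1)) * d) * (Tr ?s u \<rho> + c / d * u \<rho>)"
      by (simp only: algebra_simps)
    then show "Xop \<gamma> \<mu> a (\<lambda>\<rho>. Tr ?s u \<rho> + c / d * u \<rho>) \<rho> =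
       (\<Sum>j\<in>{1..n}. a j * (\<kappa> \<circ> ?s) j) * (Tr ?s u \<rho> + c / d * u \<rho>)"
      unfolding Xop_add Xop_scale T sm comp_apply sm' eigD(2)[OF e] cd'[symmetric] .
  qed
  fix p q assume pq: "p \<in> {1..n}" "q \<in> {1..n}"
  then have pq': "?s p \<in> {1..n}" "?s q \<in> {1..n}" using permutes_in_image[OF s] by auto
  have D1: "\<mu> (\<rho> p) * \<mu> (\<rho> q) * Tr ?s u \<rho> = \<nu> (?s p) * \<nu> (?s q) * Tr ?s u \<rho>" for \<rho>
    using eigD(4)[OF e pq', of "\<rho> \<circ> ?s"] by (simp add: Tr_def)
  \<comment> \<open>The correction term survives only for equal signs at i and i + 1, and then the
    exchange does not alter the sign vector.\<close>
  have D2: "\<mu> (\<rho> p) * \<mu> (\<rho> q) * (c / d * u \<rho>) = \<nu> (?s p) * \<nu> (?s q) * (c / d * u \<rho>)" for \<rho>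
  proof (cases "c = 0")
    case False
    then have "\<nu> i = \<nu> (i + 1)" by (intro sign_eq[OF sgn sgn]) (simp add: c_def)
    then have "\<nu> (?s j) = \<nu> j" for j by (simp add: Transposition.transpose_def)
    then show ?thesis using eigD(4)[OF e pq, of \<rho>] by (simp add: algebra_simps)
  qed simp
  show "Dop \<mu> p q (\<lambda>\<rho>. Tr ?s u \<rho> + c / d * u \<rho>) =
     (\<lambda>\<rho>. (\<nu> \<circ> ?s) p * (\<nu> \<circ> ?s) q * (Tr ?s u \<rho> + c / d * u \<rho>))"
    unfolding Dop_def comp_apply distrib_left D1 D2 ..
qed

text \<open>For equal signs the coupling equals 2k, so for nonzero k these are the differences at
  which the coefficient \<open>c / d\<close> of the intertwiner is 1 or -1.\<close>

definition bad :: "(nat \<Rightarrow> complex) \<Rightarrow> (nat \<Rightarrow> complex) \<Rightarrow> nat \<Rightarrow> nat \<Rightarrow> bool" where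
  "bad \<gamma> \<mu> p q \<longleftrightarrow> \<mu> p = \<mu> q \<and> (\<gamma> p - \<gamma> q = 2 * k \<or> \<gamma> p - \<gamma> q = - 2 * k)"

text \<open>With z the coefficient of the intertwiner, (T + z)(T - z) = 1 - z^2, and this is the
  nonvanishing of the right-hand side. If z is 1 or -1, the coupling is nonzero, hence the signs
  agree and the coupling is 2k.\<close>

lemma coefficient_square_ne_1:
  fixes \<mu> :: "nat \<Rightarrow> complex"
  assumes sgn: "\<And>j. \<mu> j * \<mu> j = 1" and "\<not> bad \<gamma> \<mu> p q"
    and d: "\<gamma> p \<noteq> \<gamma> q \<or> k * (1 + \<mu> p * \<mu> q) = 0"
  shows "(k * (1 + \<mu> p * \<mu> q) / (\<gamma> p - \<gamma> q)) * (k * (1 + \<mu> p * \<mu> q) / (\<gamma> p - \<gamma> q)) \<noteq> 1"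
proof
  let ?c = "k * (1 + \<mu> p * \<mu> q)"
  assume "(?c / (\<gamma> p - \<gamma> q)) * (?c / (\<gamma> p - \<gamma> q)) = 1"
  then have *: "?c / (\<gamma> p - \<gamma> q) = 1 \<or> ?c / (\<gamma> p - \<gamma> q) = -1" by (simp only: square_eq_1_iff)
  then have c0: "?c \<noteq> 0" by auto
  have mm: "\<mu> p = \<mu> q"
    using c0 by (intro sign_eq[OF sgn sgn]) simp
  then have "?c = 2 * k" using sgn[of q] by simp
  moreover have "\<gamma> p - \<gamma> q \<noteq> 0" using c0 d by auto
  ultimately have "\<gamma> p - \<gamma> q = 2 * k \<or> \<gamma> p - \<gamma> q = - 2 * k"
  proof -
    from * \<open>\<gamma> p - \<gamma> q \<noteq> 0\<close> have "?c = \<gamma> p - \<gamma> q \<or> ?c = - (\<gamma> p - \<gamma> q)"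
      by (simp only: divide_eq_eq) simp
    then show ?thesis unfolding \<open>?c = 2 * k\<close> by (metis minus_minus minus_mult_left)
  qed
  then show False using assms(2) mm by (simp add: bad_def)
qed

lemma irred_swap:
  assumes irr: "irred \<gamma> \<mu>" and sgn: "\<And>j. \<mu> j * \<mu> j = 1" and i: "1 \<le> i" "i < n"
    and nb: "\<not> bad \<gamma> \<mu> i (i + 1)"
  shows "irred (\<gamma> \<circ> tr i (i + 1)) (\<mu> \<circ> tr i (i + 1))"
proof (cases "\<gamma> i \<noteq> \<gamma> (i + 1) \<or> k * (1 + \<mu> i * \<mu> (i + 1)) = 0")
  \<comment> \<open>Equal weights together with a nonzero coupling mean equal signs as well, so the
    exchange changes nothing.\<close>
  case False
  then have "\<mu> i = \<mu> (i + 1)" by (intro sign_eq[OF sgn sgn]) simp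
  then have "\<gamma> \<circ> tr i (i + 1) = \<gamma>" "\<mu> \<circ> tr i (i + 1) = \<mu>"
    using False by (auto simp: fun_eq_iff Transposition.transpose_def)
  then show ?thesis using irr by simp
next
  case True
  let ?s = "tr i (i + 1)"
  let ?g = "\<gamma> \<circ> ?s" and ?m = "\<mu> \<circ> ?s"
  note s = adj_permutes[OF i]
  define z where "z = k * (1 + ?m i * ?m (i + 1)) / (?g i - ?g (i + 1))"
  define u where "u = (\<lambda>\<rho>. Tr ?s vac \<rho> + z * vac \<rho>)"
  have "eig ?g ?m (?g \<circ> ?s) (?m \<circ> ?s) u"
    unfolding u_def z_def by (rule eig_swap[OF eig_vac i]) (use True sgn in \<open>auto simp: mult.commute\<close>)
  moreover have "?g \<circ> ?s = \<gamma>" "?m \<circ> ?s = \<mu>" by (simp_all add: comp_assoc)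
  ultimately have e: "eig ?g ?m \<gamma> \<mu> u" by simp
  have "\<not> bad ?g ?m i (i + 1)"
    using nb by (auto simp: bad_def algebra_simps)
  then have z: "z * z \<noteq> 1"
    unfolding z_def using True
    by (intro coefficient_square_ne_1[where \<mu> = ?m and \<gamma> = ?g]) (auto simp: sgn mult.commute)
  \<comment> \<open>The inverse of T + z is (T - z) / (1 - z^2); applied to the generator of the
    source it gives the preimage of \<open>vac\<close>.\<close>
  define c where "c = (\<lambda>\<rho>. 1 / (1 - z * z) * (Tr ?s vac \<rho> + - z * vac \<rho>))"
  have cF: "c \<in> Fn" unfolding c_def using s by (intro Fn_add Fn_scale Tr_Fn vac_Fn)
  have ss: "Tr ?s (Tr ?s vac) = vac" by (simp add: Tr_Tr)
  have "Hm u c = (\<lambda>\<rho>. 1 / (1 - z * z) * (Tr ?s u \<rho> + - z * u \<rho>))"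
    unfolding c_def Hm_scale Hm_add Hm_Tr[OF s] Hm_vac ..
  also have "\<dots> = vac"
  proof (rule ext)
    fix \<rho>
    have T: "Tr ?s u \<rho> = vac \<rho> + z * Tr ?s vac \<rho>"
      unfolding u_def Tr_add Tr_scale ss ..
    have U: "u \<rho> = Tr ?s vac \<rho> + z * vac \<rho>" by (simp only: u_def)
    have "Tr ?s u \<rho> + - z * u \<rho> = (1 - z * z) * vac \<rho>"
      unfolding T U by (simp add: algebra_simps)
    then show "1 / (1 - z * z) * (Tr ?s u \<rho> + - z * u \<rho>) = vac \<rho>" using z by simp
  qed
  finally have "vac \<in> Hm u ` Fn" using cF by (metis imageI)
  then show ?thesis by (rule irred_image[OF irr e])
qed

end

section \<open>The irreducibility criterion\<close>

text \<open>Used to bring positions with equal labels next to each other, so that the stabiliser of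
  the labelling becomes parabolic.\<close>

lemma ex_sorting_permutation:
  fixes h :: "nat \<Rightarrow> nat"
  shows "\<exists>g. g permutes {1..n} \<and> (\<forall>p q. 1 \<le> p \<longrightarrow> p \<le> q \<longrightarrow> q \<le> n \<longrightarrow> h (g p) \<le> h (g q))"
proof -
  define xs where "xs = sort_key h [1..<Suc n]"
  define g where "g j = (if j \<in> {1..n} then xs ! (j - 1) else j)" for j
  have len: "length xs = n" and dist: "distinct xs" and set: "set xs = {1..n}"
    by (auto simp: xs_def)
  have "bij_betw (\<lambda>j. xs ! (j - 1)) {1..n} {1..n}"
  proof -
    have "bij_betw (\<lambda>j. j - 1) {1..n} {..<n}"
      by (rule bij_betw_byWitness[of _ "\<lambda>j. j + 1"]) auto
    moreover have "bij_betw ((!) xs) {..<n} {1..n}"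
      using bij_betw_nth[OF dist, of "{..<n}" "{1..n}"] len set by simp
    ultimately show ?thesis by (auto dest: bij_betw_trans simp: comp_def)
  qed
  then have "bij_betw g {1..n} {1..n}"
    by (rule bij_betw_cong[THEN iffD1, rotated]) (auto simp: g_def)
  then have "g permutes {1..n}"
    by (rule bij_imp_permutes) (auto simp: g_def)
  moreover have "h (g p) \<le> h (g q)" if "1 \<le> p" "p \<le> q" "q \<le> n" for p q
  proof -
    have "sorted (map h xs)" by (simp add: xs_def)
    from sorted_nth_mono[OF this, of "p - 1" "q - 1"] that len
    show ?thesis by (simp add: g_def)
  qed
  ultimately show ?thesis by blast
qed

section \<open>Transport of irreducibility and the two obstructions\<close>

context hecke_model
begin

declare Fn_add [rule del] Fn_scale [rule del] Fn_zero [rule del] Tr_Fn [rule del]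
  Dop_Fn [rule del] Xop_Fn [rule del] Kop_Fn [rule del] Hm_Fn [rule del]

text \<open>The absence of \<open>bad\<close> pairs is preserved by rearrangement, so every adjacent
  exchange on the way is harmless.\<close>

lemma irred_perm:
  assumes irr: "irred \<gamma> \<mu>" and sgn: "\<And>j. \<mu> j * \<mu> j = 1"
    and nb: "\<And>p q. p \<in> {1..n} \<Longrightarrow> q \<in> {1..n} \<Longrightarrow> \<not> bad \<gamma> \<mu> p q"
    and g: "g permutes {1..n}"
  shows "irred (\<gamma> \<circ> g) (\<mu> \<circ> g)"
  using g
proof (induction rule: permutes_adjacent_induct)
  case id
  then show ?case using irr by simp
next
  case (swap \<rho> i)
  have "\<rho> i \<in> {1..n}" "\<rho> (i + 1) \<in> {1..n}"
    using permutes_in_image[OF swap.hyps(1)] swap.hyps(2,3) by auto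
  then have "\<not> bad (\<gamma> \<circ> \<rho>) (\<mu> \<circ> \<rho>) i (i + 1)"
    using nb by (simp add: bad_def)
  then have "irred (\<gamma> \<circ> \<rho> \<circ> tr i (i + 1)) (\<mu> \<circ> \<rho> \<circ> tr i (i + 1))"
    by (intro irred_swap swap.IH swap.hyps) (simp add: sgn)
  then show ?case by (simp only: comp_assoc)
qed

text \<open>The image of \<open>Hm u\<close> consists of combinations of right translates of
  \<open>u\<close>, so it inherits left symmetries of \<open>u\<close>. For \<open>g\<close> other
  than the identity and nonzero \<open>z\<close> the function \<open>vac\<close> lacks this
  symmetry, which is how images are shown to be proper.\<close>

lemma Hm_left_invariant:
  assumes "\<And>\<rho>. u (g \<circ> \<rho>) = z * u \<rho>"
  shows "Hm u c (g \<circ> \<rho>) = z * Hm u c \<rho>"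
  unfolding Hm_def sum_distrib_left
  by (rule sum.cong) (simp_all add: comp_assoc assms)

text \<open>At a \<open>bad\<close> pair z is 1 or -1, and \<open>u\<close> is an eigenfunction of
  left multiplication by the transposition with eigenvalue z. The whole image of \<open>Hm u\<close>
  shares this symmetry, so \<open>vac\<close> is missed although \<open>u\<close> is
  nonzero.\<close>

lemma not_irred_adjacent:
  assumes k: "k \<noteq> 0" and sgn: "\<And>j. \<mu> j * \<mu> j = 1" and i: "1 \<le> i" "i < n"
    and b: "bad \<gamma> \<mu> i (i + 1)"
  shows "\<not> irred \<gamma> \<mu>"
proof
  assume irr: "irred \<gamma> \<mu>"
  let ?s = "tr i (i + 1)"
  define z where "z = k * (1 + \<mu> i * \<mu> (i + 1)) / (\<gamma> i - \<gamma> (i + 1))"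
  define u where "u = (\<lambda>\<rho>. Tr ?s vac \<rho> + z * vac \<rho>)"
  have "\<mu> i = \<mu> (i + 1)" using b by (simp add: bad_def)
  then have c: "k * (1 + \<mu> i * \<mu> (i + 1)) = 2 * k" using sgn by simp
  have z: "z = 1 \<or> z = -1" and d: "\<gamma> i - \<gamma> (i + 1) \<noteq> 0"
    using b k unfolding z_def c bad_def by auto
  then have zz: "z * z = 1" by auto
  have e: "eig \<gamma> \<mu> (\<gamma> \<circ> ?s) (\<mu> \<circ> ?s) u"
    unfolding u_def z_def using d by (intro eig_swap[OF eig_vac i]) (auto simp: sgn)
  have L: "stable \<gamma> \<mu> (Hm u ` Fn)" by (rule stable_image[OF e stable_Fn])
  have s_id: "?s \<noteq> id" by (metis Suc_eq_plus1 id_apply n_not_Suc_n transpose_apply_first)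
  have uid: "u id = z"
    using s_id by (simp add: u_def Tr_def vac_def)
  have "u \<in> Hm u ` Fn" using Hm_vac vac_Fn by (metis imageI)
  moreover have "u \<noteq> (\<lambda>\<rho>. 0)" using uid z by auto
  ultimately have "Hm u ` Fn \<noteq> {\<lambda>\<rho>. 0}" by auto
  then have "Hm u ` Fn = Fn" using irr L unfolding irred_def by blast
  then have "vac \<in> Hm u ` Fn" using vac_Fn by simp
  then obtain c where c: "vac = Hm u c" by auto
  have inv: "u (?s \<circ> \<rho>) = z * u \<rho>" for \<rho>
  proof -
    have 1: "?s \<circ> \<rho> \<circ> ?s = id \<longleftrightarrow> \<rho> = id" "?s \<circ> \<rho> = id \<longleftrightarrow> \<rho> = ?s" "\<rho> \<circ> ?s = id \<longleftrightarrow> \<rho> = ?s"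
    proof -
      have ss: "?s \<circ> ?s = id" by simp
      show "?s \<circ> \<rho> \<circ> ?s = id \<longleftrightarrow> \<rho> = id" using ss by (metis comp_assoc comp_id id_comp)
      show "?s \<circ> \<rho> = id \<longleftrightarrow> \<rho> = ?s" using ss by (metis comp_assoc comp_id id_comp)
      show "\<rho> \<circ> ?s = id \<longleftrightarrow> \<rho> = ?s" using ss by (metis comp_assoc comp_id id_comp)
    qed
    show ?thesis
      unfolding u_def Tr_def vac_def 1 using zz s_id by auto
  qed
  have "vac (?s \<circ> id) = z * vac id"
    using Hm_left_invariant[of u ?s z, OF inv, of c id] unfolding c[symmetric] .
  then show False using z s_id by (auto simp: vac_def)
qed

text \<open>Induction on the distance of the two positions: exchanging p with p + 1 shortens it by
  one and preserves irreducibility, unless p and p + 1 are themselves \<open>bad\<close>, where the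
  adjacent case applies.\<close>

lemma not_irred_bad:
  assumes k: "k \<noteq> 0"
  shows "(\<And>j. \<mu> j * \<mu> j = 1) \<Longrightarrow> 1 \<le> p \<Longrightarrow> p + Suc d \<le> n \<Longrightarrow> bad \<gamma> \<mu> p (p + Suc d) \<Longrightarrow> \<not> irred \<gamma> \<mu>"
proof (induction d arbitrary: p \<gamma> \<mu>)
  case 0
  then show ?case using not_irred_adjacent[OF k, of \<mu> p \<gamma>] by (simp add: Suc_eq_plus1)
next
  case (Suc d)
  let ?s = "tr p (p + 1)"
  show ?case
  proof (cases "bad \<gamma> \<mu> p (p + 1)")
    case True
    then show ?thesis using not_irred_adjacent[OF k, of \<mu> p \<gamma>] Suc.prems by simp
  next
    case False
    have "bad (\<gamma> \<circ> ?s) (\<mu> \<circ> ?s) (p + 1) (p + 1 + Suc d)"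
      using Suc.prems(4) by (simp add: bad_def Transposition.transpose_def One_nat_def)
    then have "\<not> irred (\<gamma> \<circ> ?s) (\<mu> \<circ> ?s)"
    proof (rule Suc.IH[rotated 3])
      show "(\<mu> \<circ> ?s) j * (\<mu> \<circ> ?s) j = 1" for j using Suc.prems(1) by simp
    qed (use Suc.prems in auto)
    then show ?thesis
      using irred_swap[of \<gamma> \<mu> p] False Suc.prems by auto
  qed
qed

lemma bad_sym: "bad \<gamma> \<mu> p q \<longleftrightarrow> bad \<gamma> \<mu> q p"
proof -
  have *: "x - y = 2 * k \<longleftrightarrow> y - x = - 2 * k" "x - y = - 2 * k \<longleftrightarrow> y - x = 2 * k" for x y :: complex
    by (auto simp: algebra_simps)
  show ?thesis unfolding bad_def *[of "\<gamma> p"] by auto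
qed

lemma irred_imp_not_bad:
  assumes "k \<noteq> 0" "irred \<gamma> \<mu>" "\<And>j. \<mu> j * \<mu> j = 1" "p \<in> {1..n}" "q \<in> {1..n}"
  shows "\<not> bad \<gamma> \<mu> p q"
proof -
  have *: "\<not> bad \<gamma> \<mu> p q" if "1 \<le> p" "p < q" "q \<le> n" for p q
    using not_irred_bad[OF assms(1,3), where d = "q - p - 1" and p = p and \<gamma> = \<gamma>] that assms(2) by auto
  consider "p < q" | "q < p" | "p = q" by linarith
  then show ?thesis
  proof cases
    case 3
    then show ?thesis using assms(1) by (simp add: bad_def)
  qed (use *[of p q] *[of q p] bad_sym assms(4,5) in auto)
qed

text \<open>
  The block exchange only inverts pairs of opposite sign, on which the coupling vanishes; so it
  moves the generator to another weight vector without any correction terms.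
\<close>

lemma not_irred_block_swap:
  assumes n: "n = 2 * m" "m > 0" and sgn: "\<And>j. \<mu> j * \<mu> j = 1"
    and \<mu>: "\<And>j. j \<in> {1..m} \<Longrightarrow> \<mu> j = 1" "\<And>j. j \<in> {1..m} \<Longrightarrow> \<mu> (m + j) = -1"
    and \<gamma>: "\<And>j. j \<in> {1..m} \<Longrightarrow> \<gamma> (m + j) = \<gamma> j"
  shows "\<not> irred \<gamma> \<mu>"
proof
  assume irr: "irred \<gamma> \<mu>"
  define t where "t j = (if j \<in> {1..m} then m + j else if j \<in> {m + 1..2 * m} then j - m else j)" for j
  have tt: "t \<circ> t = id" by (auto simp: t_def fun_eq_iff)
  have t: "t permutes {1..n}"
    by (rule bij_imp_permutes[OF bij_betw_byWitness[of _ t]]) (auto simp: t_def n)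
  have t_id: "t \<noteq> id" using n(2) by (auto simp: t_def fun_eq_iff intro!: exI[of _ 1])
  have sub: "j - m \<in> {1..m}" if "j \<in> {1..n}" "\<not> j \<le> m" for j
    using that by (auto simp: n)
  have \<gamma>t: "\<gamma> (t j) = \<gamma> j" if "j \<in> {1..n}" for j
    using \<gamma>[of j] \<gamma>[of "j - m", symmetric] sub[OF that] that by (auto simp: t_def n)
  have \<mu>t: "\<mu> (t j) = - \<mu> j" if "j \<in> {1..n}" for j
    using \<mu>[of j] \<mu>[of "j - m"] sub[OF that] that by (auto simp: t_def n)
  have comp_iff: "\<rho> \<circ> t = id \<longleftrightarrow> \<rho> = t" "t \<circ> \<rho> = id \<longleftrightarrow> \<rho> = t" for \<rho>
    using tt by (metis comp_assoc comp_id id_comp)+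
  have Tv: "Tr t vac \<rho> = (if \<rho> = t then 1 else 0)" for \<rho>
    by (simp add: Tr_def vac_def comp_iff)
  have e: "eig \<gamma> \<mu> \<gamma> \<mu> (Tr t vac)"
    unfolding eig_def
  proof (intro conjI allI ballI)
    show "Tr t vac \<in> Fn" by (rule Tr_Fn[OF t vac_Fn])
    fix a :: "nat \<Rightarrow> complex"
    show "Xop \<gamma> \<mu> a (Tr t vac) = (\<lambda>\<rho>. (\<Sum>j\<in>{1..n}. a j * \<gamma> j) * Tr t vac \<rho>)"
    proof (rule ext)
      fix \<rho>
      have off: "(\<Sum>(j, l)\<in>pairs n. if \<rho> j < \<rho> l
          then (a l - a j) * (k * (1 + \<mu> (\<rho> j) * \<mu> (\<rho> l))) * Tr t vac (\<rho> \<circ> tr j l) else 0) = 0"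
      proof (rule sum.neutral, clarify)
        fix j l assume jl: "(j, l) \<in> pairs n"
        show "(if \<rho> j < \<rho> l
          then (a l - a j) * (k * (1 + \<mu> (\<rho> j) * \<mu> (\<rho> l))) * Tr t vac (\<rho> \<circ> tr j l) else 0) = 0"
        proof (cases "\<rho> j < \<rho> l \<and> \<rho> \<circ> tr j l = t")
          case True
          have rj: "\<rho> j = t l" "\<rho> l = t j"
            using fun_cong[OF conjunct2[OF True], of l] fun_cong[OF conjunct2[OF True], of j] by simp_all
          then have "t l < t j" using True by simp
          then have "l \<in> {m + 1..2 * m}" "j \<in> {1..m}"
            using jl by (auto simp: t_def pairs_def n split: if_splits)
          then have "\<mu> l = -1" "\<mu> j = 1" using \<mu>(2)[of "l - m"] \<mu>(1)[of j] sub[of l] n by auto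
          then have "\<mu> (t l) = 1" "\<mu> (t j) = -1"
            using \<mu>t[of l] \<mu>t[of j] jl by (auto simp: pairs_def)
          then show ?thesis by (simp add: rj)
        qed (auto simp: Tv)
      qed
      have "(\<Sum>j\<in>{1..n}. a j * \<gamma> (t j)) = (\<Sum>j\<in>{1..n}. a j * \<gamma> j)"
        by (rule sum.cong) (auto simp: \<gamma>t)
      then show "Xop \<gamma> \<mu> a (Tr t vac) \<rho> = (\<Sum>j\<in>{1..n}. a j * \<gamma> j) * Tr t vac \<rho>"
        unfolding Xop_def off by (simp add: Tv)
    qed
  next
    fix p q assume "p \<in> {1..n}" "q \<in> {1..n}"
    then show "Dop \<mu> p q (Tr t vac) = (\<lambda>\<rho>. \<mu> p * \<mu> q * Tr t vac \<rho>)"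
      by (auto simp: Dop_def Tv \<mu>t)
  qed
  \<comment> \<open>Both summands are weight vectors of the same weight. Their sum is unchanged by
    left multiplication with the involution \<open>t\<close>, while \<open>vac\<close> is not, so
    the map attached to \<open>u\<close> misses the generator.\<close>
  define u where "u = (\<lambda>\<rho>. vac \<rho> + Tr t vac \<rho>)"
  have e: "eig \<gamma> \<mu> \<gamma> \<mu> u"
    unfolding eig_def
  proof (intro conjI allI ballI)
    show "u \<in> Fn" unfolding u_def by (intro Fn_add Tr_Fn t vac_Fn)
    show "Xop \<gamma> \<mu> a u = (\<lambda>\<rho>. (\<Sum>j\<in>{1..n}. a j * \<gamma> j) * u \<rho>)" for a
      unfolding u_def Xop_add Xop_vac eigD(2)[OF e] by (simp add: distrib_left)
    show "Dop \<mu> p q u = (\<lambda>\<rho>. \<mu> p * \<mu> q * u \<rho>)" if "p \<in> {1..n}" "q \<in> {1..n}" for p q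
      unfolding u_def Dop_def distrib_left eigD(4)[OF e that] eigD(4)[OF eig_vac that] ..
  qed
  have L: "stable \<gamma> \<mu> (Hm u ` Fn)" by (rule stable_image[OF e stable_Fn])
  have "u id = 1" unfolding u_def Tv using t_id by (auto simp: vac_def)
  then have "u \<noteq> (\<lambda>\<rho>. 0)" by auto
  moreover have "u \<in> Hm u ` Fn" using Hm_vac vac_Fn by (metis imageI)
  ultimately have "Hm u ` Fn \<noteq> {\<lambda>\<rho>. 0}" by auto
  then have "Hm u ` Fn = Fn" using irr L unfolding irred_def by blast
  then have "vac \<in> Hm u ` Fn" using vac_Fn by simp
  then obtain c where c: "vac = Hm u c" by auto
  have "u (t \<circ> \<rho>) = 1 * u \<rho>" for \<rho>
  proof -
    have "t \<circ> \<rho> = t \<longleftrightarrow> \<rho> = id"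
    proof
      assume "t \<circ> \<rho> = t"
      then have "t \<circ> t \<circ> \<rho> = t \<circ> t" by (simp only: comp_assoc)
      then show "\<rho> = id" unfolding tt by simp
    qed simp
    then show ?thesis unfolding u_def Tv by (auto simp: vac_def comp_iff)
  qed
  from Hm_left_invariant[of u t 1, OF this, of c id]
  have "vac (t \<circ> id) = 1 * vac id" unfolding c[symmetric] .
  then show False using t_id by (auto simp: vac_def)
qed

text \<open>Reduction to the block exchange: enumerate the positions of sign 1 by \<open>e\<close>
  and those of sign -1 by \<open>w \<circ> e\<close>; after this rearrangement the weight is the
  same on both halves. Irreducibility survives the rearrangement because it already excludes
  \<open>bad\<close> pairs.\<close>

lemma irred_imp_no_sign_swap:
  assumes k: "k \<noteq> 0" and n: "n > 0" and irr: "irred \<gamma> \<mu>" and sgn: "\<And>j. \<mu> j * \<mu> j = 1"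
    and w: "w permutes {1..n}" and \<gamma>w: "\<And>j. j \<in> {1..n} \<Longrightarrow> \<gamma> (w j) = \<gamma> j"
    and \<mu>w: "\<And>j. j \<in> {1..n} \<Longrightarrow> \<mu> (w j) = - \<mu> j"
  shows False
proof -
  have pm: "\<mu> j = 1 \<or> \<mu> j = -1" for j using sgn[of j] by (simp add: square_eq_1_iff)
  define A where "A = {j \<in> {1..n}. \<mu> j = 1}"
  define B where "B = {j \<in> {1..n}. \<mu> j = -1}"
  define m where "m = card A"
  have AB: "A \<union> B = {1..n}" "A \<inter> B = {}" using pm by (auto simp: A_def B_def)
  have fin: "finite A" "finite B" by (auto simp: A_def B_def)
  have wim: "w j \<in> {1..n}" if "j \<in> {1..n}" for j using permutes_in_image[OF w] that by simp
  have "w ` A = B"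
  proof
    show "w ` A \<subseteq> B" using wim \<mu>w by (auto simp: A_def B_def)
    show "B \<subseteq> w ` A"
    proof
      fix j assume j: "j \<in> B"
      have "inv_into UNIV w j \<in> {1..n}"
        using permutes_in_image[OF permutes_inv[OF w], of j] j by (auto simp: B_def)
      moreover have ww: "w (inv_into UNIV w j) = j" by (rule permutes_inverses(1)[OF w])
      ultimately have "inv_into UNIV w j \<in> A"
        using \<mu>w[of "inv_into UNIV w j"] j unfolding A_def B_def by (auto simp: minus_equation_iff)
      then show "j \<in> w ` A" using ww by (metis imageI)
    qed
  qed
  then have bw: "bij_betw w A B"
    using permutes_inj[OF w] by (simp add: bij_betw_def inj_on_def inj_def)
  then have cB: "card B = m" using bij_betw_same_card[OF bw] by (simp add: m_def)
  have n2: "n = 2 * m"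
    using card_Un_disjoint[OF fin AB(2)] cB AB(1) by (simp add: m_def)
  have m0: "m > 0" using n n2 by simp
  obtain e where e: "bij_betw e {1..m} A"
    using ex_bij_betw_nat_finite_1[OF fin(1)] m_def by auto
  define g where "g j = (if j \<in> {1..m} then e j else if j \<in> {m + 1..n} then w (e (j - m)) else j)" for j
  have b1: "bij_betw g {1..m} A"
    using e by (rule bij_betw_cong[THEN iffD1, rotated]) (auto simp: g_def)
  have "bij_betw (\<lambda>j. j - m) {m + 1..n} {1..m}"
    by (rule bij_betw_byWitness[of _ "\<lambda>j. j + m"]) (auto simp: n2)
  from bij_betw_trans[OF bij_betw_trans[OF this e] bw]
  have b2: "bij_betw g {m + 1..n} B"
    by (rule bij_betw_cong[THEN iffD1, rotated]) (auto simp: g_def)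
  have "bij_betw g ({1..m} \<union> {m + 1..n}) (A \<union> B)"
    by (rule bij_betw_combine[OF b1 b2 AB(2)])
  moreover have "{1..m} \<union> {m + 1..n} = {1..n}" using n2 by auto
  ultimately have "bij_betw g {1..n} {1..n}" using AB(1) by simp
  then have g: "g permutes {1..n}"
    by (rule bij_imp_permutes) (auto simp: g_def n2)
  have eA: "e j \<in> A" if "j \<in> {1..m}" for j using e that by (auto simp: bij_betw_def)
  have g2: "g (m + j) = w (e j)" if "j \<in> {1..m}" for j using that by (simp add: g_def n2)
  have "irred (\<gamma> \<circ> g) (\<mu> \<circ> g)"
    by (rule irred_perm[OF irr sgn _ g]) (rule irred_imp_not_bad[OF k irr sgn])
  moreover have "\<not> irred (\<gamma> \<circ> g) (\<mu> \<circ> g)"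
  proof (rule not_irred_block_swap[OF n2 m0])
    fix j assume j: "j \<in> {1..m}"
    have ej: "e j \<in> {1..n}" "\<mu> (e j) = 1" using eA[OF j] by (auto simp: A_def)
    show "(\<mu> \<circ> g) j = 1" using ej j by (simp add: g_def)
    show "(\<mu> \<circ> g) (m + j) = -1" using \<mu>w[OF ej(1)] ej(2) by (simp add: g2[OF j])
    show "(\<gamma> \<circ> g) (m + j) = (\<gamma> \<circ> g) j" using \<gamma>w[OF ej(1)] j by (simp add: g2[OF j]) (simp add: g_def)
  qed (simp add: sgn)
  ultimately show False by simp
qed

section \<open>Existence and support of weight vectors\<close>

definition lvl :: "(nat \<Rightarrow> nat) \<Rightarrow> nat" where
  "lvl \<rho> = (\<Sum>j\<in>{1..n}. j * \<rho> j)"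

text \<open>The rearrangement inequality for two entries. Thus \<open>lvl\<close> is a statistic
  opposite to the length, largest at the identity, and it is strictly monotone along the
  off-diagonal terms of \<open>Xop\<close>.\<close>

lemma lvl_transpose:
  assumes "(j, l) \<in> pairs n" "\<rho> j < \<rho> l"
  shows "lvl (\<rho> \<circ> tr j l) < lvl \<rho>"
proof -
  have *: "(\<Sum>x\<in>{1..n}. f x) = f j + f l + (\<Sum>x\<in>{1..n} - {j, l}. f x)" for f :: "nat \<Rightarrow> nat"
  proof -
    have "{1..n} = insert j (insert l ({1..n} - {j, l}))" using assms by (auto simp: pairs_def)
    then have "(\<Sum>x\<in>{1..n}. f x) = (\<Sum>x\<in>insert j (insert l ({1..n} - {j, l})). f x)" by simp
    then show ?thesis using assms by (simp add: pairs_def)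
  qed
  have "(\<Sum>x\<in>{1..n} - {j, l}. x * \<rho> (tr j l x)) = (\<Sum>x\<in>{1..n} - {j, l}. x * \<rho> x)"
    by (rule sum.cong) (auto simp: Transposition.transpose_def)
  moreover have "j * \<rho> l + l * \<rho> j < j * \<rho> j + l * \<rho> l"
  proof -
    obtain d where d: "l = j + d" "d > 0" using assms(1) less_imp_add_positive by (auto simp: pairs_def)
    obtain e where e: "\<rho> l = \<rho> j + e" "e > 0" using assms(2) less_imp_add_positive by metis
    show ?thesis unfolding e(1) unfolding d(1) using d(2) e(2) by (simp add: algebra_simps)
  qed
  ultimately show ?thesis unfolding lvl_def comp_apply * by simp
qed

lemma Xop_diag:
  assumes "\<And>j l. (j, l) \<in> pairs n \<Longrightarrow> \<rho> j < \<rho> l \<Longrightarrow> 1 + \<mu> (\<rho> j) * \<mu> (\<rho> l) \<noteq> 0 \<Longrightarrow> f (\<rho> \<circ> tr j l) = 0"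
  shows "Xop \<gamma> \<mu> a f \<rho> = (\<Sum>j\<in>{1..n}. a j * \<gamma> (\<rho> j)) * f \<rho>"
proof -
  have "(\<Sum>(j, l)\<in>pairs n. if \<rho> j < \<rho> l then (a l - a j) * (k * (1 + \<mu> (\<rho> j) * \<mu> (\<rho> l))) * f (\<rho> \<circ> tr j l) else 0) = 0"
  proof (rule sum.neutral, clarify)
    fix j l assume jl: "(j, l) \<in> pairs n"
    show "(if \<rho> j < \<rho> l then (a l - a j) * (k * (1 + \<mu> (\<rho> j) * \<mu> (\<rho> l))) * f (\<rho> \<circ> tr j l) else 0) = 0"
      using assms[OF jl] by (cases "1 + \<mu> (\<rho> j) * \<mu> (\<rho> l) = 0") simp_all
  qed
  then show ?thesis by (simp add: Xop_def)
qed

text \<open>A minimality argument: take a nonzero element of \<open>L\<close> whose support starts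
  at the highest possible \<open>lvl\<close>, and among these one with the fewest support points at
  that starting level. There all operators act diagonally, so subtracting the eigenvalue at one
  support point yields an element of \<open>L\<close> with fewer points on that level, which must be
  zero.\<close>

lemma ex_weight_vector:
  assumes L: "stable \<gamma> \<mu> L" and ne: "L \<noteq> {\<lambda>\<rho>. 0}"
  obtains u \<rho>\<^sub>0 where "u \<in> L" "u \<noteq> (\<lambda>\<rho>. 0)" "\<rho>\<^sub>0 permutes {1..n}" "eig \<gamma> \<mu> (\<gamma> \<circ> \<rho>\<^sub>0) (\<mu> \<circ> \<rho>\<^sub>0) u"
proof -
  note S = stableD[OF L]
  have perm: "\<rho> permutes {1..n}" if "u \<in> L" "u \<rho> \<noteq> 0" for u \<rho>
  proof (rule ccontr)
    assume "\<not> \<rho> permutes {1..n}"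
    from FnD[OF subsetD[OF S(1) that(1)] this] show False using that(2) by simp
  qed
  define Q where "Q q \<longleftrightarrow> (\<exists>u\<in>L. u \<noteq> (\<lambda>\<rho>. 0) \<and> (\<forall>\<rho>. u \<rho> \<noteq> 0 \<longrightarrow> q \<le> lvl \<rho>))" for q
  have bound: "q \<le> (\<Sum>j\<in>{1..n}. j * n)" if "Q q" for q
  proof -
    obtain u where u: "u \<in> L" "u \<noteq> (\<lambda>\<rho>. 0)" "\<And>\<rho>. u \<rho> \<noteq> 0 \<Longrightarrow> q \<le> lvl \<rho>"
      using \<open>Q q\<close> unfolding Q_def by blast
    obtain \<rho> where \<rho>: "u \<rho> \<noteq> 0" using u(2) by auto
    have "lvl \<rho> \<le> (\<Sum>j\<in>{1..n}. j * n)"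
      unfolding lvl_def using permutes_in_image[OF perm[OF u(1) \<rho>]] by (intro sum_mono) auto
    then show ?thesis using u(3)[OF \<rho>] by simp
  qed
  have Q0: "Q 0" using ne S(2) unfolding Q_def by auto
  define q where "q = Greatest Q"
  have Qq: "Q q" unfolding q_def by (rule GreatestI_nat[where P = Q, OF Q0 bound])
  have Qmax: "\<not> Q (Suc q)"
  proof
    assume "Q (Suc q)"
    from Greatest_le_nat[where P = Q, OF this bound] show False unfolding q_def by simp
  qed
  define good where "good u \<longleftrightarrow> u \<in> L \<and> u \<noteq> (\<lambda>\<rho>. 0) \<and> (\<forall>\<rho>. u \<rho> \<noteq> 0 \<longrightarrow> q \<le> lvl \<rho>)" for u
  \<comment> \<open>The part of the support on the extremal level q, which is the lowest level that
    occurs.\<close>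
  define top where "top u = {\<rho>. u \<rho> \<noteq> 0 \<and> lvl \<rho> = q}" for u :: pfun
  obtain u0 where "good u0" using Qq unfolding Q_def good_def by blast
  then obtain u where u: "good u" and least: "\<And>v. good v \<Longrightarrow> card (top u) \<le> card (top v)"
    using ex_has_least_nat[of good u0 "\<lambda>u. card (top u)"] by blast
  have uL: "u \<in> L" and u0: "u \<noteq> (\<lambda>\<rho>. 0)" and ulvl: "\<And>\<rho>. u \<rho> \<noteq> 0 \<Longrightarrow> q \<le> lvl \<rho>"
    using u by (auto simp: good_def)
  have "top u \<noteq> {}"
  proof
    assume "top u = {}"
    have "Suc q \<le> lvl \<rho>" if "u \<rho> \<noteq> 0" for \<rho>
    proof -
      have "lvl \<rho> \<noteq> q" using that \<open>top u = {}\<close> by (auto simp: top_def)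
      then show ?thesis using ulvl[OF that] by simp
    qed
    then have "Q (Suc q)" unfolding Q_def using uL u0 by blast
    then show False using Qmax by simp
  qed
  then obtain \<rho>\<^sub>0 where \<rho>0: "u \<rho>\<^sub>0 \<noteq> 0" "lvl \<rho>\<^sub>0 = q" by (auto simp: top_def)
  have fin: "finite (top u)"
    by (rule finite_subset[OF _ finite_permutations[of "{1..n}"]]) (use perm[OF uL] in \<open>auto simp: top_def\<close>)
  have zero: "g = (\<lambda>\<rho>. 0)"
    if g: "g \<in> L" "\<And>\<rho>. g \<rho> \<noteq> 0 \<Longrightarrow> q \<le> lvl \<rho>" "\<And>\<rho>. lvl \<rho> = q \<Longrightarrow> u \<rho> = 0 \<Longrightarrow> g \<rho> = 0" "g \<rho>\<^sub>0 = 0" for g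
  proof (rule ccontr)
    assume "g \<noteq> (\<lambda>\<rho>. 0)"
    then have "good g" using g by (simp add: good_def)
    from least[OF this] have "card (top u) \<le> card (top g)" .
    moreover have "top g \<subset> top u" using g \<rho>0 by (auto simp: top_def)
    ultimately show False using psubset_card_mono[OF fin, of "top g"] by linarith
  qed
  have sub: "(\<lambda>\<rho>. f \<rho> + - z * u \<rho>) \<in> L" if "f \<in> L" for f z
    by (rule S(3)[OF that S(4)[OF uL]])
  have low: "u (\<rho> \<circ> tr j l) = 0" if "lvl \<rho> \<le> q" "(j, l) \<in> pairs n" "\<rho> j < \<rho> l" for \<rho> j l
    using lvl_transpose[OF that(2,3)] that(1) ulvl[of "\<rho> \<circ> tr j l"] by force
  have Xlow: "Xop \<gamma> \<mu> a u \<rho> = (\<Sum>j\<in>{1..n}. a j * \<gamma> (\<rho> j)) * u \<rho>" if "lvl \<rho> \<le> q" for a \<rho>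
    by (rule Xop_diag) (use low[OF that] in blast)
  have X: "(\<lambda>\<rho>. Xop \<gamma> \<mu> a u \<rho> + - (\<Sum>j\<in>{1..n}. a j * \<gamma> (\<rho>\<^sub>0 j)) * u \<rho>) = (\<lambda>\<rho>. 0)" for a
  proof (rule zero)
    show "(\<lambda>\<rho>. Xop \<gamma> \<mu> a u \<rho> + - (\<Sum>j\<in>{1..n}. a j * \<gamma> (\<rho>\<^sub>0 j)) * u \<rho>) \<in> L"
      by (rule sub[OF S(5)[OF uL]])
    fix \<rho> assume ne0: "Xop \<gamma> \<mu> a u \<rho> + - (\<Sum>j\<in>{1..n}. a j * \<gamma> (\<rho>\<^sub>0 j)) * u \<rho> \<noteq> 0"
    show "q \<le> lvl \<rho>"
    proof (rule ccontr)
      assume "\<not> q \<le> lvl \<rho>"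
      then have "lvl \<rho> \<le> q" "u \<rho> = 0" using ulvl[of \<rho>] by auto
      then show False using ne0 Xlow[of \<rho> a] by simp
    qed
  qed (use Xlow \<rho>0 in auto)
  have D: "(\<lambda>\<rho>. Dop \<mu> p r u \<rho> + - (\<mu> (\<rho>\<^sub>0 p) * \<mu> (\<rho>\<^sub>0 r)) * u \<rho>) = (\<lambda>\<rho>. 0)"
    if "p \<in> {1..n}" "r \<in> {1..n}" for p r
  proof (rule zero)
    show "(\<lambda>\<rho>. Dop \<mu> p r u \<rho> + - (\<mu> (\<rho>\<^sub>0 p) * \<mu> (\<rho>\<^sub>0 r)) * u \<rho>) \<in> L"
      by (rule sub[OF S(7)[OF uL that]])
    fix \<rho> assume "Dop \<mu> p r u \<rho> + - (\<mu> (\<rho>\<^sub>0 p) * \<mu> (\<rho>\<^sub>0 r)) * u \<rho> \<noteq> 0"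
    then have "u \<rho> \<noteq> 0" by (auto simp: Dop_def)
    then show "q \<le> lvl \<rho>" by (rule ulvl)
  qed (auto simp: Dop_def)
  have "eig \<gamma> \<mu> (\<gamma> \<circ> \<rho>\<^sub>0) (\<mu> \<circ> \<rho>\<^sub>0) u"
    unfolding eig_def
  proof (intro conjI allI ballI)
    show "u \<in> Fn" using uL S(1) by auto
    show "Xop \<gamma> \<mu> a u = (\<lambda>\<rho>. (\<Sum>j\<in>{1..n}. a j * (\<gamma> \<circ> \<rho>\<^sub>0) j) * u \<rho>)" for a
      using fun_cong[OF X[of a]] by (simp add: fun_eq_iff)
    show "Dop \<mu> p r u = (\<lambda>\<rho>. (\<mu> \<circ> \<rho>\<^sub>0) p * (\<mu> \<circ> \<rho>\<^sub>0) r * u \<rho>)" if "p \<in> {1..n}" "r \<in> {1..n}" for p r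
      using fun_cong[OF D[OF that]] by (simp add: fun_eq_iff)
  qed
  then show ?thesis using that uL u0 perm[OF uL \<rho>0(1)] by blast
qed

text \<open>In the absence of \<open>bad\<close> pairs the intertwiners are injective, so a weight
  vector in \<open>L\<close> can be carried to any rearrangement of its weight without leaving
  \<open>L\<close>.\<close>

lemma weight_vector_perm:
  assumes L: "stable \<gamma> \<mu> L" and sgn: "\<And>j. \<nu> j * \<nu> j = 1"
    and nb: "\<And>p q. p \<in> {1..n} \<Longrightarrow> q \<in> {1..n} \<Longrightarrow> \<not> bad \<kappa> \<nu> p q"
    and u: "u \<in> L" "u \<noteq> (\<lambda>\<rho>. 0)" "eig \<gamma> \<mu> \<kappa> \<nu> u" and \<pi>: "\<pi> permutes {1..n}"
  shows "\<exists>u\<in>L. u \<noteq> (\<lambda>\<rho>. 0) \<and> eig \<gamma> \<mu> (\<kappa> \<circ> \<pi>) (\<nu> \<circ> \<pi>) u"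
  using \<pi>
proof (induction rule: permutes_adjacent_induct)
  case id
  then show ?case using u by (intro bexI[of _ u]) simp_all
next
  case (swap \<rho> i)
  note S = stableD[OF L]
  let ?s = "tr i (i + 1)"
  define K where "K = \<kappa> \<circ> \<rho>"
  define V where "V = \<nu> \<circ> \<rho>"
  have sgV: "V j * V j = 1" for j using sgn by (simp add: V_def)
  have nbV: "\<not> bad K V i (i + 1)"
    using nb[of "\<rho> i" "\<rho> (i + 1)"] permutes_in_image[OF swap.hyps(1)] swap.hyps(2,3)
    by (simp add: bad_def K_def V_def)
  have "\<exists>u\<in>L. u \<noteq> (\<lambda>\<rho>. 0) \<and> eig \<gamma> \<mu> K V u"
    unfolding K_def V_def by (rule swap.IH)
  then obtain u where u: "u \<in> L" "u \<noteq> (\<lambda>\<rho>. 0)" "eig \<gamma> \<mu> K V u" by auto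
  have "\<exists>u\<in>L. u \<noteq> (\<lambda>\<rho>. 0) \<and> eig \<gamma> \<mu> (K \<circ> ?s) (V \<circ> ?s) u"
  proof (cases "K i \<noteq> K (i + 1) \<or> k * (1 + V i * V (i + 1)) = 0")
    case False
    then have "V i = V (i + 1)" by (intro sign_eq[OF sgV sgV]) simp
    then have "K \<circ> ?s = K" "V \<circ> ?s = V"
      using False by (auto simp: fun_eq_iff Transposition.transpose_def)
    then show ?thesis using u by auto
  next
    case True
    define z where "z = k * (1 + V i * V (i + 1)) / (K i - K (i + 1))"
    define u' where "u' = (\<lambda>\<rho>. Tr ?s u \<rho> + z * u \<rho>)"
    have zz: "z * z \<noteq> 1"
      unfolding z_def using sgV nbV True by (rule coefficient_square_ne_1)
    have "eig \<gamma> \<mu> (K \<circ> ?s) (V \<circ> ?s) u'"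
      unfolding u'_def z_def using True by (intro eig_swap[OF u(3) swap.hyps(2,3) sgV]) simp
    moreover have "u' \<in> L"
      unfolding u'_def by (rule S(3)[OF S(6)[OF u(1) adj_permutes[OF swap.hyps(2,3)]] S(4)[OF u(1)]])
    moreover have "u' \<noteq> (\<lambda>\<rho>. 0)"
    proof
      assume 0: "u' = (\<lambda>\<rho>. 0)"
      \<comment> \<open>If the intertwiner kills \<open>u\<close>, using this relation twice
        multiplies \<open>u\<close> by \<open>z * z\<close>, while the transposition is an
        involution.\<close>
      have 1: "u (\<rho> \<circ> ?s) = - z * u \<rho>" for \<rho>
        using fun_cong[OF 0, of \<rho>] by (simp add: u'_def Tr_def eq_neg_iff_add_eq_0)
      have "u \<rho> = z * z * u \<rho>" for \<rho>
        using 1[of "\<rho> \<circ> ?s"] 1[of \<rho>] by (simp add: comp_assoc)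
      then have "(1 - z * z) * u \<rho> = 0" for \<rho> by (simp add: left_diff_distrib)
      then show False using zz u(2) by (auto simp: fun_eq_iff)
    qed
    ultimately show ?thesis by auto
  qed
  then show ?case unfolding K_def V_def by (simp only: comp_assoc)
qed

text \<open>A chain of subgroups in which only the first b positions may move: the full stabiliser
  of the labelling for b = n, the trivial group for b = 0.\<close>

definition stab_below :: "(nat \<Rightarrow> nat) \<Rightarrow> nat \<Rightarrow> (nat \<Rightarrow> nat) set" where
  "stab_below f b = {\<rho>. \<rho> permutes {1..n} \<and> (\<forall>j\<in>{1..n}. f (\<rho> j) = f j) \<and> (\<forall>j>b. \<rho> j = j)}"

text \<open>
  Positions carrying the same pair of parameters are adjacent, so that the stabiliser of the weight
  is a parabolic subgroup; \<open>f\<close> is a monotone label of its blocks.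
\<close>

context
  fixes \<gamma> \<mu> :: "nat \<Rightarrow> complex" and f :: "nat \<Rightarrow> nat"
  assumes sgn: "\<And>j. \<mu> j * \<mu> j = 1" and k: "k \<noteq> 0"
    and mono: "\<And>p q. 1 \<le> p \<Longrightarrow> p \<le> q \<Longrightarrow> q \<le> n \<Longrightarrow> f p \<le> f q"
    and key: "\<And>p q. p \<in> {1..n} \<Longrightarrow> q \<in> {1..n} \<Longrightarrow> f p = f q \<longleftrightarrow> \<gamma> p = \<gamma> q \<and> \<mu> p = \<mu> q"
begin

text \<open>Monotonicity of the labels, applied to the positions j < l and to the values \<rho> j <
  \<rho> l, gives both f j \<le> f l and f l \<le> f j. Hence the stabiliser is closed under passing
  from a permutation to the shorter ones reached by an off-diagonal term.\<close>

lemma stab_transpose: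
  assumes jl: "(j, l) \<in> pairs n" and \<rho>: "\<rho> permutes {1..n}" "\<rho> j < \<rho> l"
    and st: "\<And>x. x \<in> {1..n} \<Longrightarrow> f ((\<rho> \<circ> tr j l) x) = f x" and x: "x \<in> {1..n}"
  shows "f j = f l" "f (\<rho> x) = f x"
proof -
  have jl': "j \<in> {1..n}" "l \<in> {1..n}" "j < l" using jl by (auto simp: pairs_def)
  have r: "\<rho> j \<in> {1..n}" "\<rho> l \<in> {1..n}" using permutes_in_image[OF \<rho>(1)] jl' by auto
  have 1: "f (\<rho> l) = f j" "f (\<rho> j) = f l" using st[OF jl'(1)] st[OF jl'(2)] by simp_all
  have "f (\<rho> j) \<le> f (\<rho> l)" using r \<rho>(2) by (intro mono) auto
  moreover have "f j \<le> f l" using jl' by (intro mono) auto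
  ultimately show 2: "f j = f l" using 1 by simp
  show "f (\<rho> x) = f x"
    using st[OF x] 1 2 by (cases "x = j \<or> x = l") auto
qed

text \<open>Induction on \<open>lvl\<close>. If an off-diagonal term reaches \<rho>, its source lies
  in the stabiliser and \<open>stab_transpose\<close> applies. Otherwise the vectors act at \<rho>
  through the diagonal; comparing eigenvalues, \<rho> fixes the weight, and it fixes the signs up to
  a global factor. A global reversal is what \<open>nsw\<close> excludes.\<close>

lemma weight_vector_support:
  assumes e: "eig \<gamma> \<mu> \<gamma> \<mu> u"
    and nsw: "\<And>w. w permutes {1..n} \<Longrightarrow> (\<And>j. j \<in> {1..n} \<Longrightarrow> \<gamma> (w j) = \<gamma> j) \<Longrightarrow>
       (\<And>j. j \<in> {1..n} \<Longrightarrow> \<mu> (w j) = - \<mu> j) \<Longrightarrow> False"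
  shows "u \<rho> \<noteq> 0 \<Longrightarrow> \<forall>x\<in>{1..n}. f (\<rho> x) = f x"
proof (induction "lvl \<rho>" arbitrary: \<rho> rule: less_induct)
  case less
  have \<rho>: "\<rho> permutes {1..n}" using FnD[OF eigD(1)[OF e]] less.prems by (cases "\<rho> permutes {1..n}") auto
  have rim: "\<rho> x \<in> {1..n}" if "x \<in> {1..n}" for x using permutes_in_image[OF \<rho>] that by simp
  show ?case
  proof (cases "\<exists>j l. (j, l) \<in> pairs n \<and> \<rho> j < \<rho> l \<and> u (\<rho> \<circ> tr j l) \<noteq> 0")
    case True
    then obtain j l where jl: "(j, l) \<in> pairs n" "\<rho> j < \<rho> l" "u (\<rho> \<circ> tr j l) \<noteq> 0" by auto
    from less.hyps[OF lvl_transpose[of j l \<rho>, OF jl(1,2)] jl(3)]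
    have st: "\<And>x. x \<in> {1..n} \<Longrightarrow> f ((\<rho> \<circ> tr j l) x) = f x" by auto
    show ?thesis using stab_transpose(2)[OF jl(1) \<rho> jl(2) st] by auto
  next
    case False
    have X: "Xop \<gamma> \<mu> a u \<rho> = (\<Sum>j\<in>{1..n}. a j * \<gamma> (\<rho> j)) * u \<rho>" for a
      by (rule Xop_diag) (use False in auto)
    have g: "\<gamma> (\<rho> x) = \<gamma> x" if "x \<in> {1..n}" for x
    proof -
      have *: "(\<Sum>j\<in>{1..n}. (if j = x then 1 else 0) * h j) = h x" for h :: "nat \<Rightarrow> complex"
      proof -
        have "(\<Sum>j\<in>{1..n}. (if j = x then 1 else 0) * h j) = (\<Sum>j\<in>{1..n}. if j = x then h j else 0)"
          by (rule sum.cong) auto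
        then show ?thesis using that by simp
      qed
      have "(\<Sum>j\<in>{1..n}. (if j = x then 1 else 0) * \<gamma> (\<rho> j)) * u \<rho> =
          (\<Sum>j\<in>{1..n}. (if j = x then 1 else 0) * \<gamma> j) * u \<rho>"
        using X[of "\<lambda>j. if j = x then 1 else 0"] fun_cong[OF eigD(2)[OF e, of "\<lambda>j. if j = x then 1 else 0"], of \<rho>]
        by (simp only:)
      then show ?thesis unfolding * using less.prems by simp
    qed
    have m2: "\<mu> (\<rho> p) * \<mu> (\<rho> q) = \<mu> p * \<mu> q" if "p \<in> {1..n}" "q \<in> {1..n}" for p q
      using eigD(4)[OF e that, of \<rho>] less.prems by simp
    have m: "\<mu> (\<rho> x) = \<mu> x" if x: "x \<in> {1..n}" for x
    proof (rule ccontr)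
      assume ne: "\<mu> (\<rho> x) \<noteq> \<mu> x"
      have pm: "\<mu> j = 1 \<or> \<mu> j = -1" for j using sgn[of j] by (simp add: square_eq_1_iff)
      have neg: "\<mu> (\<rho> x) = - \<mu> x" using pm[of x] pm[of "\<rho> x"] ne by auto
      have "\<mu> (\<rho> q) = - \<mu> q" if "q \<in> {1..n}" for q
      proof -
        have "\<mu> x * (\<mu> (\<rho> q) + \<mu> q) = 0"
        proof -
          have e: "\<mu> x * \<mu> q = - (\<mu> x * \<mu> (\<rho> q))" using m2[OF x that] unfolding neg by simp
          show ?thesis unfolding distrib_left e by simp
        qed
        moreover have "\<mu> x \<noteq> 0" using sgn[of x] by auto
        ultimately show ?thesis by (simp add: eq_neg_iff_add_eq_0)
      qed
      then show False using nsw[OF \<rho> g] by simp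
    qed
    show ?thesis using key[OF rim] g m by auto
  qed
qed

text \<open>The support is shrunk along the chain \<open>stab_below\<close>. For a position B with
  block minimum a, a translation arranges that some support point sends B to a. Then the B-th
  coordinate operator minus its eigenvalue raises the least value of \<rho> B on the support by one
  each time, without annihilating the vector. Once that value is B, every support point fixes
  B.\<close>

lemma vac_mem_of_stab_support:
  assumes L: "stable \<gamma> \<mu> L" and u: "u \<in> L" "u \<noteq> (\<lambda>\<rho>. 0)"
    and supp: "\<And>\<rho> x. u \<rho> \<noteq> 0 \<Longrightarrow> x \<in> {1..n} \<Longrightarrow> f (\<rho> x) = f x"
  shows "vac \<in> L"
proof -
  note S = stableD[OF L]
  have perm: "\<rho> permutes {1..n}" if "u \<in> L" "u \<rho> \<noteq> 0" for u \<rho>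
  proof (rule ccontr)
    assume "\<not> \<rho> permutes {1..n}"
    from FnD[OF subsetD[OF S(1) that(1)] this] show False using that(2) by simp
  qed
  have step: "\<exists>u\<in>L. u \<noteq> (\<lambda>\<rho>. 0) \<and> (\<forall>\<rho>. u \<rho> \<noteq> 0 \<longrightarrow> \<rho> \<in> stab_below f b)"
    if b: "Suc b \<le> n" and ex: "\<exists>u\<in>L. u \<noteq> (\<lambda>\<rho>. 0) \<and> (\<forall>\<rho>. u \<rho> \<noteq> 0 \<longrightarrow> \<rho> \<in> stab_below f (Suc b))" for b
  proof -
    define B where "B = Suc b"
    have B: "B \<in> {1..n}" using b by (simp add: B_def)
    obtain u where u: "u \<in> L" "u \<noteq> (\<lambda>\<rho>. 0)" "\<And>\<rho>. u \<rho> \<noteq> 0 \<Longrightarrow> \<rho> \<in> stab_below f B"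
      using ex unfolding B_def by auto
    define C where "C = {j \<in> {1..n}. f j = f B}"
    define a where "a = Min C"
    have C: "finite C" "B \<in> C" using B by (auto simp: C_def)
    have aC: "a \<in> C" unfolding a_def by (rule Min_in) (use C in auto)
    have amin: "a \<le> j" if "j \<in> C" for j unfolding a_def using C that by simp
    have a: "a \<in> {1..n}" "f a = f B" "a \<le> B" using aC amin[OF C(2)] by (auto simp: C_def)
    have sbD: "\<rho> permutes {1..n}" "j \<in> {1..n} \<Longrightarrow> f (\<rho> j) = f j" "j > B \<Longrightarrow> \<rho> j = j"
      if "\<rho> \<in> stab_below f B" for \<rho> j using that by (auto simp: stab_below_def)
    have le_B: "\<rho> j \<le> B" if "\<rho> \<in> stab_below f B" "j \<le> B" for \<rho> j
    proof (rule ccontr)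
      assume "\<not> \<rho> j \<le> B"
      then have "\<rho> (\<rho> j) = \<rho> j" using sbD(3)[OF that(1)] by simp
      then have "\<rho> j = j" using permutes_inj[OF sbD(1)[OF that(1)]] by (simp add: inj_eq)
      then show False using that(2) \<open>\<not> \<rho> j \<le> B\<close> by simp
    qed
    have in_blk: "j \<in> C" if "a \<le> j" "j \<le> B" for j
    proof -
      have "f a \<le> f j" "f j \<le> f B" using that a(1) B by (auto intro!: mono)
      then show ?thesis using a that B by (auto simp: C_def)
    qed
    have chain: "\<exists>u\<in>L. (\<forall>\<rho>. u \<rho> \<noteq> 0 \<longrightarrow> \<rho> \<in> stab_below f B \<and> a + d \<le> \<rho> B) \<and> (\<exists>\<rho>. u \<rho> \<noteq> 0 \<and> \<rho> B = a + d)"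
      if "a + d \<le> B" for d
      using that
    proof (induction d)
      case 0
      obtain \<rho>\<^sub>0 where r0: "u \<rho>\<^sub>0 \<noteq> 0" using u(2) by auto
      note r0s = u(3)[OF r0]
      \<comment> \<open>Chosen such that translation by \<open>g\<close> carries the support point
        \<open>\<rho>\<^sub>0\<close> to \<open>tr a B\<close>, which maps B to a. As
        \<open>g\<close> lies in the stabiliser, the support stays there.\<close>
      define g where "g = tr a B \<circ> \<rho>\<^sub>0"
      have ta: "tr a B permutes {1..n}" using a B by (intro transpose_permutes_Icc) auto
      have g: "g permutes {1..n}" unfolding g_def by (rule permutes_compose[OF sbD(1)[OF r0s] ta])
      have fg: "f (g x) = f x" if "x \<in> {1..n}" for x
      proof -
        have "f (tr a B y) = f y" for y
          unfolding Transposition.transpose_def using a(2) by simp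
        then show ?thesis using sbD(2)[OF r0s that] by (simp add: g_def)
      qed
      have gB: "g j = j" if "j > B" for j
        using sbD(3)[OF r0s that] a(3) that by (simp add: g_def)
      have uT: "Tr g u \<in> L" by (rule S(6)[OF u(1) g])
      have 1: "\<rho> \<in> stab_below f B \<and> a + 0 \<le> \<rho> B" if "Tr g u \<rho> \<noteq> 0" for \<rho>
      proof -
        have rg: "\<rho> \<circ> g \<in> stab_below f B"
          by (rule u(3)) (use that in \<open>simp only: Tr_def not_False_eq_True\<close>)
        have \<rho>: "\<rho> permutes {1..n}" by (rule perm[of "Tr g u" \<rho>, OF uT that])
        have f\<rho>: "f (\<rho> x) = f x" if x: "x \<in> {1..n}" for x
        proof -
          have y: "inv_into UNIV g x \<in> {1..n}" using permutes_in_image[OF permutes_inv[OF g]] x by simp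
          have "g (inv_into UNIV g x) = x" by (rule permutes_inverses(1)[OF g])
          then show ?thesis using sbD(2)[OF rg y] fg[OF y] by simp
        qed
        have "\<rho> j = j" if "j > B" for j using sbD(3)[OF rg that] gB[OF that] by simp
        then have "\<rho> \<in> stab_below f B" using \<rho> f\<rho> by (auto simp: stab_below_def)
        moreover have "\<rho> B \<in> C"
          using f\<rho>[OF B] permutes_in_image[OF \<rho>] B by (simp add: C_def)
        ultimately show ?thesis using amin by simp
      qed
      have 2: "Tr g u (tr a B) \<noteq> 0 \<and> tr a B B = a + 0"
        using r0 by (simp add: Tr_def g_def comp_assoc[symmetric])
      show ?case using 1 2 uT by blast
    next
      case (Suc d)
      then obtain v where v: "v \<in> L" "\<And>\<rho>. v \<rho> \<noteq> 0 \<Longrightarrow> \<rho> \<in> stab_below f B"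
        "\<And>\<rho>. v \<rho> \<noteq> 0 \<Longrightarrow> a + d \<le> \<rho> B" and "\<exists>\<rho>. v \<rho> \<noteq> 0 \<and> \<rho> B = a + d" by auto
      then obtain \<rho>\<^sub>0 where r0: "v \<rho>\<^sub>0 \<noteq> 0" "\<rho>\<^sub>0 B = a + d" by blast
      define q where "q = a + d"
      have q: "q < B" "a \<le> q" using Suc.prems by (auto simp: q_def)
      define e :: "nat \<Rightarrow> complex" where "e = (\<lambda>j. if j = B then 1 else 0)"
      \<comment> \<open>All support points preserve the label of B, hence \<gamma>(\<rho> B) =
        \<gamma> B: the subtraction removes the whole diagonal part and leaves the exchange
        terms.\<close>
      define w where "w = (\<lambda>\<rho>. Xop \<gamma> \<mu> e v \<rho> + - \<gamma> B * v \<rho>)"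
      have wL: "w \<in> L" unfolding w_def by (rule S(3)[OF S(5)[OF v(1)] S(4)[OF v(1)]])
      define T where "T \<rho> = (\<lambda>(j, l). if \<rho> j < \<rho> l
        then (e l - e j) * (k * (1 + \<mu> (\<rho> j) * \<mu> (\<rho> l))) * v (\<rho> \<circ> tr j l) else 0)" for \<rho>
      have wT: "w \<rho> = sum (T \<rho>) (pairs n)" for \<rho>
      proof -
        have "(\<Sum>j\<in>{1..n}. e j * \<gamma> (\<rho> j)) = (\<Sum>j\<in>{1..n}. if j = B then \<gamma> (\<rho> j) else 0)"
          by (rule sum.cong) (auto simp: e_def)
        then have s: "(\<Sum>j\<in>{1..n}. e j * \<gamma> (\<rho> j)) = \<gamma> (\<rho> B)" using B by simp
        have "\<gamma> (\<rho> B) * v \<rho> = \<gamma> B * v \<rho>"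
        proof (cases "v \<rho> = 0")
          case False
          note sb = v(2)[OF False]
          have "\<rho> B \<in> {1..n}" using permutes_in_image[OF sbD(1)[OF sb]] B by simp
          then have "\<gamma> (\<rho> B) = \<gamma> B" using sbD(2)[OF sb B] key[OF _ B] by auto
          then show ?thesis by simp
        qed simp
        then show ?thesis unfolding w_def Xop_def s T_def by simp
      qed
      \<comment> \<open>Only exchanges of B with an earlier position contribute. For a later
        position l the exchanged permutation fixes l and keeps the value at B at most B, so \<rho> B
        = l and \<rho> l \<le> B < l, which contradicts \<rho> B < \<rho> l.\<close>
      have T_nz: "j < B \<and> l = B \<and> v (\<rho> \<circ> tr j B) \<noteq> 0 \<and> \<rho> j < \<rho> B"
        if jl: "(j, l) \<in> pairs n" and nz: "T \<rho> (j, l) \<noteq> 0" for \<rho> j l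
      proof -
        have lt: "\<rho> j < \<rho> l" and vn: "v (\<rho> \<circ> tr j l) \<noteq> 0" and en: "e l \<noteq> e j"
          using nz by (auto simp: T_def split: if_splits)
        note sb = v(2)[OF vn]
        have "l = B"
        proof (rule ccontr)
          assume lB: "l \<noteq> B"
          then have jB: "j = B" using en by (auto simp: e_def split: if_splits)
          then have "l > B" using jl by (simp add: pairs_def)
          then have "(\<rho> \<circ> tr j l) l = l" by (rule sbD(3)[OF sb])
          then have rj: "\<rho> j = l" by simp
          have "(\<rho> \<circ> tr j l) j \<le> B" by (rule le_B[OF sb]) (simp add: jB)
          then have "\<rho> l \<le> B" by simp
          then show False using lt rj \<open>l > B\<close> by simp
        qed
        then show ?thesis using lt vn jl by (auto simp: pairs_def)
      qed
      \<comment> \<open>A contribution to \<rho> comes from the exchanged permutation, whose value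
        at B is \<rho> j. This value is at least a + d, and \<rho> B exceeds it.\<close>
      have 1: "\<rho> \<in> stab_below f B \<and> a + Suc d \<le> \<rho> B" if nz: "w \<rho> \<noteq> 0" for \<rho>
      proof -
        have \<rho>: "\<rho> permutes {1..n}" by (rule perm[of w \<rho>, OF wL nz])
        obtain x where x: "x \<in> pairs n" "T \<rho> x \<noteq> 0"
          using nz unfolding wT by (meson sum.neutral)
        obtain j l where xjl: "x = (j, l)" by (cases x)
        have jl: "(j, B) \<in> pairs n" "j < B" "v (\<rho> \<circ> tr j B) \<noteq> 0" "\<rho> j < \<rho> B"
          using T_nz[of j l \<rho>] x unfolding xjl by auto
        note sb = v(2)[OF jl(3)]
        have "f (\<rho> x) = f x" if "x \<in> {1..n}" for x
          using stab_transpose(2)[OF jl(1) \<rho> jl(4) sbD(2)[OF sb] that] .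
        moreover have "\<rho> x = x" if "x > B" for x
          using sbD(3)[OF sb that] jl(2) that by simp
        ultimately have "\<rho> \<in> stab_below f B" using \<rho> by (auto simp: stab_below_def)
        moreover have "a + d \<le> \<rho> j" using v(3)[OF jl(3)] by simp
        ultimately show ?thesis using jl(4) by simp
      qed
      note sb0 = v(2)[OF r0(1)]
      define l where "l = inv_into UNIV \<rho>\<^sub>0 (Suc q)"
      have rl: "\<rho>\<^sub>0 l = Suc q" unfolding l_def by (rule permutes_inverses(1)[OF sbD(1)[OF sb0]])
      have qC: "q \<in> C" "Suc q \<in> C" using q by (auto intro!: in_blk)
      have l1: "l \<in> {1..n}"
        unfolding l_def using permutes_in_image[OF permutes_inv[OF sbD(1)[OF sb0]]] qC(2) by (simp add: C_def)
      have "l \<noteq> B" using rl r0(2) by (auto simp: q_def)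
      moreover have "l \<le> B"
      proof (rule ccontr)
        assume "\<not> l \<le> B"
        then have "\<rho>\<^sub>0 l = l" using sbD(3)[OF sb0] by simp
        then show False using rl q \<open>\<not> l \<le> B\<close> by simp
      qed
      ultimately have lB: "l < B" by simp
      define \<rho>\<^sub>1 where "\<rho>\<^sub>1 = \<rho>\<^sub>0 \<circ> tr l B"
      have r1: "\<rho>\<^sub>1 l = q" "\<rho>\<^sub>1 B = Suc q" using rl r0(2) by (simp_all add: \<rho>\<^sub>1_def q_def)
      have r1p: "\<rho>\<^sub>1 permutes {1..n}"
        unfolding \<rho>\<^sub>1_def using l1 B by (intro permutes_compose[OF _ sbD(1)[OF sb0]] transpose_permutes_Icc) auto
      have lBp: "(l, B) \<in> pairs n" using l1 B lB by (simp add: pairs_def)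
      \<comment> \<open>At \<open>\<rho>\<^sub>1\<close> every contributing j has a value that is at
        least q and below \<open>\<rho>\<^sub>1 B\<close>, which is q + 1; so only j = l remains.
        For this purpose \<open>\<rho>\<^sub>1\<close> was obtained from
        \<open>\<rho>\<^sub>0\<close> by exchanging the values q and q + 1.\<close>
      have "sum (T \<rho>\<^sub>1) (pairs n) = sum (T \<rho>\<^sub>1) {(l, B)}"
      proof (rule sum.mono_neutral_right)
        show "\<forall>x\<in>pairs n - {(l, B)}. T \<rho>\<^sub>1 x = 0"
        proof (rule ballI, rule ccontr)
          fix x assume x: "x \<in> pairs n - {(l, B)}" and nz: "T \<rho>\<^sub>1 x \<noteq> 0"
          obtain j l' where xjl: "x = (j, l')" by (cases x)
          have j: "j < B" "l' = B" "v (\<rho>\<^sub>1 \<circ> tr j B) \<noteq> 0" "\<rho>\<^sub>1 j < \<rho>\<^sub>1 B"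
            using T_nz[of j l' \<rho>\<^sub>1] x nz unfolding xjl by auto
          have "q \<le> \<rho>\<^sub>1 j" using v(3)[OF j(3)] by (simp add: q_def)
          then have "\<rho>\<^sub>1 j = \<rho>\<^sub>1 l" using j(4) r1 by simp
          then have "j = l" using permutes_inj[OF r1p] by (simp add: inj_eq)
          then show False using x xjl j(2) by simp
        qed
      qed (use lBp in auto)
      also have "\<dots> \<noteq> 0"
      proof -
        have "f q = f (Suc q)" "q \<in> {1..n}" "Suc q \<in> {1..n}" using qC by (auto simp: C_def)
        then have "\<mu> q = \<mu> (Suc q)" using key by blast
        \<comment> \<open>Two values in one block carry equal signs, so the coupling is 2k and the
          single remaining term does not vanish.\<close>
        then have K: "1 + \<mu> q * \<mu> (Suc q) = 2" using sgn by simp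
        have "\<rho>\<^sub>1 \<circ> tr l B = \<rho>\<^sub>0" by (simp add: \<rho>\<^sub>1_def comp_assoc)
        then show ?thesis using k r0(1) lB by (simp add: T_def r1 K e_def)
      qed
      finally have "w \<rho>\<^sub>1 \<noteq> 0" unfolding wT .
      moreover have "\<rho>\<^sub>1 B = a + Suc d" using r1(2) by (simp add: q_def)
      ultimately show ?case using 1 wL by blast
    qed
    from chain[of "B - a"] a(3) obtain v \<rho>\<^sub>0 where v: "v \<in> L"
      "\<And>\<rho>. v \<rho> \<noteq> 0 \<Longrightarrow> \<rho> \<in> stab_below f B" "\<And>\<rho>. v \<rho> \<noteq> 0 \<Longrightarrow> B \<le> \<rho> B" "v \<rho>\<^sub>0 \<noteq> 0" by auto
    have "\<rho> \<in> stab_below f b" if nz: "v \<rho> \<noteq> 0" for \<rho>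
    proof -
      have "\<rho> B = B" using v(3)[OF nz] le_B[OF v(2)[OF nz], of B] by simp
      then have "\<rho> j = j" if "j > b" for j
        using sbD(3)[OF v(2)[OF nz], of j] that by (cases "j = B") (auto simp: B_def)
      then show ?thesis using v(2)[OF nz] by (auto simp: stab_below_def)
    qed
    then have "\<forall>\<rho>. v \<rho> \<noteq> 0 \<longrightarrow> \<rho> \<in> stab_below f b" by simp
    moreover have "v \<noteq> (\<lambda>\<rho>. 0)" using v(4) by auto
    ultimately show ?thesis using v(1) by (intro bexI[of _ v]) simp_all
  qed
  have "\<exists>u\<in>L. u \<noteq> (\<lambda>\<rho>. 0) \<and> (\<forall>\<rho>. u \<rho> \<noteq> 0 \<longrightarrow> \<rho> \<in> stab_below f (n - d))" if "d \<le> n" for d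
    using that
  proof (induction d)
    case 0
    have "\<rho> \<in> stab_below f (n - 0)" if nz: "u \<rho> \<noteq> 0" for \<rho>
    proof -
      have \<rho>: "\<rho> permutes {1..n}" by (rule perm[of u \<rho>, OF u(1) nz])
      show ?thesis using supp[OF nz] \<rho> permutes_not_in[OF \<rho>] by (auto simp: stab_below_def)
    qed
    then have "\<forall>\<rho>. u \<rho> \<noteq> 0 \<longrightarrow> \<rho> \<in> stab_below f (n - 0)" by simp
    then show ?case using u by (intro bexI[of _ u]) simp_all
  next
    case (Suc d)
    then have "n - d = Suc (n - Suc d)" by simp
    then show ?case using step[of "n - Suc d"] Suc by simp
  qed
  from this[of n] obtain v where v: "v \<in> L" "v \<noteq> (\<lambda>\<rho>. 0)" "\<And>\<rho>. v \<rho> \<noteq> 0 \<Longrightarrow> \<rho> \<in> stab_below f 0" by auto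
  have vid: "\<rho> = id" if "v \<rho> \<noteq> 0" for \<rho>
  proof (rule ext)
    fix j
    have \<rho>: "\<rho> permutes {1..n}" and j0: "j > 0 \<Longrightarrow> \<rho> j = j" using v(3)[OF that] by (auto simp: stab_below_def)
    show "\<rho> j = id j" using j0 permutes_not_in[OF \<rho>, of j] by (cases "j = 0") auto
  qed
  then have nz: "v id \<noteq> 0" using v(2) by (metis ext)
  have "(\<lambda>\<rho>. 1 / v id * v \<rho>) = vac"
  proof (rule ext)
    fix \<rho> show "1 / v id * v \<rho> = vac \<rho>" using vid[of \<rho>] nz by (auto simp: vac_def)
  qed
  then show ?thesis using S(4)[OF v(1), of "1 / v id"] by simp
qed

end

text \<open>Sorting the positions by an injective numbering of the pairs of weight and sign makes
  equal pairs adjacent, and the claim is proved for this rearrangement. Both hypotheses are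
  insensitive to rearrangement, and \<open>irred_perm\<close> carries the result back.\<close>

lemma irred_if:
  assumes k: "k \<noteq> 0" and sgn: "\<And>j. \<mu> j * \<mu> j = 1"
    and nb: "\<And>p q. p \<in> {1..n} \<Longrightarrow> q \<in> {1..n} \<Longrightarrow> \<not> bad \<gamma> \<mu> p q"
    and nsw: "\<And>w. w permutes {1..n} \<Longrightarrow> (\<And>j. j \<in> {1..n} \<Longrightarrow> \<gamma> (w j) = \<gamma> j) \<Longrightarrow>
       (\<And>j. j \<in> {1..n} \<Longrightarrow> \<mu> (w j) = - \<mu> j) \<Longrightarrow> False"
  shows "irred \<gamma> \<mu>"
proof -
  obtain c :: "complex \<times> complex \<Rightarrow> nat" where c: "inj_on c ((\<lambda>j. (\<gamma> j, \<mu> j)) ` {1..n})"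
    using finite_imp_inj_to_nat_seg[of "(\<lambda>j. (\<gamma> j, \<mu> j)) ` {1..n}"] by auto
  define h where "h j = c (\<gamma> j, \<mu> j)" for j
  obtain g where g: "g permutes {1..n}" and srt: "\<And>p q. 1 \<le> p \<Longrightarrow> p \<le> q \<Longrightarrow> q \<le> n \<Longrightarrow> h (g p) \<le> h (g q)"
    using ex_sorting_permutation[of n h] by auto
  have gim: "g j \<in> {1..n}" if "j \<in> {1..n}" for j using permutes_in_image[OF g] that by simp
  define G where "G = \<gamma> \<circ> g"
  define M where "M = \<mu> \<circ> g"
  have sgM: "M j * M j = 1" for j by (simp add: M_def sgn)
  have nbG: "\<not> bad G M p q" if "p \<in> {1..n}" "q \<in> {1..n}" for p q
    using nb[OF gim[OF that(1)] gim[OF that(2)]] by (simp add: bad_def G_def M_def)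
  note gi = permutes_inv[OF g]
  have key: "(h \<circ> g) p = (h \<circ> g) q \<longleftrightarrow> G p = G q \<and> M p = M q" if "p \<in> {1..n}" "q \<in> {1..n}" for p q
    using inj_on_eq_iff[OF c, of "(\<gamma> (g p), \<mu> (g p))" "(\<gamma> (g q), \<mu> (g q))"] gim[OF that(1)] gim[OF that(2)]
    by (simp add: h_def G_def M_def)
  have mono: "(h \<circ> g) p \<le> (h \<circ> g) q" if "1 \<le> p" "p \<le> q" "q \<le> n" for p q using srt[OF that] by simp
  have nswG: False if w: "w permutes {1..n}" and 1: "\<And>j. j \<in> {1..n} \<Longrightarrow> G (w j) = G j"
    and 2: "\<And>j. j \<in> {1..n} \<Longrightarrow> M (w j) = - M j" for w
  proof (rule nsw)
    show "g \<circ> w \<circ> inv_into UNIV g permutes {1..n}"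
      by (rule permutes_compose[OF gi permutes_compose[OF w g]])
    fix j assume j: "j \<in> {1..n}"
    have j': "inv_into UNIV g j \<in> {1..n}" using permutes_in_image[OF gi] j by simp
    have gg: "g (inv_into UNIV g j) = j" by (rule permutes_inverses(1)[OF g])
    show "\<gamma> ((g \<circ> w \<circ> inv_into UNIV g) j) = \<gamma> j" using 1[OF j'] gg by (simp add: G_def)
    show "\<mu> ((g \<circ> w \<circ> inv_into UNIV g) j) = - \<mu> j" using 2[OF j'] gg by (simp add: M_def)
  qed
  have "irred G M"
    unfolding irred_def
  proof (intro allI impI)
    fix L assume L: "stable G M L"
    show "L = {\<lambda>\<rho>. 0} \<or> L = Fn"
    proof (cases "L = {\<lambda>\<rho>. 0}")
      case False
      obtain u0 \<rho>\<^sub>0 where u0: "u0 \<in> L" "u0 \<noteq> (\<lambda>\<rho>. 0)" and r0: "\<rho>\<^sub>0 permutes {1..n}"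
        and e0: "eig G M (G \<circ> \<rho>\<^sub>0) (M \<circ> \<rho>\<^sub>0) u0"
        by (rule ex_weight_vector[OF L False])
      have nb0: "\<not> bad (G \<circ> \<rho>\<^sub>0) (M \<circ> \<rho>\<^sub>0) p q" if "p \<in> {1..n}" "q \<in> {1..n}" for p q
        using nbG[of "\<rho>\<^sub>0 p" "\<rho>\<^sub>0 q"] permutes_in_image[OF r0] that by (simp add: bad_def)
      have sg0: "(M \<circ> \<rho>\<^sub>0) j * (M \<circ> \<rho>\<^sub>0) j = 1" for j by (simp add: sgM)
      \<comment> \<open>The weight vector obtained so far has a rearranged weight; undoing
        \<open>\<rho>\<^sub>0\<close> brings it to the weight of the generator.\<close>
      have "\<exists>u\<in>L. u \<noteq> (\<lambda>\<rho>. 0) \<and> eig G M (G \<circ> \<rho>\<^sub>0 \<circ> inv_into UNIV \<rho>\<^sub>0) (M \<circ> \<rho>\<^sub>0 \<circ> inv_into UNIV \<rho>\<^sub>0) u"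
        by (rule weight_vector_perm[OF L sg0 nb0 u0 e0 permutes_inv[OF r0]])
      then obtain u where u: "u \<in> L" "u \<noteq> (\<lambda>\<rho>. 0)" "eig G M G M u"
        by (auto simp: comp_assoc permutes_inv_o[OF r0])
      have "vac \<in> L"
      proof (rule vac_mem_of_stab_support[of M "h \<circ> g" G L u, OF sgM k mono key L u(1,2)])
        fix \<rho> x assume "u \<rho> \<noteq> 0" and x: "x \<in> {1..n}"
        have "\<forall>x\<in>{1..n}. (h \<circ> g) (\<rho> x) = (h \<circ> g) x"
          by (rule weight_vector_support[of M "h \<circ> g" G u \<rho>, OF sgM k mono key u(3) nswG \<open>u \<rho> \<noteq> 0\<close>])
        then show "(h \<circ> g) (\<rho> x) = (h \<circ> g) x" using x by auto
      qed
      then show ?thesis using stable_vac[OF L] by simp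
    qed simp
  qed
  then have "irred (G \<circ> inv_into UNIV g) (M \<circ> inv_into UNIV g)"
    by (rule irred_perm[OF _ sgM nbG gi])
  then show ?thesis
    by (simp add: G_def M_def comp_assoc permutes_inv_o[OF g])
qed

theorem irred_iff:
  assumes k: "k \<noteq> 0" and n: "n > 0" and sgn: "\<And>j. \<mu> j * \<mu> j = 1"
  shows "irred \<gamma> \<mu> \<longleftrightarrow> (\<forall>p\<in>{1..n}. \<forall>q\<in>{1..n}. \<not> bad \<gamma> \<mu> p q) \<and>
    \<not> (\<exists>w. w permutes {1..n} \<and> (\<forall>j\<in>{1..n}. \<gamma> (w j) = \<gamma> j \<and> \<mu> (w j) = - \<mu> j))"
proof
  assume irr: "irred \<gamma> \<mu>"
  show "(\<forall>p\<in>{1..n}. \<forall>q\<in>{1..n}. \<not> bad \<gamma> \<mu> p q) \<and>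
    \<not> (\<exists>w. w permutes {1..n} \<and> (\<forall>j\<in>{1..n}. \<gamma> (w j) = \<gamma> j \<and> \<mu> (w j) = - \<mu> j))"
    using irred_imp_not_bad[OF k irr sgn] irred_imp_no_sign_swap[OF k n irr sgn] by blast
next
  assume "(\<forall>p\<in>{1..n}. \<forall>q\<in>{1..n}. \<not> bad \<gamma> \<mu> p q) \<and>
    \<not> (\<exists>w. w permutes {1..n} \<and> (\<forall>j\<in>{1..n}. \<gamma> (w j) = \<gamma> j \<and> \<mu> (w j) = - \<mu> j))"
  then show "irred \<gamma> \<mu>" by (intro irred_if[OF k sgn]) blast+
qed

end

section \<open>Signed permutations\<close>

lemma group_gen_id: "id \<in> group_gen S"
proof -
  have "\<one>\<^bsub>BijGroup UNIV\<^esub> = (id :: rvec \<Rightarrow> rvec)"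
    by (simp add: BijGroup_def restrict_UNIV id_def)
  then show ?thesis unfolding group_gen_def by (metis generate.one)
qed

lemma group_gen_incl: "x \<in> S \<Longrightarrow> x \<in> group_gen S"
  unfolding group_gen_def by (rule generate.incl)

lemma involution_Bij:
  fixes x :: "'a \<Rightarrow> 'a"
  assumes "x \<circ> x = id"
  shows "x \<in> Bij UNIV"
  using o_bij[OF assms assms] by (simp add: Bij_def)

lemma BijGroup_UNIV_mult:
  assumes "x \<in> Bij UNIV" "y \<in> Bij UNIV"
  shows "x \<otimes>\<^bsub>BijGroup UNIV\<^esub> y = x \<circ> y"
  using assms by (simp add: BijGroup_def compose_def comp_def restrict_UNIV)

lemma BijGroup_inv_involution:
  fixes x :: "'a \<Rightarrow> 'a"
  assumes "x \<circ> x = id"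
  shows "inv\<^bsub>BijGroup UNIV\<^esub> x = x"
proof -
  interpret group "BijGroup (UNIV :: 'a set)" by (rule group_BijGroup)
  have x: "x \<in> carrier (BijGroup UNIV)" using involution_Bij[OF assms] by (simp add: BijGroup_def)
  show ?thesis
    by (rule inv_equality[OF _ x x])
       (use involution_Bij[OF assms] assms in \<open>simp add: BijGroup_UNIV_mult, simp add: BijGroup_def restrict_UNIV id_def\<close>)
qed

text \<open>The multiplication of \<open>BijGroup\<close> is composition on bijections; involutions
  generate bijections, so the two agree here.\<close>

lemma group_gen_comp:
  assumes S: "\<And>x. x \<in> S \<Longrightarrow> x \<circ> x = id" and "x \<in> group_gen S" "y \<in> group_gen S"
  shows "x \<circ> y \<in> group_gen S"
proof -
  interpret group "BijGroup (UNIV :: rvec set)" by (rule group_BijGroup)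
  have S': "S \<subseteq> carrier (BijGroup UNIV)" using involution_Bij[OF S] by (auto simp: BijGroup_def)
  have "z \<in> Bij UNIV" if "z \<in> group_gen S" for z
    using generate_incl[OF S'] that unfolding group_gen_def by (auto simp: BijGroup_def)
  then have "x \<otimes>\<^bsub>BijGroup UNIV\<^esub> y = x \<circ> y" using assms by (intro BijGroup_UNIV_mult)
  moreover have "x \<otimes>\<^bsub>BijGroup UNIV\<^esub> y \<in> group_gen S"
    using assms(2,3) unfolding group_gen_def by (rule generate.eng)
  ultimately show ?thesis by simp
qed

text \<open>Generators are their own inverses, so the inverse case of \<open>generate\<close> falls
  back on the case of a generator.\<close>

lemma group_gen_induct [consumes 1, case_names involution id incl comp]:
  assumes x: "x \<in> group_gen S" and S: "\<And>x. x \<in> S \<Longrightarrow> x \<circ> x = id"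
    and "P id" and incl: "\<And>x. x \<in> S \<Longrightarrow> P x"
    and comp: "\<And>x y. x \<in> group_gen S \<Longrightarrow> y \<in> group_gen S \<Longrightarrow> P x \<Longrightarrow> P y \<Longrightarrow> P (x \<circ> y)"
  shows "P x"
proof -
  interpret group "BijGroup (UNIV :: rvec set)" by (rule group_BijGroup)
  have S': "S \<subseteq> carrier (BijGroup UNIV)" using involution_Bij[OF S] by (auto simp: BijGroup_def)
  have B: "z \<in> Bij UNIV" if "z \<in> group_gen S" for z
    using generate_incl[OF S'] that unfolding group_gen_def by (auto simp: BijGroup_def)
  have "x \<in> generate (BijGroup UNIV) S" using x by (simp add: group_gen_def)
  then show ?thesis
  proof (induction rule: generate.induct)
    case one
    have "\<one>\<^bsub>BijGroup UNIV\<^esub> = (id :: rvec \<Rightarrow> rvec)"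
      by (simp add: BijGroup_def restrict_UNIV id_def)
    then show ?case using assms(3) by (simp only:)
  next
    case (incl h)
    then show ?case by (rule assms(4))
  next
    case (inv h)
    then show ?case using BijGroup_inv_involution[OF S[OF inv]] assms(4)[OF inv] by simp
  next
    case (eng h1 h2)
    then have "h1 \<in> group_gen S" "h2 \<in> group_gen S" by (simp_all add: group_gen_def)
    then have "P (h1 \<circ> h2)" "h1 \<otimes>\<^bsub>BijGroup UNIV\<^esub> h2 = h1 \<circ> h2"
      using comp[of h1 h2] eng B by (simp_all add: BijGroup_UNIV_mult)
    then show ?case by (simp only:)
  qed
qed

text \<open>The signed permutation that sends the basis vector with index j to the one with index
  \<pi>(j), times the sign at \<pi>(j): signs are indexed by the target.\<close>

definition sp :: "(nat \<Rightarrow> real) \<Rightarrow> (nat \<Rightarrow> nat) \<Rightarrow> endo" where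
  "sp s \<pi> v = (\<lambda>l. s l * v (inv_into UNIV \<pi> l))"

text \<open>Signs are normalised to 1 outside the index range, so that the sign vector can be
  recovered from \<open>sp s \<pi>\<close> as a map on all sequences.\<close>

definition signs :: "nat \<Rightarrow> (nat \<Rightarrow> real) set" where
  "signs n = {s. (\<forall>l. s l = 1 \<or> s l = -1) \<and> (\<forall>l. l \<notin> {1..n} \<longrightarrow> s l = 1)}"

abbreviation sone :: "nat \<Rightarrow> real" where "sone \<equiv> \<lambda>_. 1"

definition flip :: "nat \<Rightarrow> nat \<Rightarrow> real" where
  "flip j = (\<lambda>l. if l = j then -1 else 1)"

lemma sp_id: "sp sone id = id"
  by (auto simp: sp_def fun_eq_iff)

lemma sp_comp:
  assumes "bij \<pi>" "bij \<pi>'"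
  shows "sp s \<pi> \<circ> sp s' \<pi>' = sp (\<lambda>l. s l * s' (inv_into UNIV \<pi> l)) (\<pi> \<circ> \<pi>')"
  by (simp add: sp_def fun_eq_iff o_inv_distrib[OF assms])

lemma sp_eps:
  assumes "bij \<pi>"
  shows "sp s \<pi> (eps j) = (\<lambda>l. if l = \<pi> j then s l else 0)"
proof -
  have "inv_into UNIV \<pi> l = j \<longleftrightarrow> l = \<pi> j" for l
    using assms by (metis bij_inv_eq_iff)
  then show ?thesis by (auto simp: sp_def eps_def fun_eq_iff)
qed

lemma signs_nonzero: "s \<in> signs n \<Longrightarrow> s l \<noteq> 0"
  by (auto simp: signs_def dest!: spec[of _ l])

lemma signs_sq: "s \<in> signs n \<Longrightarrow> s l * s l = 1"
  by (auto simp: signs_def dest!: spec[of _ l])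

lemma sp_inject:
  assumes "s \<in> signs n" "s' \<in> signs n" "bij \<pi>" "bij \<pi>'" "sp s \<pi> = sp s' \<pi>'"
  shows "s = s'" "\<pi> = \<pi>'"
proof -
  have eq: "(if l = \<pi> j then s l else 0) = (if l = \<pi>' j then s' l else 0)" for j l
    using fun_cong[OF fun_cong[OF assms(5)], of "eps j" l] assms(3,4) by (simp add: sp_eps)
  show p: "\<pi> = \<pi>'"
  proof
    fix j show "\<pi> j = \<pi>' j"
      using eq[of "\<pi> j" j] signs_nonzero[OF assms(1), of "\<pi> j"] by (auto split: if_splits)
  qed
  show "s = s'"
  proof
    fix l
    obtain j where "l = \<pi> j" using assms(3) by (metis bij_pointE)
    then show "s l = s' l" using eq[of l j] p by auto
  qed
qed

lemma signs_one [simp]: "sone \<in> signs n"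
  by (simp add: signs_def)

lemma signs_flip: "j \<in> {1..n} \<Longrightarrow> flip j \<in> signs n"
  by (auto simp: signs_def flip_def)

lemma signs_mult: "s \<in> signs n \<Longrightarrow> s' \<in> signs n \<Longrightarrow> (\<lambda>l. s l * s' l) \<in> signs n"
proof -
  assume s: "s \<in> signs n" "s' \<in> signs n"
  have "s l * s' l = 1 \<or> s l * s' l = -1" for l
  proof -
    have "s l = 1 \<or> s l = -1" "s' l = 1 \<or> s' l = -1" using s by (simp_all add: signs_def)
    then show ?thesis by auto
  qed
  moreover have "s l * s' l = 1" if "l \<notin> {1..n}" for l
    using s that by (simp add: signs_def)
  ultimately show ?thesis unfolding signs_def by blast
qed

lemma signs_above: "s \<in> signs n \<Longrightarrow> l > n \<Longrightarrow> s l = 1"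
  by (simp add: signs_def)

lemma signs_perm:
  assumes "s \<in> signs n" "\<pi> permutes {1..n}"
  shows "(\<lambda>l. s (\<pi> l)) \<in> signs n"
  using assms permutes_in_image[OF assms(2)] by (auto simp: signs_def)

lemma sp_permutes_comp:
  assumes "\<pi> permutes A" "\<pi>' permutes B"
  shows "sp s \<pi> \<circ> sp s' \<pi>' = sp (\<lambda>l. s l * s' (inv_into UNIV \<pi> l)) (\<pi> \<circ> \<pi>')"
  using sp_comp[OF permutes_bij[OF assms(1)] permutes_bij[OF assms(2)]] .

lemma sp_decomp: "\<pi> permutes A \<Longrightarrow> sp s \<pi> = sp s id \<circ> sp sone \<pi>"
  by (simp add: sp_comp[OF bij_id permutes_bij])

lemma sp_torus_comp: "sp s id \<circ> sp s' id = sp (\<lambda>l. s l * s' l) id"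
  by (simp add: sp_comp)

lemma sp_one_comp: "\<pi> permutes A \<Longrightarrow> \<pi>' permutes B \<Longrightarrow> sp sone \<pi> \<circ> sp sone \<pi>' = sp sone (\<pi> \<circ> \<pi>')"
  by (simp add: sp_permutes_comp)

lemma sp_torus_move:
  assumes "\<pi> permutes A"
  shows "sp s id \<circ> sp sone \<pi> = sp sone \<pi> \<circ> sp (s \<circ> \<pi>) id"
  using assms by (simp add: sp_comp permutes_bij permutes_inverses)

section \<open>Reflections as signed permutations and the groups they generate\<close>

lemma inner_eps: "j \<in> {1..n} \<Longrightarrow> inner_n n (eps j) v = v j"
  by (simp add: inner_n_def eps_def if_distrib[of "\<lambda>x. x * _"] cong: if_cong)

lemma inner_add: "inner_n n (\<lambda>l. a * u l + b * w l) v = a * inner_n n u v + b * inner_n n w v"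
  by (simp add: inner_n_def sum_distrib_left sum.distrib algebra_simps)

lemma reflect_eps_scaled:
  assumes "j \<in> {1..n}" "a \<in> {1, -1}"
  shows "reflect n (\<lambda>l. a * eps j l) = sp (flip j) id"
proof -
  have "inner_n n (\<lambda>l. a * eps j l) v = a * v j" for v
    using inner_add[of n a "eps j" 0 "eps j" v] inner_eps[OF assms(1)] by simp
  then show ?thesis using assms(2)
    by (auto simp: reflect_def coroot_def sp_def flip_def eps_def fun_eq_iff)
qed

lemma reflect_eps: "j \<in> {1..n} \<Longrightarrow> reflect n (eps j) = sp (flip j) id"
  using reflect_eps_scaled[of j n 1] by simp

text \<open>The two coordinates are exchanged with the common sign -ab: a pure exchange for
  \<epsilon>_i - \<epsilon>_j, an exchange with two sign changes for \<epsilon>_i +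
  \<epsilon>_j.\<close>

lemma reflect_pair:
  assumes ij: "i \<in> {1..n}" "j \<in> {1..n}" "i \<noteq> j" and ab: "a \<in> {1, -1}" "b \<in> {1, -1}"
  shows "reflect n (\<lambda>l. a * eps i l + b * eps j l) =
     sp (\<lambda>l. if l = i \<or> l = j then - a * b else 1) (tr i j)"
proof -
  have "inner_n n (\<lambda>l. a * eps i l + b * eps j l) v = a * v i + b * v j" for v
    by (simp only: inner_add inner_eps[OF ij(1)] inner_eps[OF ij(2)])
  moreover have "inv_into UNIV (tr i j) = tr i j"
    by (simp add: inv_equality)
  ultimately have r: "reflect n (\<lambda>l. a * eps i l + b * eps j l) v l =
      v l - 2 * (a * v i + b * v j) / (a * (a * eps i i + b * eps j i) + b * (a * eps i j + b * eps j j)) * (a * eps i l + b * eps j l)"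
    and i: "inv_into UNIV (tr i j) = tr i j" for v l
    by (simp_all only: reflect_def coroot_def)
  have "reflect n (\<lambda>l. a * eps i l + b * eps j l) v l = sp (\<lambda>l. if l = i \<or> l = j then - a * b else 1) (tr i j) v l" for v l
    unfolding r sp_def i using ij ab
    by (auto simp: eps_def Transposition.transpose_def field_simps)
  then show ?thesis by blast
qed

lemma reflect_rootA:
  assumes "i \<in> {1..n}" "j \<in> {1..n}" "i \<noteq> j"
  shows "reflect n (rootA i j) = sp sone (tr i j)"
proof -
  have "(\<lambda>l. if l = i \<or> l = j then - (1::real) * - 1 else 1) = sone" by auto
  then show ?thesis using reflect_pair[OF assms, of 1 "-1"] by (simp add: rootA_def)
qed

lemma sp_transpose_involution:
  assumes "s i * s j = 1" "\<And>l. s l * s l = 1"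
  shows "sp s (tr i j) \<circ> sp s (tr i j) = id"
proof -
  have i: "inv_into UNIV (tr i j) = tr i j" by (simp add: inv_equality)
  have "s l * s (tr i j l) = 1" for l
    using assms by (auto simp: Transposition.transpose_def mult.commute)
  then show ?thesis
    by (simp add: sp_comp i) (simp add: sp_id[unfolded id_def] id_def)
qed

lemma sp_torus_involution: "(\<And>l. s l * s l = 1) \<Longrightarrow> sp s id \<circ> sp s id = id"
  by (simp add: sp_torus_comp sp_id)

lemma flip_sq: "flip j l * flip j l = 1"
  by (simp add: flip_def)

lemma torus_gens_involution: "x \<in> reflect n ` (eps ` {1..n}) \<Longrightarrow> x \<circ> x = id"
  by (auto simp: reflect_eps intro!: sp_torus_involution flip_sq)

text \<open>For the reverse inclusion the negative signs of a sign vector are switched on one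
  position at a time.\<close>

lemma T_B_eq: "T_B n = {sp s id | s. s \<in> signs n}"
proof
  define Q where "Q = {sp s id | s. s \<in> signs n}"
  have "x \<in> Q" if "x \<in> group_gen (reflect n ` (eps ` {1..n}))" for x
    using that
  proof (induction rule: group_gen_induct)
    case (involution x)
    then show ?case by (rule torus_gens_involution)
  next
    case id
    have "id \<in> Q"
      unfolding Q_def by (rule CollectI, rule exI[of _ sone]) (simp add: sp_id)
    then show ?case .
  next
    case (incl x)
    then obtain j where j: "j \<in> {1..n}" "x = sp (flip j) id" using reflect_eps[of _ n] by auto
    then show ?case using signs_flip[OF j(1)] unfolding Q_def by blast
  next
    case (comp x y)
    then obtain s s' where "x = sp s id" "s \<in> signs n" "y = sp s' id" "s' \<in> signs n"
      unfolding Q_def by blast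
    then have "x \<circ> y \<in> Q" unfolding Q_def using sp_torus_comp[of s s'] signs_mult[of s n s'] by blast
    then show ?case .
  qed
  then show "T_B n \<subseteq> {sp s id | s. s \<in> signs n}"
    unfolding T_B_def Weyl_def Q_def by blast
  show "{sp s id | s. s \<in> signs n} \<subseteq> T_B n"
  proof clarify
    fix s assume s: "s \<in> signs n"
    have "sp (\<lambda>l. if l \<in> A then s l else 1) id \<in> T_B n" if "finite A" for A
      using that
    proof (induction A rule: finite_induct)
      case empty
      have "sp sone id \<in> T_B n" unfolding T_B_def Weyl_def sp_id by (rule group_gen_id)
      then show ?case by (simp only: empty_iff if_False)
    next
      case (insert j A)
      show ?case
      proof (cases "s j = 1")
        case True
        then have "(\<lambda>l. if l \<in> insert j A then s l else 1) = (\<lambda>l. if l \<in> A then s l else 1)"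
          by (auto simp: fun_eq_iff)
        then show ?thesis using insert by simp
      next
        case False
        then have sj: "s j = -1" "j \<in> {1..n}" using s by (auto simp: signs_def)
        have "(\<lambda>l. if l \<in> insert j A then s l else 1) = (\<lambda>l. flip j l * (if l \<in> A then s l else 1))"
          using sj insert(2) by (auto simp: fun_eq_iff flip_def)
        then have e: "sp (\<lambda>l. if l \<in> insert j A then s l else 1) id = sp (flip j) id \<circ> sp (\<lambda>l. if l \<in> A then s l else 1) id"
          by (simp only: sp_torus_comp)
        have "sp (flip j) id \<in> T_B n"
          unfolding T_B_def Weyl_def by (rule group_gen_incl) (use sj reflect_eps in force)
        then show ?thesis
          using insert.IH unfolding e T_B_def Weyl_def
          by (intro group_gen_comp[OF torus_gens_involution[of _ n]])
      qed
    qed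
    from this[of "{1..n}"] have "sp (\<lambda>l. if l \<in> {1..n} then s l else 1) id \<in> T_B n" by simp
    moreover have "(\<lambda>l. if l \<in> {1..n} then s l else 1) = s" using s by (auto simp: signs_def fun_eq_iff)
    ultimately show "sp s id \<in> T_B n" by simp
  qed
qed

lemma flip_adj_signs: "1 \<le> i \<Longrightarrow> i < n \<Longrightarrow> (\<lambda>l. flip i l * flip (i + 1) l) \<in> signs n"
  by (intro signs_mult signs_flip) auto

lemma U_gen_eq:
  "{reflect n (eps i) \<circ> reflect n (eps (i + 1)) | i. 1 \<le> i \<and> i < n} =
    {sp (\<lambda>l. flip i l * flip (i + 1) l) id | i. 1 \<le> i \<and> i < n}"
proof -
  have "reflect n (eps i) \<circ> reflect n (eps (i + 1)) = sp (\<lambda>l. flip i l * flip (i + 1) l) id"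
    if "1 \<le> i" "i < n" for i
    using that by (simp add: reflect_eps sp_torus_comp)
  then show ?thesis by (intro Collect_cong) metis
qed

lemma U_gens_involution:
  "x \<in> {sp (\<lambda>l. flip i l * flip (i + 1) l) id | i. 1 \<le> i \<and> i < n} \<Longrightarrow> x \<circ> x = id"
  by (auto intro!: sp_torus_involution simp: flip_def)

lemma prod_flip: "j \<in> {1..n} \<Longrightarrow> (\<Prod>l\<in>{1..n}. flip j l) = -1"
  by (simp add: flip_def)

text \<open>The parity of the number of sign changes is invariant under the generators. Conversely,
  the highest sign change, at position m + 1, is cleared by the generator for m and m + 1; parity
  prevents a single sign change at position 1 from remaining.\<close>

lemma U_D_eq: "U_D n = {sp s id | s. s \<in> signs n \<and> (\<Prod>j\<in>{1..n}. s j) = 1}"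
proof
  let ?S = "{sp (\<lambda>l. flip i l * flip (i + 1) l) id | i. 1 \<le> i \<and> i < n}"
  have U: "U_D n = group_gen ?S" by (simp add: U_D_def U_gen_eq)
  define Q where "Q = {sp s id | s. s \<in> signs n \<and> (\<Prod>j\<in>{1..n}. s j) = 1}"
  have "x \<in> Q" if "x \<in> group_gen ?S" for x
    using that
  proof (induction rule: group_gen_induct)
    case (involution x)
    then show ?case by (rule U_gens_involution)
  next
    case id
    have "id \<in> Q"
      unfolding Q_def by (rule CollectI, rule exI[of _ sone]) (simp add: sp_id)
    then show ?case .
  next
    case (incl x)
    then obtain i where i: "x = sp (\<lambda>l. flip i l * flip (i + 1) l) id" "1 \<le> i" "i < n" by blast
    have "(\<Prod>j\<in>{1..n}. flip i j * flip (i + 1) j) = 1"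
      unfolding prod.distrib using prod_flip[of i n] prod_flip[of "i + 1" n] i by simp
    then have "x \<in> Q"
      unfolding Q_def using flip_adj_signs[OF i(2,3)] i(1) by blast
    then show ?case .
  next
    case (comp x y)
    then obtain s s' where *: "x = sp s id" "s \<in> signs n" "(\<Prod>j\<in>{1..n}. s j) = 1"
      "y = sp s' id" "s' \<in> signs n" "(\<Prod>j\<in>{1..n}. s' j) = 1" unfolding Q_def by blast
    have "(\<Prod>j\<in>{1..n}. s j * s' j) = 1" using * by (simp add: prod.distrib)
    then have "x \<circ> y \<in> Q"
      unfolding Q_def using * sp_torus_comp[of s s'] signs_mult[of s n s'] by blast
    then show ?case .
  qed
  then show "U_D n \<subseteq> {sp s id | s. s \<in> signs n \<and> (\<Prod>j\<in>{1..n}. s j) = 1}"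
    unfolding U Q_def by blast
  have "sp s id \<in> U_D n" if "s \<in> signs n" "(\<Prod>j\<in>{1..n}. s j) = 1" "\<And>l. l > m \<Longrightarrow> s l = 1" "m \<le> n" for s m
    using that
  proof (induction m arbitrary: s)
    case 0
    have "s l = 1" for l
      using 0(1,3) by (cases "l = 0") (auto simp: signs_def)
    then have "s = sone" by (simp add: fun_eq_iff)
    then have "sp s id \<in> U_D n" unfolding U using group_gen_id[of ?S] sp_id by (simp only:)
    then show ?case .
  next
    case (Suc m)
    show ?case
    proof (cases "s (Suc m) = 1")
      case True
      then have "\<And>l. l > m \<Longrightarrow> s l = 1" using Suc.prems(3) by (metis Suc_lessI)
      then show ?thesis using Suc by auto
    next
      case False
      then have s1: "s (Suc m) = -1" using Suc.prems(1) by (auto simp: signs_def)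
      have m: "m \<ge> 1"
      proof (rule ccontr)
        assume "\<not> m \<ge> 1"
        then have "m = 0" by simp
        then have "(\<Prod>j\<in>{1..n}. s j) = (\<Prod>j\<in>{1..n}. flip 1 j)"
          using Suc.prems(1,3) s1 by (intro prod.cong) (auto simp: flip_def One_nat_def)
        then show False using prod_flip[of 1 n] Suc.prems \<open>m = 0\<close> by simp
      qed
      define s' where "s' = (\<lambda>l. (flip m l * flip (m + 1) l) * s l)"
      have ff: "(\<Prod>j\<in>{1..n}. flip m j * flip (m + 1) j) = 1"
        unfolding prod.distrib using prod_flip[of m n] prod_flip[of "m + 1" n] m Suc.prems(4) by simp
      have "sp s' id \<in> U_D n"
      proof (rule Suc.IH)
        show "s' \<in> signs n" unfolding s'_def using m Suc.prems by (intro signs_mult[OF flip_adj_signs]) auto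
        show "(\<Prod>j\<in>{1..n}. s' j) = 1" unfolding s'_def prod.distrib[of "\<lambda>j. flip m j * flip (m + 1) j"] ff
          using Suc.prems(2) by simp
        show "s' l = 1" if "l > m" for l
          using that s1 Suc.prems(3)[of l] by (cases "l = Suc m") (auto simp: s'_def flip_def)
      qed (use Suc.prems in simp)
      moreover have "sp (\<lambda>l. flip m l * flip (m + 1) l) id \<in> U_D n"
        unfolding U by (rule group_gen_incl) (use m Suc.prems in auto)
      moreover have "sp s id = sp (\<lambda>l. flip m l * flip (m + 1) l) id \<circ> sp s' id"
      proof -
        have "(flip m l * flip (m + 1) l) * ((flip m l * flip (m + 1) l) * s l) = s l" for l
          by (simp add: flip_def)
        then show ?thesis unfolding sp_torus_comp s'_def by (simp only:)
      qed
      ultimately show ?thesis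
        unfolding U by (simp only:) (rule group_gen_comp[OF U_gens_involution])
    qed
  qed
  then show "{sp s id | s. s \<in> signs n \<and> (\<Prod>j\<in>{1..n}. s j) = 1} \<subseteq> U_D n"
    by (blast intro: signs_above)
qed

text \<open>Stated for an arbitrary finite index set because it serves W_A as well as the two blocks
  of the group \<open>Weyl n (R_sub n m)\<close>.\<close>

lemma group_gen_transpositions:
  assumes "finite A" and E: "\<And>x. x \<in> S \<Longrightarrow> \<exists>i\<in>A. \<exists>j\<in>A. i \<noteq> j \<and> x = sp sone (tr i j)"
    and G: "\<And>i j. i \<in> A \<Longrightarrow> j \<in> A \<Longrightarrow> i \<noteq> j \<Longrightarrow> sp sone (tr i j) \<in> S"
  shows "group_gen S = {sp sone \<pi> | \<pi>. \<pi> permutes A}"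
proof
  have inv: "x \<circ> x = id" if "x \<in> S" for x
    using E[OF that] sp_transpose_involution[of sone] by auto
  define Q where "Q = {sp sone \<pi> | \<pi>. \<pi> permutes A}"
  have "x \<in> Q" if "x \<in> group_gen S" for x
    using that
  proof (induction rule: group_gen_induct)
    case (involution x)
    then show ?case by (rule inv)
  next
    case id
    have "id \<in> Q"
      unfolding Q_def by (rule CollectI, rule exI[of _ id]) (simp add: sp_id permutes_id)
    then show ?case .
  next
    case (incl x)
    then obtain i j where "i \<in> A" "j \<in> A" "x = sp sone (tr i j)" using E[OF incl] by blast
    then show ?case using permutes_swap_id[of i A j] unfolding Q_def by blast
  next
    case (comp x y)
    then obtain p q where *: "x = sp sone p" "y = sp sone q" "p permutes A" "q permutes A"
      unfolding Q_def by blast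
    then have "x \<circ> y \<in> Q"
      unfolding Q_def using sp_one_comp[of p A q A] permutes_compose[of q A p] by blast
    then show ?case .
  qed
  then show "group_gen S \<subseteq> {sp sone \<pi> | \<pi>. \<pi> permutes A}" unfolding Q_def by blast
  show "{sp sone \<pi> | \<pi>. \<pi> permutes A} \<subseteq> group_gen S"
  proof clarify
    fix \<pi> assume "\<pi> permutes A"
    with assms(1) show "sp sone \<pi> \<in> group_gen S"
    proof (induction rule: permutes_rev_induct)
      case id
      show ?case using group_gen_id[of S] sp_id by (simp only:)
    next
      case (swap a b p)
      have "sp sone (p \<circ> tr a b) = sp sone p \<circ> sp sone (tr a b)"
        using sp_one_comp[OF swap.hyps(4) permutes_swap_id[OF swap.hyps(1,2)]] by simp
      then show ?case
        using group_gen_comp[OF inv swap.IH group_gen_incl[OF G[OF swap.hyps(1,2,3)]]] by (simp only:)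
    qed
  qed
qed

lemma W_A_eq: "W_A n = {sp sone \<pi> | \<pi>. \<pi> permutes {1..n}}"
  unfolding W_A_def Weyl_def
proof (rule group_gen_transpositions)
  show "\<exists>i\<in>{1..n}. \<exists>j\<in>{1..n}. i \<noteq> j \<and> x = sp sone (tr i j)" if "x \<in> reflect n ` R_A n" for x
    using that reflect_rootA[of _ n] unfolding R_A_def by blast
  show "sp sone (tr i j) \<in> reflect n ` R_A n" if "i \<in> {1..n}" "j \<in> {1..n}" "i \<noteq> j" for i j
  proof -
    have "rootA i j \<in> R_A n" using that unfolding R_A_def by blast
    then show ?thesis using reflect_rootA[OF that] by (metis imageI)
  qed
qed simp

lemma R_B_involution:
  assumes "x \<in> reflect n ` R_B n"
  shows "x \<circ> x = id" "\<exists>s \<pi>. x = sp s \<pi> \<and> s \<in> signs n \<and> \<pi> permutes {1..n}"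
proof -
  from assms consider (pair) a b i j where "x = reflect n (\<lambda>l. a * eps i l + b * eps j l)"
      "a \<in> {1, -1}" "b \<in> {1, -1}" "1 \<le> i" "i < j" "j \<le> n"
    | (single) a i where "x = reflect n (\<lambda>l. a * eps i l)" "a \<in> {1, -1}" "i \<in> {1..n}"
    unfolding R_B_def by blast
  then have "x \<circ> x = id \<and> (\<exists>s \<pi>. x = sp s \<pi> \<and> s \<in> signs n \<and> \<pi> permutes {1..n})"
  proof cases
    case pair
    let ?s = "\<lambda>l. if l = i \<or> l = j then - a * b else 1"
    have x: "x = sp ?s (tr i j)" using reflect_pair[of i n j a b] pair by simp
    have "?s \<in> signs n" using pair by (auto simp: signs_def)
    moreover have "tr i j permutes {1..n}" using pair by (intro transpose_permutes_Icc) auto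
    moreover have "x \<circ> x = id" unfolding x by (rule sp_transpose_involution) (use pair in auto)
    ultimately show ?thesis using x by blast
  next
    case single
    then have x: "x = sp (flip i) id" using reflect_eps_scaled by simp
    have "x \<circ> x = id" unfolding x by (rule sp_torus_involution[OF flip_sq])
    then show ?thesis using x signs_flip[OF single(3)] permutes_id by blast
  qed
  then show "x \<circ> x = id" "\<exists>s \<pi>. x = sp s \<pi> \<and> s \<in> signs n \<and> \<pi> permutes {1..n}" by auto
qed

lemma group_gen_mono:
  assumes "\<And>x. x \<in> S \<Longrightarrow> x \<circ> x = id" "S' \<subseteq> S"
  shows "group_gen S' \<subseteq> group_gen S"
proof
  fix x assume x: "x \<in> group_gen S'"
  then show "x \<in> group_gen S"
  proof (induction rule: group_gen_induct)
    case (comp x y)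
    show ?case by (rule group_gen_comp[OF assms(1) comp(3,4)])
  qed (use assms group_gen_id group_gen_incl in \<open>auto simp only:\<close>)
qed

text \<open>Every signed permutation is a sign change times a permutation, so one inclusion follows
  once T and W_A are seen to lie in the group.\<close>

lemma W_B_eq: "W_B n = {sp s \<pi> | s \<pi>. s \<in> signs n \<and> \<pi> permutes {1..n}}"
proof
  define Q where "Q = {sp s \<pi> | s \<pi>. s \<in> signs n \<and> \<pi> permutes {1..n}}"
  have "x \<in> Q" if "x \<in> group_gen (reflect n ` R_B n)" for x
    using that
  proof (induction rule: group_gen_induct)
    case (involution x)
    then show ?case by (rule R_B_involution(1))
  next
    case id
    have "id \<in> Q"
      unfolding Q_def by (rule CollectI, rule exI[of _ sone], rule exI[of _ id]) (simp add: sp_id permutes_id)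
    then show ?case .
  next
    case (incl x)
    then show ?case using R_B_involution(2)[of x n] unfolding Q_def by blast
  next
    case (comp x y)
    then obtain p q s s' where *: "x = sp s p" "y = sp s' q" "p permutes {1..n}" "q permutes {1..n}"
      "s \<in> signs n" "s' \<in> signs n" unfolding Q_def by blast
    have "(\<lambda>l. s l * s' (inv_into UNIV p l)) \<in> signs n"
      by (rule signs_mult[OF *(5) signs_perm[OF *(6) permutes_inv[OF *(3)]]])
    then have "x \<circ> y \<in> Q"
      using sp_permutes_comp[OF *(3,4), of s s'] permutes_compose[OF *(4,3)] *(1,2) unfolding Q_def by blast
    then show ?case .
  qed
  then show "W_B n \<subseteq> {sp s \<pi> | s \<pi>. s \<in> signs n \<and> \<pi> permutes {1..n}}"
    unfolding W_B_def Weyl_def Q_def by blast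
  have R: "rootA i j \<in> R_B n" if ij: "i \<in> {1..n}" "j \<in> {1..n}" "i \<noteq> j" for i j
  proof (cases "i < j")
    case True
    have "rootA i j = (\<lambda>l. 1 * eps i l + (-1) * eps j l)" by (simp add: rootA_def)
    moreover have "\<exists>a b i' j'. (\<lambda>l. 1 * eps i l + (-1) * eps j l) = (\<lambda>l. a * eps i' l + b * eps j' l) \<and>
        a \<in> {1, -1} \<and> b \<in> {1, -1} \<and> 1 \<le> i' \<and> i' < j' \<and> j' \<le> n"
      by (rule exI[of _ 1], rule exI[of _ "-1"], rule exI[of _ i], rule exI[of _ j]) (use True ij in auto)
    ultimately show ?thesis unfolding R_B_def by (intro UnI1 CollectI) (simp only:)
  next
    case False
    have "rootA i j = (\<lambda>l. (-1) * eps j l + 1 * eps i l)" by (simp add: rootA_def)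
    moreover have "\<exists>a b i' j'. (\<lambda>l. (-1) * eps j l + 1 * eps i l) = (\<lambda>l. a * eps i' l + b * eps j' l) \<and>
        a \<in> {1, -1} \<and> b \<in> {1, -1} \<and> 1 \<le> i' \<and> i' < j' \<and> j' \<le> n"
      by (rule exI[of _ "-1"], rule exI[of _ 1], rule exI[of _ j], rule exI[of _ i]) (use False ij in auto)
    ultimately show ?thesis unfolding R_B_def by (intro UnI1 CollectI) (simp only:)
  qed
  have "reflect n ` R_A n \<subseteq> reflect n ` R_B n"
    using R unfolding R_A_def by blast
  from group_gen_mono[OF R_B_involution(1) this]
  have A: "W_A n \<subseteq> W_B n" by (simp add: W_A_def W_B_def Weyl_def)
  have "eps i \<in> R_B n" if "i \<in> {1..n}" for i
  proof -
    have "eps i = (\<lambda>l. 1 * eps i l)" by simp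
    moreover have "\<exists>a i'. (\<lambda>l. 1 * eps i l) = (\<lambda>l. a * eps i' l) \<and> a \<in> {1, -1} \<and> i' \<in> {1..n}"
      by (rule exI[of _ 1], rule exI[of _ i]) (use that in auto)
    ultimately show ?thesis unfolding R_B_def by (intro UnI2 CollectI) (simp only:)
  qed
  then have "reflect n ` (eps ` {1..n}) \<subseteq> reflect n ` R_B n" by blast
  from group_gen_mono[OF R_B_involution(1) this]
  have T: "T_B n \<subseteq> W_B n" by (simp add: T_B_def W_B_def Weyl_def)
  show "{sp s \<pi> | s \<pi>. s \<in> signs n \<and> \<pi> permutes {1..n}} \<subseteq> W_B n"
  proof clarify
    fix s \<pi> assume s: "s \<in> signs n" and \<pi>: "\<pi> permutes {1..n}"
    have "sp s id \<in> W_B n" "sp sone \<pi> \<in> W_B n" using T A s \<pi> T_B_eq W_A_eq by blast+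
    then show "sp s \<pi> \<in> W_B n"
      using group_gen_comp[of "reflect n ` R_B n", OF R_B_involution(1)] sp_decomp[OF \<pi>, of s]
      by (simp add: W_B_def Weyl_def)
  qed
qed

lemma T_subset_W: "T_B n \<subseteq> W_B n"
  unfolding T_B_eq W_B_eq using permutes_id by blast

lemma W_A_subset_W: "W_A n \<subseteq> W_B n"
  unfolding W_A_eq W_B_eq using signs_one by blast

lemma U_subset_T: "U_D n \<subseteq> T_B n"
  unfolding U_D_eq T_B_eq by blast

text \<open>The matrix is diagonal; its indices start at 0 while coordinates start at 1, hence the
  shifts.\<close>

lemma det_n_torus: "det_n n (sp s id) = (\<Prod>j\<in>{1..n}. s j)"
proof -
  let ?M = "mat n n (\<lambda>(i, j). sp s id (eps (j + 1)) (i + 1))"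
  have e: "?M $$ (i, j) = (if i = j then s (i + 1) else 0)" if "i < n" "j < n" for i j
    using that by (simp add: sp_eps)
  have "upper_triangular ?M" using e by (auto simp: upper_triangular_def)
  then have "det ?M = prod_list (diag_mat ?M)" by (rule det_upper_triangular) auto
  also have "diag_mat ?M = map (\<lambda>i. s (i + 1)) [0..<n]"
    using e by (auto simp: diag_mat_def intro!: map_cong)
  also have "prod_list \<dots> = (\<Prod>i\<in>{0..<n}. s (i + 1))"
    by (metis atLeastLessThan_upt distinct_upt prod.distinct_set_conv_list)
  also have "\<dots> = (\<Prod>j\<in>{1..n}. s j)"
    by (rule prod.reindex_bij_witness[of _ "\<lambda>j. j - 1" "\<lambda>j. j + 1"]) auto
  finally show ?thesis unfolding det_n_def .
qed

section \<open>The algebras of type B and D\<close>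

text \<open>Since \<open>a\<close> is a fresh key, no cancellation takes place: membership of the
  sum in \<open>free_ring\<close> then passes to both summands, which later inductions use.\<close>

lemma poly_mapping_single_induct [case_names zero add]:
  assumes "P 0" "\<And>f a b. P f \<Longrightarrow> a \<notin> Poly_Mapping.keys f \<Longrightarrow> P (f + Poly_Mapping.single a b)"
  shows "P (f :: 'a \<Rightarrow>\<^sub>0 'b::comm_monoid_add)"
proof (induction f rule: update_induct)
  case const
  then show ?case by (rule assms(1))
next
  case (update f a b)
  have "Poly_Mapping.update a b f = f + Poly_Mapping.single a b"
    using update(1) by (intro poly_mapping_eqI)
      (auto simp: lookup_update lookup_add lookup_single when_def in_keys_iff)
  then show ?case using assms(2)[OF update(3,1)] by simp
qed

section \<open>The free algebra and its scalars\<close>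

lemma free_ring_carrier_iff:
  "f \<in> carrier (free_ring A) \<longleftrightarrow> (\<forall>u \<in> Poly_Mapping.keys f. set (letters u) \<subseteq> A)"
  by (simp add: free_ring_def)

lemma free_ring_simps [simp]:
  "\<zero>\<^bsub>free_ring A\<^esub> = 0" "\<one>\<^bsub>free_ring A\<^esub> = 1"
  "f \<oplus>\<^bsub>free_ring A\<^esub> g = f + g" "f \<otimes>\<^bsub>free_ring A\<^esub> g = f * g"
  by (simp_all add: free_ring_def)

lemma letters_zero [simp]: "letters 0 = []"
  by (simp add: zero_fmon_def)

lemma letters_plus [simp]: "letters (u + v) = letters u @ letters v"
  by (simp add: plus_fmon_def)

lemma free_ring_closed:
  "0 \<in> carrier (free_ring A)" "1 \<in> carrier (free_ring A)"
  "f \<in> carrier (free_ring A) \<Longrightarrow> g \<in> carrier (free_ring A) \<Longrightarrow> f + g \<in> carrier (free_ring A)"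
  "f \<in> carrier (free_ring A) \<Longrightarrow> g \<in> carrier (free_ring A) \<Longrightarrow> f * g \<in> carrier (free_ring A)"
  "f \<in> carrier (free_ring A) \<Longrightarrow> - f \<in> carrier (free_ring A)"
  "f \<in> carrier (free_ring A) \<Longrightarrow> g \<in> carrier (free_ring A) \<Longrightarrow> f - g \<in> carrier (free_ring A)"
  "scal c \<in> carrier (free_ring A)"
proof -
  show a: "f + g \<in> carrier (free_ring A)" if "f \<in> carrier (free_ring A)" "g \<in> carrier (free_ring A)" for f g
    using that keys_add[of f g] unfolding free_ring_carrier_iff by blast
  show "f * g \<in> carrier (free_ring A)" if "f \<in> carrier (free_ring A)" "g \<in> carrier (free_ring A)"
  proof -
    have "set (letters u) \<subseteq> A" if u: "u \<in> Poly_Mapping.keys (f * g)" for u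
    proof -
      obtain v w where "u = v + w" "v \<in> Poly_Mapping.keys f" "w \<in> Poly_Mapping.keys g"
        using keys_mult[of f g] u by auto
      then show ?thesis
        using \<open>f \<in> carrier (free_ring A)\<close> \<open>g \<in> carrier (free_ring A)\<close> by (simp add: free_ring_carrier_iff)
    qed
    then show ?thesis by (simp add: free_ring_carrier_iff)
  qed
  show m: "- f \<in> carrier (free_ring A)" if "f \<in> carrier (free_ring A)" for f
    using that by (simp add: free_ring_carrier_iff in_keys_iff)
  show "f - g \<in> carrier (free_ring A)" if "f \<in> carrier (free_ring A)" "g \<in> carrier (free_ring A)"
    using a[OF that(1) m[OF that(2)]] by simp
qed (auto simp: free_ring_carrier_iff scal_def)

lemma gen_closed: "g \<in> A \<Longrightarrow> gen g \<in> carrier (free_ring A)"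
  by (simp add: free_ring_carrier_iff gen_def)

lemma ring_free_ring: "ring (free_ring A)"
proof (rule ringI)
  show "abelian_group (free_ring A)"
  proof (rule abelian_groupI)
    fix x assume "x \<in> carrier (free_ring A)"
    then show "\<exists>y\<in>carrier (free_ring A). y \<oplus>\<^bsub>free_ring A\<^esub> x = \<zero>\<^bsub>free_ring A\<^esub>"
      by (intro bexI[of _ "- x"]) (simp_all add: free_ring_closed)
  qed (simp_all add: free_ring_closed add.assoc add.commute)
  show "monoid (free_ring A)"
    by (rule monoidI) (simp_all add: free_ring_closed mult.assoc)
qed (simp_all add: distrib_left distrib_right)

lemma free_ring_minus: "f \<in> carrier (free_ring A) \<Longrightarrow> \<ominus>\<^bsub>free_ring A\<^esub> f = - f"
  by (rule abelian_group.minus_equality[OF ring.is_abelian_group[OF ring_free_ring]])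
     (simp_all add: free_ring_closed)

lemma scal_central: "scal c * f = f * scal c"
  by (induction f rule: poly_mapping_single_induct)
     (simp_all add: scal_def distrib_left distrib_right mult_single mult.commute)

lemma scal_add: "scal (a + b) = scal a + scal b"
  by (simp add: scal_def single_add)

lemma scal_mult: "scal (a * b) = scal a * scal b"
  by (simp add: scal_def mult_single)

lemma scal_zero: "scal 0 = 0"
  by (simp add: scal_def)

lemma scal_one: "scal 1 = 1"
  by (simp add: scal_def)

lemma complexify_VC: "\<zeta> \<in> VR n \<Longrightarrow> complexify \<zeta> \<in> VC n"
  by (simp add: VR_def VC_def complexify_def)

lemma VC_perm: "u \<in> VC n \<Longrightarrow> \<pi> permutes {1..n} \<Longrightarrow> u \<circ> \<pi> \<in> VC n"
  by (auto simp: VC_def permutes_not_in)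

lemma VR_perm: "u \<in> VR n \<Longrightarrow> \<pi> permutes {1..n} \<Longrightarrow> u \<circ> \<pi> \<in> VR n"
  by (auto simp: VR_def permutes_not_in)

lemma sp_one_apply: "sp sone \<pi> v = v \<circ> inv_into UNIV \<pi>"
  by (simp add: sp_def fun_eq_iff)

lemma inv_transpose: "inv_into UNIV (tr i j) = tr i j"
  by (simp add: inv_equality)

lemma W_B_comp: "w \<in> W_B n \<Longrightarrow> w' \<in> W_B n \<Longrightarrow> w \<circ> w' \<in> W_B n"
  unfolding W_B_def Weyl_def by (rule group_gen_comp[OF R_B_involution(1)])

lemma W_B_id: "id \<in> W_B n"
  unfolding W_B_def Weyl_def by (rule group_gen_id)

lemma reflect_simple: "1 \<le> i \<Longrightarrow> i < n \<Longrightarrow> reflect n (rootA i (i + 1)) = sp sone (tr i (i + 1))"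
  by (rule reflect_rootA) auto

lemma W_B_simple: "1 \<le> i \<Longrightarrow> i < n \<Longrightarrow> sp sone (tr i (i + 1)) \<in> W_B n"
proof -
  assume "1 \<le> i" "i < n"
  then have "tr i (i + 1) permutes {1..n}" by (intro transpose_permutes_Icc) auto
  then show ?thesis unfolding W_B_eq using signs_one by blast
qed

lemma T_B_flip: "i \<in> {1..n} \<Longrightarrow> sp (flip i) id \<in> T_B n"
  unfolding T_B_eq using signs_flip by blast

lemma coroot_simple:
  assumes "1 \<le> i" "i < n"
  shows "coroot n (rootA i (i + 1)) v = v i - v (i + 1)"
proof -
  have i: "inner_n n (rootA i (i + 1)) w = w i - w (i + 1)" for w
    using inner_add[of n 1 "eps i" "-1" "eps (i + 1)" w] inner_eps[of i n w] inner_eps[of "i + 1" n w] assms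
    by (simp add: rootA_def)
  show ?thesis unfolding coroot_def i by (simp add: rootA_def eps_def)
qed

locale hecke_algebra = hecke_model n k for n :: nat and k :: complex +
  assumes n2: "n \<ge> 2"
begin

abbreviation "FR \<equiv> free_ring (gensB n)"
abbreviation "H \<equiv> H_B n k"
abbreviation "cl \<equiv> clsB n k"
abbreviation "Sc \<equiv> scalB n k"
abbreviation "V \<equiv> vecB n k"
abbreviation "t \<equiv> tB n k"
abbreviation hmul (infixl \<open>*h\<close> 70) where "x *h y \<equiv> x \<otimes>\<^bsub>H\<^esub> y"
abbreviation hadd (infixl \<open>+h\<close> 65) where "x +h y \<equiv> x \<oplus>\<^bsub>H\<^esub> y"

section \<open>The presentation of the algebra of type B as a quotient\<close>

lemma gen_Vec: "u \<in> VC n \<Longrightarrow> gen (Vec u) \<in> carrier FR"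
  by (rule gen_closed) (simp add: gensB_def)

lemma gen_Grp: "w \<in> W_B n \<Longrightarrow> gen (Grp w) \<in> carrier FR"
  by (rule gen_closed) (simp add: gensB_def)

lemma VC_lin: "u \<in> VC n \<Longrightarrow> v \<in> VC n \<Longrightarrow> (\<lambda>l. a * u l + b * v l) \<in> VC n"
  by (simp add: VC_def)

lemma ktilde_closed:
  assumes "1 \<le> i" "i < n"
  shows "ktilde n k i \<in> carrier FR"
proof -
  have "reflect n (eps i) \<in> W_B n" "reflect n (eps (i + 1)) \<in> W_B n"
    using T_B_flip[of i n] T_B_flip[of "i + 1" n] T_subset_W assms by (auto simp: reflect_eps)
  then show ?thesis
    unfolding ktilde_def by (intro free_ring_closed gen_Grp)
qed

lemma relsB_closed: "relsB n k \<subseteq> carrier FR"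
proof
  fix r assume "r \<in> relsB n k"
  then show "r \<in> carrier FR"
  proof cases
    case (lin u v a b)
    then show ?thesis by (auto intro!: free_ring_closed gen_Vec VC_lin)
  next
    case (comm u v)
    then show ?thesis by (auto intro!: free_ring_closed gen_Vec)
  next
    case one
    then show ?thesis by (auto intro!: free_ring_closed gen_Grp W_B_id)
  next
    case (mult w w')
    then show ?thesis by (auto intro!: free_ring_closed gen_Grp W_B_comp)
  next
    case (torus x \<zeta>)
    have "x \<in> W_B n" using torus(2) T_subset_W by auto
    then show ?thesis unfolding torus(1) using torus(3) by (intro free_ring_closed gen_Grp gen_Vec complexify_VC)
  next
    case (cross i \<alpha> \<zeta>)
    have r: "reflect n \<alpha> = sp sone (tr i (i + 1))" using cross reflect_simple by simp
    have w: "reflect n \<alpha> \<in> W_B n" unfolding r using cross W_B_simple by simp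
    have "tr i (i + 1) permutes {1..n}" using cross by (intro transpose_permutes_Icc) auto
    then have v: "reflect n \<alpha> \<zeta> \<in> VR n" unfolding r sp_one_apply inv_transpose by (rule VR_perm[OF cross(5)])
    show ?thesis unfolding cross(1)
      by (intro free_ring_closed gen_Grp[OF w] gen_Vec complexify_VC v cross(5) ktilde_closed cross(2,3))
  qed
qed

lemma ideal_idealB: "ideal (idealB n k) FR"
  unfolding idealB_def by (rule ring.genideal_ideal[OF ring_free_ring relsB_closed])

lemma ring_H: "ring H"
  unfolding H_B_def by (rule ideal.quotient_is_ring[OF ideal_idealB])

lemma cl_hom: "cl \<in> Ring.ring_hom FR H"
  using ideal.rcos_ring_hom[OF ideal_idealB] unfolding H_B_def clsB_def[abs_def] .

lemma cl_closed: "f \<in> carrier FR \<Longrightarrow> cl f \<in> carrier H"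
  using Ring.ring_hom_closed[OF cl_hom] .

lemma cl_mult: "f \<in> carrier FR \<Longrightarrow> g \<in> carrier FR \<Longrightarrow> cl (f * g) = cl f *h cl g"
  using ring_hom_mult[OF cl_hom] by simp

lemma cl_add: "f \<in> carrier FR \<Longrightarrow> g \<in> carrier FR \<Longrightarrow> cl (f + g) = cl f +h cl g"
  using ring_hom_add[OF cl_hom] by simp

lemma cl_one: "cl 1 = \<one>\<^bsub>H\<^esub>"
  using ring_hom_one[OF cl_hom] by simp

lemma cl_zero: "cl 0 = \<zero>\<^bsub>H\<^esub>"
  using ring_hom_zero[OF cl_hom ring_free_ring ring_H] by simp

lemma carrier_H: "carrier H = cl ` carrier FR"
  unfolding H_B_def FactRing_def A_RCOSETS_def' clsB_def by (simp add: UNION_singleton_eq_range)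

lemma cl_eq_iff:
  assumes "f \<in> carrier FR" "g \<in> carrier FR"
  shows "cl f = cl g \<longleftrightarrow> f - g \<in> idealB n k"
proof -
  have "f \<ominus>\<^bsub>FR\<^esub> g = f - g"
    using free_ring_minus[OF assms(2)] by (simp add: a_minus_def)
  then show ?thesis
    using ring.quotient_eq_iff_same_a_r_cos[OF ring_free_ring ideal_idealB assms]
    by (simp add: clsB_def)
qed

lemma relsB_ideal: "relsB n k \<subseteq> idealB n k"
  unfolding idealB_def by (rule ring.genideal_self[OF ring_free_ring relsB_closed])

lemma cl_eqI: "f - g \<in> relsB n k \<Longrightarrow> f \<in> carrier FR \<Longrightarrow> g \<in> carrier FR \<Longrightarrow> cl f = cl g"
  using cl_eq_iff relsB_ideal by blast

lemma Sc_closed [simp]: "Sc c \<in> carrier H"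
  unfolding scalB_def by (intro cl_closed free_ring_closed)

lemma V_closed [simp]: "u \<in> VC n \<Longrightarrow> V u \<in> carrier H"
  unfolding vecB_def by (intro cl_closed gen_Vec)

lemma t_closed [simp]: "w \<in> W_B n \<Longrightarrow> t w \<in> carrier H"
  unfolding tB_def by (intro cl_closed gen_Grp)

lemma Sc_add: "Sc (a + b) = Sc a +h Sc b"
  unfolding scalB_def scal_add by (intro cl_add free_ring_closed)

lemma Sc_mult: "Sc (a * b) = Sc a *h Sc b"
  unfolding scalB_def scal_mult by (intro cl_mult free_ring_closed)

lemma Sc_zero: "Sc 0 = \<zero>\<^bsub>H\<^esub>"
  unfolding scalB_def scal_zero by (rule cl_zero)

lemma Sc_one: "Sc 1 = \<one>\<^bsub>H\<^esub>"
  unfolding scalB_def scal_one by (rule cl_one)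

lemma Sc_central:
  assumes "x \<in> carrier H"
  shows "Sc c *h x = x *h Sc c"
proof -
  obtain f where f: "f \<in> carrier FR" "x = cl f" using assms carrier_H by auto
  then show ?thesis
    unfolding scalB_def using scal_central[of c f] by (simp add: cl_mult[symmetric] free_ring_closed)
qed

lemma V_lin:
  assumes "u \<in> VC n" "v \<in> VC n"
  shows "V (\<lambda>l. a * u l + b * v l) = Sc a *h V u +h Sc b *h V v"
proof -
  have "V (\<lambda>l. a * u l + b * v l) = cl (scal a * gen (Vec u) + scal b * gen (Vec v))"
    unfolding vecB_def
    by (rule cl_eqI[OF relsB.lin[OF assms]])
       (intro free_ring_closed gen_Vec VC_lin assms)+
  also have "\<dots> = Sc a *h V u +h Sc b *h V v"
    unfolding scalB_def vecB_def using assms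
    by (simp add: cl_add cl_mult free_ring_closed gen_Vec)
  finally show ?thesis .
qed

lemma t_id: "t id = \<one>\<^bsub>H\<^esub>"
proof -
  have "cl (gen (Grp id)) = cl 1"
    by (rule cl_eqI[OF relsB.one]) (intro free_ring_closed gen_Grp W_B_id)+
  then show ?thesis unfolding tB_def by (simp add: cl_one)
qed

lemma t_mult:
  assumes "w \<in> W_B n" "w' \<in> W_B n"
  shows "t w *h t w' = t (w \<circ> w')"
proof -
  have "cl (gen (Grp w) * gen (Grp w')) = cl (gen (Grp (w \<circ> w')))"
    by (rule cl_eqI[OF relsB.mult[OF assms]]) (intro free_ring_closed gen_Grp W_B_comp assms)+
  then show ?thesis unfolding tB_def using assms by (simp add: cl_mult gen_Grp)
qed

text \<open>The relations for T and for the simple reflections are imposed on real vectors; this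
  splitting extends them to complex vectors by linearity.\<close>

lemma VC_split:
  assumes "u \<in> VC n"
  obtains x y where "x \<in> VR n" "y \<in> VR n" "u = (\<lambda>l. 1 * complexify x l + \<i> * complexify y l)"
proof
  show "(\<lambda>l. Re (u l)) \<in> VR n" "(\<lambda>l. Im (u l)) \<in> VR n" using assms by (auto simp: VC_def VR_def)
  show "u = (\<lambda>l. 1 * complexify (\<lambda>l. Re (u l)) l + \<i> * complexify (\<lambda>l. Im (u l)) l)"
    by (rule ext) (simp add: complexify_def complex_eq[symmetric])
qed

end

context hecke_algebra
begin

interpretation H: ring H by (rule ring_H)

lemma t_torus:
  assumes x: "x \<in> T_B n" and u: "u \<in> VC n"
  shows "t x *h V u = V u *h t x"
proof -
  have xW: "x \<in> W_B n" using x T_subset_W by auto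
  have r: "t x *h V (complexify z) = V (complexify z) *h t x" if z: "z \<in> VR n" for z
  proof -
    have "cl (gen (Grp x) * gen (Vec (complexify z))) = cl (gen (Vec (complexify z)) * gen (Grp x))"
      by (rule cl_eqI[OF relsB.torus[OF x z]]) (intro free_ring_closed gen_Grp gen_Vec complexify_VC xW z)+
    then show ?thesis unfolding vecB_def tB_def using xW z by (simp add: cl_mult gen_Grp gen_Vec complexify_VC)
  qed
  obtain y z where yz: "y \<in> VR n" "z \<in> VR n" and u': "u = (\<lambda>l. 1 * complexify y l + \<i> * complexify z l)"
    using VC_split[OF u] by metis
  have tx: "t x \<in> carrier H" using xW by simp
  have v: "V (complexify y) \<in> carrier H" "V (complexify z) \<in> carrier H" using yz by (simp_all add: complexify_VC)
  have e: "V u = Sc 1 *h V (complexify y) +h Sc \<i> *h V (complexify z)"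
    unfolding u' by (rule V_lin) (use yz in \<open>simp_all add: complexify_VC\<close>)
  have "t x *h (Sc c *h V (complexify w)) = Sc c *h V (complexify w) *h t x" if "w \<in> VR n" for c w
    using that tx Sc_central[OF tx, of c] r[OF that]
    by (metis H.m_assoc Sc_closed V_closed complexify_VC)
  then show ?thesis unfolding e using tx v yz by (simp add: H.l_distr H.r_distr)
qed

text \<open>The class of \<open>ktilde\<close>, with t_i t_(i+1) written as one element of U so that
  it visibly lies in the commutative subalgebra.\<close>

definition Kel :: "nat \<Rightarrow> gensym free_alg set" where
  "Kel i = Sc k *h (\<one>\<^bsub>H\<^esub> +h t (sp (\<lambda>l. flip i l * flip (i + 1) l) id))"

lemma flip_pair_W: "1 \<le> i \<Longrightarrow> i < n \<Longrightarrow> sp (\<lambda>l. flip i l * flip (i + 1) l) id \<in> W_B n"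
  using flip_adj_signs T_subset_W T_B_eq by blast

lemma Kel_closed [simp]: "1 \<le> i \<Longrightarrow> i < n \<Longrightarrow> Kel i \<in> carrier H"
  unfolding Kel_def using flip_pair_W by simp

lemma cl_ktilde:
  assumes i: "1 \<le> i" "i < n"
  shows "cl (ktilde n k i) = Kel i"
proof -
  have r: "reflect n (eps i) = sp (flip i) id" "reflect n (eps (i + 1)) = sp (flip (i + 1)) id"
    using i by (auto intro!: reflect_eps)
  have W: "sp (flip i) id \<in> W_B n" "sp (flip (i + 1)) id \<in> W_B n"
    using T_B_flip[of i n] T_B_flip[of "i + 1" n] T_subset_W i by auto
  have "cl (ktilde n k i) = Sc k *h (\<one>\<^bsub>H\<^esub> +h t (sp (flip i) id) *h t (sp (flip (i + 1)) id))"
    unfolding ktilde_def r scalB_def tB_def using W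
    by (simp add: cl_mult cl_add cl_one free_ring_closed gen_Grp)
  then show ?thesis by (simp add: Kel_def t_mult[OF W] sp_torus_comp)
qed

text \<open>The cross relation in coordinates: the coroot of \<epsilon>_i - \<epsilon>_(i+1),
  evaluated at the reflected vector, is the coordinate at i + 1 minus the one at i.\<close>

lemma t_cross:
  assumes i: "1 \<le> i" "i < n" and u: "u \<in> VC n"
  shows "t (sp sone (tr i (i + 1))) *h V u =
     V (u \<circ> tr i (i + 1)) *h t (sp sone (tr i (i + 1))) +h Sc (u (i + 1) - u i) *h Kel i"
proof -
  let ?s = "tr i (i + 1)"
  let ?w = "sp sone ?s"
  have W: "?w \<in> W_B n" using W_B_simple[OF i] .
  have s: "?s permutes {1..n}" using i by (intro transpose_permutes_Icc) auto
  note ref = reflect_simple[OF i]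
  have r: "t ?w *h V (complexify z) =
     V (complexify (z \<circ> ?s)) *h t ?w +h Sc (complex_of_real (z (i + 1) - z i)) *h Kel i" if z: "z \<in> VR n" for z
  proof -
    have ap: "sp sone ?s z = z \<circ> ?s" by (simp only: sp_one_apply inv_transpose)
    have rz: "z \<circ> ?s \<in> VR n" by (rule VR_perm[OF z s])
    have co: "coroot n (rootA i (i + 1)) (z \<circ> ?s) = z (i + 1) - z i"
      by (simp add: coroot_simple[OF i])
    note rel = relsB.cross[OF i refl z, of k, unfolded ref ap co]
    have "cl (gen (Grp ?w) * gen (Vec (complexify z))) =
        cl (gen (Vec (complexify (z \<circ> ?s))) * gen (Grp ?w) + scal (complex_of_real (z (i + 1) - z i)) * ktilde n k i)"
      by (rule cl_eqI[OF rel]) (intro free_ring_closed gen_Grp gen_Vec complexify_VC W z rz ktilde_closed i)+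
    then show ?thesis
      unfolding vecB_def tB_def scalB_def cl_ktilde[OF i, symmetric] using W z rz i
      by (simp add: cl_mult cl_add free_ring_closed gen_Grp gen_Vec complexify_VC ktilde_closed)
  qed
  obtain y z where yz: "y \<in> VR n" "z \<in> VR n" and u': "u = (\<lambda>l. 1 * complexify y l + \<i> * complexify z l)"
    using VC_split[OF u] by metis
  have ysz: "y \<circ> ?s \<in> VR n" "z \<circ> ?s \<in> VR n" using VR_perm s yz by auto
  note cls = complexify_VC[OF yz(1)] complexify_VC[OF yz(2)] complexify_VC[OF ysz(1)] complexify_VC[OF ysz(2)]
  have e: "V u = Sc 1 *h V (complexify y) +h Sc \<i> *h V (complexify z)"
    unfolding u' by (rule V_lin) (use cls in simp_all)
  have us: "u \<circ> ?s = (\<lambda>l. 1 * complexify (y \<circ> ?s) l + \<i> * complexify (z \<circ> ?s) l)"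
    by (simp add: u' complexify_def fun_eq_iff)
  have e': "V (u \<circ> ?s) = Sc 1 *h V (complexify (y \<circ> ?s)) +h Sc \<i> *h V (complexify (z \<circ> ?s))"
    unfolding us by (rule V_lin) (use cls in simp_all)
  have ue: "u (i + 1) - u i = 1 * complex_of_real (y (i + 1) - y i) + \<i> * complex_of_real (z (i + 1) - z i)"
    by (simp add: u' complexify_def algebra_simps)
  have sc: "Sc (u (i + 1) - u i) = Sc 1 *h Sc (complex_of_real (y (i + 1) - y i)) +h Sc \<i> *h Sc (complex_of_real (z (i + 1) - z i))"
    unfolding ue Sc_add Sc_mult ..
  note tw = t_closed[OF W]
  have *: "t ?w *h (Sc c *h V (complexify z)) =
     Sc c *h V (complexify (z \<circ> ?s)) *h t ?w +h Sc c *h Sc (complex_of_real (z (i + 1) - z i)) *h Kel i"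
    if z: "z \<in> VR n" for c z
  proof -
    have c: "V (complexify z) \<in> carrier H" "V (complexify (z \<circ> ?s)) \<in> carrier H"
      using z VR_perm[OF z s] by (simp_all add: complexify_VC)
    have "t ?w *h (Sc c *h V (complexify z)) = Sc c *h (t ?w *h V (complexify z))"
      using Sc_central[OF tw, of c] tw c by (metis H.m_assoc Sc_closed)
    also have "\<dots> = Sc c *h (V (complexify (z \<circ> ?s)) *h t ?w) +h Sc c *h (Sc (complex_of_real (z (i + 1) - z i)) *h Kel i)"
      unfolding r[OF z] using tw c i by (simp add: H.r_distr)
    finally show ?thesis using tw c i by (simp add: H.m_assoc)
  qed
  have VC4: "V (complexify y) \<in> carrier H" "V (complexify z) \<in> carrier H"
    "V (complexify (y \<circ> ?s)) \<in> carrier H" "V (complexify (z \<circ> ?s)) \<in> carrier H"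
    using cls by simp_all
  have "t ?w *h V u = (Sc 1 *h V (complexify (y \<circ> ?s)) *h t ?w +h Sc 1 *h Sc (complex_of_real (y (i + 1) - y i)) *h Kel i)
     +h (Sc \<i> *h V (complexify (z \<circ> ?s)) *h t ?w +h Sc \<i> *h Sc (complex_of_real (z (i + 1) - z i)) *h Kel i)"
    unfolding e using tw VC4 by (simp add: H.r_distr *[OF yz(1)] *[OF yz(2)])
  also have "\<dots> = (Sc 1 *h V (complexify (y \<circ> ?s)) *h t ?w +h Sc \<i> *h V (complexify (z \<circ> ?s)) *h t ?w)
     +h (Sc 1 *h Sc (complex_of_real (y (i + 1) - y i)) *h Kel i +h Sc \<i> *h Sc (complex_of_real (z (i + 1) - z i)) *h Kel i)"
    using tw VC4 i by (simp add: H.a_ac)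
  also have "\<dots> = V (u \<circ> ?s) *h t ?w +h Sc (u (i + 1) - u i) *h Kel i"
    unfolding e' sc using tw VC4 i by (simp add: H.l_distr)
  finally show ?thesis .
qed

text \<open>Words grow by letters appended on the right, in accordance with the straightening below,
  where normal forms are multiplied by generators from the right.\<close>

lemma H_induct [consumes 1, case_names one scal add vec grp]:
  assumes h: "h \<in> carrier H"
    and one: "P \<one>\<^bsub>H\<^esub>"
    and scal: "\<And>x c. x \<in> carrier H \<Longrightarrow> P x \<Longrightarrow> P (Sc c *h x)"
    and add: "\<And>x y. x \<in> carrier H \<Longrightarrow> y \<in> carrier H \<Longrightarrow> P x \<Longrightarrow> P y \<Longrightarrow> P (x +h y)"
    and vec: "\<And>x u. x \<in> carrier H \<Longrightarrow> P x \<Longrightarrow> u \<in> VC n \<Longrightarrow> P (x *h V u)"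
    and grp: "\<And>x w. x \<in> carrier H \<Longrightarrow> P x \<Longrightarrow> w \<in> W_B n \<Longrightarrow> P (x *h t w)"
  shows "P h"
proof -
  have word_cl: "Poly_Mapping.single (Word us) 1 \<in> carrier FR" if "set us \<subseteq> gensB n" for us
    using that by (simp add: free_ring_carrier_iff)
  have word: "P (cl (Poly_Mapping.single (Word us) 1))" if "set us \<subseteq> gensB n" for us
  proof -
    show "P (cl (Poly_Mapping.single (Word us) 1))"
      using that
    proof (induction us rule: rev_induct)
      case Nil
      have "Poly_Mapping.single (Word []) 1 = (1 :: gensym free_alg)"
        unfolding zero_fmon_def[symmetric] by (rule single_one)
      then show ?case using one by (simp add: cl_one)
    next
      case (snoc g us)
      have "Poly_Mapping.single (Word (us @ [g])) 1 = Poly_Mapping.single (Word us) 1 * gen g"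
        by (simp add: gen_def mult_single plus_fmon_def)
      moreover have "set us \<subseteq> gensB n" "g \<in> gensB n" using snoc.prems by auto
      ultimately have e: "cl (Poly_Mapping.single (Word (us @ [g])) 1) = cl (Poly_Mapping.single (Word us) 1) *h cl (gen g)"
        using word_cl by (simp add: cl_mult gen_closed)
      have us: "cl (Poly_Mapping.single (Word us) 1) \<in> carrier H" "P (cl (Poly_Mapping.single (Word us) 1))"
        using word_cl cl_closed snoc by auto
      from \<open>g \<in> gensB n\<close> consider u where "g = Vec u" "u \<in> VC n" | w where "g = Grp w" "w \<in> W_B n"
        by (auto simp: gensB_def)
      then show ?case
        unfolding e by cases (use vec[OF us] grp[OF us] in \<open>simp_all add: vecB_def tB_def\<close>)
    qed
  qed
  have zero: "P \<zero>\<^bsub>H\<^esub>" using scal[OF _ one, of 0] by (simp add: Sc_zero)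
  have "f \<in> carrier FR \<Longrightarrow> P (cl f)" for f
  proof (induction f rule: poly_mapping_single_induct)
    case zero
    then show ?case using \<open>P \<zero>\<^bsub>H\<^esub>\<close> by (simp add: cl_zero)
  next
    case (add f a b)
    have sub: "set (letters u) \<subseteq> gensB n" if "u \<in> Poly_Mapping.keys f \<or> u = a \<and> b \<noteq> 0" for u
    proof -
      have "u \<in> Poly_Mapping.keys (f + Poly_Mapping.single a b)"
        using that add.hyps by (auto simp: in_keys_iff lookup_add lookup_single when_def)
      then show ?thesis using add.prems unfolding free_ring_carrier_iff by blast
    qed
    then have f: "f \<in> carrier FR" by (simp add: free_ring_carrier_iff)
    show ?case
    proof (cases "b = 0")
      case True
      then show ?thesis using add f by simp
    next
      case False
      obtain us where a: "a = Word us" by (cases a)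
      have us: "set us \<subseteq> gensB n" using sub[of a] False a by simp
      have "Poly_Mapping.single a b = scal b * Poly_Mapping.single (Word us) 1"
        by (simp add: a scal_def mult_single)
      then have "cl (f + Poly_Mapping.single a b) = cl f +h Sc b *h cl (Poly_Mapping.single (Word us) 1)"
        using f word_cl[OF us] by (simp add: cl_add cl_mult scalB_def free_ring_closed)
      then show ?thesis
        using assms(4)[OF cl_closed[OF f] _ add.IH[OF f] scal[OF cl_closed[OF word_cl[OF us]] word[OF us]]]
          cl_closed[OF word_cl[OF us]] by simp
    qed
  qed
  then show ?thesis using h carrier_H by auto
qed

section \<open>Straightening and normal forms in the algebra of type B\<close>

definition AA :: "gensym free_alg set set" where
  "AA = generate_ring H (range Sc \<union> V ` VC n \<union> t ` U_D n)"

lemma U_W: "x \<in> U_D n \<Longrightarrow> x \<in> W_B n"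
  using U_subset_T T_subset_W by blast

lemma AA_gens: "range Sc \<union> V ` VC n \<union> t ` U_D n \<subseteq> carrier H"
  using U_W by auto

lemma AA_closed: "a \<in> AA \<Longrightarrow> a \<in> carrier H"
  unfolding AA_def by (rule H.generate_ring_in_carrier[OF AA_gens])

lemma AA_Sc: "Sc c \<in> AA"
  unfolding AA_def by (rule generate_ring.incl) auto

lemma AA_V: "u \<in> VC n \<Longrightarrow> V u \<in> AA"
  unfolding AA_def by (rule generate_ring.incl) auto

lemma AA_t: "x \<in> U_D n \<Longrightarrow> t x \<in> AA"
  unfolding AA_def by (rule generate_ring.incl) auto

lemma AA_add: "a \<in> AA \<Longrightarrow> b \<in> AA \<Longrightarrow> a +h b \<in> AA"
  unfolding AA_def by (rule generate_ring.eng_add)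

lemma AA_mult: "a \<in> AA \<Longrightarrow> b \<in> AA \<Longrightarrow> a *h b \<in> AA"
  unfolding AA_def by (rule generate_ring.eng_mult)

lemma AA_minus: "a \<in> AA \<Longrightarrow> \<ominus>\<^bsub>H\<^esub> a \<in> AA"
  unfolding AA_def by (rule generate_ring.a_inv)

lemma AA_one: "\<one>\<^bsub>H\<^esub> \<in> AA"
  unfolding AA_def by (rule generate_ring.one)

lemma AA_zero: "\<zero>\<^bsub>H\<^esub> \<in> AA"
  unfolding AA_def by (rule H.zero_in_generate)

lemma flip_pair_U: "1 \<le> i \<Longrightarrow> i < n \<Longrightarrow> sp (\<lambda>l. flip i l * flip (i + 1) l) id \<in> U_D n"
  unfolding U_D_def U_gen_eq by (rule group_gen_incl) blast

lemma AA_Kel: "1 \<le> i \<Longrightarrow> i < n \<Longrightarrow> Kel i \<in> AA"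
  unfolding Kel_def by (intro AA_mult AA_add AA_Sc AA_one AA_t flip_pair_U)

lemma U_conj:
  assumes "x \<in> U_D n" "\<pi> permutes {1..n}"
  obtains y where "y \<in> U_D n" "x \<circ> sp sone \<pi> = sp sone \<pi> \<circ> y"
proof -
  obtain s where s: "x = sp s id" "s \<in> signs n" "(\<Prod>j\<in>{1..n}. s j) = 1" using assms(1) unfolding U_D_eq by blast
  have "(\<Prod>j\<in>{1..n}. s (\<pi> j)) = (\<Prod>j\<in>{1..n}. s j)"
    by (rule prod.permute[OF assms(2), unfolded comp_def, symmetric])
  then have "sp (s \<circ> \<pi>) id \<in> U_D n"
    unfolding U_D_eq using s signs_perm[OF s(2) assms(2)] by (auto simp: comp_def)
  then show ?thesis using that sp_torus_move[OF assms(2), of s] s(1) by blast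
qed

text \<open>Straightening past a simple reflection, by induction on how \<open>a\<close> is
  generated. For a vector the cross relation is applied to the reflected vector, and its correction
  lies in \<open>AA\<close>. For a product the right factor is moved before the left one.\<close>

lemma AA_move:
  assumes i: "1 \<le> i" "i < n" and a: "a \<in> AA"
  shows "\<exists>a1\<in>AA. \<exists>a2\<in>AA. a *h t (sp sone (tr i (i + 1))) = t (sp sone (tr i (i + 1))) *h a1 +h a2"
proof -
  let ?s = "tr i (i + 1)"
  let ?w = "sp sone ?s"
  have W: "?w \<in> W_B n" using W_B_simple[OF i] .
  note tw = t_closed[OF W]
  have s: "?s permutes {1..n}" using i by (intro transpose_permutes_Icc) auto
  have "a \<in> generate_ring H (range Sc \<union> V ` VC n \<union> t ` U_D n)" using a by (simp add: AA_def)
  then show ?thesis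
  proof (induction rule: generate_ring.induct)
    case one
    show ?case by (rule bexI[OF _ AA_one], rule bexI[OF _ AA_zero]) (use tw in simp)
  next
    case (incl h)
    then consider (sc) c where "h = Sc c" | (vec) u where "h = V u" "u \<in> VC n" | (t) x where "h = t x" "x \<in> U_D n"
      by auto
    then show ?case
    proof cases
      case sc
      show ?thesis by (rule bexI[OF _ AA_Sc[of c]], rule bexI[OF _ AA_zero]) (use tw Sc_central[OF tw] sc in simp)
    next
      case vec
      have u: "u \<circ> ?s \<in> VC n" by (rule VC_perm[OF vec(2) s])
      have ss: "u \<circ> ?s \<circ> ?s = u" by (simp add: comp_assoc)
      have e: "t ?w *h V (u \<circ> ?s) = V u *h t ?w +h Sc (u i - u (i + 1)) *h Kel i"
        using t_cross[OF i u] unfolding ss by simp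
      have "V u *h t ?w = t ?w *h V (u \<circ> ?s) +h \<ominus>\<^bsub>H\<^esub> (Sc (u i - u (i + 1)) *h Kel i)"
        unfolding e using tw vec i by (simp add: H.a_assoc H.r_neg)
      moreover have "\<ominus>\<^bsub>H\<^esub> (Sc (u i - u (i + 1)) *h Kel i) \<in> AA"
        by (intro AA_minus AA_mult AA_Sc AA_Kel i)
      ultimately show ?thesis using vec AA_V[OF u] by blast
    next
      case t
      obtain y where y: "y \<in> U_D n" "x \<circ> ?w = ?w \<circ> y" using U_conj[OF t(2) s] .
      have "t x *h t ?w = t ?w *h t y"
        using t_mult[OF U_W[OF t(2)] W] t_mult[OF W U_W[OF y(1)]] y(2) by simp
      then show ?thesis
        by (intro bexI[OF _ AA_t[OF y(1)]] bexI[OF _ AA_zero]) (use tw t U_W[OF y(1)] in simp)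
    qed
  next
    case (a_inv h)
    then obtain a1 a2 where a: "a1 \<in> AA" "a2 \<in> AA" "h *h t ?w = t ?w *h a1 +h a2" by auto
    have h: "h \<in> carrier H" using a_inv(1) AA_closed by (simp add: AA_def)
    have "\<ominus>\<^bsub>H\<^esub> h *h t ?w = t ?w *h (\<ominus>\<^bsub>H\<^esub> a1) +h \<ominus>\<^bsub>H\<^esub> a2"
      using h tw a AA_closed[OF a(1)] AA_closed[OF a(2)]
      by (simp add: H.l_minus H.r_minus H.minus_add H.a_comm)
    then show ?case using AA_minus a by blast
  next
    case (eng_add h1 h2)
    then obtain a1 a2 b1 b2 where ab: "a1 \<in> AA" "a2 \<in> AA" "h1 *h t ?w = t ?w *h a1 +h a2"
      "b1 \<in> AA" "b2 \<in> AA" "h2 *h t ?w = t ?w *h b1 +h b2" by auto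
    have h: "h1 \<in> carrier H" "h2 \<in> carrier H" using eng_add(1,2) AA_closed by (simp_all add: AA_def)
    have "(h1 +h h2) *h t ?w = t ?w *h (a1 +h b1) +h (a2 +h b2)"
      using h tw ab(3,6) AA_closed[OF ab(1)] AA_closed[OF ab(2)] AA_closed[OF ab(4)] AA_closed[OF ab(5)]
      by (simp add: H.l_distr H.r_distr H.a_ac)
    then show ?case using AA_add ab by blast
  next
    case (eng_mult h1 h2)
    then obtain a1 a2 b1 b2 where ab: "a1 \<in> AA" "a2 \<in> AA" "h1 *h t ?w = t ?w *h a1 +h a2"
      "b1 \<in> AA" "b2 \<in> AA" "h2 *h t ?w = t ?w *h b1 +h b2" by auto
    have h1A: "h1 \<in> AA" using eng_mult(1) by (simp add: AA_def)
    have h: "h1 \<in> carrier H" "h2 \<in> carrier H" using eng_mult(1,2) AA_closed by (simp_all add: AA_def)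
    note c = AA_closed[OF ab(1)] AA_closed[OF ab(2)] AA_closed[OF ab(4)] AA_closed[OF ab(5)]
    have "h1 *h h2 *h t ?w = h1 *h (t ?w *h b1 +h b2)"
      using h tw by (simp add: H.m_assoc ab(6))
    also have "\<dots> = (h1 *h t ?w) *h b1 +h h1 *h b2"
      using h tw c by (simp add: H.m_assoc H.r_distr)
    also have "\<dots> = t ?w *h (a1 *h b1) +h (a2 *h b1 +h h1 *h b2)"
      unfolding ab(3) using h tw c by (simp add: H.m_assoc H.l_distr H.a_assoc)
    finally show ?case using AA_add AA_mult ab h1A by blast
  qed
qed

text \<open>Sums of elements t_w a with w in W_A and a in \<open>AA\<close>: the candidate for the
  algebra of type D, confirmed in \<open>carrier_H_D\<close>.\<close>

inductive_set DD :: "gensym free_alg set set" where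
  base: "\<pi> permutes {1..n} \<Longrightarrow> a \<in> AA \<Longrightarrow> t (sp sone \<pi>) *h a \<in> DD"
| add: "x \<in> DD \<Longrightarrow> y \<in> DD \<Longrightarrow> x +h y \<in> DD"

lemma sp_one_W: "\<pi> permutes {1..n} \<Longrightarrow> sp sone \<pi> \<in> W_B n"
  unfolding W_B_eq using signs_one by blast

lemma DD_closed: "x \<in> DD \<Longrightarrow> x \<in> carrier H"
  by (induction rule: DD.induct) (simp_all add: sp_one_W AA_closed)

lemma DD_AA: "a \<in> AA \<Longrightarrow> a \<in> DD"
proof -
  assume a: "a \<in> AA"
  have "t (sp sone id) *h a = a" using AA_closed[OF a] by (simp only: sp_id t_id H.l_one)
  then show ?thesis using DD.base[OF permutes_id a] by (simp only:)
qed

lemma DD_zero: "\<zero>\<^bsub>H\<^esub> \<in> DD"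
  by (rule DD_AA[OF AA_zero])

lemma DD_mult_AA: "x \<in> DD \<Longrightarrow> b \<in> AA \<Longrightarrow> x *h b \<in> DD"
proof (induction rule: DD.induct)
  case (base \<pi> a)
  then have "t (sp sone \<pi>) *h a *h b = t (sp sone \<pi>) *h (a *h b)"
    by (simp add: H.m_assoc sp_one_W AA_closed)
  then show ?case using DD.base[OF base(1) AA_mult[OF base(2,3)]] by simp
next
  case (add x y)
  then show ?case using DD.add by (simp add: H.l_distr DD_closed AA_closed)
qed

lemma DD_mult_simple:
  assumes i: "1 \<le> i" "i < n"
  shows "x \<in> DD \<Longrightarrow> x *h t (sp sone (tr i (i + 1))) \<in> DD"
proof (induction rule: DD.induct)
  case (base \<pi> a)
  let ?s = "tr i (i + 1)"
  let ?w = "sp sone ?s"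
  have s: "?s permutes {1..n}" using i by (intro transpose_permutes_Icc) auto
  have W: "?w \<in> W_B n" using W_B_simple[OF i] .
  obtain a1 a2 where a: "a1 \<in> AA" "a2 \<in> AA" "a *h t ?w = t ?w *h a1 +h a2"
    using AA_move[OF i base(2)] by auto
  have "t (sp sone \<pi>) *h a *h t ?w = t (sp sone \<pi>) *h t ?w *h a1 +h t (sp sone \<pi>) *h a2"
    using sp_one_W[OF base(1)] W a(3) AA_closed[OF a(1)] AA_closed[OF a(2)] AA_closed[OF base(2)]
    by (simp add: H.m_assoc H.r_distr)
  also have "t (sp sone \<pi>) *h t ?w = t (sp sone (\<pi> \<circ> ?s))"
    using t_mult[OF sp_one_W[OF base(1)] W] sp_one_comp[OF base(1) s] by simp
  finally show ?case
    using DD.add[OF DD.base[OF permutes_compose[OF s base(1)] a(1)] DD.base[OF base(1) a(2)]] by simp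
next
  case (add x y)
  then show ?case using DD.add W_B_simple[OF i] by (simp add: H.l_distr DD_closed)
qed

text \<open>A representative of the nontrivial coset of U in T. Multiplication by it leads from the
  fixed points of \<open>delta\<close> to the eigenvalue -1.\<close>

definition t1 :: "gensym free_alg set" where
  "t1 = t (sp (flip 1) id)"

lemma flip1_T: "sp (flip 1) id \<in> T_B n"
  by (rule T_B_flip) (use n2 in simp)

lemma flip1_W: "sp (flip 1) id \<in> W_B n"
  using flip1_T T_subset_W by auto

lemma t1_closed [simp]: "t1 \<in> carrier H"
  unfolding t1_def using flip1_W by simp

lemma t1_sq: "t1 *h t1 = \<one>\<^bsub>H\<^esub>"
  unfolding t1_def t_mult[OF flip1_W flip1_W]
  using sp_torus_involution[of "flip 1", OF flip_sq] t_id by simp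

text \<open>The product of all signs is 1 or -1, and the flip at position 1 changes it.\<close>

lemma T_cases:
  assumes "x \<in> T_B n"
  obtains (even) "x \<in> U_D n" | (odd) y where "y \<in> U_D n" "x = y \<circ> sp (flip 1) id"
proof -
  obtain s where s: "x = sp s id" "s \<in> signs n" using assms unfolding T_B_eq by blast
  have f1: "flip 1 \<in> signs n" using n2 by (intro signs_flip) auto
  have p: "(\<Prod>j\<in>{1..n}. flip 1 j) = -1" using n2 by (intro prod_flip) auto
  have "(\<Prod>j\<in>{1..n}. s j) * (\<Prod>j\<in>{1..n}. s j) = 1"
    unfolding prod.distrib[symmetric] using signs_sq[OF s(2)] by simp
  then consider "(\<Prod>j\<in>{1..n}. s j) = 1" | "(\<Prod>j\<in>{1..n}. s j) = -1" by (auto simp: square_eq_1_iff)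
  then show ?thesis
  proof cases
    case 1
    then show ?thesis using even s unfolding U_D_eq by blast
  next
    case 2
    have "(\<Prod>j\<in>{1..n}. s j * flip 1 j) = 1" unfolding prod.distrib using 2 p by simp
    then have y: "sp (\<lambda>l. s l * flip 1 l) id \<in> U_D n"
      unfolding U_D_eq using signs_mult[OF s(2) f1] by blast
    have "s l * flip 1 l * flip 1 l = s l" for l by (simp add: flip_def)
    then have "x = sp (\<lambda>l. s l * flip 1 l) id \<circ> sp (flip 1) id"
      by (simp only: sp_torus_comp s(1))
    then show ?thesis using odd y by blast
  qed
qed

definition EE :: "gensym free_alg set set" where
  "EE = {d +h d' *h t1 | d d'. d \<in> DD \<and> d' \<in> DD}"

lemma EE_I: "d \<in> DD \<Longrightarrow> d' \<in> DD \<Longrightarrow> x = d +h d' *h t1 \<Longrightarrow> x \<in> EE"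
  unfolding EE_def by blast

lemma EE_torus:
  assumes x: "x \<in> EE" and y: "y \<in> T_B n"
  shows "x *h t y \<in> EE"
proof -
  obtain d d' where d: "d \<in> DD" "d' \<in> DD" "x = d +h d' *h t1" using x by (auto simp: EE_def)
  note c = DD_closed[OF d(1)] DD_closed[OF d(2)]
  have comm: "t1 *h t z = t z *h t1" if zT: "z \<in> T_B n" for z
  proof -
    obtain s where s: "z = sp s id" "s \<in> signs n" using zT unfolding T_B_eq by blast
    have zW: "z \<in> W_B n" using zT T_subset_W by auto
    have "sp (flip 1) id \<circ> z = z \<circ> sp (flip 1) id" by (simp add: s sp_torus_comp mult.commute)
    then show ?thesis
      unfolding t1_def t_mult[OF flip1_W zW] t_mult[OF zW flip1_W] by (simp only:)
  qed
  show ?thesis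
    using y
  proof (cases rule: T_cases)
    case even
    have ty: "t y \<in> carrier H" using U_W[OF even] by simp
    have "x *h t y = d *h t y +h (d' *h t y) *h t1"
      unfolding d(3) using c ty comm[OF y] by (simp add: H.l_distr H.m_assoc)
    then show ?thesis by (rule EE_I[rotated 2]) (intro DD_mult_AA d AA_t even)+
  next
    case (odd z)
    have tz: "t z \<in> carrier H" using U_W[OF odd(1)] by simp
    have zT: "z \<in> T_B n" using odd(1) U_subset_T by auto
    have ty: "t y = t z *h t1" unfolding t1_def odd(2) using t_mult[OF U_W[OF odd(1)] flip1_W] by simp
    have "d' *h t1 *h (t z *h t1) = d' *h t z"
    proof -
      have "d' *h t1 *h (t z *h t1) = d' *h ((t1 *h t z) *h t1)" using c tz by (simp add: H.m_assoc)
      also have "\<dots> = d' *h (t z *h (t1 *h t1))" unfolding comm[OF zT] using tz by (simp add: H.m_assoc)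
      finally show ?thesis using t1_sq tz by simp
    qed
    then have "x *h t y = d' *h t z +h (d *h t z) *h t1"
      unfolding d(3) ty using c tz by (simp add: H.l_distr H.m_assoc H.a_comm)
    then show ?thesis by (rule EE_I[rotated 2]) (intro DD_mult_AA d AA_t odd(1))+
  qed
qed

text \<open>Past a simple reflection \<open>t1\<close> turns into another element of T, which
  \<open>EE_torus\<close> absorbs.\<close>

lemma EE_simple:
  assumes x: "x \<in> EE" and i: "1 \<le> i" "i < n"
  shows "x *h t (sp sone (tr i (i + 1))) \<in> EE"
proof -
  let ?s = "tr i (i + 1)"
  let ?w = "sp sone ?s"
  have s: "?s permutes {1..n}" using i by (intro transpose_permutes_Icc) auto
  have W: "?w \<in> W_B n" using W_B_simple[OF i] .
  note tw = t_closed[OF W]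
  obtain d d' where d: "d \<in> DD" "d' \<in> DD" "x = d +h d' *h t1" using x by (auto simp: EE_def)
  note c = DD_closed[OF d(1)] DD_closed[OF d(2)]
  define z where "z = sp (flip 1 \<circ> ?s) id"
  have z: "z \<in> T_B n"
    unfolding z_def T_B_eq using signs_perm[OF signs_flip[of 1 n] s] n2 by (auto simp: comp_def)
  have zW: "z \<in> W_B n" using z T_subset_W by auto
  have "t1 *h t ?w = t ?w *h t z"
    using t_mult[OF flip1_W W] t_mult[OF W zW] sp_torus_move[OF s, of "flip 1"]
    unfolding t1_def z_def by (simp only:)
  then have e: "x *h t ?w = d *h t ?w +h d' *h t ?w *h t z"
    unfolding d(3) using c tw zW by (simp add: H.l_distr H.m_assoc)
  have dw: "d *h t ?w \<in> DD" "d' *h t ?w \<in> DD" using DD_mult_simple[OF i] d by auto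
  have "d' *h t ?w = d' *h t ?w +h \<zero>\<^bsub>H\<^esub> *h t1" using c tw by simp
  then have "d' *h t ?w \<in> EE" using EE_I[OF dw(2) DD_zero] by blast
  from EE_torus[OF this z] obtain e e' where ee: "e \<in> DD" "e' \<in> DD" "d' *h t ?w *h t z = e +h e' *h t1"
    by (auto simp: EE_def)
  have "x *h t ?w = (d *h t ?w +h e) +h e' *h t1"
    unfolding e ee(3) using DD_closed[OF dw(1)] DD_closed[OF ee(1)] DD_closed[OF ee(2)] by (simp add: H.a_assoc)
  then show ?thesis by (rule EE_I[OF DD.add[OF dw(1) ee(1)] ee(2)])
qed

lemma DD_scal: "x \<in> DD \<Longrightarrow> Sc c *h x \<in> DD"
proof -
  assume x: "x \<in> DD"
  show ?thesis unfolding Sc_central[OF DD_closed[OF x]] by (rule DD_mult_AA[OF x AA_Sc])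
qed

text \<open>\<open>EE\<close> contains the unit and is closed under right multiplication by every
  generator; a general group element is split into its part in T and a product of simple
  reflections.\<close>

lemma H_decomposition:
  assumes "h \<in> carrier H"
  shows "h \<in> EE"
  using assms
proof (induction rule: H_induct)
  case one
  show ?case by (rule EE_I[OF DD_AA[OF AA_one] DD_zero]) simp
next
  case (scal x c)
  then obtain d d' where d: "d \<in> DD" "d' \<in> DD" "x = d +h d' *h t1" by (auto simp: EE_def)
  have "Sc c *h x = Sc c *h d +h Sc c *h d' *h t1"
    unfolding d(3) using DD_closed d by (simp add: H.r_distr H.m_assoc)
  then show ?case by (rule EE_I[OF DD_scal[OF d(1)] DD_scal[OF d(2)]])
next
  case (add x y)
  then obtain d d' e e' where d: "d \<in> DD" "d' \<in> DD" "x = d +h d' *h t1"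
    "e \<in> DD" "e' \<in> DD" "y = e +h e' *h t1" by (auto simp: EE_def)
  note c = DD_closed[OF d(1)] DD_closed[OF d(2)] DD_closed[OF d(4)] DD_closed[OF d(5)]
  have "x +h y = (d +h e) +h (d' +h e') *h t1"
    unfolding d(3,6) using c by (simp add: H.l_distr H.a_ac)
  then show ?case by (rule EE_I[OF DD.add[OF d(1,4)] DD.add[OF d(2,5)]])
next
  case (vec x u)
  then obtain d d' where d: "d \<in> DD" "d' \<in> DD" "x = d +h d' *h t1" by (auto simp: EE_def)
  note c = DD_closed[OF d(1)] DD_closed[OF d(2)]
  have "t1 *h V u = V u *h t1" unfolding t1_def by (rule t_torus[OF flip1_T vec.hyps(2)])
  then have "x *h V u = d *h V u +h d' *h V u *h t1"
    unfolding d(3) using c vec.hyps(2) by (simp add: H.l_distr H.m_assoc)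
  then show ?case by (rule EE_I[OF DD_mult_AA[OF d(1) AA_V[OF vec.hyps(2)]] DD_mult_AA[OF d(2) AA_V[OF vec.hyps(2)]]])
next
  case (grp x w)
  obtain s \<pi> where w: "w = sp s \<pi>" "s \<in> signs n" "\<pi> permutes {1..n}" using grp.hyps(2) unfolding W_B_eq by blast
  have sT: "sp s id \<in> T_B n" unfolding T_B_eq using w by blast
  have sW: "sp s id \<in> W_B n" using sT T_subset_W by auto
  have perm: "y *h t (sp sone \<rho>) \<in> EE" if "\<rho> permutes {1..n}" "y \<in> EE" "y \<in> carrier H" for y \<rho>
    using that(1)
  proof (induction rule: permutes_adjacent_induct)
    case id
    have "y *h t (sp sone id) = y" using that(3) by (simp only: sp_id t_id H.r_one)
    then show ?case using that(2) by (simp only:)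
  next
    case (swap \<rho> i)
    have s: "tr i (i + 1) permutes {1..n}" using swap by (intro transpose_permutes_Icc) auto
    have e: "t (sp sone (\<rho> \<circ> tr i (i + 1))) = t (sp sone \<rho>) *h t (sp sone (tr i (i + 1)))"
      using t_mult[OF sp_one_W[OF swap.hyps(1)] sp_one_W[OF s]] sp_one_comp[OF swap.hyps(1) s] by (simp only:)
    have "y *h t (sp sone (\<rho> \<circ> tr i (i + 1))) = y *h t (sp sone \<rho>) *h t (sp sone (tr i (i + 1)))"
      unfolding e using that(3) sp_one_W[OF swap.hyps(1)] sp_one_W[OF s] by (simp only: H.m_assoc t_closed)
    then show ?case using EE_simple[OF swap.IH swap.hyps(2,3)] by (simp only:)
  qed
  have "x *h t w = x *h t (sp s id) *h t (sp sone \<pi>)"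
    using sp_decomp[OF w(3), of s] t_mult[OF sW sp_one_W[OF w(3)]] grp.hyps(1) sW sp_one_W[OF w(3)]
    by (simp add: w(1) H.m_assoc)
  moreover have "x *h t (sp s id) \<in> EE" by (rule EE_torus[OF grp.IH sT])
  ultimately show ?case using perm[OF w(3)] grp.hyps(1) sW by simp
qed

end

section \<open>The representation on functions of permutations\<close>

context hecke_algebra
begin

text \<open>The value of the sign character at the torus element \<open>sp s id\<close> after the
  indices have been moved by \<rho>.\<close>

definition msign :: "(nat \<Rightarrow> complex) \<Rightarrow> (nat \<Rightarrow> real) \<Rightarrow> (nat \<Rightarrow> nat) \<Rightarrow> complex" where
  "msign \<mu> s \<rho> = (\<Prod>j\<in>{1..n}. if s j = -1 then \<mu> (\<rho> j) else 1)"

text \<open>The operator is described through a decomposition of the group element into signs and a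
  permutation. The choice is harmless because \<open>sp_inject\<close> makes the decomposition
  unique.\<close>

definition Wop :: "(nat \<Rightarrow> complex) \<Rightarrow> endo \<Rightarrow> pfun \<Rightarrow> pfun" where
  "Wop \<mu> w = (SOME F. \<exists>s \<pi>. s \<in> signs n \<and> \<pi> permutes {1..n} \<and> w = sp s \<pi> \<and>
     F = (\<lambda>f \<rho>. msign \<mu> s \<rho> * f (\<rho> \<circ> \<pi>)))"

lemma Wop_sp:
  assumes "s \<in> signs n" "\<pi> permutes {1..n}"
  shows "Wop \<mu> (sp s \<pi>) f = (\<lambda>\<rho>. msign \<mu> s \<rho> * f (\<rho> \<circ> \<pi>))"
proof -
  let ?Q = "\<lambda>F. \<exists>s' \<pi>'. s' \<in> signs n \<and> \<pi>' permutes {1..n} \<and> sp s \<pi> = sp s' \<pi>' \<and>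
     F = (\<lambda>f \<rho>. msign \<mu> s' \<rho> * f (\<rho> \<circ> \<pi>'))"
  have "?Q (\<lambda>f \<rho>. msign \<mu> s \<rho> * f (\<rho> \<circ> \<pi>))" using assms by blast
  then have "?Q (Wop \<mu> (sp s \<pi>))" unfolding Wop_def by (rule someI[where P = ?Q])
  then obtain s' \<pi>' where *: "s' \<in> signs n" "\<pi>' permutes {1..n}" "sp s \<pi> = sp s' \<pi>'"
    "Wop \<mu> (sp s \<pi>) = (\<lambda>f \<rho>. msign \<mu> s' \<rho> * f (\<rho> \<circ> \<pi>'))" by blast
  have "s = s'" "\<pi> = \<pi>'"
    using sp_inject[OF assms(1) *(1) permutes_bij[OF assms(2)] permutes_bij[OF *(2)] *(3)] by auto
  then show ?thesis using *(4) by simp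
qed

lemma msign_one: "msign \<mu> sone \<rho> = 1"
  by (simp add: msign_def)

lemma Wop_one: "\<pi> permutes {1..n} \<Longrightarrow> Wop \<mu> (sp sone \<pi>) f = Tr \<pi> f"
  by (simp add: Wop_sp msign_one Tr_def)

lemma Wop_id: "Wop \<mu> id f = f"
  using Wop_one[OF permutes_id, of \<mu> f] unfolding sp_id Tr_id .

lemma msign_flip: "j \<in> {1..n} \<Longrightarrow> msign \<mu> (flip j) \<rho> = \<mu> (\<rho> j)"
proof -
  assume j: "j \<in> {1..n}"
  have "msign \<mu> (flip j) \<rho> = (\<Prod>l\<in>{1..n}. if l = j then \<mu> (\<rho> l) else 1)"
    unfolding msign_def by (rule prod.cong) (auto simp: flip_def)
  then show ?thesis using j by simp
qed

lemma msign_mult: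
  assumes sgn: "\<And>j. \<mu> j * \<mu> j = (1::complex)" and s: "s \<in> signs n" "s' \<in> signs n"
  shows "msign \<mu> (\<lambda>l. s l * s' l) \<rho> = msign \<mu> s \<rho> * msign \<mu> s' \<rho>"
  unfolding msign_def prod.distrib[symmetric]
proof (rule prod.cong[OF refl])
  fix j
  have "s j = 1 \<or> s j = -1" "s' j = 1 \<or> s' j = -1" using s by (simp_all add: signs_def)
  then show "(if s j * s' j = - 1 then \<mu> (\<rho> j) else 1) =
      (if s j = - 1 then \<mu> (\<rho> j) else 1) * (if s' j = - 1 then \<mu> (\<rho> j) else 1)"
    using sgn[of "\<rho> j"] by auto
qed

lemma msign_perm:
  assumes p: "\<pi> permutes {1..n}"
  shows "msign \<mu> (\<lambda>l. s (inv_into UNIV \<pi> l)) \<rho> = msign \<mu> s (\<rho> \<circ> \<pi>)"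
  unfolding msign_def
proof (rule prod.reindex_bij_witness[of _ \<pi> "inv_into UNIV \<pi>"])
  fix j assume j: "j \<in> {1..n}"
  show "\<pi> (inv_into UNIV \<pi> j) = j" by (rule permutes_inverses(1)[OF p])
  show "inv_into UNIV \<pi> j \<in> {1..n}" using permutes_in_image[OF permutes_inv[OF p]] j by simp
  show "inv_into UNIV \<pi> (\<pi> j) = j" by (rule permutes_inverses(2)[OF p])
  show "\<pi> j \<in> {1..n}" using permutes_in_image[OF p] j by simp
  show "(if s (inv_into UNIV \<pi> j) = -1 then \<mu> ((\<rho> \<circ> \<pi>) (inv_into UNIV \<pi> j)) else 1) =
    (if s (inv_into UNIV \<pi> j) = -1 then \<mu> (\<rho> j) else 1)"
    by (simp add: permutes_inverses(1)[OF p])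
qed

lemma Wop_comp:
  assumes sgn: "\<And>j. \<mu> j * \<mu> j = 1" and w: "w \<in> W_B n" "w' \<in> W_B n"
  shows "Wop \<mu> w (Wop \<mu> w' f) = Wop \<mu> (w \<circ> w') f"
proof -
  obtain s \<pi> where 1: "w = sp s \<pi>" "s \<in> signs n" "\<pi> permutes {1..n}" using w(1) unfolding W_B_eq by blast
  obtain s' \<pi>' where 2: "w' = sp s' \<pi>'" "s' \<in> signs n" "\<pi>' permutes {1..n}" using w(2) unfolding W_B_eq by blast
  have s'': "(\<lambda>l. s' (inv_into UNIV \<pi> l)) \<in> signs n" by (rule signs_perm[OF 2(2) permutes_inv[OF 1(3)]])
  have c: "w \<circ> w' = sp (\<lambda>l. s l * s' (inv_into UNIV \<pi> l)) (\<pi> \<circ> \<pi>')"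
    unfolding 1(1) 2(1) by (rule sp_permutes_comp[OF 1(3) 2(3)])
  show ?thesis
    unfolding c Wop_sp[OF signs_mult[OF 1(2) s''] permutes_compose[OF 2(3) 1(3)]]
    unfolding 1(1) 2(1) Wop_sp[OF 1(2,3)] Wop_sp[OF 2(2,3)] msign_mult[OF sgn 1(2) s''] msign_perm[OF 1(3)]
    by (simp add: comp_assoc mult.assoc)
qed

lemma Wop_Fn: "w \<in> W_B n \<Longrightarrow> f \<in> Fn \<Longrightarrow> Wop \<mu> w f \<in> Fn"
proof -
  assume w: "w \<in> W_B n" and f: "f \<in> Fn"
  obtain s \<pi> where 1: "w = sp s \<pi>" "s \<in> signs n" "\<pi> permutes {1..n}" using w unfolding W_B_eq by blast
  show ?thesis unfolding 1(1) Wop_sp[OF 1(2,3)]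
    using f by (auto simp: Fn_def permutes_comp_right_iff[OF 1(3)])
qed

text \<open>Torus elements act by multiplication with \<open>msign\<close>. Exchanging two entries
  with nonzero coupling leaves this factor unchanged, by \<open>one_plus_mult_transpose\<close> at
  each position, so \<open>Xop_mult\<close> applies.\<close>

lemma Xop_Wop_torus:
  assumes sgn: "\<And>j. \<mu> j * \<mu> j = 1" and x: "x \<in> T_B n"
  shows "Wop \<mu> x (Xop \<gamma> \<mu> a f) = Xop \<gamma> \<mu> a (Wop \<mu> x f)"
proof -
  obtain s where s: "x = sp s id" "s \<in> signs n" using x unfolding T_B_eq by blast
  have w: "Wop \<mu> x f = (\<lambda>\<rho>. msign \<mu> s \<rho> * f \<rho>)" for f
    unfolding s(1) Wop_sp[OF s(2) permutes_id] by simp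
  have "(1 + \<mu> (\<rho> j) * \<mu> (\<rho> l)) * msign \<mu> s (\<rho> \<circ> tr j l) = (1 + \<mu> (\<rho> j) * \<mu> (\<rho> l)) * msign \<mu> s \<rho>" for \<rho> j l
  proof -
    have "(1 + \<mu> (\<rho> j) * \<mu> (\<rho> l)) * (\<Prod>i\<in>A. if s i = -1 then \<mu> (\<rho> (tr j l i)) else 1) =
        (1 + \<mu> (\<rho> j) * \<mu> (\<rho> l)) * (\<Prod>i\<in>A. if s i = -1 then \<mu> (\<rho> i) else 1)" if "finite A" for A
      using that
    proof (induction A rule: finite_induct)
      case (insert i A)
      let ?c = "1 + \<mu> (\<rho> j) * \<mu> (\<rho> l)"
      let ?P = "\<Prod>i\<in>A. if s i = -1 then \<mu> (\<rho> (tr j l i)) else 1"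
      let ?Q = "\<Prod>i\<in>A. if s i = -1 then \<mu> (\<rho> i) else 1"
      show ?case
      proof (cases "s i = -1")
        case True
        have "?c * (\<mu> (\<rho> (tr j l i)) * ?P) = (?c * \<mu> (\<rho> (tr j l i))) * ?P" by (simp only: mult.assoc)
        also have "\<dots> = \<mu> (\<rho> i) * (?c * ?P)"
          unfolding one_plus_mult_transpose[of \<mu> \<rho> j l i, OF sgn] by (simp only: mult_ac)
        also have "\<dots> = ?c * (\<mu> (\<rho> i) * ?Q)" unfolding insert.IH by (simp only: mult_ac)
        finally show ?thesis using insert True by simp
      next
        case False
        then show ?thesis using insert by simp
      qed
    qed simp
    from this[of "{1..n}"] show ?thesis unfolding msign_def comp_apply by simp
  qed
  then show ?thesis unfolding w by (intro ext Xop_mult[symmetric])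
qed

section \<open>The action of the free algebra and its descent to the quotient\<close>

fun sop :: "(nat \<Rightarrow> complex) \<Rightarrow> (nat \<Rightarrow> complex) \<Rightarrow> gensym \<Rightarrow> pfun \<Rightarrow> pfun" where
  "sop \<gamma> \<mu> (Vec a) f = Xop \<gamma> \<mu> a f"
| "sop \<gamma> \<mu> (Grp w) f = Wop \<mu> w f"

text \<open>The linear extension of \<open>sop\<close> to the free algebra; the rightmost letter of
  a word acts before the others.\<close>

definition ev :: "(nat \<Rightarrow> complex) \<Rightarrow> (nat \<Rightarrow> complex) \<Rightarrow> gensym free_alg \<Rightarrow> pfun \<Rightarrow> pfun" where
  "ev \<gamma> \<mu> F f = (\<lambda>\<rho>. \<Sum>u\<in>Poly_Mapping.keys F. Poly_Mapping.lookup F u * foldr (sop \<gamma> \<mu>) (letters u) f \<rho>)"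

lemma ev_superset:
  assumes "finite A" "Poly_Mapping.keys F \<subseteq> A"
  shows "ev \<gamma> \<mu> F f \<rho> = (\<Sum>u\<in>A. Poly_Mapping.lookup F u * foldr (sop \<gamma> \<mu>) (letters u) f \<rho>)"
  unfolding ev_def using assms by (intro sum.mono_neutral_left) (auto simp: in_keys_iff)

lemma ev_zero: "ev \<gamma> \<mu> 0 f = (\<lambda>\<rho>. 0)"
  by (simp add: ev_def)

lemma ev_add: "ev \<gamma> \<mu> (F + G) f = (\<lambda>\<rho>. ev \<gamma> \<mu> F f \<rho> + ev \<gamma> \<mu> G f \<rho>)"
proof
  fix \<rho>
  let ?A = "Poly_Mapping.keys F \<union> Poly_Mapping.keys G"
  have A: "finite ?A" "Poly_Mapping.keys F \<subseteq> ?A" "Poly_Mapping.keys G \<subseteq> ?A" "Poly_Mapping.keys (F + G) \<subseteq> ?A"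
    using keys_add[of F G] by auto
  show "ev \<gamma> \<mu> (F + G) f \<rho> = ev \<gamma> \<mu> F f \<rho> + ev \<gamma> \<mu> G f \<rho>"
    unfolding ev_superset[OF A(1,2)] ev_superset[OF A(1,3)] ev_superset[OF A(1,4)]
    by (simp add: lookup_add distrib_right sum.distrib)
qed

lemma ev_single: "ev \<gamma> \<mu> (Poly_Mapping.single u c) f = (\<lambda>\<rho>. c * foldr (sop \<gamma> \<mu>) (letters u) f \<rho>)"
  using ev_superset[of "{u}" "Poly_Mapping.single u c" \<gamma> \<mu> f] by (simp add: fun_eq_iff)

lemma ev_minus: "ev \<gamma> \<mu> (- F) f = (\<lambda>\<rho>. - ev \<gamma> \<mu> F f \<rho>)"
  using ev_add[of \<gamma> \<mu> F "- F" f] by (simp add: ev_zero fun_eq_iff eq_neg_iff_add_eq_0 add.commute)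

lemma ev_diff: "ev \<gamma> \<mu> (F - G) f = (\<lambda>\<rho>. ev \<gamma> \<mu> F f \<rho> - ev \<gamma> \<mu> G f \<rho>)"
  using ev_add[of \<gamma> \<mu> F "- G" f] by (simp add: ev_minus)

lemma Wop_linear:
  "w \<in> W_B n \<Longrightarrow> Wop \<mu> w (\<lambda>\<rho>. a * f \<rho> + b * g \<rho>) = (\<lambda>\<rho>. a * Wop \<mu> w f \<rho> + b * Wop \<mu> w g \<rho>)"
proof -
  assume w: "w \<in> W_B n"
  obtain s \<pi> where 1: "w = sp s \<pi>" "s \<in> signs n" "\<pi> permutes {1..n}" using w unfolding W_B_eq by blast
  show ?thesis unfolding 1(1) Wop_sp[OF 1(2,3)] by (simp add: algebra_simps)
qed

lemma sop_linear:
  assumes "g \<in> gensB n"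
  shows "sop \<gamma> \<mu> g (\<lambda>\<rho>. a * f \<rho> + b * h \<rho>) = (\<lambda>\<rho>. a * sop \<gamma> \<mu> g f \<rho> + b * sop \<gamma> \<mu> g h \<rho>)"
  using assms unfolding gensB_def by (auto simp: Xop_add Xop_scale Wop_linear)

lemma word_linear:
  assumes "set us \<subseteq> gensB n"
  shows "foldr (sop \<gamma> \<mu>) us (\<lambda>\<rho>. a * f \<rho> + b * h \<rho>) =
    (\<lambda>\<rho>. a * foldr (sop \<gamma> \<mu>) us f \<rho> + b * foldr (sop \<gamma> \<mu>) us h \<rho>)"
  using assms by (induction us) (simp_all add: sop_linear)

lemma word_zero:
  assumes "set us \<subseteq> gensB n"
  shows "foldr (sop \<gamma> \<mu>) us (\<lambda>\<rho>. 0) = (\<lambda>\<rho>. 0)"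
  using word_linear[OF assms, of \<gamma> \<mu> 0 "\<lambda>\<rho>. 0" 0 "\<lambda>\<rho>. 0"] by simp

lemma FR_keys: "F \<in> carrier FR \<Longrightarrow> u \<in> Poly_Mapping.keys F \<Longrightarrow> set (letters u) \<subseteq> gensB n"
  by (simp add: free_ring_carrier_iff)

text \<open>Induction over the monomials of both factors. Pulling a word through a sum uses
  linearity of its letters, which is known for the actual generators.\<close>

lemma ev_mult:
  assumes "F \<in> carrier FR" "G \<in> carrier FR"
  shows "ev \<gamma> \<mu> (F * G) f = ev \<gamma> \<mu> F (ev \<gamma> \<mu> G f)"
proof -
  have s: "ev \<gamma> \<mu> (Poly_Mapping.single u c * G) f = (\<lambda>\<rho>. c * foldr (sop \<gamma> \<mu>) (letters u) (ev \<gamma> \<mu> G f) \<rho>)"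
    if u: "set (letters u) \<subseteq> gensB n" for u c G
  proof (induction G rule: poly_mapping_single_induct)
    case zero
    then show ?case by (simp add: ev_zero word_zero[OF u])
  next
    case (add G v d)
    have e: "ev \<gamma> \<mu> (G + Poly_Mapping.single v d) f = (\<lambda>\<rho>. 1 * ev \<gamma> \<mu> G f \<rho> + d * foldr (sop \<gamma> \<mu>) (letters v) f \<rho>)"
      by (simp add: ev_add ev_single)
    show ?case
      unfolding e word_linear[OF u]
      by (simp add: distrib_left ev_add add.IH mult_single ev_single mult.assoc)
  qed
  have "ev \<gamma> \<mu> (F * G) f = ev \<gamma> \<mu> F (ev \<gamma> \<mu> G f)" if "F \<in> carrier FR" for F
    using that
  proof (induction F rule: poly_mapping_single_induct)
    case zero
    then show ?case by (simp add: ev_zero)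
  next
    case (add F u c)
    have sub: "set (letters v) \<subseteq> gensB n" if "v \<in> Poly_Mapping.keys F \<or> v = u \<and> c \<noteq> 0" for v
    proof -
      have "v \<in> Poly_Mapping.keys (F + Poly_Mapping.single u c)"
        using that add.hyps by (auto simp: in_keys_iff lookup_add lookup_single when_def)
      then show ?thesis by (rule FR_keys[OF add.prems])
    qed
    then have F: "F \<in> carrier FR" by (simp add: free_ring_carrier_iff)
    show ?case
    proof (cases "c = 0")
      case True
      then show ?thesis using add.IH[OF F] by simp
    next
      case False
      then have u: "set (letters u) \<subseteq> gensB n" using sub by simp
      show ?thesis by (simp add: distrib_right ev_add ev_single add.IH[OF F] s[OF u])
    qed
  qed
  then show ?thesis using assms by blast
qed

lemma ev_gen: "ev \<gamma> \<mu> (gen g) f = sop \<gamma> \<mu> g f"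
  by (simp add: gen_def ev_single)

lemma ev_scal: "ev \<gamma> \<mu> (scal c) f = (\<lambda>\<rho>. c * f \<rho>)"
  by (simp add: scal_def ev_single)

lemma ev_one: "ev \<gamma> \<mu> 1 f = f"
  using ev_scal[of \<gamma> \<mu> 1 f] by (simp add: scal_one)

lemma word_Fn: "set us \<subseteq> gensB n \<Longrightarrow> f \<in> Fn \<Longrightarrow> foldr (sop \<gamma> \<mu>) us f \<in> Fn"
  by (induction us) (auto simp: gensB_def Xop_Fn Wop_Fn)

lemma ev_Fn:
  assumes "F \<in> carrier FR" "f \<in> Fn"
  shows "ev \<gamma> \<mu> F f \<in> Fn"
  unfolding ev_def by (intro Fn_sum Fn_scale word_Fn FR_keys[OF assms(1)] assms(2))

lemma ev_linear:
  assumes "F \<in> carrier FR"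
  shows "ev \<gamma> \<mu> F (\<lambda>\<rho>. a * f \<rho> + b * h \<rho>) = (\<lambda>\<rho>. a * ev \<gamma> \<mu> F f \<rho> + b * ev \<gamma> \<mu> F h \<rho>)"
proof
  fix \<rho>
  have "ev \<gamma> \<mu> F (\<lambda>\<rho>. a * f \<rho> + b * h \<rho>) \<rho> = (\<Sum>u\<in>Poly_Mapping.keys F. Poly_Mapping.lookup F u *
     (a * foldr (sop \<gamma> \<mu>) (letters u) f \<rho> + b * foldr (sop \<gamma> \<mu>) (letters u) h \<rho>))"
    unfolding ev_def by (rule sum.cong) (simp_all add: word_linear[OF FR_keys[OF assms]])
  then show "ev \<gamma> \<mu> F (\<lambda>\<rho>. a * f \<rho> + b * h \<rho>) \<rho> = a * ev \<gamma> \<mu> F f \<rho> + b * ev \<gamma> \<mu> F h \<rho>"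
    by (simp add: ev_def sum_distrib_left sum.distrib algebra_simps)
qed

text \<open>The substantial cases are the commutativity of vectors, supplied by
  \<open>Xop_commute\<close>, and the cross relation, supplied by \<open>Tr_Xop_eq\<close>.\<close>

lemma ev_relsB:
  assumes sgn: "\<And>j. \<mu> j * \<mu> j = 1" and r: "r \<in> relsB n k" and f: "f \<in> Fn"
  shows "ev \<gamma> \<mu> r f = (\<lambda>\<rho>. 0)"
  using r
proof cases
  case (lin u v a b)
  have "ev \<gamma> \<mu> r f = (\<lambda>\<rho>. Xop \<gamma> \<mu> (\<lambda>l. a * u l + b * v l) f \<rho> - (a * Xop \<gamma> \<mu> u f \<rho> + b * Xop \<gamma> \<mu> v f \<rho>))"
    unfolding lin(1) using lin(2,3)
    by (simp add: ev_diff ev_add ev_mult free_ring_closed gen_Vec ev_gen ev_scal)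
  then show ?thesis by (simp add: Xop_lin)
next
  case (comm u v)
  have "ev \<gamma> \<mu> r f = (\<lambda>\<rho>. Xop \<gamma> \<mu> u (Xop \<gamma> \<mu> v f) \<rho> - Xop \<gamma> \<mu> v (Xop \<gamma> \<mu> u f) \<rho>)"
    unfolding comm(1) using comm(2,3)
    by (simp add: ev_diff ev_mult free_ring_closed gen_Vec ev_gen)
  then show ?thesis using Xop_commute[of f \<mu> \<gamma> u v, OF f sgn] by simp
next
  case one
  then show ?thesis by (simp add: ev_diff ev_gen ev_one Wop_id)
next
  case (mult w w')
  have "ev \<gamma> \<mu> r f = (\<lambda>\<rho>. Wop \<mu> w (Wop \<mu> w' f) \<rho> - Wop \<mu> (w \<circ> w') f \<rho>)"
    unfolding mult(1) using mult(2,3) by (simp add: ev_diff ev_mult gen_Grp ev_gen)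
  then show ?thesis using Wop_comp[of \<mu> w w' f, OF sgn mult(2,3)] by simp
next
  case (torus x \<zeta>)
  have xW: "x \<in> W_B n" using torus(2) T_subset_W by auto
  have "ev \<gamma> \<mu> r f = (\<lambda>\<rho>. Wop \<mu> x (Xop \<gamma> \<mu> (complexify \<zeta>) f) \<rho> - Xop \<gamma> \<mu> (complexify \<zeta>) (Wop \<mu> x f) \<rho>)"
    unfolding torus(1) using xW torus(3)
    by (simp add: ev_diff ev_mult gen_Grp gen_Vec complexify_VC ev_gen)
  then show ?thesis using Xop_Wop_torus[of \<mu> x \<gamma> "complexify \<zeta>" f, OF sgn torus(2)] by simp
next
  case (cross i \<alpha> \<zeta>)
  let ?s = "tr i (i + 1)"
  have i: "1 \<le> i" "i < n" using cross by auto
  have s: "?s permutes {1..n}" by (rule adj_permutes[OF i])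
  have ref: "reflect n \<alpha> = sp sone ?s" using cross reflect_simple by simp
  have W: "sp sone ?s \<in> W_B n" using W_B_simple[OF i] .
  have ap: "sp sone ?s \<zeta> = \<zeta> \<circ> ?s" by (simp only: sp_one_apply inv_transpose)
  have z: "complexify \<zeta> \<in> VC n" "complexify (\<zeta> \<circ> ?s) \<in> VC n"
    using cross(5) VR_perm[OF cross(5) s] by (simp_all add: complexify_VC)
  have co: "coroot n \<alpha> (\<zeta> \<circ> ?s) = \<zeta> (i + 1) - \<zeta> i"
    by (simp add: coroot_simple[OF i] cross(4))
  have r: "reflect n (eps i) = sp (flip i) id" "reflect n (eps (i + 1)) = sp (flip (i + 1)) id"
    using i by (auto intro!: reflect_eps)
  have W2: "sp (flip i) id \<in> W_B n" "sp (flip (i + 1)) id \<in> W_B n"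
    using T_B_flip[of i n] T_B_flip[of "i + 1" n] T_subset_W i by auto
  have fl: "Wop \<mu> (sp (flip j) id) f = (\<lambda>\<rho>. \<mu> (\<rho> j) * f \<rho>)" if "j \<in> {1..n}" for j f
    unfolding Wop_sp[OF signs_flip[OF that] permutes_id] msign_flip[OF that] by simp
  have K: "ev \<gamma> \<mu> (ktilde n k i) f = Kop \<mu> i f"
  proof -
    have "ev \<gamma> \<mu> (ktilde n k i) f = (\<lambda>\<rho>. k * (f \<rho> + Wop \<mu> (sp (flip i) id) (Wop \<mu> (sp (flip (i + 1)) id) f) \<rho>))"
      unfolding ktilde_def r using W2
      by (simp add: ev_mult ev_add free_ring_closed gen_Grp ev_gen ev_scal ev_one)
    then show ?thesis using fl[of i] fl[of "i + 1"] i by (simp add: Kop_def algebra_simps)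
  qed
  have kc: "ktilde n k i \<in> carrier FR" by (rule ktilde_closed[OF i])
  have "ev \<gamma> \<mu> r f = (\<lambda>\<rho>. Wop \<mu> (sp sone ?s) (Xop \<gamma> \<mu> (complexify \<zeta>) f) \<rho>
      - (Xop \<gamma> \<mu> (complexify (\<zeta> \<circ> ?s)) (Wop \<mu> (sp sone ?s) f) \<rho> + complex_of_real (\<zeta> (i + 1) - \<zeta> i) * Kop \<mu> i f \<rho>))"
    unfolding cross(1) ref ap co using W z kc
    by (simp add: ev_diff ev_add ev_mult free_ring_closed gen_Grp gen_Vec ev_gen ev_scal K)
  also have "\<dots> = (\<lambda>\<rho>. 0)"
  proof -
    have c: "complexify (\<zeta> \<circ> ?s) = complexify \<zeta> \<circ> ?s" by (simp add: complexify_def fun_eq_iff)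
    have d: "complex_of_real (\<zeta> (i + 1) - \<zeta> i) = complexify \<zeta> (i + 1) - complexify \<zeta> i" by (simp add: complexify_def)
    show ?thesis unfolding Wop_one[OF s] c d Tr_Xop_eq[OF i f] by simp
  qed
  finally show ?thesis .
qed

text \<open>The elements acting by zero on \<open>Fn\<close> form a two-sided ideal, because
  \<open>Fn\<close> is invariant; it contains the relations and hence the ideal they
  generate.\<close>

lemma ev_idealB:
  assumes sgn: "\<And>j. \<mu> j * \<mu> j = 1" and r: "r \<in> idealB n k" and f: "f \<in> Fn"
  shows "ev \<gamma> \<mu> r f = (\<lambda>\<rho>. 0)"
proof -
  let ?J = "{F \<in> carrier FR. \<forall>f\<in>Fn. ev \<gamma> \<mu> F f = (\<lambda>\<rho>. 0)}"
  have ev0: "ev \<gamma> \<mu> F (\<lambda>\<rho>. 0) = (\<lambda>\<rho>. 0)" if "F \<in> carrier FR" for F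
    using ev_linear[OF that, of \<gamma> \<mu> 0 "\<lambda>\<rho>. 0" 0 "\<lambda>\<rho>. 0"] by simp
  have "ideal ?J FR"
  proof (rule idealI[OF ring_free_ring])
    show "subgroup ?J (add_monoid FR)"
    proof (rule group.subgroupI)
      show "group (add_monoid FR)"
        using ring.is_abelian_group[OF ring_free_ring] abelian_group.a_group by blast
      show "?J \<noteq> {}" using free_ring_closed(1) ev_zero by blast
      fix a assume a: "a \<in> ?J"
      have "inv\<^bsub>add_monoid FR\<^esub> a = - a"
        using free_ring_minus[of a "gensB n"] a by (simp add: a_inv_def)
      then show "inv\<^bsub>add_monoid FR\<^esub> a \<in> ?J" using a by (simp add: free_ring_closed ev_minus)
      fix b assume "b \<in> ?J"
      then show "a \<otimes>\<^bsub>add_monoid FR\<^esub> b \<in> ?J" using a by (simp add: free_ring_closed ev_add)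
    qed auto
    fix a x assume a: "a \<in> ?J" and x: "x \<in> carrier FR"
    show "x \<otimes>\<^bsub>FR\<^esub> a \<in> ?J" using a x by (simp add: free_ring_closed ev_mult ev0)
    show "a \<otimes>\<^bsub>FR\<^esub> x \<in> ?J" using a x by (simp add: free_ring_closed ev_mult ev_Fn)
  qed
  moreover have "relsB n k \<subseteq> ?J" using relsB_closed ev_relsB[of \<mu> _ _ \<gamma>, OF sgn] by blast
  ultimately have "idealB n k \<subseteq> ?J"
    unfolding idealB_def by (rule ring.genideal_minimal[OF ring_free_ring])
  then show ?thesis using r f by blast
qed

text \<open>A representative in the free algebra is chosen; \<open>rho_cl\<close> shows that the
  choice does not matter on \<open>Fn\<close>.\<close>

definition rho :: "(nat \<Rightarrow> complex) \<Rightarrow> (nat \<Rightarrow> complex) \<Rightarrow> gensym free_alg set \<Rightarrow> pfun \<Rightarrow> pfun" where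
  "rho \<gamma> \<mu> h f = ev \<gamma> \<mu> (SOME F. F \<in> carrier FR \<and> cl F = h) f"

end

locale hecke_rep = hecke_algebra +
  fixes \<gamma> \<mu> :: "nat \<Rightarrow> complex"
  assumes sgn: "\<And>j. \<mu> j * \<mu> j = 1"
begin

interpretation H: ring H by (rule ring_H)

abbreviation "R \<equiv> rho \<gamma> \<mu>"

lemma rho_cl:
  assumes F: "F \<in> carrier FR" and f: "f \<in> Fn"
  shows "R (cl F) f = ev \<gamma> \<mu> F f"
proof -
  let ?G = "SOME G. G \<in> carrier FR \<and> cl G = cl F"
  have G: "?G \<in> carrier FR \<and> cl ?G = cl F" by (rule someI[of _ F]) (use F in simp)
  then have "?G - F \<in> idealB n k" using cl_eq_iff[of ?G F] F by simp
  from ev_idealB[of \<mu> "?G - F" f \<gamma>, OF sgn this f] show ?thesis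
    by (simp add: rho_def ev_diff fun_eq_iff)
qed

lemma rho_Fn: "h \<in> carrier H \<Longrightarrow> f \<in> Fn \<Longrightarrow> R h f \<in> Fn"
  using carrier_H rho_cl ev_Fn by (metis (no_types, lifting) imageE)

lemma rho_mult: "g \<in> carrier H \<Longrightarrow> h \<in> carrier H \<Longrightarrow> f \<in> Fn \<Longrightarrow> R (g *h h) f = R g (R h f)"
proof -
  assume g: "g \<in> carrier H" and h: "h \<in> carrier H" and f: "f \<in> Fn"
  obtain F where F: "F \<in> carrier FR" "g = cl F" using g carrier_H by auto
  obtain G where G: "G \<in> carrier FR" "h = cl G" using h carrier_H by auto
  show ?thesis
    unfolding F(2) G(2) cl_mult[OF F(1) G(1), symmetric]
    using F(1) G(1) f by (simp add: rho_cl free_ring_closed ev_mult ev_Fn)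
qed

lemma rho_add: "g \<in> carrier H \<Longrightarrow> h \<in> carrier H \<Longrightarrow> f \<in> Fn \<Longrightarrow> R (g +h h) f = (\<lambda>\<rho>. R g f \<rho> + R h f \<rho>)"
proof -
  assume g: "g \<in> carrier H" and h: "h \<in> carrier H" and f: "f \<in> Fn"
  obtain F where F: "F \<in> carrier FR" "g = cl F" using g carrier_H by auto
  obtain G where G: "G \<in> carrier FR" "h = cl G" using h carrier_H by auto
  show ?thesis
    unfolding F(2) G(2) cl_add[OF F(1) G(1), symmetric]
    using F(1) G(1) f by (simp add: rho_cl free_ring_closed ev_add)
qed

lemma rho_linear:
  assumes h: "h \<in> carrier H" and "f \<in> Fn" "g \<in> Fn"
  shows "R h (\<lambda>\<rho>. a * f \<rho> + b * g \<rho>) = (\<lambda>\<rho>. a * R h f \<rho> + b * R h g \<rho>)"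
proof -
  obtain F where F: "F \<in> carrier FR" "h = cl F" using h carrier_H by auto
  have "(\<lambda>\<rho>. a * f \<rho> + b * g \<rho>) \<in> Fn" using assms by (intro Fn_add Fn_scale)
  then show ?thesis unfolding F(2) using F(1) assms by (simp add: rho_cl ev_linear)
qed

lemma rho_one: "f \<in> Fn \<Longrightarrow> R \<one>\<^bsub>H\<^esub> f = f"
  unfolding cl_one[symmetric] by (simp add: rho_cl free_ring_closed ev_one)

lemma rho_Sc: "f \<in> Fn \<Longrightarrow> R (Sc c) f = (\<lambda>\<rho>. c * f \<rho>)"
  unfolding scalB_def by (simp add: rho_cl free_ring_closed ev_scal)

lemma rho_V: "u \<in> VC n \<Longrightarrow> f \<in> Fn \<Longrightarrow> R (V u) f = Xop \<gamma> \<mu> u f"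
  unfolding vecB_def by (simp add: rho_cl gen_Vec ev_gen)

lemma rho_t: "w \<in> W_B n \<Longrightarrow> f \<in> Fn \<Longrightarrow> R (t w) f = Wop \<mu> w f"
  unfolding tB_def by (simp add: rho_cl gen_Grp ev_gen)

lemma rho_zero: "f \<in> Fn \<Longrightarrow> R \<zero>\<^bsub>H\<^esub> f = (\<lambda>\<rho>. 0)"
  using rho_Sc[of f 0] by (simp add: Sc_zero)

lemma rho_minus:
  assumes h: "h \<in> carrier H" and f: "f \<in> Fn"
  shows "R (\<ominus>\<^bsub>H\<^esub> h) f = (\<lambda>\<rho>. - R h f \<rho>)"
proof -
  have "(\<lambda>\<rho>. R h f \<rho> + R (\<ominus>\<^bsub>H\<^esub> h) f \<rho>) = (\<lambda>\<rho>. 0)"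
    using rho_add[OF h H.a_inv_closed[OF h] f] rho_zero[OF f] H.r_neg[OF h] by simp
  then show ?thesis by (simp add: fun_eq_iff eq_neg_iff_add_eq_0 add.commute)
qed

text \<open>The eigenvalue of \<open>AA\<close> on the generator, read off at the identity
  permutation, where \<open>vac\<close> is 1.\<close>

definition chr :: "gensym free_alg set \<Rightarrow> complex" where
  "chr a = R a vac id"

text \<open>An eigenvector of the generators is one of the ring they generate. This produces the
  character whose existence the description \<open>charSU\<close> presupposes.\<close>

lemma rho_vac_AA: "a \<in> AA \<Longrightarrow> R a vac = (\<lambda>\<rho>. chr a * vac \<rho>)"
proof -
  assume "a \<in> AA"
  then have "a \<in> generate_ring H (range Sc \<union> V ` VC n \<union> t ` U_D n)" by (simp add: AA_def)
  then have "\<exists>c. R a vac = (\<lambda>\<rho>. c * vac \<rho>)"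
  proof (induction rule: generate_ring.induct)
    case one
    show ?case by (rule exI[of _ 1]) (simp add: rho_one vac_Fn)
  next
    case (incl h)
    then consider (sc) c where "h = Sc c" | (vec) u where "h = V u" "u \<in> VC n" | (t) x where "h = t x" "x \<in> U_D n"
      by auto
    then show ?case
    proof cases
      case sc
      then show ?thesis by (auto simp: rho_Sc vac_Fn)
    next
      case vec
      then show ?thesis by (auto simp: rho_V vac_Fn Xop_vac)
    next
      case t
      obtain s where s: "x = sp s id" "s \<in> signs n" using t(2) unfolding U_D_eq by blast
      have "R h vac = (\<lambda>\<rho>. msign \<mu> s id * vac \<rho>)"
        unfolding t(1) rho_t[OF U_W[OF t(2)] vac_Fn] unfolding s(1) Wop_sp[OF s(2) permutes_id]
        by (auto simp: vac_def)
      then show ?thesis by blast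
    qed
  next
    case (a_inv h)
    then obtain c where "R h vac = (\<lambda>\<rho>. c * vac \<rho>)" by blast
    moreover have "h \<in> carrier H" using a_inv(1) AA_closed by (simp add: AA_def)
    ultimately show ?case by (intro exI[of _ "- c"]) (simp add: rho_minus vac_Fn)
  next
    case (eng_add h1 h2)
    then obtain c d where "R h1 vac = (\<lambda>\<rho>. c * vac \<rho>)" "R h2 vac = (\<lambda>\<rho>. d * vac \<rho>)" by blast
    moreover have "h1 \<in> carrier H" "h2 \<in> carrier H" using eng_add(1,2) AA_closed by (simp_all add: AA_def)
    ultimately show ?case by (intro exI[of _ "c + d"]) (simp add: rho_add vac_Fn distrib_right)
  next
    case (eng_mult h1 h2)
    then obtain c d where cd: "R h1 vac = (\<lambda>\<rho>. c * vac \<rho>)" "R h2 vac = (\<lambda>\<rho>. d * vac \<rho>)" by blast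
    have h: "h1 \<in> carrier H" "h2 \<in> carrier H" using eng_mult(1,2) AA_closed by (simp_all add: AA_def)
    have "R (h1 *h h2) vac = R h1 (\<lambda>\<rho>. d * vac \<rho> + 0 * vac \<rho>)" using rho_mult[OF h vac_Fn] cd(2) by simp
    also have "\<dots> = (\<lambda>\<rho>. d * c * vac \<rho>)"
      unfolding rho_linear[OF h(1) vac_Fn vac_Fn] cd(1) by (simp add: mult.assoc)
    finally show ?case by blast
  qed
  then obtain c where c: "R a vac = (\<lambda>\<rho>. c * vac \<rho>)" by blast
  then have "chr a = c" by (simp add: chr_def vac_def)
  then show ?thesis using c by simp
qed

lemma chr_add: "a \<in> AA \<Longrightarrow> b \<in> AA \<Longrightarrow> chr (a +h b) = chr a + chr b"
  by (simp add: chr_def rho_add AA_closed vac_Fn)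

lemma chr_mult: "a \<in> AA \<Longrightarrow> b \<in> AA \<Longrightarrow> chr (a *h b) = chr a * chr b"
proof -
  assume a: "a \<in> AA" and b: "b \<in> AA"
  have "R (a *h b) vac = R a (\<lambda>\<rho>. chr b * vac \<rho> + 0 * vac \<rho>)"
    using rho_mult[OF AA_closed[OF a] AA_closed[OF b] vac_Fn] rho_vac_AA[OF b] by simp
  also have "\<dots> = (\<lambda>\<rho>. chr b * (chr a * vac \<rho>))"
    unfolding rho_linear[OF AA_closed[OF a] vac_Fn vac_Fn] rho_vac_AA[OF a] by simp
  finally show ?thesis by (simp add: chr_def[of "a *h b"] vac_def)
qed

lemma chr_gens:
  "chr (Sc c) = c"
  "u \<in> VC n \<Longrightarrow> chr (V u) = (\<Sum>j\<in>{1..n}. u j * \<gamma> j)"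
  "s \<in> signs n \<Longrightarrow> sp s id \<in> U_D n \<Longrightarrow> chr (t (sp s id)) = msign \<mu> s id"
  "chr \<one>\<^bsub>H\<^esub> = 1"
proof -
  show "chr (Sc c) = c" by (simp add: chr_def rho_Sc vac_Fn) (simp add: vac_def)
  show "chr \<one>\<^bsub>H\<^esub> = 1" by (simp add: chr_def rho_one vac_Fn) (simp add: vac_def)
  show "chr (V u) = (\<Sum>j\<in>{1..n}. u j * \<gamma> j)" if "u \<in> VC n"
    using that by (simp add: chr_def rho_V vac_Fn Xop_vac) (simp add: vac_def)
  show "chr (t (sp s id)) = msign \<mu> s id" if "s \<in> signs n" "sp s id \<in> U_D n"
    unfolding chr_def rho_t[OF U_W[OF that(2)] vac_Fn] Wop_sp[OF that(1) permutes_id] by (simp add: vac_def)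
qed

end

section \<open>The automorphism \<open>\<delta>\<close> and its fixed points\<close>

context hecke_algebra
begin

interpretation H: ring H by (rule ring_H)

text \<open>
  The column sums of a signed permutation are its signs, so this multiplicative function extends the
  determinant on T to all of W_B and is trivial on W_A.
\<close>

definition sgw :: "endo \<Rightarrow> complex" where
  "sgw w = (\<Prod>j\<in>{1..n}. complex_of_real (\<Sum>l\<in>{1..n}. w (eps j) l))"

lemma sgw_sp:
  assumes "s \<in> signs n" "\<pi> permutes {1..n}"
  shows "sgw (sp s \<pi>) = complex_of_real (\<Prod>j\<in>{1..n}. s j)"
proof -
  have "(\<Sum>l\<in>{1..n}. sp s \<pi> (eps j) l) = s (\<pi> j)" if "j \<in> {1..n}" for j
    using permutes_in_image[OF assms(2), of j] that by (simp add: sp_eps[OF permutes_bij[OF assms(2)]])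
  then have "sgw (sp s \<pi>) = (\<Prod>j\<in>{1..n}. complex_of_real (s (\<pi> j)))"
    unfolding sgw_def by (intro prod.cong) auto
  also have "\<dots> = (\<Prod>j\<in>{1..n}. complex_of_real (s j))"
    using prod.permute[OF assms(2), of "\<lambda>j. complex_of_real (s j)"] by (simp add: comp_def)
  finally show ?thesis by simp
qed

lemma sgw_comp:
  assumes "w \<in> W_B n" "w' \<in> W_B n"
  shows "sgw (w \<circ> w') = sgw w * sgw w'"
proof -
  obtain s \<pi> where 1: "w = sp s \<pi>" "s \<in> signs n" "\<pi> permutes {1..n}" using assms(1) unfolding W_B_eq by blast
  obtain s' \<pi>' where 2: "w' = sp s' \<pi>'" "s' \<in> signs n" "\<pi>' permutes {1..n}" using assms(2) unfolding W_B_eq by blast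
  have s'': "(\<lambda>l. s' (inv_into UNIV \<pi> l)) \<in> signs n" by (rule signs_perm[OF 2(2) permutes_inv[OF 1(3)]])
  have c: "w \<circ> w' = sp (\<lambda>l. s l * s' (inv_into UNIV \<pi> l)) (\<pi> \<circ> \<pi>')"
    unfolding 1(1) 2(1) by (rule sp_permutes_comp[OF 1(3) 2(3)])
  have p: "(\<Prod>j\<in>{1..n}. s' (inv_into UNIV \<pi> j)) = (\<Prod>j\<in>{1..n}. s' j)"
    using prod.permute[OF permutes_inv[OF 1(3)], of s'] by (simp add: comp_def)
  show ?thesis
    unfolding c sgw_sp[OF signs_mult[OF 1(2) s''] permutes_compose[OF 2(3) 1(3)]] prod.distrib p
    unfolding 1(1) 2(1) sgw_sp[OF 1(2,3)] sgw_sp[OF 2(2,3)] by simp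
qed

lemma sgw_sq: "w \<in> W_B n \<Longrightarrow> sgw w * sgw w = 1"
proof -
  assume w: "w \<in> W_B n"
  obtain s \<pi> where 1: "w = sp s \<pi>" "s \<in> signs n" "\<pi> permutes {1..n}" using w unfolding W_B_eq by blast
  have "(\<Prod>j\<in>{1..n}. s j) * (\<Prod>j\<in>{1..n}. s j) = 1"
    unfolding prod.distrib[symmetric] using signs_sq[OF 1(2)] by simp
  then show ?thesis unfolding 1(1) sgw_sp[OF 1(2,3)] by (metis of_real_1 of_real_mult)
qed

lemma sgw_one: "\<pi> permutes {1..n} \<Longrightarrow> sgw (sp sone \<pi>) = 1"
  by (simp add: sgw_sp)

lemma sgw_torus: "s \<in> signs n \<Longrightarrow> sgw (sp s id) = complex_of_real (\<Prod>j\<in>{1..n}. s j)"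
  by (rule sgw_sp[OF _ permutes_id])

fun chl :: "gensym \<Rightarrow> complex" where
  "chl (Vec a) = 1" | "chl (Grp w) = sgw w"

definition chw :: "gensym fmon \<Rightarrow> complex" where
  "chw u = prod_list (map chl (letters u))"

lemma chw_plus: "chw (u + v) = chw u * chw v"
  by (simp add: chw_def)

lemma chw_sq: "set (letters u) \<subseteq> gensB n \<Longrightarrow> chw u * chw u = 1"
proof -
  have "prod_list (map chl us) * prod_list (map chl us) = 1" if "set us \<subseteq> gensB n" for us
    using that
  proof (induction us)
    case (Cons g us)
    have "chl g * chl g = 1" using Cons.prems by (auto simp: gensB_def sgw_sq)
    then have "(chl g * chl g) * (prod_list (map chl us) * prod_list (map chl us)) = 1" using Cons by simp
    then show ?case by (simp add: mult_ac)
  qed simp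
  then show "set (letters u) \<subseteq> gensB n \<Longrightarrow> chw u * chw u = 1" by (simp add: chw_def)
qed

text \<open>The lift of \<open>delta\<close> to the free algebra: each word is scaled by the product
  of the characters of its letters, vectors counting as 1. Multiplicativity of \<open>chw\<close> on
  words makes it a ring homomorphism.\<close>

definition Dl :: "gensym free_alg \<Rightarrow> gensym free_alg" where
  "Dl F = Abs_poly_mapping (\<lambda>u. chw u * Poly_Mapping.lookup F u)"

lemma lookup_Dl: "Poly_Mapping.lookup (Dl F) u = chw u * Poly_Mapping.lookup F u"
proof -
  have "finite {u. chw u * Poly_Mapping.lookup F u \<noteq> 0}"
    by (rule finite_subset[OF _ finite_keys[of F]]) (auto simp: in_keys_iff)
  then show ?thesis by (simp add: Dl_def)
qed

lemma Dl_add: "Dl (F + G) = Dl F + Dl G"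
  by (rule poly_mapping_eqI) (simp add: lookup_Dl lookup_add distrib_left)

lemma Dl_diff: "Dl (F - G) = Dl F - Dl G"
  by (rule poly_mapping_eqI) (simp add: lookup_Dl lookup_minus right_diff_distrib)

lemma Dl_single: "Dl (Poly_Mapping.single u c) = Poly_Mapping.single u (chw u * c)"
  by (rule poly_mapping_eqI) (simp add: lookup_Dl lookup_single when_def)

lemma Dl_zero: "Dl 0 = 0"
  by (rule poly_mapping_eqI) (simp add: lookup_Dl)

lemma Dl_mult: "Dl (F * G) = Dl F * Dl G"
proof (induction F rule: poly_mapping_single_induct)
  case (add F u c)
  have "Dl (Poly_Mapping.single u c * G) = Dl (Poly_Mapping.single u c) * Dl G"
  proof (induction G rule: poly_mapping_single_induct)
    case (add G v d)
    then show ?case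
      by (simp add: distrib_left Dl_add mult_single Dl_single chw_plus mult_ac)
  qed (simp add: Dl_zero)
  then show ?case using add.IH by (simp add: distrib_right Dl_add)
qed (simp add: Dl_zero)

lemma Dl_gen: "Dl (gen g) = scal (chl g) * gen g"
  by (simp add: gen_def scal_def Dl_single mult_single chw_def)

lemma Dl_scal: "Dl (scal c) = scal c"
  by (simp add: scal_def Dl_single chw_def)

lemma Dl_one: "Dl 1 = 1"
  using Dl_scal[of 1] by (simp add: scal_one)

lemma Dl_closed: "F \<in> carrier FR \<Longrightarrow> Dl F \<in> carrier FR"
  by (simp add: free_ring_carrier_iff in_keys_iff lookup_Dl)

lemma Dl_Dl: "F \<in> carrier FR \<Longrightarrow> Dl (Dl F) = F"
proof (rule poly_mapping_eqI)
  fix u assume F: "F \<in> carrier FR"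
  show "Poly_Mapping.lookup (Dl (Dl F)) u = Poly_Mapping.lookup F u"
  proof (cases "u \<in> Poly_Mapping.keys F")
    case True
    then have "chw u * chw u = 1" by (rule chw_sq[OF FR_keys[OF F]])
    then have "chw u * chw u * Poly_Mapping.lookup F u = Poly_Mapping.lookup F u" by simp
    then show ?thesis by (simp add: lookup_Dl mult.assoc)
  qed (simp add: lookup_Dl in_keys_iff)
qed

lemma scal_shift: "(scal a * x) * (scal b * y) = scal (a * b) * (x * y)"
proof -
  have "(scal a * x) * (scal b * y) = scal a * (x * scal b) * y" by (simp only: mult.assoc)
  also have "\<dots> = scal a * (scal b * x) * y" by (simp only: scal_central)
  finally show ?thesis by (simp only: scal_mult mult.assoc)
qed

lemma ideal_scal: "r \<in> idealB n k \<Longrightarrow> scal c * r \<in> idealB n k"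
  using ideal.I_l_closed[OF ideal_idealB, of r "scal c"] free_ring_closed(7)[of c "gensB n"] by simp

text \<open>Every relation is homogeneous for the character and is mapped to a scalar multiple of
  itself. In the cross relation \<open>ktilde\<close> is fixed because its product term contains two
  sign changes, each contributing -1.\<close>

lemma Dl_relsB:
  assumes "r \<in> relsB n k"
  shows "Dl r \<in> idealB n k"
proof -
  have r: "r \<in> idealB n k" using assms relsB_ideal by auto
  from assms show ?thesis
  proof cases
    case (lin u v a b)
    then have "Dl r = r" by (simp add: Dl_diff Dl_add Dl_mult Dl_gen Dl_scal scal_one)
    then show ?thesis using r by simp
  next
    case (comm u v)
    then have "Dl r = r" by (simp add: Dl_diff Dl_mult Dl_gen scal_one)
    then show ?thesis using r by simp
  next
    case one
    have "sgw id = 1" using sgw_one[OF permutes_id] unfolding sp_id .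
    then have "Dl r = r" unfolding one Dl_diff Dl_gen Dl_one chl.simps by (simp only: scal_one mult_1)
    then show ?thesis using r by simp
  next
    case (mult w w')
    have "Dl r = scal (sgw w * sgw w') * r"
      unfolding mult(1) Dl_diff Dl_mult Dl_gen chl.simps scal_shift sgw_comp[OF mult(2,3)]
      by (simp only: right_diff_distrib)
    then show ?thesis using ideal_scal[OF r] by simp
  next
    case (torus x \<zeta>)
    have "Dl r = scal (sgw x) * r"
      unfolding torus(1) Dl_diff Dl_mult Dl_gen chl.simps scal_shift by (simp add: right_diff_distrib)
    then show ?thesis using ideal_scal[OF r] by simp
  next
    case (cross i \<alpha> \<zeta>)
    have i: "1 \<le> i" "i < n" using cross by auto
    have "reflect n \<alpha> = sp sone (tr i (i + 1))" using cross reflect_simple by simp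
    then have s1: "sgw (reflect n \<alpha>) = 1" using sgw_one[OF adj_permutes[OF i]] by simp
    have "sgw (reflect n (eps j)) = -1" if "j \<in> {1..n}" for j
      unfolding reflect_eps[OF that] sgw_torus[OF signs_flip[OF that]] prod_flip[OF that] by simp
    then have "sgw (reflect n (eps i)) = -1" "sgw (reflect n (eps (i + 1))) = -1" using i by auto
    then have K: "Dl (ktilde n k i) = ktilde n k i"
      unfolding ktilde_def Dl_mult Dl_add Dl_one Dl_scal Dl_gen scal_shift chl.simps by (simp add: scal_one)
    have "Dl r = r"
      unfolding cross(1) Dl_diff Dl_mult Dl_add Dl_scal Dl_gen chl.simps s1 K by (simp only: scal_one mult_1)
    then show ?thesis using r by simp
  qed
qed

lemma Dl_ideal:
  assumes "r \<in> idealB n k"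
  shows "Dl r \<in> idealB n k"
proof -
  let ?J = "{F \<in> carrier FR. Dl F \<in> idealB n k}"
  have hom: "ring_hom_ring FR FR Dl"
    by (rule ring_hom_ringI[OF ring_free_ring ring_free_ring])
       (simp_all add: Dl_closed Dl_mult Dl_add Dl_one)
  have "ideal ?J FR"
    by (rule ring_hom_ring.ideal_vimage[OF hom ideal_idealB])
  moreover have "relsB n k \<subseteq> ?J" using relsB_closed Dl_relsB by blast
  ultimately have "idealB n k \<subseteq> ?J"
    unfolding idealB_def by (rule ring.genideal_minimal[OF ring_free_ring])
  then show ?thesis using assms by blast
qed

text \<open>Restricted to the carrier because \<open>delta\<close> is required to be
  extensional.\<close>

definition dd :: "gensym free_alg set \<Rightarrow> gensym free_alg set" where
  "dd = (\<lambda>h\<in>carrier H. cl (Dl (SOME F. F \<in> carrier FR \<and> cl F = h)))"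

lemma dd_cl:
  assumes F: "F \<in> carrier FR"
  shows "dd (cl F) = cl (Dl F)"
proof -
  let ?G = "SOME G. G \<in> carrier FR \<and> cl G = cl F"
  have G: "?G \<in> carrier FR \<and> cl ?G = cl F" by (rule someI[of _ F]) (use F in simp)
  then have "?G - F \<in> idealB n k" using cl_eq_iff[of ?G F] F by simp
  then have "Dl ?G - Dl F \<in> idealB n k" using Dl_ideal by (simp only: Dl_diff[symmetric])
  then have "cl (Dl ?G) = cl (Dl F)" using G F by (simp add: cl_eq_iff Dl_closed)
  then show ?thesis using cl_closed[OF F] by (simp add: dd_def)
qed

lemma dd_closed: "h \<in> carrier H \<Longrightarrow> dd h \<in> carrier H"
  using carrier_H dd_cl Dl_closed cl_closed by (metis (no_types, lifting) imageE)

lemma dd_mult: "g \<in> carrier H \<Longrightarrow> h \<in> carrier H \<Longrightarrow> dd (g *h h) = dd g *h dd h"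
proof -
  assume g: "g \<in> carrier H" and h: "h \<in> carrier H"
  obtain F where F: "F \<in> carrier FR" "g = cl F" using g carrier_H by auto
  obtain G where G: "G \<in> carrier FR" "h = cl G" using h carrier_H by auto
  have "dd (cl (F * G)) = cl (Dl F * Dl G)"
    using dd_cl[OF free_ring_closed(4)[OF F(1) G(1)]] by (simp only: Dl_mult)
  then show ?thesis
    unfolding F(2) G(2) dd_cl[OF F(1)] dd_cl[OF G(1)]
    using F(1) G(1) by (simp add: cl_mult Dl_closed)
qed

lemma dd_add: "g \<in> carrier H \<Longrightarrow> h \<in> carrier H \<Longrightarrow> dd (g +h h) = dd g +h dd h"
proof -
  assume g: "g \<in> carrier H" and h: "h \<in> carrier H"
  obtain F where F: "F \<in> carrier FR" "g = cl F" using g carrier_H by auto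
  obtain G where G: "G \<in> carrier FR" "h = cl G" using h carrier_H by auto
  have "dd (cl (F + G)) = cl (Dl F + Dl G)"
    using dd_cl[OF free_ring_closed(3)[OF F(1) G(1)]] by (simp only: Dl_add)
  then show ?thesis
    unfolding F(2) G(2) dd_cl[OF F(1)] dd_cl[OF G(1)]
    using F(1) G(1) by (simp add: cl_add Dl_closed)
qed

lemma dd_one: "dd \<one>\<^bsub>H\<^esub> = \<one>\<^bsub>H\<^esub>"
  using dd_cl[OF free_ring_closed(2)] by (simp add: cl_one Dl_one)

lemma dd_dd: "h \<in> carrier H \<Longrightarrow> dd (dd h) = h"
proof -
  assume h: "h \<in> carrier H"
  obtain F where F: "F \<in> carrier FR" "h = cl F" using h carrier_H by auto
  show ?thesis unfolding F(2) dd_cl[OF F(1)] dd_cl[OF Dl_closed[OF F(1)]] Dl_Dl[OF F(1)] ..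
qed

lemma dd_Sc: "dd (Sc c) = Sc c"
  unfolding scalB_def by (simp add: dd_cl free_ring_closed Dl_scal)

lemma dd_V: "u \<in> VC n \<Longrightarrow> dd (V u) = V u"
  unfolding vecB_def by (simp add: dd_cl gen_Vec Dl_gen scal_one)

lemma dd_t: "w \<in> W_B n \<Longrightarrow> dd (t w) = Sc (sgw w) *h t w"
  unfolding vecB_def tB_def scalB_def by (simp add: dd_cl gen_Grp Dl_gen cl_mult free_ring_closed)

lemma dd_hom: "dd \<in> Ring.ring_hom H H"
  by (rule Ring.ring_hom_memI) (simp_all add: dd_closed dd_mult dd_add dd_one)

lemma dd_iso: "dd \<in> ring_iso H H"
proof -
  have "bij_betw dd (carrier H) (carrier H)"
    by (rule bij_betw_byWitness[of _ dd]) (auto simp: dd_dd dd_closed)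
  then show ?thesis using dd_hom by (simp add: ring_iso_def)
qed

text \<open>Existence is \<open>dd\<close>. For uniqueness the prescribed values have to reach all
  generators: complex vectors are split into real ones, and a group element is a product of one in T
  and one in W_A.\<close>

lemma delta_eq: "delta n k = dd"
  unfolding delta_def
proof (rule the_equality)
  have "dd (t x) = Sc (complex_of_real (det_n n x)) *h t x" if x: "x \<in> T_B n" for x
  proof -
    obtain s where s: "x = sp s id" "s \<in> signs n" using x unfolding T_B_eq by blast
    have "x \<in> W_B n" using x T_subset_W by auto
    then have "dd (t x) = Sc (sgw x) *h t x" by (rule dd_t)
    moreover have "sgw x = complex_of_real (det_n n x)"
      unfolding s(1) sgw_torus[OF s(2)] det_n_torus ..
    ultimately show ?thesis by (simp only:)
  qed
  moreover have "dd (t w) = t w" if w: "w \<in> W_A n" for w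
  proof -
    obtain \<pi> where \<pi>: "w = sp sone \<pi>" "\<pi> permutes {1..n}" using w unfolding W_A_eq by blast
    have "w \<in> W_B n" using w W_A_subset_W by auto
    then show ?thesis using dd_t[of w] sgw_one[OF \<pi>(2)] \<pi>(1) by (simp add: Sc_one)
  qed
  moreover have "dd \<in> extensional (carrier H)" by (simp add: dd_def)
  ultimately show "dd \<in> ring_iso H H \<and> dd \<in> extensional (carrier H) \<and> (\<forall>c. dd (Sc c) = Sc c) \<and>
     (\<forall>\<xi>\<in>VR n. dd (V (complexify \<xi>)) = V (complexify \<xi>)) \<and>
     (\<forall>x\<in>T_B n. dd (t x) = Sc (complex_of_real (det_n n x)) *h t x) \<and> (\<forall>w\<in>W_A n. dd (t w) = t w)"
    using dd_iso dd_Sc dd_V complexify_VC by blast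
next
  fix d
  assume d: "d \<in> ring_iso H H \<and> d \<in> extensional (carrier H) \<and> (\<forall>c. d (Sc c) = Sc c) \<and>
     (\<forall>\<xi>\<in>VR n. d (V (complexify \<xi>)) = V (complexify \<xi>)) \<and>
     (\<forall>x\<in>T_B n. d (t x) = Sc (complex_of_real (det_n n x)) *h t x) \<and> (\<forall>w\<in>W_A n. d (t w) = t w)"
  have dh: "d \<in> Ring.ring_hom H H" using d by (simp add: ring_iso_def)
  note dm = Ring.ring_hom_mult[OF dh] and da = Ring.ring_hom_add[OF dh] and d1 = Ring.ring_hom_one[OF dh]
  have dV: "d (V u) = V u" if u: "u \<in> VC n" for u
  proof -
    obtain y z where yz: "y \<in> VR n" "z \<in> VR n" and u': "u = (\<lambda>l. 1 * complexify y l + \<i> * complexify z l)"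
      using VC_split[OF u] by metis
    have e: "V u = Sc 1 *h V (complexify y) +h Sc \<i> *h V (complexify z)"
      unfolding u' by (rule V_lin) (use yz in \<open>simp_all add: complexify_VC\<close>)
    show ?thesis unfolding e using d yz by (simp add: dm da complexify_VC)
  qed
  have dt: "d (t w) = dd (t w)" if w: "w \<in> W_B n" for w
  proof -
    obtain s \<pi> where 1: "w = sp s \<pi>" "s \<in> signs n" "\<pi> permutes {1..n}" using w unfolding W_B_eq by blast
    have x: "sp s id \<in> T_B n" unfolding T_B_eq using 1 by blast
    have xW: "sp s id \<in> W_B n" using x T_subset_W by auto
    have a: "sp sone \<pi> \<in> W_A n" unfolding W_A_eq using 1 by blast
    have aW: "sp sone \<pi> \<in> W_B n" using a W_A_subset_W by auto
    have e: "t w = t (sp s id) *h t (sp sone \<pi>)"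
      unfolding t_mult[OF xW aW] 1(1) sp_decomp[OF 1(3), of s, symmetric] ..
    have "d (t (sp s id)) = dd (t (sp s id))"
      using d x dd_t[OF xW] sgw_torus[OF 1(2)] det_n_torus[of n s] by simp
    moreover have "d (t (sp sone \<pi>)) = dd (t (sp sone \<pi>))"
      using d a dd_t[OF aW] sgw_one[OF 1(3)] aW by (simp add: Sc_one)
    ultimately show ?thesis unfolding e using xW aW by (simp add: dm dd_mult)
  qed
  have "d h = dd h" if "h \<in> carrier H" for h
    using that
  proof (induction rule: H_induct)
    case one
    show ?case by (simp add: d1 dd_one)
  next
    case (scal x c)
    then show ?case using d by (simp add: dm dd_mult dd_Sc)
  next
    case (add x y)
    then show ?case by (simp add: da dd_add)
  next
    case (vec x u)
    then show ?case by (simp add: dm dd_mult dV dd_V)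
  next
    case (grp x w)
    then show ?case by (simp add: dm dd_mult dt)
  qed
  then show "d = dd" using d by (intro extensionalityI[of d "carrier H" dd]) (simp_all add: dd_def)
qed

section \<open>Fixed points of the automorphism\<close>

lemma AA_dd: "a \<in> AA \<Longrightarrow> dd a = a"
proof -
  assume "a \<in> AA"
  then have "a \<in> generate_ring H (range Sc \<union> V ` VC n \<union> t ` U_D n)" by (simp add: AA_def)
  then show ?thesis
  proof (induction rule: generate_ring.induct)
    case one
    show ?case by (rule dd_one)
  next
    case (incl h)
    have "dd (t x) = t x" if x: "x \<in> U_D n" for x
    proof -
      obtain s where s: "x = sp s id" "s \<in> signs n" "(\<Prod>j\<in>{1..n}. s j) = 1" using x unfolding U_D_eq by blast
      have "sgw x = 1" unfolding s(1) sgw_torus[OF s(2)] s(3) by simp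
      then show ?thesis using dd_t[OF U_W[OF x]] U_W[OF x] by (simp add: Sc_one)
    qed
    then show ?case using incl dd_Sc dd_V by auto
  next
    case (a_inv h)
    have h: "h \<in> carrier H" using a_inv(1) AA_closed by (simp add: AA_def)
    have "dd (\<ominus>\<^bsub>H\<^esub> h) +h dd h = \<zero>\<^bsub>H\<^esub>"
      using dd_add[OF H.a_inv_closed[OF h] h] dd_Sc[of 0] h by (simp add: H.l_neg Sc_zero)
    then have "\<ominus>\<^bsub>H\<^esub> dd h = dd (\<ominus>\<^bsub>H\<^esub> h)"
      using h by (intro H.minus_equality) (simp_all add: dd_closed)
    then show ?case using a_inv(2) by simp
  next
    case (eng_add h1 h2)
    then have "h1 \<in> carrier H" "h2 \<in> carrier H" using AA_closed by (simp_all add: AA_def)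
    then show ?case using eng_add by (simp add: dd_add)
  next
    case (eng_mult h1 h2)
    then have "h1 \<in> carrier H" "h2 \<in> carrier H" using AA_closed by (simp_all add: AA_def)
    then show ?case using eng_mult by (simp add: dd_mult)
  qed
qed

lemma DD_dd: "x \<in> DD \<Longrightarrow> dd x = x"
proof (induction rule: DD.induct)
  case (base \<pi> a)
  then show ?case
    using dd_t[OF sp_one_W[OF base(1)]] sgw_one[OF base(1)] AA_dd[OF base(2)]
    by (simp add: dd_mult sp_one_W AA_closed Sc_one)
next
  case (add x y)
  then show ?case by (simp add: dd_add DD_closed)
qed

lemma dd_t1: "dd t1 = Sc (-1) *h t1"
proof -
  have f: "flip 1 \<in> signs n" using n2 by (intro signs_flip) auto
  have "sgw (sp (flip 1) id) = -1"
    unfolding sgw_torus[OF f] using prod_flip[of 1 n] n2 by simp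
  then show ?thesis unfolding t1_def dd_t[OF flip1_W] by (simp only:)
qed

text \<open>On a normal form d + e, with e in \<open>DD\<close> times \<open>t1\<close>, the
  automorphism changes the sign of e. A fixed element thus satisfies 2e = 0, and 2 is an invertible
  scalar.\<close>

lemma carrier_H_D: "carrier (H_D n k) = DD"
proof
  show "DD \<subseteq> carrier (H_D n k)"
    using DD_closed DD_dd by (auto simp: H_D_def delta_eq)
  show "carrier (H_D n k) \<subseteq> DD"
  proof
    fix h assume "h \<in> carrier (H_D n k)"
    then have h: "h \<in> carrier H" "dd h = h" by (auto simp: H_D_def delta_eq)
    obtain d d' where d: "d \<in> DD" "d' \<in> DD" "h = d +h d' *h t1"
      using H_decomposition[OF h(1)] by (auto simp: EE_def)
    note c = DD_closed[OF d(1)] DD_closed[OF d(2)]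
    define e where "e = d' *h t1"
    have e: "e \<in> carrier H" using c by (simp add: e_def)
    have "dd h = d +h d' *h (Sc (-1) *h t1)"
      unfolding d(3) using c by (simp add: dd_add dd_mult DD_dd d dd_t1)
    also have "d' *h (Sc (-1) *h t1) = Sc (-1) *h e"
      unfolding e_def using c Sc_central[OF c(2), of "-1"] by (metis H.m_assoc Sc_closed t1_closed)
    finally have "d +h e = d +h Sc (-1) *h e" using h(2) d(3) by (simp add: e_def)
    then have e2: "e = Sc (-1) *h e" using c e by (simp add: H.add.l_cancel)
    have "e +h e = Sc (-1) *h e +h Sc 1 *h e" using e2 e by (simp add: Sc_one)
    also have "\<dots> = \<zero>\<^bsub>H\<^esub>" using e by (simp add: H.l_distr[symmetric] Sc_add[symmetric] Sc_zero)
    finally have "Sc 2 *h e = \<zero>\<^bsub>H\<^esub>"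
      using e Sc_add[of 1 1] by (simp add: H.l_distr Sc_one)
    then have "Sc (1 / 2) *h (Sc 2 *h e) = \<zero>\<^bsub>H\<^esub>" by simp
    then have "e = \<zero>\<^bsub>H\<^esub>" using e by (simp add: H.m_assoc[symmetric] Sc_mult[symmetric] Sc_one)
    then show "h \<in> DD" using d c by (simp add: e_def)
  qed
qed

lemma subring_H_D: "subring DD H"
proof (rule H.subringI)
  show "DD \<subseteq> carrier H" using DD_closed by auto
  show "\<one>\<^bsub>H\<^esub> \<in> DD" by (rule DD_AA[OF AA_one])
  have fix_iff: "x \<in> DD \<longleftrightarrow> x \<in> carrier H \<and> dd x = x" for x
    using carrier_H_D by (auto simp: H_D_def delta_eq)
  show "x *h y \<in> DD" if "x \<in> DD" "y \<in> DD" for x y using that by (simp add: fix_iff dd_mult)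
  show "x +h y \<in> DD" if "x \<in> DD" "y \<in> DD" for x y using that by (rule DD.add)
  show "\<ominus>\<^bsub>H\<^esub> x \<in> DD" if x: "x \<in> DD" for x
  proof -
    have "\<ominus>\<^bsub>H\<^esub> x = Sc (-1) *h x"
    proof (rule H.minus_equality)
      have "Sc (-1) *h x +h Sc 1 *h x = \<zero>\<^bsub>H\<^esub>"
        using DD_closed[OF x] by (simp only: H.l_distr[symmetric] Sc_add[symmetric] Sc_closed) (simp add: Sc_zero DD_closed[OF x])
      then show "Sc (-1) *h x +h x = \<zero>\<^bsub>H\<^esub>" using DD_closed[OF x] by (simp add: Sc_one)
    qed (use DD_closed[OF x] in auto)
    then show ?thesis using DD_scal[OF x] by simp
  qed
qed

lemma H_D_eq: "H_D n k = H\<lparr>carrier := DD\<rparr>"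
  using carrier_H_D by (simp add: H_D_def)

lemma ring_H_D: "ring (H_D n k)"
  unfolding H_D_eq by (rule H.subring_is_ring[OF subring_H_D])

lemma H_D_simps [simp]:
  "x \<otimes>\<^bsub>H_D n k\<^esub> y = x *h y" "x \<oplus>\<^bsub>H_D n k\<^esub> y = x +h y"
  "\<one>\<^bsub>H_D n k\<^esub> = \<one>\<^bsub>H\<^esub>" "\<zero>\<^bsub>H_D n k\<^esub> = \<zero>\<^bsub>H\<^esub>"
  by (simp_all add: H_D_def)

lemma H_D_minus: "x \<in> DD \<Longrightarrow> \<ominus>\<^bsub>H_D n k\<^esub> x = \<ominus>\<^bsub>H\<^esub> x"
proof -
  assume x: "x \<in> DD"
  interpret D: ring "H_D n k" by (rule ring_H_D)
  have m: "\<ominus>\<^bsub>H\<^esub> x \<in> DD" using subringE(5)[OF subring_H_D x] .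
  show ?thesis
    by (rule D.minus_equality) (use x m DD_closed[OF x] in \<open>simp_all add: carrier_H_D H.l_neg\<close>)
qed

text \<open>\<open>SU\<close> is generated inside the algebra of type D and \<open>AA\<close> inside
  that of type B. The operations agree, and \<open>H_D_minus\<close> identifies the negatives, so
  both inductions go through.\<close>

lemma SU_eq: "SU n k = AA"
proof
  let ?G = "range Sc \<union> V ` VC n \<union> t ` U_D n"
  show "SU n k \<subseteq> AA"
  proof
    fix a assume "a \<in> SU n k"
    then have "a \<in> generate_ring (H_D n k) ?G" by (simp add: SU_def)
    then show "a \<in> AA"
    proof (induction rule: generate_ring.induct)
      case one
      show ?case by (simp add: AA_one)
    next
      case (incl h)
      then show ?case using AA_Sc AA_V AA_t by auto
    next
      case (a_inv h)
      then show ?case using H_D_minus[OF DD_AA] AA_minus by simp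
    qed (simp_all add: AA_add AA_mult)
  qed
  show "AA \<subseteq> SU n k"
  proof
    fix a assume "a \<in> AA"
    then have "a \<in> generate_ring H ?G" by (simp add: AA_def)
    then show "a \<in> SU n k"
      unfolding SU_def
    proof (induction rule: generate_ring.induct)
      case one
      show ?case using generate_ring.one[of "H_D n k" ?G] by simp
    next
      case (incl h)
      then show ?case by (rule generate_ring.incl)
    next
      case (a_inv h)
      have "h \<in> DD" using a_inv(1) DD_AA by (simp add: AA_def)
      then show ?case using generate_ring.a_inv[OF a_inv(2)] H_D_minus by simp
    next
      case (eng_add h1 h2)
      then show ?case using generate_ring.eng_add[of h1 "H_D n k" ?G h2] by simp
    next
      case (eng_mult h1 h2)
      then show ?case using generate_ring.eng_mult[of h1 "H_D n k" ?G h2] by simp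
    qed
  qed
qed

end

context hecke_rep
begin

interpretation H: ring H by (rule ring_H)

text \<open>Existence comes from the eigenvalue character \<open>chr\<close>; a ring homomorphism is
  determined by its values on the generators of \<open>AA\<close>, which gives uniqueness.\<close>

lemma charSU_eq:
  assumes \<Gamma>: "\<And>u. u \<in> VC n \<Longrightarrow> \<Gamma> u = (\<Sum>j\<in>{1..n}. u j * \<gamma> j)"
    and \<chi>: "\<And>s. s \<in> signs n \<Longrightarrow> sp s id \<in> U_D n \<Longrightarrow> \<chi> (sp s id) = msign \<mu> s id"
  shows "charSU n k \<Gamma> \<chi> = restrict chr AA"
  unfolding charSU_def SU_eq
proof (rule the_equality)
  let ?C = "\<lparr>carrier = UNIV, monoid.mult = (*), monoid.one = 1, ring.zero = 0, ring.add = (+)\<rparr> :: complex ring"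
  let ?S = "(H_D n k)\<lparr>carrier := AA\<rparr>"
  have hom: "restrict chr AA \<in> Ring.ring_hom ?S ?C"
    by (rule Ring.ring_hom_memI) (simp_all add: AA_mult AA_add AA_one chr_mult chr_add chr_gens)
  have "chr (t x) = \<chi> x" if x: "x \<in> U_D n" for x
  proof -
    obtain s where s: "x = sp s id" "s \<in> signs n" using x unfolding U_D_eq by blast
    show ?thesis using chr_gens(3)[OF s(2)] \<chi>[OF s(2)] x s(1) by simp
  qed
  then show "restrict chr AA \<in> extensional AA \<and> restrict chr AA \<in> Ring.ring_hom ?S ?C \<and>
      (\<forall>c. restrict chr AA (Sc c) = c) \<and> (\<forall>\<xi>\<in>VC n. restrict chr AA (V \<xi>) = \<Gamma> \<xi>) \<and>
      (\<forall>x\<in>U_D n. restrict chr AA (t x) = \<chi> x)"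
    using hom by (simp add: AA_Sc AA_V AA_t chr_gens \<Gamma>)
  fix f
  assume f: "f \<in> extensional AA \<and> f \<in> Ring.ring_hom ?S ?C \<and>
      (\<forall>c. f (Sc c) = c) \<and> (\<forall>\<xi>\<in>VC n. f (V \<xi>) = \<Gamma> \<xi>) \<and> (\<forall>x\<in>U_D n. f (t x) = \<chi> x)"
  then have fh: "f \<in> Ring.ring_hom ?S ?C" by simp
  have fm: "f (a *h b) = f a * f b" if "a \<in> AA" "b \<in> AA" for a b
    using Ring.ring_hom_mult[OF fh, of a b] that by simp
  have fa: "f (a +h b) = f a + f b" if "a \<in> AA" "b \<in> AA" for a b
    using Ring.ring_hom_add[OF fh, of a b] that by simp
  have "f a = chr a" if "a \<in> AA" for a
  proof -
    have "a \<in> generate_ring H (range Sc \<union> V ` VC n \<union> t ` U_D n)" using that by (simp add: AA_def)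
    then show ?thesis
    proof (induction rule: generate_ring.induct)
      case one
      show ?case using Ring.ring_hom_one[OF fh] by (simp add: chr_gens)
    next
      case (incl h)
      then show ?case using f \<open>\<And>x. x \<in> U_D n \<Longrightarrow> chr (t x) = \<chi> x\<close> by (auto simp: chr_gens \<Gamma>)
    next
      case (a_inv h)
      have h: "h \<in> AA" using a_inv(1) by (simp add: AA_def)
      have 0: "h +h \<ominus>\<^bsub>H\<^esub> h = Sc 0" using AA_closed[OF h] by (simp add: H.r_neg Sc_zero)
      have "f h + f (\<ominus>\<^bsub>H\<^esub> h) = 0" using fa[OF h AA_minus[OF h]] 0 f by simp
      moreover have "chr h + chr (\<ominus>\<^bsub>H\<^esub> h) = 0" using chr_add[OF h AA_minus[OF h]] 0 by (simp add: chr_gens)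
      ultimately show ?case using a_inv(2) by (metis add_left_cancel)
    next
      case (eng_add h1 h2)
      then have "h1 \<in> AA" "h2 \<in> AA" by (simp_all add: AA_def)
      then show ?case using eng_add by (simp add: fa chr_add)
    next
      case (eng_mult h1 h2)
      then have "h1 \<in> AA" "h2 \<in> AA" by (simp_all add: AA_def)
      then show ?case using eng_mult by (simp add: fm chr_mult)
    qed
  qed
  then show "f = restrict chr AA" using f by (intro extensionalityI[of f AA]) simp_all
qed

end

section \<open>The induced module\<close>

context hecke_rep
begin

interpretation H: ring H by (rule ring_H)

abbreviation "FA \<equiv> free_Abelian_group (DD \<times> (UNIV :: complex set))"
definition KK :: "(gensym free_alg set \<times> complex \<Rightarrow>\<^sub>0 int) set" where
  "KK = generate FA (tensor_rels (H_D n k) AA (one_dim (restrict chr AA)))"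

text \<open>The map induced by sending h \<otimes> z to z times h applied to \<open>vac\<close>. It
  is balanced because \<open>AA\<close> acts on \<open>vac\<close> through
  \<open>chr\<close>.\<close>

definition phi :: "(gensym free_alg set \<times> complex \<Rightarrow>\<^sub>0 int) \<Rightarrow> pfun" where
  "phi x = (\<lambda>\<rho>. \<Sum>p\<in>Poly_Mapping.keys x. of_int (Poly_Mapping.lookup x p) * (snd p * R (fst p) vac \<rho>))"

text \<open>The normal form attached to a function, with inverses as in the indexing of the model.
  It is a section of \<open>phi\<close> over \<open>Fn\<close> and additive modulo the
  relations.\<close>

definition can :: "pfun \<Rightarrow> (gensym free_alg set \<times> complex \<Rightarrow>\<^sub>0 int)" where
  "can c = (\<Sum>\<pi>\<in>{\<pi>. \<pi> permutes {1..n}}. frag_of (t (sp sone (inv_into UNIV \<pi>)), c \<pi>))"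

lemma finite_perms: "finite {\<pi>. \<pi> permutes {1..n}}"
  by (rule finite_permutations) simp

lemma phi_superset:
  assumes "finite A" "Poly_Mapping.keys x \<subseteq> A"
  shows "phi x \<rho> = (\<Sum>p\<in>A. of_int (Poly_Mapping.lookup x p) * (snd p * R (fst p) vac \<rho>))"
  unfolding phi_def using assms by (intro sum.mono_neutral_left) (auto simp: in_keys_iff)

lemma phi_zero: "phi 0 = (\<lambda>\<rho>. 0)"
  by (simp add: phi_def)

lemma phi_add: "phi (x + y) = (\<lambda>\<rho>. phi x \<rho> + phi y \<rho>)"
proof
  fix \<rho>
  let ?A = "Poly_Mapping.keys x \<union> Poly_Mapping.keys y"
  have A: "finite ?A" "Poly_Mapping.keys x \<subseteq> ?A" "Poly_Mapping.keys y \<subseteq> ?A" "Poly_Mapping.keys (x + y) \<subseteq> ?A"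
    using keys_add[of x y] by auto
  show "phi (x + y) \<rho> = phi x \<rho> + phi y \<rho>"
    unfolding phi_superset[OF A(1,2)] phi_superset[OF A(1,3)] phi_superset[OF A(1,4)]
    by (simp add: lookup_add distrib_right sum.distrib)
qed

lemma phi_minus: "phi (- x) = (\<lambda>\<rho>. - phi x \<rho>)"
  using phi_add[of x "- x"] by (simp add: phi_zero fun_eq_iff eq_neg_iff_add_eq_0 add.commute)

lemma phi_diff: "phi (x - y) = (\<lambda>\<rho>. phi x \<rho> - phi y \<rho>)"
  using phi_add[of x "- y"] by (simp add: phi_minus)

lemma phi_frag_of: "phi (frag_of (h, z)) = (\<lambda>\<rho>. z * R h vac \<rho>)"
  by (simp add: phi_def)

lemma phi_sum: "phi (\<Sum>i\<in>I. x i) = (\<lambda>\<rho>. \<Sum>i\<in>I. phi (x i) \<rho>)"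
  by (induction I rule: infinite_finite_induct) (simp_all add: phi_zero phi_add)

lemma FA_iff: "x \<in> carrier FA \<longleftrightarrow> Poly_Mapping.keys x \<subseteq> DD \<times> UNIV"
  by (rule carrier_free_Abelian_group_iff)

lemma FA_zero: "0 \<in> carrier FA"
  by (simp add: FA_iff)

lemma FA_add: "x \<in> carrier FA \<Longrightarrow> y \<in> carrier FA \<Longrightarrow> x + y \<in> carrier FA"
  unfolding FA_iff using keys_add[of x y] by blast

lemma FA_minus: "x \<in> carrier FA \<Longrightarrow> - x \<in> carrier FA"
  by (simp add: FA_iff)

lemma FA_diff: "x \<in> carrier FA \<Longrightarrow> y \<in> carrier FA \<Longrightarrow> x - y \<in> carrier FA"
  using FA_add[OF _ FA_minus, of x y] by simp

lemma FA_frag: "h \<in> DD \<Longrightarrow> frag_of (h, z) \<in> carrier FA"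
  by (simp add: FA_iff)

lemma FA_sum: "(\<And>i. i \<in> I \<Longrightarrow> x i \<in> carrier FA) \<Longrightarrow> (\<Sum>i\<in>I. x i) \<in> carrier FA"
  by (induction I rule: infinite_finite_induct) (simp_all add: FA_zero FA_add del: carrier_free_Abelian_group_iff)

lemma t_DD: "\<pi> permutes {1..n} \<Longrightarrow> t (sp sone \<pi>) \<in> DD"
  using DD.base[OF _ AA_one, of \<pi>] sp_one_W[of \<pi>] by simp

lemma can_FA: "can c \<in> carrier FA"
  unfolding can_def by (intro FA_sum FA_frag t_DD) (simp add: permutes_inv)

lemma R_t: "\<pi> permutes {1..n} \<Longrightarrow> f \<in> Fn \<Longrightarrow> R (t (sp sone \<pi>)) f = Tr \<pi> f"
  by (simp add: rho_t sp_one_W Wop_one)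

lemma Tr_inv_vac:
  assumes "\<pi> permutes {1..n}"
  shows "Tr (inv_into UNIV \<pi>) vac \<rho> = (if \<rho> = \<pi> then 1 else 0)"
proof -
  have "\<rho> \<circ> inv_into UNIV \<pi> = id \<longleftrightarrow> \<rho> = \<pi>"
    using permutes_inv_o[OF assms] by (metis comp_assoc comp_id id_comp)
  then show ?thesis unfolding Tr_def vac_def by simp
qed

lemma phi_can:
  assumes "c \<in> Fn"
  shows "phi (can c) = c"
proof (rule Fn_eqI)
  show "c \<in> Fn" by fact
  have e: "phi (can c) \<rho> = (\<Sum>\<pi>\<in>{\<pi>. \<pi> permutes {1..n}}. if \<rho> = \<pi> then c \<pi> else 0)" for \<rho>
    unfolding can_def phi_sum phi_frag_of
    by (rule sum.cong) (auto simp: R_t permutes_inv vac_Fn Tr_inv_vac)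
  show "phi (can c) \<in> Fn" unfolding Fn_def e using finite_perms by simp
  show "phi (can c) \<rho> = c \<rho>" if "\<rho> permutes {1..n}" for \<rho>
    unfolding e using finite_perms that by simp
qed

lemma KK_zero: "0 \<in> KK"
  using generate.one[of FA] unfolding KK_def by simp

lemma rels_FA: "tensor_rels (H_D n k) AA (one_dim (restrict chr AA)) \<subseteq> carrier FA"
  using DD_AA subringE(6)[OF subring_H_D] DD.add
  by (auto simp: tensor_rels_def carrier_H_D one_dim_def simp del: carrier_free_Abelian_group_iff
      intro!: FA_diff FA_add FA_frag)

lemma KK_FA: "x \<in> KK \<Longrightarrow> x \<in> carrier FA"
  unfolding KK_def by (rule group.generate_in_carrier[OF group_free_Abelian_group rels_FA])

lemma KK_add: "x \<in> KK \<Longrightarrow> y \<in> KK \<Longrightarrow> x + y \<in> KK"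
  unfolding KK_def using generate.eng[of x FA _ y] by simp

lemma KK_minus: "x \<in> KK \<Longrightarrow> - x \<in> KK"
proof -
  assume x: "x \<in> KK"
  have "Poly_Mapping.keys x \<subseteq> DD \<times> UNIV" using KK_FA[OF x] by (simp only: FA_iff)
  then show ?thesis
    using group.generate_m_inv_closed[OF group_free_Abelian_group rels_FA, of x] x unfolding KK_def
    by (simp only: inv_free_Abelian_group)
qed

lemma KK_diff: "x \<in> KK \<Longrightarrow> y \<in> KK \<Longrightarrow> x - y \<in> KK"
  using KK_add[OF _ KK_minus, of x y] by simp

lemma KK_sum: "(\<And>i. i \<in> I \<Longrightarrow> x i \<in> KK) \<Longrightarrow> (\<Sum>i\<in>I. x i) \<in> KK"
  by (induction I rule: infinite_finite_induct) (simp_all add: KK_zero KK_add)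

lemma KK_rel1: "r \<in> DD \<Longrightarrow> s \<in> DD \<Longrightarrow> frag_of (r +h s, m) - (frag_of (r, m) + frag_of (s, m)) \<in> KK"
  unfolding KK_def by (rule generate.incl) (auto simp: tensor_rels_def carrier_H_D one_dim_def)

lemma KK_rel2: "r \<in> DD \<Longrightarrow> frag_of (r, m + m') - (frag_of (r, m) + frag_of (r, m')) \<in> KK"
  unfolding KK_def by (rule generate.incl) (auto simp: tensor_rels_def carrier_H_D one_dim_def)

lemma KK_rel3: "r \<in> DD \<Longrightarrow> a \<in> AA \<Longrightarrow> frag_of (r *h a, m) - frag_of (r, chr a * m) \<in> KK"
  unfolding KK_def
proof (rule generate.incl)
  assume "r \<in> DD" "a \<in> AA"
  then have "\<exists>r' a' m'. frag_of (r *h a, m) - frag_of (r, chr a * m) =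
     frag_of (r' \<otimes>\<^bsub>H_D n k\<^esub> a', m') - frag_of (r', a' \<odot>\<^bsub>one_dim (restrict chr AA)\<^esub> m') \<and>
     r' \<in> carrier (H_D n k) \<and> a' \<in> AA \<and> m' \<in> carrier (one_dim (restrict chr AA))"
    by (intro exI[of _ r] exI[of _ a] exI[of _ m]) (simp add: carrier_H_D one_dim_def)
  then show "frag_of (r *h a, m) - frag_of (r, chr a * m) \<in> tensor_rels (H_D n k) AA (one_dim (restrict chr AA))"
    unfolding tensor_rels_def by blast
qed

lemma KK_frag_zero: "r \<in> DD \<Longrightarrow> frag_of (r, 0) \<in> KK"
  using KK_minus[OF KK_rel2[of r 0 0]] by simp

lemma phi_KK:
  assumes "x \<in> KK"
  shows "phi x = (\<lambda>\<rho>. 0)"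
proof -
  have rel: "phi x = (\<lambda>\<rho>. 0)" if "x \<in> tensor_rels (H_D n k) AA (one_dim (restrict chr AA))" for x
  proof -
    from that consider
      (1) r s m where "x = frag_of (r +h s, m) - (frag_of (r, m) + frag_of (s, m))" "r \<in> DD" "s \<in> DD"
    | (2) r m m' where "x = frag_of (r, m + m') - (frag_of (r, m) + frag_of (r, m'))" "r \<in> DD"
    | (3) r a m where "x = frag_of (r *h a, m) - frag_of (r, chr a * m)" "r \<in> DD" "a \<in> AA"
      by (auto simp: tensor_rels_def carrier_H_D one_dim_def)
    then show ?thesis
    proof cases
      case 1
      then show ?thesis
        by (simp add: phi_diff phi_add phi_frag_of rho_add DD_closed vac_Fn distrib_left)
    next
      case 2
      then show ?thesis by (simp add: phi_diff phi_add phi_frag_of distrib_right)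
    next
      case 3
      have "R (r *h a) vac = R r (\<lambda>\<rho>. chr a * vac \<rho> + 0 * vac \<rho>)"
        using rho_mult[OF DD_closed[OF 3(2)] AA_closed[OF 3(3)] vac_Fn] rho_vac_AA[OF 3(3)] by simp
      then have "R (r *h a) vac = (\<lambda>\<rho>. chr a * R r vac \<rho>)"
        unfolding rho_linear[OF DD_closed[OF 3(2)] vac_Fn vac_Fn] by simp
      then show ?thesis unfolding 3(1) by (simp add: phi_diff phi_frag_of)
    qed
  qed
  show ?thesis
    using assms unfolding KK_def
  proof (induction rule: generate.induct)
    case one
    then show ?case by (simp add: phi_zero)
  next
    case (incl h)
    then show ?case by (rule rel)
  next
    case (inv h)
    have "h \<in> carrier FA" using inv rels_FA by blast
    then show ?case using rel[OF inv] by (simp add: phi_minus)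
  next
    case (eng h1 h2)
    then show ?case by (simp add: phi_add)
  qed
qed

lemma can_add: "can (\<lambda>\<rho>. c \<rho> + d \<rho>) - (can c + can d) \<in> KK"
proof -
  have "can (\<lambda>\<rho>. c \<rho> + d \<rho>) - (can c + can d) = (\<Sum>\<pi>\<in>{\<pi>. \<pi> permutes {1..n}}.
     frag_of (t (sp sone (inv_into UNIV \<pi>)), c \<pi> + d \<pi>) -
     (frag_of (t (sp sone (inv_into UNIV \<pi>)), c \<pi>) + frag_of (t (sp sone (inv_into UNIV \<pi>)), d \<pi>)))"
    by (simp add: can_def sum_subtractf sum.distrib)
  then show ?thesis by (simp only:) (intro KK_sum KK_rel2 t_DD, simp add: permutes_inv)
qed

lemma can_zero: "can (\<lambda>\<rho>. 0) \<in> KK"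
  unfolding can_def by (intro KK_sum KK_frag_zero t_DD) (simp add: permutes_inv)

lemma can_minus: "can (\<lambda>\<rho>. - c \<rho>) + can c \<in> KK"
  using KK_diff[OF can_zero can_add[of "\<lambda>\<rho>. - c \<rho>" c]] by (simp add: add.commute)

text \<open>Modulo the relations every element is in normal form, so the relations are the kernel of \<open>phi\<close>.\<close>

lemma can_phi:
  assumes "x \<in> carrier FA"
  shows "x - can (phi x) \<in> KK"
proof -
  have frag: "frag_of (h, z) - can (phi (frag_of (h, z))) \<in> KK" if "h \<in> DD" for h z
    using that
  proof (induction rule: DD.induct)
    case (base \<pi> a)
    define w where "w = chr a * z"
    have p: "inv_into UNIV \<pi> permutes {1..n}" by (rule permutes_inv[OF base(1)])
    have ii: "inv_into UNIV (inv_into UNIV \<pi>) = \<pi>" by (rule inv_inv_eq[OF permutes_bij[OF base(1)]])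
    note tD = t_DD[OF base(1)]
    have 1: "frag_of (t (sp sone \<pi>) *h a, z) - frag_of (t (sp sone \<pi>), w) \<in> KK"
      unfolding w_def by (rule KK_rel3[OF tD base(2)])
    have "phi (frag_of (t (sp sone \<pi>) *h a, z)) = phi (frag_of (t (sp sone \<pi>), w))"
      using phi_KK[OF 1] by (simp add: phi_diff fun_eq_iff)
    also have "\<dots> = (\<lambda>\<rho>. w * (if \<rho> = inv_into UNIV \<pi> then 1 else 0))"
      unfolding phi_frag_of R_t[OF base(1) vac_Fn] using Tr_inv_vac[OF p] unfolding ii by simp
    finally have ph: "phi (frag_of (t (sp sone \<pi>) *h a, z)) = (\<lambda>\<rho>. w * (if \<rho> = inv_into UNIV \<pi> then 1 else 0))" .
    let ?P = "{\<pi>. \<pi> permutes {1..n}}"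
    let ?g = "\<lambda>\<sigma>. frag_of (t (sp sone (inv_into UNIV \<sigma>)), w * (if \<sigma> = inv_into UNIV \<pi> then 1 else 0))"
    \<comment> \<open>Summands with coefficient 0 are still nonzero generators of the free abelian
      group; they are split off here and recognised as elements of \<open>KK\<close> below.\<close>
    have "can (phi (frag_of (t (sp sone \<pi>) *h a, z))) = ?g (inv_into UNIV \<pi>) + sum ?g (?P - {inv_into UNIV \<pi>})"
      unfolding ph can_def using p by (intro sum.remove[OF finite_perms]) simp
    then have c: "can (phi (frag_of (t (sp sone \<pi>) *h a, z))) = frag_of (t (sp sone \<pi>), w) + sum ?g (?P - {inv_into UNIV \<pi>})"
      by (simp add: ii)
    have 2: "sum ?g (?P - {inv_into UNIV \<pi>}) \<in> KK"
      by (rule KK_sum) (auto intro!: KK_frag_zero t_DD permutes_inv)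
    show ?case unfolding c using KK_diff[OF 1 2] by (simp add: diff_diff_eq)
  next
    case (add x y)
    have 1: "frag_of (x +h y, z) - (frag_of (x, z) + frag_of (y, z)) \<in> KK" by (rule KK_rel1[OF add(1,2)])
    have p: "phi (frag_of (x +h y, z)) = (\<lambda>\<rho>. phi (frag_of (x, z)) \<rho> + phi (frag_of (y, z)) \<rho>)"
      using phi_KK[OF 1] by (simp add: phi_diff phi_add fun_eq_iff)
    have "frag_of (x +h y, z) - can (phi (frag_of (x +h y, z))) =
      (frag_of (x +h y, z) - (frag_of (x, z) + frag_of (y, z)))
      + ((frag_of (x, z) - can (phi (frag_of (x, z)))) + (frag_of (y, z) - can (phi (frag_of (y, z)))))
      - (can (phi (frag_of (x +h y, z))) - (can (phi (frag_of (x, z))) + can (phi (frag_of (y, z)))))"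
      by simp
    moreover have "\<dots> \<in> KK"
      unfolding p by (intro KK_diff KK_add 1 add(3,4) can_add)
    ultimately show ?case by simp
  qed
  have "Poly_Mapping.keys x \<subseteq> DD \<times> UNIV" using assms by (simp only: FA_iff)
  then show ?thesis
  proof (induction x rule: frag_induction)
    case zero
    then show ?case using KK_minus[OF can_zero] by (simp add: phi_zero)
  next
    case (one p)
    then show ?case using frag by auto
  next
    case (diff x y)
    have p: "phi (x - y) = (\<lambda>\<rho>. phi x \<rho> + - phi y \<rho>)" by (simp add: phi_diff)
    have "x - y - can (phi (x - y)) = (x - can (phi x)) - (y - can (phi y))
       - ((can (phi (x - y)) - (can (phi x) + can (\<lambda>\<rho>. - phi y \<rho>))) + (can (\<lambda>\<rho>. - phi y \<rho>) + can (phi y)))"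
      by simp
    moreover have "\<dots> \<in> KK"
      unfolding p by (intro KK_diff KK_add can_add can_minus diff)
    ultimately show ?case by simp
  qed
qed

lemma KK_iff: "x \<in> KK \<longleftrightarrow> x \<in> carrier FA \<and> phi x = (\<lambda>\<rho>. 0)"
proof
  assume x: "x \<in> carrier FA \<and> phi x = (\<lambda>\<rho>. 0)"
  have "x - can (phi x) + can (\<lambda>\<rho>. 0) \<in> KK"
    by (rule KK_add[OF can_phi can_zero]) (use x in blast)
  then show "x \<in> KK" using x by simp
qed (use KK_FA phi_KK in blast)

text \<open>The cosets of \<open>KK\<close> are the fibres of \<open>phi\<close> over
  \<open>Fn\<close>, so \<open>fib\<close> identifies \<open>Fn\<close> with the induced
  module.\<close>

definition fib :: "pfun \<Rightarrow> (gensym free_alg set \<times> complex \<Rightarrow>\<^sub>0 int) set" where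
  "fib c = {y \<in> carrier FA. phi y = c}"

lemma phi_Fn: "x \<in> carrier FA \<Longrightarrow> phi x \<in> Fn"
proof -
  assume x: "x \<in> carrier FA"
  have "(\<lambda>\<rho>. of_int (Poly_Mapping.lookup x p) * (snd p * R (fst p) vac \<rho>)) \<in> Fn"
    if p: "p \<in> Poly_Mapping.keys x" for p
  proof -
    have "fst p \<in> DD" using x p unfolding FA_iff by auto
    then show ?thesis by (intro Fn_scale rho_Fn DD_closed vac_Fn)
  qed
  then show ?thesis unfolding phi_def by (rule Fn_sum)
qed

lemma coset_fib:
  assumes x: "x \<in> carrier FA"
  shows "KK #>\<^bsub>FA\<^esub> x = fib (phi x)"
proof
  show "KK #>\<^bsub>FA\<^esub> x \<subseteq> fib (phi x)"
  proof
    fix y assume "y \<in> KK #>\<^bsub>FA\<^esub> x"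
    then obtain h where h: "h \<in> KK" "y = h + x" by (auto simp: r_coset_def)
    then show "y \<in> fib (phi x)"
      using FA_add[OF KK_FA[OF h(1)] x] phi_KK[OF h(1)] by (simp add: fib_def phi_add del: carrier_free_Abelian_group_iff)
  qed
  show "fib (phi x) \<subseteq> KK #>\<^bsub>FA\<^esub> x"
  proof
    fix y assume y: "y \<in> fib (phi x)"
    then have "y - x \<in> KK" unfolding KK_iff fib_def using FA_diff[OF _ x] by (simp add: phi_diff del: carrier_free_Abelian_group_iff)
    then show "y \<in> KK #>\<^bsub>FA\<^esub> x" unfolding r_coset_def by (auto intro!: bexI[of _ "y - x"])
  qed
qed

lemma fib_can: "c \<in> Fn \<Longrightarrow> can c \<in> fib c"
  using can_FA phi_can by (simp add: fib_def)

lemma fib_inj: "c \<in> Fn \<Longrightarrow> fib c = fib d \<Longrightarrow> c = d"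
  using fib_can[of c] by (auto simp: fib_def)

definition NN :: "(gensym free_alg set, (gensym free_alg set \<times> complex \<Rightarrow>\<^sub>0 int) set) module" where
  "NN = tensor_module (H_D n k) AA (one_dim (restrict chr AA))"

lemma NN_carrier: "carrier NN = fib ` Fn"
proof -
  have "carrier NN = rcosets\<^bsub>FA\<^esub> KK"
    by (simp add: NN_def KK_def tensor_module_def Let_def FactGroup_def carrier_H_D one_dim_def)
  also have "\<dots> = (\<lambda>x. fib (phi x)) ` carrier FA"
    unfolding RCOSETS_def using coset_fib by auto
  also have "\<dots> = fib ` Fn"
  proof
    show "(\<lambda>x. fib (phi x)) ` carrier FA \<subseteq> fib ` Fn" using phi_Fn by blast
    show "fib ` Fn \<subseteq> (\<lambda>x. fib (phi x)) ` carrier FA"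
    proof clarify
      fix c assume "c \<in> Fn"
      then show "fib c \<in> (\<lambda>x. fib (phi x)) ` carrier FA"
        using phi_can[of c] can_FA[of c] by (intro image_eqI[of _ _ "can c"]) simp_all
    qed
  qed
  finally show ?thesis .
qed

lemma NN_zero: "\<zero>\<^bsub>NN\<^esub> = fib (\<lambda>\<rho>. 0)"
proof -
  have "\<zero>\<^bsub>NN\<^esub> = KK"
    by (simp add: NN_def KK_def tensor_module_def Let_def FactGroup_def carrier_H_D one_dim_def)
  then show ?thesis using KK_iff unfolding fib_def by auto
qed

lemma NN_add:
  assumes "c \<in> Fn" "d \<in> Fn"
  shows "fib c \<oplus>\<^bsub>NN\<^esub> fib d = fib (\<lambda>\<rho>. c \<rho> + d \<rho>)"
proof -
  have "fib c \<oplus>\<^bsub>NN\<^esub> fib d = fib c <#>\<^bsub>FA\<^esub> fib d"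
    by (simp add: NN_def KK_def tensor_module_def Let_def FactGroup_def carrier_H_D one_dim_def)
  also have "\<dots> = fib (\<lambda>\<rho>. c \<rho> + d \<rho>)"
  proof
    show "fib c <#>\<^bsub>FA\<^esub> fib d \<subseteq> fib (\<lambda>\<rho>. c \<rho> + d \<rho>)"
      unfolding set_mult_def fib_def by (auto simp: phi_add FA_add simp del: carrier_free_Abelian_group_iff)
    show "fib (\<lambda>\<rho>. c \<rho> + d \<rho>) \<subseteq> fib c <#>\<^bsub>FA\<^esub> fib d"
    proof
      fix y assume y: "y \<in> fib (\<lambda>\<rho>. c \<rho> + d \<rho>)"
      then have "y - can c \<in> fib d"
        using FA_diff[OF _ can_FA, of y c] phi_can[OF assms(1)] by (simp add: fib_def phi_diff del: carrier_free_Abelian_group_iff)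
      moreover have "y = can c + (y - can c)" by simp
      ultimately show "y \<in> fib c <#>\<^bsub>FA\<^esub> fib d"
        unfolding set_mult_def mult_free_Abelian_group using fib_can[OF assms(1)] by blast
    qed
  qed
  finally show ?thesis .
qed

text \<open>The union in the definition of the action runs over all representatives. Every term is
  the same coset, since \<open>phi\<close> of the transformed representative depends only on
  \<open>phi\<close> of the original one.\<close>

lemma NN_smult:
  assumes r: "r \<in> DD" and c: "c \<in> Fn"
  shows "r \<odot>\<^bsub>NN\<^esub> fib c = fib (R r c)"
proof -
  let ?e = "frag_extend (\<lambda>(s, m). frag_of (r *h s, m))"
  have e: "?e x \<in> carrier FA \<and> phi (?e x) = R r (phi x)" if "x \<in> carrier FA" for x
  proof -
    have "Poly_Mapping.keys x \<subseteq> DD \<times> UNIV" using that by (simp only: FA_iff)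
    then have "x \<in> carrier FA \<and> ?e x \<in> carrier FA \<and> phi (?e x) = R r (phi x)"
    proof (induction x rule: frag_induction)
      case zero
      have "R r (\<lambda>\<rho>. 0) = (\<lambda>\<rho>. 0)"
        using rho_linear[OF DD_closed[OF r] vac_Fn vac_Fn, of 0 0] by simp
      then show ?case by (simp add: phi_zero)
    next
      case (one p)
      obtain s m where p: "p = (s, m)" "s \<in> DD" using one by (cases p) auto
      have "R r (\<lambda>\<rho>. m * R s vac \<rho> + 0 * vac \<rho>) = (\<lambda>\<rho>. m * R r (R s vac) \<rho> + 0 * R r vac \<rho>)"
        by (rule rho_linear[OF DD_closed[OF r] rho_Fn[OF DD_closed[OF p(2)] vac_Fn] vac_Fn])
      then show ?case
        using p r subringE(6)[OF subring_H_D r p(2)]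
        by (simp add: phi_frag_of rho_mult DD_closed vac_Fn)
    next
      case (diff x y)
      then have xy: "x \<in> carrier FA" "y \<in> carrier FA" by auto
      have "phi (x - y) = (\<lambda>\<rho>. 1 * phi x \<rho> + (-1) * phi y \<rho>)" by (simp add: phi_diff)
      then have "R r (phi (x - y)) = (\<lambda>\<rho>. R r (phi x) \<rho> - R r (phi y) \<rho>)"
        using rho_linear[OF DD_closed[OF r] phi_Fn[OF xy(1)] phi_Fn[OF xy(2)], of 1 "-1"] by simp
      then show ?case
        using diff by (simp add: frag_extend_diff phi_diff FA_diff del: carrier_free_Abelian_group_iff)
    qed
    then show ?thesis by blast
  qed
  have "r \<odot>\<^bsub>NN\<^esub> fib c = (\<Union>x\<in>fib c. KK #>\<^bsub>FA\<^esub> ?e x)"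
    by (simp add: NN_def KK_def tensor_module_def Let_def carrier_H_D one_dim_def)
  also have "\<dots> = (\<Union>x\<in>fib c. fib (R r c))"
    by (rule SUP_cong[OF refl]) (use e coset_fib in \<open>simp add: fib_def del: carrier_free_Abelian_group_iff\<close>)
  also have "\<dots> = fib (R r c)" using fib_can[OF c] by auto
  finally show ?thesis .
qed

lemma Fn_minus: "c \<in> Fn \<Longrightarrow> (\<lambda>\<rho>. - c \<rho>) \<in> Fn"
  by (simp add: Fn_def)

lemma NN_abelian: "abelian_group NN"
proof (rule abelian_groupI)
  fix x y assume "x \<in> carrier NN" "y \<in> carrier NN"
  then obtain c d where 1: "x = fib c" "c \<in> Fn" "y = fib d" "d \<in> Fn" unfolding NN_carrier by auto
  show "x \<oplus>\<^bsub>NN\<^esub> y \<in> carrier NN" using 1 by (simp add: NN_add NN_carrier Fn_add)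
  show "x \<oplus>\<^bsub>NN\<^esub> y = y \<oplus>\<^bsub>NN\<^esub> x" using 1 by (simp add: NN_add add.commute)
  fix z assume "z \<in> carrier NN"
  then obtain e where 2: "z = fib e" "e \<in> Fn" unfolding NN_carrier by auto
  show "x \<oplus>\<^bsub>NN\<^esub> y \<oplus>\<^bsub>NN\<^esub> z = x \<oplus>\<^bsub>NN\<^esub> (y \<oplus>\<^bsub>NN\<^esub> z)" using 1 2 by (simp add: NN_add Fn_add add.assoc)
next
  show "\<zero>\<^bsub>NN\<^esub> \<in> carrier NN" unfolding NN_zero NN_carrier using Fn_zero by blast
  fix x assume "x \<in> carrier NN"
  then obtain c where 1: "x = fib c" "c \<in> Fn" unfolding NN_carrier by auto
  show "\<zero>\<^bsub>NN\<^esub> \<oplus>\<^bsub>NN\<^esub> x = x" unfolding NN_zero 1(1) using 1(2) by (simp add: NN_add Fn_zero)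
  show "\<exists>y\<in>carrier NN. y \<oplus>\<^bsub>NN\<^esub> x = \<zero>\<^bsub>NN\<^esub>"
    unfolding NN_zero 1(1) NN_carrier using 1(2) by (intro bexI[of _ "fib (\<lambda>\<rho>. - c \<rho>)"]) (simp_all add: NN_add Fn_minus)
qed

lemma NN_module: "left_module (H_D n k) NN"
proof -
  have D: "a *h b \<in> DD" "a +h b \<in> DD" if "a \<in> DD" "b \<in> DD" for a b
    using that subringE(6)[OF subring_H_D] DD.add by auto
  have "left_module_axioms (H_D n k) NN"
  proof
    fix a x assume a: "a \<in> carrier (H_D n k)" and "x \<in> carrier NN"
    then obtain c where c: "x = fib c" "c \<in> Fn" unfolding NN_carrier by auto
    have aD: "a \<in> DD" using a carrier_H_D by simp
    note Rc = rho_Fn[OF DD_closed[OF aD] c(2)]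
    show "a \<odot>\<^bsub>NN\<^esub> x \<in> carrier NN" using c Rc by (simp add: NN_smult[OF aD] NN_carrier)
    { fix y assume "y \<in> carrier NN"
      then obtain d where d: "y = fib d" "d \<in> Fn" unfolding NN_carrier by auto
      have l: "R a (\<lambda>\<rho>. c \<rho> + d \<rho>) = (\<lambda>\<rho>. R a c \<rho> + R a d \<rho>)"
        using rho_linear[OF DD_closed[OF aD] c(2) d(2), of 1 1] by simp
      show "a \<odot>\<^bsub>NN\<^esub> (x \<oplus>\<^bsub>NN\<^esub> y) = (a \<odot>\<^bsub>NN\<^esub> x) \<oplus>\<^bsub>NN\<^esub> (a \<odot>\<^bsub>NN\<^esub> y)"
        using c d Rc rho_Fn[OF DD_closed[OF aD] d(2)] by (simp add: NN_add NN_smult[OF aD] Fn_add l) }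
    fix b assume b: "b \<in> carrier (H_D n k)"
    have bD: "b \<in> DD" using b carrier_H_D by simp
    note Rbc = rho_Fn[OF DD_closed[OF bD] c(2)]
    show "(a \<oplus>\<^bsub>H_D n k\<^esub> b) \<odot>\<^bsub>NN\<^esub> x = (a \<odot>\<^bsub>NN\<^esub> x) \<oplus>\<^bsub>NN\<^esub> (b \<odot>\<^bsub>NN\<^esub> x)"
      using c Rc Rbc by (simp add: NN_smult aD bD D NN_add rho_add DD_closed)
    show "(a \<otimes>\<^bsub>H_D n k\<^esub> b) \<odot>\<^bsub>NN\<^esub> x = a \<odot>\<^bsub>NN\<^esub> (b \<odot>\<^bsub>NN\<^esub> x)"
      using c Rbc by (simp add: NN_smult aD bD D rho_mult DD_closed)
  next
    fix x assume "x \<in> carrier NN"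
    then obtain c where c: "x = fib c" "c \<in> Fn" unfolding NN_carrier by auto
    show "\<one>\<^bsub>H_D n k\<^esub> \<odot>\<^bsub>NN\<^esub> x = x"
      using c by (simp add: NN_smult DD_AA AA_one rho_one)
  qed
  then show ?thesis
    by (rule left_module.intro[OF ring_H_D NN_abelian])
qed

lemma NN_minus: "c \<in> Fn \<Longrightarrow> inv\<^bsub>add_monoid NN\<^esub> (fib c) = fib (\<lambda>\<rho>. - c \<rho>)"
  using abelian_group.minus_equality[OF NN_abelian, of "fib (\<lambda>\<rho>. - c \<rho>)" "fib c"]
  by (simp add: NN_add Fn_minus NN_carrier NN_zero a_inv_def)

section \<open>Submodules of the induced module as stable subspaces\<close>

lemma Xop_truncate: "\<exists>u\<in>VC n. \<forall>f. Xop \<gamma> \<mu> a f = Xop \<gamma> \<mu> u f"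
proof (rule bexI[of _ "\<lambda>j. if j \<in> {1..n} then a j else 0"])
  show "\<forall>f. Xop \<gamma> \<mu> a f = Xop \<gamma> \<mu> (\<lambda>j. if j \<in> {1..n} then a j else 0) f"
    by (intro allI Xop_cong) simp
qed (simp add: VC_def)

text \<open>For p = q the operator is the identity, as signs square to 1; otherwise the product of
  the two reflections lies in U.\<close>

lemma Dop_DD:
  assumes "p \<in> {1..n}" "q \<in> {1..n}"
  shows "\<exists>x\<in>DD. \<forall>f\<in>Fn. R x f = Dop \<mu> p q f"
proof (cases "p = q")
  case True
  have "R \<one>\<^bsub>H\<^esub> f = Dop \<mu> p q f" if "f \<in> Fn" for f
    unfolding rho_one[OF that] Dop_def True by (simp add: sgn)
  then show ?thesis using DD_AA[OF AA_one] by blast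
next
  case False
  let ?s = "\<lambda>l. flip p l * flip q l"
  have s: "?s \<in> signs n" using assms by (intro signs_mult signs_flip)
  have "(\<Prod>j\<in>{1..n}. flip p j * flip q j) = 1"
    unfolding prod.distrib prod_flip[OF assms(1)] prod_flip[OF assms(2)] by simp
  then have U: "sp ?s id \<in> U_D n" unfolding U_D_eq using s by blast
  have m: "msign \<mu> ?s \<rho> = \<mu> (\<rho> p) * \<mu> (\<rho> q)" for \<rho>
    unfolding msign_mult[OF sgn signs_flip[OF assms(1)] signs_flip[OF assms(2)]]
    by (simp only: msign_flip[OF assms(1)] msign_flip[OF assms(2)])
  have "R (t (sp ?s id)) f = Dop \<mu> p q f" if "f \<in> Fn" for f
    unfolding rho_t[OF U_W[OF U] that] Wop_sp[OF s permutes_id] m Dop_def by simp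
  then show ?thesis using DD_AA[OF AA_t[OF U]] by blast
qed

text \<open>Stability asks for products of two signs, while an element of U carries an arbitrary
  even sign vector. Induction over the generators of U bridges the gap, and \<open>sp_inject\<close>
  recovers the sign vector at the end.\<close>

lemma stable_msign:
  assumes L: "stable \<gamma> \<mu> L" and s: "s \<in> signs n" "(\<Prod>j\<in>{1..n}. s j) = 1" and f: "f \<in> L"
  shows "(\<lambda>\<rho>. msign \<mu> s \<rho> * f \<rho>) \<in> L"
proof -
  let ?P = "\<lambda>x. \<exists>s. s \<in> signs n \<and> x = sp s id \<and> (\<forall>f\<in>L. (\<lambda>\<rho>. msign \<mu> s \<rho> * f \<rho>) \<in> L)"
  have "sp s id \<in> U_D n" unfolding U_D_eq using s by blast
  then have "sp s id \<in> group_gen {sp (\<lambda>l. flip i l * flip (i + 1) l) id | i. 1 \<le> i \<and> i < n}"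
    by (simp only: U_D_def U_gen_eq)
  then have "?P (sp s id)"
  proof (induction rule: group_gen_induct)
    case (involution x)
    then show ?case by (rule U_gens_involution)
  next
    case id
    have "?P id" using sp_id by (intro exI[of _ sone]) (simp add: msign_one)
    then show ?case .
  next
    case (incl x)
    then obtain i where i: "x = sp (\<lambda>l. flip i l * flip (i + 1) l) id" "1 \<le> i" "i < n" by blast
    have ii: "i \<in> {1..n}" "i + 1 \<in> {1..n}" using i by auto
    have "msign \<mu> (\<lambda>l. flip i l * flip (i + 1) l) \<rho> = \<mu> (\<rho> i) * \<mu> (\<rho> (i + 1))" for \<rho>
      unfolding msign_mult[OF sgn signs_flip[OF ii(1)] signs_flip[OF ii(2)]]
      by (simp only: msign_flip[OF ii(1)] msign_flip[OF ii(2)])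
    then have "(\<lambda>\<rho>. msign \<mu> (\<lambda>l. flip i l * flip (i + 1) l) \<rho> * f \<rho>) \<in> L" if "f \<in> L" for f
      using stableD(7)[OF L that ii] by (simp add: Dop_def)
    then show ?case using i flip_adj_signs[OF i(2,3)] by blast
  next
    case (comp x y)
    then obtain s s' where *: "s \<in> signs n" "x = sp s id" "\<forall>f\<in>L. (\<lambda>\<rho>. msign \<mu> s \<rho> * f \<rho>) \<in> L"
      "s' \<in> signs n" "y = sp s' id" "\<forall>f\<in>L. (\<lambda>\<rho>. msign \<mu> s' \<rho> * f \<rho>) \<in> L" by blast
    have "(\<lambda>\<rho>. msign \<mu> (\<lambda>l. s l * s' l) \<rho> * f \<rho>) \<in> L" if "f \<in> L" for f
    proof -
      have "(\<lambda>\<rho>. msign \<mu> s' \<rho> * f \<rho>) \<in> L" using *(6) that by blast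
      from bspec[OF *(3) this]
      have "(\<lambda>\<rho>. msign \<mu> s \<rho> * (msign \<mu> s' \<rho> * f \<rho>)) \<in> L" .
      then show ?thesis unfolding msign_mult[OF sgn *(1,4)] by (simp only: mult.assoc)
    qed
    moreover have "x \<circ> y = sp (\<lambda>l. s l * s' l) id" by (simp only: *(2,5) sp_torus_comp)
    ultimately have "?P (x \<circ> y)" using signs_mult[OF *(1,4)] by blast
    then show ?case .
  qed
  then obtain s' where s': "s' \<in> signs n" "sp s id = sp s' id" "\<forall>f\<in>L. (\<lambda>\<rho>. msign \<mu> s' \<rho> * f \<rho>) \<in> L" by blast
  have "s = s'" by (rule sp_inject(1)[OF s(1) s'(1) bij_id bij_id s'(2)])
  then show ?thesis using s'(3) f by blast
qed

lemma stable_AA: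
  assumes L: "stable \<gamma> \<mu> L" and "a \<in> AA" "f \<in> L"
  shows "R a f \<in> L"
proof -
  note S = stableD[OF L]
  have LF: "f \<in> Fn" if "f \<in> L" for f using S(1) that by auto
  have "a \<in> generate_ring H (range Sc \<union> V ` VC n \<union> t ` U_D n)" using assms(2) by (simp add: AA_def)
  then have "\<forall>f\<in>L. R a f \<in> L"
  proof (induction rule: generate_ring.induct)
    case one
    show ?case using LF by (simp add: rho_one)
  next
    case (incl h)
    then consider (sc) c where "h = Sc c" | (vec) u where "h = V u" "u \<in> VC n" | (t) x where "h = t x" "x \<in> U_D n"
      by auto
    then show ?case
    proof cases
      case sc
      then show ?thesis using LF S(4) by (simp add: rho_Sc)
    next
      case vec
      then show ?thesis using LF S(5) by (simp add: rho_V)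
    next
      case t
      obtain s where s: "x = sp s id" "s \<in> signs n" "(\<Prod>j\<in>{1..n}. s j) = 1" using t(2) unfolding U_D_eq by blast
      have "R h f = (\<lambda>\<rho>. msign \<mu> s \<rho> * f \<rho>)" if "f \<in> L" for f
        unfolding t(1) rho_t[OF U_W[OF t(2)] LF[OF that]] unfolding s(1) Wop_sp[OF s(2) permutes_id] by simp
      then show ?thesis using stable_msign[OF L s(2,3)] by simp
    qed
  next
    case (a_inv h)
    have h: "h \<in> carrier H" using a_inv(1) AA_closed by (simp add: AA_def)
    show ?case
    proof
      fix f assume f: "f \<in> L"
      have "(\<lambda>\<rho>. (-1) * R h f \<rho>) \<in> L" using S(4) a_inv(2) f by blast
      then show "R (\<ominus>\<^bsub>H\<^esub> h) f \<in> L" using rho_minus[OF h LF[OF f]] by simp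
    qed
  next
    case (eng_add h1 h2)
    have h: "h1 \<in> carrier H" "h2 \<in> carrier H" using eng_add(1,2) AA_closed by (simp_all add: AA_def)
    show ?case using eng_add(3,4) LF S(3) by (simp add: rho_add[OF h])
  next
    case (eng_mult h1 h2)
    have h: "h1 \<in> carrier H" "h2 \<in> carrier H" using eng_mult(1,2) AA_closed by (simp_all add: AA_def)
    show ?case using eng_mult(3,4) LF by (simp add: rho_mult[OF h])
  qed
  then show ?thesis using assms(3) by blast
qed

lemma stable_DD:
  assumes L: "stable \<gamma> \<mu> L" and "x \<in> DD" and f: "f \<in> L"
  shows "R x f \<in> L"
  using assms(2)
proof (induction rule: DD.induct)
  case (base \<pi> a)
  have fF: "f \<in> Fn" using stableD(1)[OF L] f by auto
  have "R (t (sp sone \<pi>) *h a) f = Tr \<pi> (R a f)"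
    using rho_mult[OF t_closed[OF sp_one_W[OF base(1)]] AA_closed[OF base(2)] fF]
      R_t[OF base(1) rho_Fn[OF AA_closed[OF base(2)] fF]] by simp
  then show ?case using stableD(6)[OF L stable_AA[OF L base(2) f] base(1)] by simp
next
  case (add x y)
  have fF: "f \<in> Fn" using stableD(1)[OF L] f by auto
  show ?case using rho_add[OF DD_closed[OF add(1)] DD_closed[OF add(2)] fF] stableD(3)[OF L add(3,4)] by simp
qed

lemma submodule_of_stable:
  assumes L: "stable \<gamma> \<mu> L"
  shows "submodule (fib ` L) (H_D n k) NN"
proof -
  note S = stableD[OF L]
  have LF: "f \<in> Fn" if "f \<in> L" for f using S(1) that by auto
  have neg: "(\<lambda>\<rho>. - c \<rho>) \<in> L" if "c \<in> L" for c using S(4)[OF that, of "-1"] by simp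
  have "subgroup (fib ` L) (add_monoid NN)"
  proof
    show "fib ` L \<subseteq> carrier (add_monoid NN)" using LF by (auto simp: NN_carrier)
    show "x \<otimes>\<^bsub>add_monoid NN\<^esub> y \<in> fib ` L" if "x \<in> fib ` L" "y \<in> fib ` L" for x y
      using that S(3) LF by (auto simp: NN_add)
    show "\<one>\<^bsub>add_monoid NN\<^esub> \<in> fib ` L" using S(2) by (simp add: NN_zero)
    show "inv\<^bsub>add_monoid NN\<^esub> x \<in> fib ` L" if "x \<in> fib ` L" for x
      using that neg LF by (auto simp: NN_minus)
  qed
  moreover have "submodule_axioms (fib ` L) (H_D n k) NN"
  proof
    fix a x assume a: "a \<in> carrier (H_D n k)" and "x \<in> fib ` L"
    then obtain c where c: "c \<in> L" "x = fib c" by auto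
    have aD: "a \<in> DD" using a carrier_H_D by simp
    show "a \<odot>\<^bsub>NN\<^esub> x \<in> fib ` L"
      unfolding c(2) NN_smult[OF aD LF[OF c(1)]] using stable_DD[OF L aD c(1)] by blast
  qed
  ultimately show ?thesis by (rule submodule.intro)
qed

lemma stable_of_submodule:
  assumes "submodule N (H_D n k) NN"
  shows "stable \<gamma> \<mu> {c \<in> Fn. fib c \<in> N}" "N = fib ` {c \<in> Fn. fib c \<in> N}"
proof -
  interpret N: submodule N "H_D n k" NN by fact
  have add: "fib c \<oplus>\<^bsub>NN\<^esub> fib d \<in> N" if "fib c \<in> N" "fib d \<in> N" for c d using N.m_closed that by simp
  have act: "fib (R x c) \<in> N" if "x \<in> DD" "c \<in> Fn" "fib c \<in> N" for x c
    using N.smult_closed[of x "fib c"] that carrier_H_D NN_smult by simp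
  show "stable \<gamma> \<mu> {c \<in> Fn. fib c \<in> N}"
    unfolding stable_def
  proof (intro conjI ballI allI impI)
    show "(\<lambda>\<rho>. 0) \<in> {c \<in> Fn. fib c \<in> N}" using N.one_closed Fn_zero by (simp add: NN_zero)
    fix f assume "f \<in> {c \<in> Fn. fib c \<in> N}"
    then have f: "f \<in> Fn" "fib f \<in> N" by auto
    show "(\<lambda>\<rho>. f \<rho> + g \<rho>) \<in> {c \<in> Fn. fib c \<in> N}" if "g \<in> {c \<in> Fn. fib c \<in> N}" for g
      using add[OF f(2), of g] that f by (simp add: NN_add Fn_add)
    show "(\<lambda>\<rho>. c * f \<rho>) \<in> {c \<in> Fn. fib c \<in> N}" for c
      using act[OF DD_AA[OF AA_Sc] f, of c] f(1) by (simp add: rho_Sc Fn_scale)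
    show "Xop \<gamma> \<mu> a f \<in> {c \<in> Fn. fib c \<in> N}" for a
    proof -
      obtain u where u: "u \<in> VC n" "\<forall>f. Xop \<gamma> \<mu> a f = Xop \<gamma> \<mu> u f" using Xop_truncate by blast
      show ?thesis using act[OF DD_AA[OF AA_V[OF u(1)]] f] f(1) u by (simp add: rho_V Xop_Fn)
    qed
    show "Tr g f \<in> {c \<in> Fn. fib c \<in> N}" if "g permutes {1..n}" for g
      using act[OF t_DD[OF that] f] f(1) that by (simp add: R_t Tr_Fn)
    show "Dop \<mu> p q f \<in> {c \<in> Fn. fib c \<in> N}" if pq: "p \<in> {1..n}" "q \<in> {1..n}" for p q
    proof -
      obtain x where "x \<in> DD" "\<forall>f\<in>Fn. R x f = Dop \<mu> p q f" using Dop_DD[OF pq] by blast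
      then show ?thesis using act[of x f] f by (simp add: Dop_Fn)
    qed
  qed auto
  show "N = fib ` {c \<in> Fn. fib c \<in> N}" using N.subset by (auto simp: NN_carrier)
qed

text \<open>The bijection \<open>fib\<close> matches stable subspaces with submodules in both
  directions. Simplicity also asks for a nonzero module, which \<open>vac\<close> provides.\<close>

theorem simple_NN_iff: "simple_module (H_D n k) NN \<longleftrightarrow> irred \<gamma> \<mu>"
proof
  assume s: "simple_module (H_D n k) NN"
  show "irred \<gamma> \<mu>"
    unfolding irred_def
  proof (intro allI impI)
    fix L assume L: "stable \<gamma> \<mu> L"
    have LF: "f \<in> Fn" if "f \<in> L" for f using stableD(1)[OF L] that by auto
    have "fib ` L = {\<zero>\<^bsub>NN\<^esub>} \<or> fib ` L = carrier NN"
      using s submodule_of_stable[OF L] by (auto simp: simple_module_def)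
    then show "L = {\<lambda>\<rho>. 0} \<or> L = Fn"
    proof
      assume z: "fib ` L = {\<zero>\<^bsub>NN\<^esub>}"
      have "c = (\<lambda>\<rho>. 0)" if "c \<in> L" for c
      proof -
        have "fib c \<in> fib ` L" using that by (rule imageI)
        then have "fib c = fib (\<lambda>\<rho>. 0)" unfolding z NN_zero by simp
        then show ?thesis by (rule fib_inj[OF LF[OF that]])
      qed
      then have "L \<subseteq> {\<lambda>\<rho>. 0}" by (intro subsetI) simp
      then have "L = {\<lambda>\<rho>. 0}" using stableD(2)[OF L] by (intro equalityI) simp_all
      then show ?thesis ..
    next
      assume c: "fib ` L = carrier NN"
      have "c \<in> L" if "c \<in> Fn" for c
      proof -
        have "fib c \<in> fib ` L" unfolding c NN_carrier using that by blast
        then obtain d where "d \<in> L" "fib c = fib d" by auto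
        then show ?thesis using fib_inj[OF that, of d] by simp
      qed
      then have "L = Fn" using LF by (intro equalityI subsetI)
      then show ?thesis ..
    qed
  qed
next
  assume irr: "irred \<gamma> \<mu>"
  have "fib vac \<noteq> \<zero>\<^bsub>NN\<^esub>"
  proof
    assume "fib vac = \<zero>\<^bsub>NN\<^esub>"
    then have "vac = (\<lambda>\<rho>. 0)" using fib_inj[OF vac_Fn] by (simp add: NN_zero)
    from fun_cong[OF this, of id] show False by (simp add: vac_def)
  qed
  moreover have "fib vac \<in> carrier NN" unfolding NN_carrier by (rule imageI[OF vac_Fn])
  ultimately have "carrier NN \<noteq> {\<zero>\<^bsub>NN\<^esub>}" by auto
  moreover have "N = {\<zero>\<^bsub>NN\<^esub>} \<or> N = carrier NN" if N: "submodule N (H_D n k) NN" for N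
  proof -
    let ?L = "{c \<in> Fn. fib c \<in> N}"
    have "?L = {\<lambda>\<rho>. 0} \<or> ?L = Fn"
      using irr stable_of_submodule(1)[OF N] by (simp add: irred_def)
    then have "fib ` ?L = {\<zero>\<^bsub>NN\<^esub>} \<or> fib ` ?L = carrier NN"
    proof
      assume "?L = {\<lambda>\<rho>. 0}"
      then show ?thesis unfolding NN_zero by (simp only: image_insert image_empty simp_thms)
    next
      assume "?L = Fn"
      then show ?thesis unfolding NN_carrier by (simp only: simp_thms)
    qed
    then show ?thesis by (simp only: stable_of_submodule(2)[OF N, symmetric])
  qed
  ultimately show "simple_module (H_D n k) NN" using NN_module by (simp add: simple_module_def)
qed

end

section \<open>Stabilisers and the combinatorial data\<close>

definition ceps :: "nat \<Rightarrow> cvec" where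
  "ceps j = complexify (eps j)"

lemma ceps_apply: "ceps j l = (if l = j then 1 else 0)"
  by (simp add: ceps_def complexify_def eps_def)

section \<open>Coordinates of linear forms and of their translates\<close>

lemma dual_expand:
  assumes \<Gamma>: "\<Gamma> \<in> dualVC n" and u: "u \<in> VC n"
  shows "\<Gamma> u = (\<Sum>j\<in>{1..n}. u j * \<Gamma> (ceps j))"
proof -
  have lin: "\<Gamma> (\<lambda>l. a * v l + b * w l) = a * \<Gamma> v + b * \<Gamma> w" if "v \<in> VC n" "w \<in> VC n" for a b v w
    using \<Gamma> that unfolding dualVC_def by blast
  have c: "ceps j \<in> VC n" if "j \<in> {1..n}" for j using that by (auto simp: VC_def ceps_apply)
  have "\<Gamma> (\<lambda>l. if l \<in> A then u l else 0) = (\<Sum>j\<in>A. u j * \<Gamma> (ceps j))" if "A \<subseteq> {1..n}" for A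
    using finite_subset[OF that finite_atLeastAtMost] that
  proof (induction A rule: finite_induct)
    case empty
    have "\<Gamma> (\<lambda>l. 0 * u l + 0 * u l) = 0 * \<Gamma> u + 0 * \<Gamma> u" by (rule lin[OF u u])
    then show ?case by simp
  next
    case (insert j A)
    have v: "(\<lambda>l. if l \<in> A then u l else 0) \<in> VC n" using u by (simp add: VC_def)
    have "(\<lambda>l. if l \<in> insert j A then u l else 0) = (\<lambda>l. u j * ceps j l + 1 * (if l \<in> A then u l else 0))"
      using insert(2) by (auto simp: fun_eq_iff ceps_apply)
    then have "\<Gamma> (\<lambda>l. if l \<in> insert j A then u l else 0) = u j * \<Gamma> (ceps j) + 1 * \<Gamma> (\<lambda>l. if l \<in> A then u l else 0)"
      using lin[OF c v, of j "u j" 1] insert.prems by simp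
    then show ?case using insert by simp
  qed
  from this[OF subset_refl] have "\<Gamma> (\<lambda>l. if l \<in> {1..n} then u l else 0) = (\<Sum>j\<in>{1..n}. u j * \<Gamma> (ceps j))" .
  moreover have "(\<lambda>l. if l \<in> {1..n} then u l else 0) = u" using u by (auto simp: VC_def fun_eq_iff)
  ultimately show ?thesis by simp
qed

lemma sp_one_inverse:
  assumes "\<pi> permutes A"
  shows "inv_into UNIV (sp sone \<pi>) = sp sone (inv_into UNIV \<pi>)"
proof (rule inv_unique_comp)
  show "sp sone \<pi> \<circ> sp sone (inv_into UNIV \<pi>) = id"
    unfolding sp_one_comp[OF assms permutes_inv[OF assms]] permutes_inv_o(1)[OF assms] by (rule sp_id)
  show "sp sone (inv_into UNIV \<pi>) \<circ> sp sone \<pi> = id"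
    unfolding sp_one_comp[OF permutes_inv[OF assms] assms] permutes_inv_o(2)[OF assms] by (rule sp_id)
qed

lemma extendC_sp: "extendC (sp sone \<pi>) v = v \<circ> inv_into UNIV \<pi>"
  by (simp add: extendC_def sp_def fun_eq_iff complex_eq_iff)

lemma act_dual_expand:
  assumes \<pi>: "\<pi> permutes {1..n}"
    and \<Gamma>: "\<And>u. u \<in> VC n \<Longrightarrow> \<Gamma> u = (\<Sum>j\<in>{1..n}. u j * g j)" and u: "u \<in> VC n"
  shows "act_dual n (sp sone \<pi>) \<Gamma> u = (\<Sum>j\<in>{1..n}. u j * g (inv_into UNIV \<pi> j))"
proof -
  have e: "extendC (inv_into UNIV (sp sone \<pi>)) u = u \<circ> \<pi>"
    unfolding sp_one_inverse[OF \<pi>] extendC_sp inv_inv_eq[OF permutes_bij[OF \<pi>]] ..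
  have "act_dual n (sp sone \<pi>) \<Gamma> u = (\<Sum>j\<in>{1..n}. u (\<pi> j) * g j)"
    using \<Gamma>[OF VC_perm[OF u \<pi>]] u by (simp add: act_dual_def e)
  also have "\<dots> = (\<Sum>j\<in>{1..n}. u j * g (inv_into UNIV \<pi> j))"
    by (rule sum.reindex_bij_witness[of _ "inv_into UNIV \<pi>" \<pi>])
       (use permutes_in_image[OF \<pi>] permutes_in_image[OF permutes_inv[OF \<pi>]] permutes_inverses[OF \<pi>] in auto)
  finally show ?thesis .
qed

lemma sum_ceps: "p \<in> {1..n} \<Longrightarrow> (\<Sum>j\<in>{1..n}. ceps p j * g j) = (g p :: complex)"
proof -
  assume "p \<in> {1..n}"
  moreover have "(\<Sum>j\<in>{1..n}. ceps p j * g j) = (\<Sum>j\<in>{1..n}. if j = p then g j else 0)"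
    by (rule sum.cong) (auto simp: ceps_apply)
  ultimately show ?thesis by simp
qed

lemma sum_complexify_rootA:
  assumes "p \<in> {1..n}" "q \<in> {1..n}"
  shows "(\<Sum>j\<in>{1..n}. complexify (rootA p q) j * g j) = g p - (g q :: complex)"
proof -
  have "complexify (rootA p q) j * g j = ceps p j * g j - ceps q j * g j" for j
    by (simp add: ceps_def complexify_def rootA_def left_diff_distrib)
  then show ?thesis using sum_ceps[OF assms(1), of g] sum_ceps[OF assms(2), of g] by (simp add: sum_subtractf)
qed

section \<open>The sign vector of a character of T and its stabilisers\<close>

context hecke_algebra
begin

context
  fixes \<mu> :: "endo \<Rightarrow> complex"
  assumes \<mu>: "\<mu> \<in> char_group (T_B n)"
begin

text \<open>Extended by 1 outside the index range so that every value is a sign, as the locale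
  \<open>hecke_rep\<close> demands.\<close>

definition mu :: "nat \<Rightarrow> complex" where
  "mu j = (if j \<in> {1..n} then \<mu> (reflect n (eps j)) else 1)"

lemma char_mult: "x \<in> T_B n \<Longrightarrow> y \<in> T_B n \<Longrightarrow> \<mu> (x \<circ> y) = \<mu> x * \<mu> y"
  using \<mu> unfolding char_group_def by blast

lemma char_nonzero: "x \<in> T_B n \<Longrightarrow> \<mu> x \<noteq> 0"
  using \<mu> unfolding char_group_def by (auto simp: PiE_def Pi_def)

lemma id_T: "id \<in> T_B n"
  unfolding T_B_def Weyl_def by (rule group_gen_id)

lemma char_id: "\<mu> id = 1"
proof -
  have "\<mu> id * \<mu> id = \<mu> id * 1" using char_mult[OF id_T id_T] by (simp only: comp_id mult_1_right)
  then show ?thesis using char_nonzero[OF id_T] by (simp only: mult_cancel_left) simp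
qed

lemma mu_flip: "j \<in> {1..n} \<Longrightarrow> mu j = \<mu> (sp (flip j) id)"
  by (simp add: mu_def reflect_eps)

lemma mu_sq: "mu j * mu j = 1"
proof (cases "j \<in> {1..n}")
  case True
  have "mu j * mu j = \<mu> (sp (flip j) id \<circ> sp (flip j) id)"
    unfolding mu_flip[OF True] using char_mult[OF T_B_flip[OF True] T_B_flip[OF True]] by simp
  then show ?thesis using sp_torus_involution[of "flip j", OF flip_sq] char_id by simp
next
  case False
  then have "mu j = 1" by (simp only: mu_def if_False)
  then show ?thesis by simp
qed

lemma mu_pm: "mu j = 1 \<or> mu j = -1"
  using mu_sq[of j] by (simp add: square_eq_1_iff)

lemma char_sp:
  assumes s: "s \<in> signs n"
  shows "\<mu> (sp s id) = msign mu s id"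
proof -
  have "\<mu> (sp (\<lambda>l. if l \<in> A then s l else 1) id) = (\<Prod>j\<in>A. if s j = -1 then mu j else 1)" if "A \<subseteq> {1..n}" for A
    using finite_subset[OF that finite_atLeastAtMost] that
  proof (induction A rule: finite_induct)
    case empty
    have "\<mu> (sp sone id) = 1" unfolding sp_id by (rule char_id)
    then show ?case by (simp only: empty_iff if_False prod.empty)
  next
    case (insert j A)
    have j: "j \<in> {1..n}" using insert.prems by auto
    have IH: "\<mu> (sp (\<lambda>l. if l \<in> A then s l else 1) id) = (\<Prod>j\<in>A. if s j = -1 then mu j else 1)"
      by (rule insert.IH) (use insert.prems in blast)
    have step: "(\<Prod>j\<in>insert j A. if s j = -1 then mu j else 1) = (if s j = -1 then mu j else 1) * (\<Prod>j\<in>A. if s j = -1 then mu j else 1)"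
      by (rule prod.insert[OF insert.hyps])
    have sA: "(\<lambda>l. if l \<in> A then s l else 1) \<in> signs n" using s by (auto simp: signs_def)
    then have TA: "sp (\<lambda>l. if l \<in> A then s l else 1) id \<in> T_B n" unfolding T_B_eq by blast
    show ?case
    proof (cases "s j = -1")
      case True
      have e: "(\<lambda>l. if l \<in> insert j A then s l else 1) = (\<lambda>l. flip j l * (if l \<in> A then s l else 1))"
        using True insert(2) by (auto simp: fun_eq_iff flip_def)
      have "\<mu> (sp (\<lambda>l. if l \<in> insert j A then s l else 1) id) = mu j * \<mu> (sp (\<lambda>l. if l \<in> A then s l else 1) id)"
        unfolding e sp_torus_comp[symmetric] mu_flip[OF j] by (rule char_mult[OF T_B_flip[OF j] TA])
      then show ?thesis unfolding IH step if_P[OF True] .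
    next
      case False
      then have "s j = 1" using s by (auto simp: signs_def)
      then have e: "(\<lambda>l. if l \<in> insert j A then s l else 1) = (\<lambda>l. if l \<in> A then s l else 1)"
        by (auto simp: fun_eq_iff)
      show ?thesis unfolding e IH step if_not_P[OF False] by (simp only: mult_1_left)
    qed
  qed
  from this[OF subset_refl] have "\<mu> (sp (\<lambda>l. if l \<in> {1..n} then s l else 1) id) = (\<Prod>j\<in>{1..n}. if s j = -1 then mu j else 1)" .
  moreover have "(\<lambda>l. if l \<in> {1..n} then s l else 1) = s" using s by (auto simp: signs_def fun_eq_iff)
  ultimately show ?thesis unfolding msign_def id_apply by simp
qed

text \<open>The parameter \<open>c\<close> lets one computation serve two groups: with
  \<open>c s\<close> the product of the signs of \<open>s\<close> it covers T, with the constant 1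
  it covers U.\<close>

lemma act_char_sp:
  assumes \<pi>: "\<pi> permutes {1..n}" and s: "s \<in> signs n" and G: "sp s id \<in> G"
    and \<chi>: "\<And>s. s \<in> signs n \<Longrightarrow> (\<Prod>j\<in>{1..n}. s j) = c s \<Longrightarrow> \<chi> (sp s id) = msign mu s id"
    and c: "(\<Prod>j\<in>{1..n}. s j) = c s" "c (s \<circ> \<pi>) = c s"
  shows "act_char G (sp sone \<pi>) \<chi> (sp s id) = msign mu s (inv_into UNIV \<pi>)"
proof -
  have sp': "s \<circ> \<pi> \<in> signs n" using signs_perm[OF s \<pi>] by (simp add: comp_def)
  have pp: "(\<Prod>j\<in>{1..n}. (s \<circ> \<pi>) j) = (\<Prod>j\<in>{1..n}. s j)" using prod.permute[OF \<pi>, of s] by simp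
  have "inv_into UNIV (sp sone \<pi>) \<circ> sp s id \<circ> sp sone \<pi> =
      inv_into UNIV (sp sone \<pi>) \<circ> (sp sone \<pi> \<circ> sp (s \<circ> \<pi>) id)"
    unfolding comp_assoc sp_torus_move[OF \<pi>] ..
  also have "\<dots> = sp (s \<circ> \<pi>) id"
  proof -
    have "inv_into UNIV (sp sone \<pi>) \<circ> sp sone \<pi> = id"
      unfolding sp_one_inverse[OF \<pi>] sp_one_comp[OF permutes_inv[OF \<pi>] \<pi>] permutes_inv_o(2)[OF \<pi>] by (rule sp_id)
    then show ?thesis unfolding comp_assoc[symmetric] by (simp only: id_comp)
  qed
  finally have e: "inv_into UNIV (sp sone \<pi>) \<circ> sp s id \<circ> sp sone \<pi> = sp (s \<circ> \<pi>) id" .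
  have "act_char G (sp sone \<pi>) \<chi> (sp s id) = \<chi> (sp (s \<circ> \<pi>) id)"
    unfolding act_char_def restrict_apply'[OF G] e ..
  also have "\<dots> = msign mu (s \<circ> \<pi>) id" by (rule \<chi>[OF sp']) (simp only: pp c)
  also have "\<dots> = msign mu s (inv_into UNIV \<pi>)"
  proof -
    have "(\<lambda>l. s (inv_into UNIV (inv_into UNIV \<pi>) l)) = s \<circ> \<pi>"
      unfolding inv_inv_eq[OF permutes_bij[OF \<pi>]] by (simp add: comp_def)
    then show ?thesis
      using msign_perm[OF permutes_inv[OF \<pi>], of mu s id] by (simp only: id_comp)
  qed
  finally show ?thesis .
qed

lemma T_stab_iff:
  assumes \<pi>: "\<pi> permutes {1..n}"
  shows "sp sone \<pi> \<in> stabA n (T_B n) \<mu> \<longleftrightarrow> (\<forall>j\<in>{1..n}. mu (inv_into UNIV \<pi> j) = mu j)"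
proof -
  have W: "sp sone \<pi> \<in> W_A n" unfolding W_A_eq using \<pi> by blast
  have ext: "\<mu> \<in> extensional (T_B n)" using \<mu> unfolding char_group_def by (auto simp: PiE_def)
  have ac: "act_char (T_B n) (sp sone \<pi>) \<mu> (sp s id) = msign mu s (inv_into UNIV \<pi>)" if s: "s \<in> signs n" for s
  proof (rule act_char_sp[OF \<pi> s, where c = "\<lambda>s. \<Prod>j\<in>{1..n}. s j"])
    show "sp s id \<in> T_B n" unfolding T_B_eq using s by blast
    show "(\<Prod>j\<in>{1..n}. (s \<circ> \<pi>) j) = (\<Prod>j\<in>{1..n}. s j)" using prod.permute[OF \<pi>, of s] by simp
  qed (use char_sp in auto)
  have "act_char (T_B n) (sp sone \<pi>) \<mu> = \<mu> \<longleftrightarrow> (\<forall>s\<in>signs n. msign mu s (inv_into UNIV \<pi>) = msign mu s id)"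
  proof
    assume a: "act_char (T_B n) (sp sone \<pi>) \<mu> = \<mu>"
    show "\<forall>s\<in>signs n. msign mu s (inv_into UNIV \<pi>) = msign mu s id"
    proof
      fix s assume s: "s \<in> signs n"
      show "msign mu s (inv_into UNIV \<pi>) = msign mu s id" using ac[OF s] char_sp[OF s] a by simp
    qed
  next
    assume a: "\<forall>s\<in>signs n. msign mu s (inv_into UNIV \<pi>) = msign mu s id"
    show "act_char (T_B n) (sp sone \<pi>) \<mu> = \<mu>"
    proof (rule extensionalityI[OF _ ext])
      show "act_char (T_B n) (sp sone \<pi>) \<mu> \<in> extensional (T_B n)" by (simp add: act_char_def)
      fix x assume "x \<in> T_B n"
      then obtain s where s: "x = sp s id" "s \<in> signs n" unfolding T_B_eq by blast
      show "act_char (T_B n) (sp sone \<pi>) \<mu> x = \<mu> x"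
        unfolding s(1) ac[OF s(2)] char_sp[OF s(2)] using a s(2) by blast
    qed
  qed
  also have "\<dots> \<longleftrightarrow> (\<forall>j\<in>{1..n}. mu (inv_into UNIV \<pi> j) = mu j)"
  proof
    assume a: "\<forall>s\<in>signs n. msign mu s (inv_into UNIV \<pi>) = msign mu s id"
    show "\<forall>j\<in>{1..n}. mu (inv_into UNIV \<pi> j) = mu j"
    proof
      fix j assume j: "j \<in> {1..n}"
      show "mu (inv_into UNIV \<pi> j) = mu j"
        using bspec[OF a signs_flip[OF j]] unfolding msign_flip[OF j] by simp
    qed
  next
    assume a: "\<forall>j\<in>{1..n}. mu (inv_into UNIV \<pi> j) = mu j"
    then show "\<forall>s\<in>signs n. msign mu s (inv_into UNIV \<pi>) = msign mu s id"
      unfolding msign_def by (intro ballI prod.cong) auto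
  qed
  finally show ?thesis using W by (simp add: stabA_def)
qed

text \<open>On even sign vectors only products of two values of \<open>mu\<close> are visible, so
  fixing the restricted character means fixing \<open>mu\<close> up to one global sign.\<close>

lemma U_stab_iff:
  assumes \<pi>: "\<pi> permutes {1..n}"
  shows "sp sone \<pi> \<in> stabA n (U_D n) (restrict \<mu> (U_D n)) \<longleftrightarrow>
    (\<forall>j\<in>{1..n}. mu (inv_into UNIV \<pi> j) = mu j) \<or> (\<forall>j\<in>{1..n}. mu (inv_into UNIV \<pi> j) = - mu j)"
proof -
  let ?m = "\<lambda>j. mu (inv_into UNIV \<pi> j)"
  let ?S = "{s \<in> signs n. (\<Prod>j\<in>{1..n}. s j) = 1}"
  have W: "sp sone \<pi> \<in> W_A n" unfolding W_A_eq using \<pi> by blast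
  have inU: "sp s id \<in> U_D n" if "s \<in> ?S" for s unfolding U_D_eq using that by blast
  have r: "restrict \<mu> (U_D n) (sp s id) = msign mu s id" if "s \<in> ?S" for s
    unfolding restrict_apply'[OF inU[OF that]] by (rule char_sp) (use that in simp)
  have ac: "act_char (U_D n) (sp sone \<pi>) (restrict \<mu> (U_D n)) (sp s id) = msign mu s (inv_into UNIV \<pi>)" if s: "s \<in> ?S" for s
    by (rule act_char_sp[OF \<pi> _ inU[OF s], where c = "\<lambda>s. 1"]) (use r s in auto)
  have "act_char (U_D n) (sp sone \<pi>) (restrict \<mu> (U_D n)) = restrict \<mu> (U_D n)
      \<longleftrightarrow> (\<forall>s\<in>?S. msign mu s (inv_into UNIV \<pi>) = msign mu s id)"
  proof
    assume a: "act_char (U_D n) (sp sone \<pi>) (restrict \<mu> (U_D n)) = restrict \<mu> (U_D n)"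
    show "\<forall>s\<in>?S. msign mu s (inv_into UNIV \<pi>) = msign mu s id"
    proof
      fix s assume s: "s \<in> ?S"
      show "msign mu s (inv_into UNIV \<pi>) = msign mu s id"
        unfolding ac[OF s, symmetric] r[OF s, symmetric] a ..
    qed
  next
    assume a: "\<forall>s\<in>?S. msign mu s (inv_into UNIV \<pi>) = msign mu s id"
    show "act_char (U_D n) (sp sone \<pi>) (restrict \<mu> (U_D n)) = restrict \<mu> (U_D n)"
    proof (rule extensionalityI)
      show "act_char (U_D n) (sp sone \<pi>) (restrict \<mu> (U_D n)) \<in> extensional (U_D n)" by (simp add: act_char_def)
      show "restrict \<mu> (U_D n) \<in> extensional (U_D n)" by simp
      fix x assume "x \<in> U_D n"
      then obtain s where s: "x = sp s id" "s \<in> ?S" unfolding U_D_eq by blast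
      show "act_char (U_D n) (sp sone \<pi>) (restrict \<mu> (U_D n)) x = restrict \<mu> (U_D n) x"
        unfolding s(1) ac[OF s(2)] r[OF s(2)] using a s(2) by blast
    qed
  qed
  also have "\<dots> \<longleftrightarrow> (\<forall>j\<in>{1..n}. ?m j = mu j) \<or> (\<forall>j\<in>{1..n}. ?m j = - mu j)"
  proof
    assume a: "\<forall>s\<in>?S. msign mu s (inv_into UNIV \<pi>) = msign mu s id"
    have pair: "?m p * ?m q = mu p * mu q" if pq: "p \<in> {1..n}" "q \<in> {1..n}" "p \<noteq> q" for p q
    proof -
      have "(\<Prod>j\<in>{1..n}. flip p j * flip q j) = 1"
        unfolding prod.distrib prod_flip[OF pq(1)] prod_flip[OF pq(2)] by simp
      then have "(\<lambda>l. flip p l * flip q l) \<in> ?S" using signs_mult[OF signs_flip signs_flip] pq by simp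
      from bspec[OF a this] show ?thesis
        unfolding msign_mult[OF mu_sq signs_flip[OF pq(1)] signs_flip[OF pq(2)]]
          msign_flip[OF pq(1)] msign_flip[OF pq(2)] by simp
    qed
    show "(\<forall>j\<in>{1..n}. ?m j = mu j) \<or> (\<forall>j\<in>{1..n}. ?m j = - mu j)"
    proof (rule disjCI)
      assume "\<not> (\<forall>j\<in>{1..n}. ?m j = - mu j)"
      then obtain p where p: "p \<in> {1..n}" "?m p \<noteq> - mu p" by auto
      have mp: "?m p = mu p" using p(2) mu_pm[of p] mu_pm[of "inv_into UNIV \<pi> p"] by auto
      show "\<forall>j\<in>{1..n}. ?m j = mu j"
      proof
        fix q assume q: "q \<in> {1..n}"
        show "?m q = mu q"
        proof (cases "p = q")
          case False
          have "mu p * ?m q = mu p * mu q" using pair[OF p(1) q False] unfolding mp .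
          moreover have "mu p \<noteq> 0" using mu_sq[of p] by auto
          ultimately show ?thesis by (simp only: mult_cancel_left) simp
        qed (use mp in simp)
      qed
    qed
  next
    assume a: "(\<forall>j\<in>{1..n}. ?m j = mu j) \<or> (\<forall>j\<in>{1..n}. ?m j = - mu j)"
    show "\<forall>s\<in>?S. msign mu s (inv_into UNIV \<pi>) = msign mu s id"
    proof
      fix s assume s: "s \<in> ?S"
      show "msign mu s (inv_into UNIV \<pi>) = msign mu s id"
        using a
      proof
        assume "\<forall>j\<in>{1..n}. ?m j = mu j"
        then show ?thesis unfolding msign_def by (intro prod.cong) auto
      next
        assume b: "\<forall>j\<in>{1..n}. ?m j = - mu j"
        \<comment> \<open>Reversing all values of \<open>mu\<close> multiplies \<open>msign\<close>
          by the product of the signs of \<open>s\<close>, which is 1 on U.\<close>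
        have "msign mu s (inv_into UNIV \<pi>) = (\<Prod>j\<in>{1..n}. complex_of_real (s j) * (if s j = -1 then mu (id j) else 1))"
          unfolding msign_def
        proof (rule prod.cong[OF refl])
          fix j assume j: "j \<in> {1..n}"
          have "s j = 1 \<or> s j = -1" using s by (simp add: signs_def)
          then show "(if s j = -1 then ?m j else 1) = complex_of_real (s j) * (if s j = -1 then mu (id j) else 1)"
            using b j by auto
        qed
        also have "\<dots> = complex_of_real (\<Prod>j\<in>{1..n}. s j) * msign mu s id"
          unfolding msign_def prod.distrib by simp
        also have "(\<Prod>j\<in>{1..n}. s j) = 1" using s by simp
        finally show ?thesis by (simp only: of_real_1 mult_1_left)
      qed
    qed
  qed
  finally show ?thesis using W by (simp add: stabA_def)
qed

text \<open>The stabiliser of the restricted character exceeds that of the character exactly by the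
  permutations reversing all signs; the index 1 shows that such a permutation cannot also fix
  them.\<close>

lemma stab_neq_iff:
  "stabA n (T_B n) \<mu> \<noteq> stabA n (U_D n) (restrict \<mu> (U_D n)) \<longleftrightarrow>
    (\<exists>w. w permutes {1..n} \<and> (\<forall>j\<in>{1..n}. mu (w j) = - mu j))"
proof
  assume ne: "stabA n (T_B n) \<mu> \<noteq> stabA n (U_D n) (restrict \<mu> (U_D n))"
  have "\<exists>\<pi>. \<pi> permutes {1..n} \<and> (sp sone \<pi> \<in> stabA n (T_B n) \<mu> \<longleftrightarrow> sp sone \<pi> \<notin> stabA n (U_D n) (restrict \<mu> (U_D n)))"
  proof (rule ccontr)
    assume c: "\<not> ?thesis"
    have "stabA n (T_B n) \<mu> = stabA n (U_D n) (restrict \<mu> (U_D n))"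
    proof (rule Set.set_eqI)
      fix w
      show "w \<in> stabA n (T_B n) \<mu> \<longleftrightarrow> w \<in> stabA n (U_D n) (restrict \<mu> (U_D n))"
      proof (cases "w \<in> W_A n")
        case True
        then obtain \<pi> where "w = sp sone \<pi>" "\<pi> permutes {1..n}" unfolding W_A_eq by blast
        then show ?thesis using c by blast
      qed (simp add: stabA_def)
    qed
    then show False using ne by simp
  qed
  then obtain \<pi> where \<pi>: "\<pi> permutes {1..n}" "\<forall>j\<in>{1..n}. mu (inv_into UNIV \<pi> j) = - mu j"
    using T_stab_iff U_stab_iff by blast
  then show "\<exists>w. w permutes {1..n} \<and> (\<forall>j\<in>{1..n}. mu (w j) = - mu j)"
    using permutes_inv[OF \<pi>(1)] by blast
next
  assume "\<exists>w. w permutes {1..n} \<and> (\<forall>j\<in>{1..n}. mu (w j) = - mu j)"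
  then obtain w where w: "w permutes {1..n}" "\<forall>j\<in>{1..n}. mu (w j) = - mu j" by blast
  note wi = permutes_inv[OF w(1)]
  have ii: "inv_into UNIV (inv_into UNIV w) = w" by (rule inv_inv_eq[OF permutes_bij[OF w(1)]])
  have "sp sone (inv_into UNIV w) \<in> stabA n (U_D n) (restrict \<mu> (U_D n))"
    unfolding U_stab_iff[OF wi] ii using w(2) by blast
  moreover have "sp sone (inv_into UNIV w) \<notin> stabA n (T_B n) \<mu>"
    unfolding T_stab_iff[OF wi] ii
  proof
    assume a: "\<forall>j\<in>{1..n}. mu (w j) = mu j"
    have "1 \<in> {1..n}" using n2 by simp
    then have "mu 1 = - mu 1" using a w(2) by metis
    then show False using mu_pm[of 1] by auto
  qed
  ultimately show "stabA n (T_B n) \<mu> \<noteq> stabA n (U_D n) (restrict \<mu> (U_D n))" by blast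
qed

section \<open>The arrangement of the indices by sign and the element sigma\<close>

definition jp :: "nat \<Rightarrow> nat" where
  "jp p = (if p \<in> {1..n} then jlist n \<mu> ! (p - 1) else p)"

lemma plus_set_eq: "plus_set n \<mu> = {j \<in> {1..n}. mu j = 1}"
  by (auto simp: plus_set_def mu_def)

lemma minus_set_eq: "minus_set n \<mu> = {j \<in> {1..n}. mu j = -1}"
  by (auto simp: minus_set_def mu_def)

lemma jlist_props: "distinct (jlist n \<mu>)" "set (jlist n \<mu>) = {1..n}" "length (jlist n \<mu>) = n"
proof -
  have fin: "finite (plus_set n \<mu>)" "finite (minus_set n \<mu>)" by (simp_all add: plus_set_def minus_set_def)
  show d: "distinct (jlist n \<mu>)" unfolding jlist_def using fin by (auto simp: plus_set_eq minus_set_eq)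
  show s: "set (jlist n \<mu>) = {1..n}" unfolding jlist_def using fin mu_pm by (auto simp: plus_set_eq minus_set_eq)
  show "length (jlist n \<mu>) = n" using distinct_card[OF d] s by simp
qed

lemma jp_permutes: "jp permutes {1..n}"
proof -
  have "bij_betw (\<lambda>j. j - 1) {1..n} {..<n}"
    by (rule bij_betw_byWitness[of _ "\<lambda>j. j + 1"]) auto
  moreover have "bij_betw ((!) (jlist n \<mu>)) {..<n} {1..n}"
    using bij_betw_nth[OF jlist_props(1), of "{..<n}" "{1..n}"] jlist_props by simp
  ultimately have "bij_betw ((!) (jlist n \<mu>) \<circ> (\<lambda>j. j - 1)) {1..n} {1..n}"
    by (rule bij_betw_trans)
  then have "bij_betw jp {1..n} {1..n}"
    by (rule bij_betw_cong[THEN iffD1, rotated]) (auto simp: jp_def)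
  then show ?thesis by (rule bij_imp_permutes) (auto simp: jp_def)
qed

lemma mu_jp:
  assumes "p \<in> {1..n}"
  shows "mu (jp p) = (if p \<le> card (plus_set n \<mu>) then 1 else -1)"
proof -
  let ?i = "card (plus_set n \<mu>)"
  have fin: "finite (plus_set n \<mu>)" "finite (minus_set n \<mu>)" by (simp_all add: plus_set_def minus_set_def)
  have len: "length (sorted_list_of_set (plus_set n \<mu>)) = ?i" by simp
  have jl: "length (sorted_list_of_set (plus_set n \<mu>)) + length (sorted_list_of_set (minus_set n \<mu>)) = n"
    using jlist_props(3) by (simp add: jlist_def)
  show ?thesis
  proof (cases "p \<le> ?i")
    case True
    then have lt: "p - 1 < length (sorted_list_of_set (plus_set n \<mu>))" using assms len by auto
    have "jp p = sorted_list_of_set (plus_set n \<mu>) ! (p - 1)"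
      unfolding jp_def if_P[OF assms] jlist_def nth_append if_P[OF lt] ..
    then have "jp p \<in> plus_set n \<mu>" using nth_mem[OF lt] fin(1) by simp
    then show ?thesis using True by (simp add: plus_set_eq)
  next
    case False
    then have ge: "\<not> p - 1 < length (sorted_list_of_set (plus_set n \<mu>))" using assms len by auto
    have lt: "p - 1 - ?i < length (sorted_list_of_set (minus_set n \<mu>))" using assms False jl len by auto
    have "jp p = sorted_list_of_set (minus_set n \<mu>) ! (p - 1 - ?i)"
      unfolding jp_def if_P[OF assms] jlist_def nth_append if_not_P[OF ge] by (simp only: len)
    then have "jp p \<in> minus_set n \<mu>" using nth_mem[OF lt] fin(2) by simp
    then show ?thesis using False by (simp add: minus_set_eq)
  qed
qed

text \<open>The conditions prescribe the images of all basis vectors, so they single out one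
  permutation, the inverse of p \<mapsto> j_p.\<close>

lemma sigma_eq: "sigma n \<mu> = sp sone (inv_into UNIV jp)"
  unfolding sigma_def
proof (rule the_equality)
  note ji = permutes_inv[OF jp_permutes]
  have val: "jlist n \<mu> ! (p - 1) = jp p" if "p \<in> {1..n}" for p using that by (simp add: jp_def)
  have e: "sp sone \<pi> (eps j) = eps (\<pi> j)" if "\<pi> permutes {1..n}" for \<pi> j
    unfolding sp_eps[OF permutes_bij[OF that]] by (simp add: eps_def)
  show "sp sone (inv_into UNIV jp) \<in> W_A n \<and> (\<forall>p\<in>{1..n}. sp sone (inv_into UNIV jp) (eps (jlist n \<mu> ! (p - 1))) = eps p)"
    using ji val e[OF ji] permutes_inverses(2)[OF jp_permutes] unfolding W_A_eq by auto
  fix w assume w: "w \<in> W_A n \<and> (\<forall>p\<in>{1..n}. w (eps (jlist n \<mu> ! (p - 1))) = eps p)"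
  then obtain \<pi> where \<pi>: "w = sp sone \<pi>" "\<pi> permutes {1..n}" unfolding W_A_eq by blast
  have ei: "a = b" if "eps a = eps b" for a b
    using fun_cong[OF that, of a] by (auto simp: eps_def split: if_splits)
  have pj: "\<pi> (jp p) = p" for p
  proof (cases "p \<in> {1..n}")
    case True
    have "w (eps (jlist n \<mu> ! (p - 1))) = eps p" using w True by blast
    then have "eps (\<pi> (jp p)) = eps p" unfolding \<pi>(1) val[OF True] e[OF \<pi>(2)] .
    then show ?thesis by (rule ei)
  next
    case False
    then show ?thesis using permutes_not_in[OF jp_permutes] permutes_not_in[OF \<pi>(2)] by simp
  qed
  have "\<pi> j = inv_into UNIV jp j" for j
    using pj[of "inv_into UNIV jp j"] permutes_inverses(1)[OF jp_permutes] by simp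
  then have "\<pi> = inv_into UNIV jp" by (simp add: fun_eq_iff)
  then show "w = sp sone (inv_into UNIV jp)" using \<pi>(1) by simp
qed

end

text \<open>A permutation preserving both blocks is the product of one supported on each block, and
  the transpositions within a block are the reflections in the roots of
  \<open>R_sub\<close>.\<close>

lemma Weyl_R_sub:
  assumes m: "m \<le> n"
  shows "Weyl n (R_sub n m) = {sp sone \<pi> | \<pi>. \<pi> permutes {1..n} \<and> (\<forall>j\<in>{1..n}. \<pi> j \<le> m \<longleftrightarrow> j \<le> m)}"
proof -
  let ?blk = "\<lambda>p q. 1 \<le> p \<and> p < q \<and> q \<le> m \<or> m < p \<and> p < q \<and> q \<le> n"
  let ?S = "reflect n ` R_sub n m"
  have ref: "x \<in> ?S \<longleftrightarrow> (\<exists>p q. ?blk p q \<and> x = sp sone (tr p q))" for x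
  proof -
    have r: "reflect n (\<lambda>l. a * rootA p q l) = sp sone (tr p q)" if "?blk p q" "a \<in> {1, -1}" for a p q
    proof -
      have pq: "p \<in> {1..n}" "q \<in> {1..n}" "p \<noteq> q" using that(1) m by auto
      have "(\<lambda>l. a * rootA p q l) = (\<lambda>l. a * eps p l + (- a) * eps q l)" by (simp add: rootA_def algebra_simps)
      moreover have "- a \<in> {1, -1}" using that(2) by auto
      ultimately have "reflect n (\<lambda>l. a * rootA p q l) = sp (\<lambda>l. if l = p \<or> l = q then - a * (- a) else 1) (tr p q)"
        using reflect_pair[OF pq that(2), of "- a"] by simp
      also have "(\<lambda>l. if l = p \<or> l = q then - a * (- a) else 1) = sone" using that(2) by auto
      finally show ?thesis .
    qed
    show ?thesis
    proof
      assume "x \<in> ?S"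
      then obtain a p q where "x = reflect n (\<lambda>l. a * rootA p q l)" "a \<in> {1, -1}" "?blk p q"
        unfolding R_sub_def by blast
      then show "\<exists>p q. ?blk p q \<and> x = sp sone (tr p q)" using r by blast
    next
      assume "\<exists>p q. ?blk p q \<and> x = sp sone (tr p q)"
      then obtain p q where pq: "?blk p q" "x = sp sone (tr p q)" by blast
      have "(\<lambda>l. 1 * rootA p q l) \<in> R_sub n m" unfolding R_sub_def using pq(1) by blast
      from imageI[OF this, of "reflect n"] show "x \<in> ?S" using r[OF pq(1), of 1] pq(2) by simp
    qed
  qed
  have inv: "x \<circ> x = id" if "x \<in> ?S" for x
    using that sp_transpose_involution[of sone] unfolding ref by auto
  define Q where "Q = {sp sone \<pi> | \<pi>. \<pi> permutes {1..n} \<and> (\<forall>j\<in>{1..n}. \<pi> j \<le> m \<longleftrightarrow> j \<le> m)}"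
  have "x \<in> Q" if "x \<in> group_gen ?S" for x
    using that
  proof (induction rule: group_gen_induct)
    case (involution x)
    then show ?case by (rule inv)
  next
    case id
    have "id \<in> Q"
      unfolding Q_def by (rule CollectI, rule exI[of _ id]) (simp add: sp_id permutes_id)
    then show ?case .
  next
    case (incl x)
    then obtain p q where pq: "?blk p q" "x = sp sone (tr p q)" unfolding ref by blast
    have "tr p q permutes {1..n}" using pq m by (intro transpose_permutes_Icc) auto
    moreover have "\<forall>j\<in>{1..n}. tr p q j \<le> m \<longleftrightarrow> j \<le> m"
      using pq(1) by (auto simp: Transposition.transpose_def)
    ultimately show ?case unfolding Q_def using pq(2) by blast
  next
    case (comp x y)
    then obtain a b where ab: "x = sp sone a" "a permutes {1..n}" "\<forall>j\<in>{1..n}. a j \<le> m \<longleftrightarrow> j \<le> m"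
      "y = sp sone b" "b permutes {1..n}" "\<forall>j\<in>{1..n}. b j \<le> m \<longleftrightarrow> j \<le> m" unfolding Q_def by blast
    have "\<forall>j\<in>{1..n}. (a \<circ> b) j \<le> m \<longleftrightarrow> j \<le> m"
      using ab(3,6) permutes_in_image[OF ab(5)] by simp
    then have "x \<circ> y \<in> Q"
      unfolding Q_def using sp_one_comp[OF ab(2,5)] permutes_compose[OF ab(5,2)] ab(1,4) by blast
    then show ?case .
  qed
  moreover have "x \<in> group_gen ?S" if xQ: "x \<in> Q" for x
  proof -
    obtain \<pi> where \<pi>: "x = sp sone \<pi>" "\<pi> permutes {1..n}" "\<And>j. j \<in> {1..n} \<Longrightarrow> \<pi> j \<le> m \<longleftrightarrow> j \<le> m"
      using xQ unfolding Q_def by blast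
    define a where "a j = (if j \<in> {1..m} then \<pi> j else j)" for j
    define b where "b j = (if j \<in> {m + 1..n} then \<pi> j else j)" for j
    have im: "\<pi> j \<in> {1..n} \<longleftrightarrow> j \<in> {1..n}" for j by (rule permutes_in_image[OF \<pi>(2)])
    have inj: "inj_on \<pi> A" for A using permutes_inj[OF \<pi>(2)] by (simp add: inj_on_def inj_def)
    have "\<pi> ` {1..m} \<subseteq> {1..m}"
    proof
      fix y assume "y \<in> \<pi> ` {1..m}"
      then obtain j where j: "y = \<pi> j" "j \<in> {1..m}" by auto
      then show "y \<in> {1..m}" using im[of j] \<pi>(3)[of j] m by auto
    qed
    then have "\<pi> ` {1..m} = {1..m}" by (intro endo_inj_surj inj) auto
    then have "bij_betw \<pi> {1..m} {1..m}" using inj by (simp add: bij_betw_def)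
    then have "bij_betw a {1..m} {1..m}" by (rule bij_betw_cong[THEN iffD1, rotated]) (simp add: a_def)
    then have a: "a permutes {1..m}" by (rule bij_imp_permutes) (auto simp: a_def)
    have "\<pi> ` {m + 1..n} \<subseteq> {m + 1..n}"
    proof
      fix y assume "y \<in> \<pi> ` {m + 1..n}"
      then obtain j where j: "y = \<pi> j" "j \<in> {m + 1..n}" by auto
      then have "j \<in> {1..n}" "\<not> j \<le> m" by auto
      then show "y \<in> {m + 1..n}" using im[of j] \<pi>(3)[of j] j(1) by auto
    qed
    then have "\<pi> ` {m + 1..n} = {m + 1..n}" by (intro endo_inj_surj inj) auto
    then have "bij_betw \<pi> {m + 1..n} {m + 1..n}" using inj by (simp add: bij_betw_def)
    then have "bij_betw b {m + 1..n} {m + 1..n}" by (rule bij_betw_cong[THEN iffD1, rotated]) (simp add: b_def)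
    then have b: "b permutes {m + 1..n}" by (rule bij_imp_permutes) (auto simp: b_def)
    have "\<pi> j = a (b j)" for j
    proof -
      consider "j \<in> {1..m}" | "j \<in> {m + 1..n}" | "j \<notin> {1..n}" by (cases "j \<le> m") auto
      then show ?thesis
      proof cases
        case 1
        then show ?thesis by (auto simp: a_def b_def)
      next
        case 2
        then have "\<pi> j \<in> {m + 1..n}" using \<open>\<pi> ` {m + 1..n} = {m + 1..n}\<close> by blast
        then show ?thesis using 2 by (auto simp: a_def b_def)
      next
        case 3
        then have "\<pi> j = j" by (rule permutes_not_in[OF \<pi>(2)])
        then show ?thesis by (simp add: a_def b_def)
      qed
    qed
    then have ab: "sp sone \<pi> = sp sone a \<circ> sp sone b"
      unfolding sp_one_comp[OF a b] by (intro arg_cong[of _ _ "sp sone"]) (simp add: fun_eq_iff)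
    let ?T = "\<lambda>A. {sp sone (tr i j) | i j. i \<in> A \<and> j \<in> A \<and> i \<noteq> j}"
    have sub: "?T A \<subseteq> ?S" if "A = {1..m} \<or> A = {m + 1..n}" for A
    proof
      fix x assume "x \<in> ?T A"
      then obtain i j where ij: "x = sp sone (tr i j)" "i \<in> A" "j \<in> A" "i \<noteq> j" by blast
      then have "?blk i j \<or> ?blk j i" using that by auto
      then show "x \<in> ?S" unfolding ref using ij(1) transpose_commute[of i j] by metis
    qed
    have gen: "sp sone c \<in> group_gen ?S" if "A = {1..m} \<or> A = {m + 1..n}" "c permutes A" for c A
    proof -
      have "group_gen (?T A) = {sp sone \<pi> | \<pi>. \<pi> permutes A}"
        by (rule group_gen_transpositions) (use that(1) in auto)
      then have "sp sone c \<in> group_gen (?T A)" using that(2) by blast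
      then show ?thesis using group_gen_mono[OF inv sub[OF that(1)]] by blast
    qed
    show ?thesis unfolding \<pi>(1) ab by (rule group_gen_comp[OF inv gen[OF _ a] gen[OF _ b]]) auto
  qed
  ultimately show ?thesis unfolding Weyl_def Q_def by blast
qed

end

section \<open>Translation of the criterion into conditions on roots and orbits\<close>

lemma ex_permutes_conjugate:
  assumes c: "c permutes A"
  shows "(\<exists>w. w permutes A \<and> (\<forall>j\<in>A. Q (w j) j)) \<longleftrightarrow> (\<exists>h. h permutes A \<and> (\<forall>j\<in>A. Q (c (h j)) (c j)))"
proof
  note ci = permutes_inv[OF c]
  assume "\<exists>w. w permutes A \<and> (\<forall>j\<in>A. Q (w j) j)"
  then obtain w where w: "w permutes A" "\<And>j. j \<in> A \<Longrightarrow> Q (w j) j" by blast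
  have "inv_into UNIV c \<circ> (w \<circ> c) permutes A" by (intro permutes_compose w(1) c ci)
  moreover have "Q (c ((inv_into UNIV c \<circ> (w \<circ> c)) j)) (c j)" if "j \<in> A" for j
    using w(2)[of "c j"] that permutes_in_image[OF c] permutes_inverses(1)[OF c] by simp
  ultimately show "\<exists>h. h permutes A \<and> (\<forall>j\<in>A. Q (c (h j)) (c j))" by blast
next
  note ci = permutes_inv[OF c]
  assume "\<exists>h. h permutes A \<and> (\<forall>j\<in>A. Q (c (h j)) (c j))"
  then obtain h where h: "h permutes A" "\<And>j. j \<in> A \<Longrightarrow> Q (c (h j)) (c j)" by blast
  have "c \<circ> (h \<circ> inv_into UNIV c) permutes A" by (intro permutes_compose h(1) c ci)
  moreover have "Q ((c \<circ> (h \<circ> inv_into UNIV c)) j) j" if "j \<in> A" for j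
    using h(2)[of "inv_into UNIV c j"] that permutes_in_image[OF ci] permutes_inverses(1)[OF c] by simp
  ultimately show "\<exists>w. w permutes A \<and> (\<forall>j\<in>A. Q (w j) j)" by blast
qed

lemma P_set_empty_iff:
  assumes i: "i \<le> n"
    and \<Gamma>: "\<And>u. u \<in> VC n \<Longrightarrow> \<Gamma> u = (\<Sum>j\<in>{1..n}. u j * g j)"
  shows "P_set n k i \<Gamma> = {} \<longleftrightarrow>
    (\<forall>p\<in>{1..n}. \<forall>q\<in>{1..n}. p < q \<and> (p \<le> i \<longleftrightarrow> q \<le> i) \<longrightarrow> g p - g q \<noteq> 2 * k \<and> g p - g q \<noteq> - 2 * k)"
proof -
  have ev: "\<Gamma> (complexify (rootA p q)) = g p - g q" if "p \<in> {1..n}" "q \<in> {1..n}" for p q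
  proof -
    have "complexify (rootA p q) \<in> VC n" using that by (auto simp: VC_def complexify_def rootA_def eps_def)
    then show ?thesis unfolding \<Gamma>[OF \<open>complexify (rootA p q) \<in> VC n\<close>] by (intro sum_complexify_rootA that)
  qed
  have "\<alpha> \<in> P_set n k i \<Gamma> \<longleftrightarrow> (\<exists>p q. p \<in> {1..n} \<and> q \<in> {1..n} \<and> p < q \<and> (p \<le> i \<longleftrightarrow> q \<le> i) \<and>
      (g p - g q = 2 * k \<or> g p - g q = - 2 * k) \<and> \<alpha> = rootA p q)" for \<alpha>
  proof
    assume a: "\<alpha> \<in> P_set n k i \<Gamma>"
    then obtain p q where pq: "\<alpha> = rootA p q" "1 \<le> p" "p < q" "q \<le> n"
      unfolding P_set_def R_A_pos_def by blast
    from a obtain a p' q' where a': "\<alpha> = (\<lambda>l. a * rootA p' q' l)" "a \<in> {1, -1}"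
      "1 \<le> p' \<and> p' < q' \<and> q' \<le> i \<or> i < p' \<and> p' < q' \<and> q' \<le> n"
      unfolding P_set_def R_sub_def by blast
    \<comment> \<open>The root is given once by a pair from the positive system and once by a signed
      pair from \<open>R_sub\<close>; its coordinates at the latter show that both pairs
      coincide.\<close>
    have "rootA p q p' = a * rootA p' q' p'" "rootA p q q' = a * rootA p' q' q'"
      unfolding pq(1)[symmetric] a'(1) by simp_all
    then have "p' = p \<and> q' = q"
      using a'(2,3) pq(3) by (auto simp: rootA_def eps_def split: if_splits)
    then show "\<exists>p q. p \<in> {1..n} \<and> q \<in> {1..n} \<and> p < q \<and> (p \<le> i \<longleftrightarrow> q \<le> i) \<and>
        (g p - g q = 2 * k \<or> g p - g q = - 2 * k) \<and> \<alpha> = rootA p q"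
      using a pq a'(3) ev[of p q] unfolding P_set_def by (intro exI[of _ p] exI[of _ q]) auto
  next
    assume "\<exists>p q. p \<in> {1..n} \<and> q \<in> {1..n} \<and> p < q \<and> (p \<le> i \<longleftrightarrow> q \<le> i) \<and>
        (g p - g q = 2 * k \<or> g p - g q = - 2 * k) \<and> \<alpha> = rootA p q"
    then obtain p q where pq: "p \<in> {1..n}" "q \<in> {1..n}" "p < q" "p \<le> i \<longleftrightarrow> q \<le> i"
      "g p - g q = 2 * k \<or> g p - g q = - 2 * k" "\<alpha> = rootA p q" by blast
    have "1 \<le> p \<and> p < q \<and> q \<le> i \<or> i < p \<and> p < q \<and> q \<le> n" using pq(1-4) by auto
    then have "(\<lambda>l. 1 * rootA p q l) \<in> R_sub n i" unfolding R_sub_def by blast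
    then have "\<alpha> \<in> R_sub n i" by (simp add: pq(6))
    moreover have "\<alpha> \<in> R_A_pos n" unfolding R_A_pos_def pq(6) using pq(1-3) by auto
    ultimately show "\<alpha> \<in> P_set n k i \<Gamma>" unfolding P_set_def using pq(5) ev[OF pq(1,2)] pq(6) by simp
  qed
  then show ?thesis by blast
qed

context hecke_algebra
begin

text \<open>If \<pi> preserves the blocks and realises the translate by \<tau>, then the block
  exchange followed by the inverse of \<pi> preserves the weight and exchanges the blocks.
  Conversely, such an \<open>h\<close> preceded by the block exchange preserves the blocks, and its
  inverse realises the translate.\<close>

lemma act_tau_in_orbit_iff:
  assumes nm: "n = 2 * m"
    and \<Gamma>: "\<And>u. u \<in> VC n \<Longrightarrow> \<Gamma> u = (\<Sum>j\<in>{1..n}. u j * g j)"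
  shows "act_tau n m \<Gamma> \<in> (\<lambda>w. act_dual n w \<Gamma>) ` Weyl n (R_sub n m) \<longleftrightarrow>
    (\<exists>h. h permutes {1..n} \<and> (\<forall>j\<in>{1..n}. g (h j) = g j \<and> (h j \<le> m \<longleftrightarrow> \<not> j \<le> m)))"
proof -
  define t where "t l = (if l \<in> {1..m} then m + l else if l \<in> {m + 1..2 * m} then l - m else l)" for l
  have tau: "tau m v = v \<circ> t" for v by (auto simp: tau_def t_def fun_eq_iff)
  have tt: "t (t l) = l" for l by (auto simp: t_def)
  have t_mem: "t l \<in> {1..n} \<longleftrightarrow> l \<in> {1..n}" for l by (auto simp: t_def nm)
  have t_blk: "t l \<le> m \<longleftrightarrow> \<not> l \<le> m" if "l \<in> {1..n}" for l using that by (auto simp: t_def nm)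
  have t: "t permutes {1..n}"
  proof (rule bij_imp_permutes)
    show "bij_betw t {1..n} {1..n}" by (rule bij_betw_byWitness[of _ t]) (use tt t_mem in auto)
    show "t l = l" if "l \<notin> {1..n}" for l using that by (auto simp: t_def nm)
  qed
  have tau_exp: "act_tau n m \<Gamma> u = (\<Sum>j\<in>{1..n}. u j * g (t j))" if u: "u \<in> VC n" for u
  proof -
    have "act_tau n m \<Gamma> u = (\<Sum>j\<in>{1..n}. u (t j) * g j)"
      using \<Gamma>[OF VC_perm[OF u t]] u by (simp add: act_tau_def tau)
    also have "\<dots> = (\<Sum>j\<in>{1..n}. u j * g (t j))"
      by (rule sum.reindex_bij_witness[of _ t t]) (simp_all only: tt t_mem)
    finally show ?thesis .
  qed
  have dual_exp: "act_dual n (sp sone \<pi>) \<Gamma> u = (\<Sum>j\<in>{1..n}. u j * g (inv_into UNIV \<pi> j))"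
    if "\<pi> permutes {1..n}" "u \<in> VC n" for \<pi> u
    by (rule act_dual_expand[OF that(1) _ that(2)]) (rule \<Gamma>)
  have eq_iff: "act_tau n m \<Gamma> = act_dual n (sp sone \<pi>) \<Gamma> \<longleftrightarrow> (\<forall>p\<in>{1..n}. g (t p) = g (inv_into UNIV \<pi> p))"
    if \<pi>: "\<pi> permutes {1..n}" for \<pi>
  proof
    assume e: "act_tau n m \<Gamma> = act_dual n (sp sone \<pi>) \<Gamma>"
    show "\<forall>p\<in>{1..n}. g (t p) = g (inv_into UNIV \<pi> p)"
    proof
      fix p assume p: "p \<in> {1..n}"
      then have c: "ceps p \<in> VC n" by (auto simp: VC_def ceps_apply)
      have "(\<Sum>j\<in>{1..n}. ceps p j * g (t j)) = (\<Sum>j\<in>{1..n}. ceps p j * g (inv_into UNIV \<pi> j))"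
        unfolding tau_exp[OF c, symmetric] dual_exp[OF \<pi> c, symmetric] e ..
      then show "g (t p) = g (inv_into UNIV \<pi> p)"
        unfolding sum_ceps[OF p, of "\<lambda>j. g (t j)"] sum_ceps[OF p, of "\<lambda>j. g (inv_into UNIV \<pi> j)"] .
    qed
  next
    assume e: "\<forall>p\<in>{1..n}. g (t p) = g (inv_into UNIV \<pi> p)"
    show "act_tau n m \<Gamma> = act_dual n (sp sone \<pi>) \<Gamma>"
    proof (rule extensionalityI[of _ "VC n"])
      show "act_tau n m \<Gamma> \<in> extensional (VC n)" by (simp add: act_tau_def)
      show "act_dual n (sp sone \<pi>) \<Gamma> \<in> extensional (VC n)" by (simp add: act_dual_def)
      fix u assume u: "u \<in> VC n"
      show "act_tau n m \<Gamma> u = act_dual n (sp sone \<pi>) \<Gamma> u"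
        unfolding tau_exp[OF u] dual_exp[OF \<pi> u] by (rule sum.cong) (use e in auto)
    qed
  qed
  have mn: "m \<le> n" using nm by simp
  have "act_tau n m \<Gamma> \<in> (\<lambda>w. act_dual n w \<Gamma>) ` Weyl n (R_sub n m) \<longleftrightarrow>
    (\<exists>\<pi>. \<pi> permutes {1..n} \<and> (\<forall>j\<in>{1..n}. \<pi> j \<le> m \<longleftrightarrow> j \<le> m) \<and> (\<forall>p\<in>{1..n}. g (t p) = g (inv_into UNIV \<pi> p)))"
    unfolding Weyl_R_sub[OF mn] using eq_iff by blast
  also have "\<dots> \<longleftrightarrow> (\<exists>h. h permutes {1..n} \<and> (\<forall>j\<in>{1..n}. g (h j) = g j \<and> (h j \<le> m \<longleftrightarrow> \<not> j \<le> m)))"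
  proof
    assume "\<exists>\<pi>. \<pi> permutes {1..n} \<and> (\<forall>j\<in>{1..n}. \<pi> j \<le> m \<longleftrightarrow> j \<le> m) \<and> (\<forall>p\<in>{1..n}. g (t p) = g (inv_into UNIV \<pi> p))"
    then obtain \<pi> where \<pi>: "\<pi> permutes {1..n}" "\<And>j. j \<in> {1..n} \<Longrightarrow> \<pi> j \<le> m \<longleftrightarrow> j \<le> m"
      "\<And>p. p \<in> {1..n} \<Longrightarrow> g (t p) = g (inv_into UNIV \<pi> p)" by blast
    have "inv_into UNIV \<pi> \<circ> t permutes {1..n}" by (rule permutes_compose[OF t permutes_inv[OF \<pi>(1)]])
    moreover have "g ((inv_into UNIV \<pi> \<circ> t) j) = g j \<and> ((inv_into UNIV \<pi> \<circ> t) j \<le> m \<longleftrightarrow> \<not> j \<le> m)"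
      if j: "j \<in> {1..n}" for j
    proof -
      have tj: "t j \<in> {1..n}" using j t_mem by blast
      have it: "inv_into UNIV \<pi> (t j) \<in> {1..n}" using tj permutes_in_image[OF permutes_inv[OF \<pi>(1)]] by blast
      have "g (inv_into UNIV \<pi> (t j)) = g j" using \<pi>(3)[OF tj] unfolding tt by simp
      moreover have "inv_into UNIV \<pi> (t j) \<le> m \<longleftrightarrow> \<not> j \<le> m"
        using \<pi>(2)[OF it] t_blk[OF j] unfolding permutes_inverses(1)[OF \<pi>(1)] by blast
      ultimately show ?thesis by simp
    qed
    ultimately show "\<exists>h. h permutes {1..n} \<and> (\<forall>j\<in>{1..n}. g (h j) = g j \<and> (h j \<le> m \<longleftrightarrow> \<not> j \<le> m))" by blast
  next
    assume "\<exists>h. h permutes {1..n} \<and> (\<forall>j\<in>{1..n}. g (h j) = g j \<and> (h j \<le> m \<longleftrightarrow> \<not> j \<le> m))"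
    then obtain h where h: "h permutes {1..n}" "\<And>j. j \<in> {1..n} \<Longrightarrow> g (h j) = g j"
      "\<And>j. j \<in> {1..n} \<Longrightarrow> h j \<le> m \<longleftrightarrow> \<not> j \<le> m" by blast
    define f where "f = h \<circ> t"
    have f: "f permutes {1..n}" unfolding f_def by (rule permutes_compose[OF t h(1)])
    have f_blk: "f j \<le> m \<longleftrightarrow> j \<le> m" if "j \<in> {1..n}" for j
      using h(3)[of "t j"] t_blk[OF that] t_mem[of j] that by (simp add: f_def)
    have "inv_into UNIV f j \<le> m \<longleftrightarrow> j \<le> m" if "j \<in> {1..n}" for j
      using f_blk[of "inv_into UNIV f j"] that permutes_in_image[OF permutes_inv[OF f]]
      unfolding permutes_inverses(1)[OF f] by blast
    moreover have "g (t p) = g (inv_into UNIV (inv_into UNIV f) p)" if "p \<in> {1..n}" for p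
      unfolding inv_inv_eq[OF permutes_bij[OF f]] using h(2)[of "t p"] t_mem[of p] that by (simp add: f_def)
    ultimately show "\<exists>\<pi>. \<pi> permutes {1..n} \<and> (\<forall>j\<in>{1..n}. \<pi> j \<le> m \<longleftrightarrow> j \<le> m) \<and> (\<forall>p\<in>{1..n}. g (t p) = g (inv_into UNIV \<pi> p))"
      using permutes_inv[OF f] by blast
  qed
  finally show ?thesis .
qed

text \<open>The reversal maps the indices of sign 1 bijectively onto those of sign -1, and every
  index has one of these signs.\<close>

lemma sign_swap_card:
  assumes \<mu>: "\<mu> \<in> char_group (T_B n)" and w: "w permutes {1..n}" "\<And>j. j \<in> {1..n} \<Longrightarrow> mu \<mu> (w j) = - mu \<mu> j"
  shows "n = 2 * card (plus_set n \<mu>)"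
proof -
  have im: "w j \<in> {1..n} \<longleftrightarrow> j \<in> {1..n}" for j by (rule permutes_in_image[OF w(1)])
  have "w ` plus_set n \<mu> = minus_set n \<mu>"
  proof (rule subset_antisym)
    show "w ` plus_set n \<mu> \<subseteq> minus_set n \<mu>"
    proof
      fix y assume "y \<in> w ` plus_set n \<mu>"
      then obtain x where x: "y = w x" "x \<in> {1..n}" "mu \<mu> x = 1" unfolding plus_set_eq[OF \<mu>] by blast
      then show "y \<in> minus_set n \<mu>" unfolding minus_set_eq[OF \<mu>] using w(2)[OF x(2)] im[of x] by simp
    qed
    show "minus_set n \<mu> \<subseteq> w ` plus_set n \<mu>"
    proof
      fix y assume "y \<in> minus_set n \<mu>"
      then have y: "y \<in> {1..n}" "mu \<mu> y = -1" unfolding minus_set_eq[OF \<mu>] by auto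
      let ?x = "inv_into UNIV w y"
      have x: "w ?x = y" by (rule permutes_inverses(1)[OF w(1)])
      then have "?x \<in> {1..n}" using im[of ?x] y(1) by simp
      then have "?x \<in> plus_set n \<mu>" unfolding plus_set_eq[OF \<mu>] using w(2)[of ?x] x y(2) by auto
      then show "y \<in> w ` plus_set n \<mu>" using x by (metis imageI)
    qed
  qed
  then have "card (minus_set n \<mu>) = card (plus_set n \<mu>)"
    using card_image[OF inj_on_subset[OF permutes_inj[OF w(1)] subset_UNIV], of "plus_set n \<mu>"] by simp
  moreover have "card (plus_set n \<mu> \<union> minus_set n \<mu>) = card (plus_set n \<mu>) + card (minus_set n \<mu>)"
    by (rule card_Un_disjoint) (auto simp: plus_set_def minus_set_def)
  moreover have "plus_set n \<mu> \<union> minus_set n \<mu> = {1..n}"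
    unfolding plus_set_eq[OF \<mu>] minus_set_eq[OF \<mu>] using mu_pm[OF \<mu>] by blast
  ultimately show ?thesis by simp
qed

lemma simple_principal_series_iff:
  assumes \<Gamma>: "\<Gamma> \<in> dualVC n" and \<mu>: "\<mu> \<in> char_group (T_B n)"
  shows "simple_module (H_D n k) (principal_series n k \<Gamma> (restrict \<mu> (U_D n))) \<longleftrightarrow>
    irred (\<lambda>j. \<Gamma> (ceps j)) (mu \<mu>)"
proof -
  interpret R: hecke_rep n k "\<lambda>j. \<Gamma> (ceps j)" "mu \<mu>"
    by unfold_locales (rule mu_sq[OF \<mu>])
  have "charSU n k \<Gamma> (restrict \<mu> (U_D n)) = restrict R.chr AA"
  proof (rule R.charSU_eq)
    show "\<Gamma> u = (\<Sum>j\<in>{1..n}. u j * \<Gamma> (ceps j))" if "u \<in> VC n" for u by (rule dual_expand[OF \<Gamma> that])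
    show "restrict \<mu> (U_D n) (sp s id) = msign (mu \<mu>) s id" if "s \<in> signs n" "sp s id \<in> U_D n" for s
      unfolding restrict_apply'[OF that(2)] by (rule char_sp[OF \<mu> that(1)])
  qed
  then have "principal_series n k \<Gamma> (restrict \<mu> (U_D n)) = R.NN"
    unfolding principal_series_def R.NN_def SU_eq by simp
  then show ?thesis using R.simple_NN_iff by simp
qed

text \<open>One criterion for both cases, which differ only in whether a permutation reversing all
  signs exists. Reindexing by \<open>jp\<close> puts the sign vector into block form, where equal
  signs mean the same block.\<close>

theorem principal_series_criterion:
  assumes k: "k \<noteq> 0" and \<Gamma>: "\<Gamma> \<in> dualVC n" and \<mu>: "\<mu> \<in> char_group (T_B n)"
  defines "\<Gamma>\<sigma> \<equiv> act_dual n (sigma n \<mu>) \<Gamma>" and "i \<equiv> card (plus_set n \<mu>)"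
  defines "swaps \<equiv> \<lambda>w. w permutes {1..n} \<and> (\<forall>j\<in>{1..n}. mu \<mu> (w j) = - mu \<mu> j)"
  shows "simple_module (H_D n k) (principal_series n k \<Gamma> (restrict \<mu> (U_D n))) \<longleftrightarrow>
      P_set n k i \<Gamma>\<sigma> = {} \<and> \<not> (\<exists>w. swaps w \<and> (\<forall>j\<in>{1..n}. \<Gamma> (ceps (w j)) = \<Gamma> (ceps j)))"
    and "n = 2 * i \<Longrightarrow> act_tau n i \<Gamma>\<sigma> \<in> (\<lambda>w. act_dual n w \<Gamma>\<sigma>) ` Weyl n (R_sub n i) \<longleftrightarrow>
      (\<exists>w. swaps w \<and> (\<forall>j\<in>{1..n}. \<Gamma> (ceps (w j)) = \<Gamma> (ceps j)))"
proof -
  let ?g = "\<lambda>j. \<Gamma> (ceps j)"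
  let ?c = "jp \<mu>"
  note c = jp_permutes[OF \<mu>]
  have im: "?c p \<in> {1..n} \<longleftrightarrow> p \<in> {1..n}" for p by (rule permutes_in_image[OF c])
  have exp: "\<Gamma>\<sigma> u = (\<Sum>j\<in>{1..n}. u j * ?g (?c j))" if "u \<in> VC n" for u
  proof -
    have "act_dual n (sp sone (inv_into UNIV ?c)) \<Gamma> u = (\<Sum>j\<in>{1..n}. u j * ?g (inv_into UNIV (inv_into UNIV ?c) j))"
      by (rule act_dual_expand[OF permutes_inv[OF c] _ that]) (rule dual_expand[OF \<Gamma>])
    then show ?thesis unfolding inv_inv_eq[OF permutes_bij[OF c]] \<Gamma>\<sigma>_def sigma_eq[OF \<mu>] .
  qed
  have mu: "mu \<mu> (?c p) = (if p \<le> i then 1 else -1)" if "p \<in> {1..n}" for p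
    unfolding i_def by (rule mu_jp[OF \<mu> that])
  have mu_eq: "mu \<mu> (?c p) = mu \<mu> (?c q) \<longleftrightarrow> (p \<le> i \<longleftrightarrow> q \<le> i)" if "p \<in> {1..n}" "q \<in> {1..n}" for p q
    unfolding mu[OF that(1)] mu[OF that(2)] by simp
  have "i \<le> card {1..n}" unfolding i_def by (rule card_mono) (auto simp: plus_set_def)
  then have "i \<le> n" by simp
  have P: "P_set n k i \<Gamma>\<sigma> = {} \<longleftrightarrow> (\<forall>p\<in>{1..n}. \<forall>q\<in>{1..n}. p < q \<and> (p \<le> i \<longleftrightarrow> q \<le> i) \<longrightarrow>
      ?g (?c p) - ?g (?c q) \<noteq> 2 * k \<and> ?g (?c p) - ?g (?c q) \<noteq> - 2 * k)"
    by (rule P_set_empty_iff[OF \<open>i \<le> n\<close>]) (rule exp)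
  have P': "(\<forall>p\<in>{1..n}. \<forall>q\<in>{1..n}. \<not> bad ?g (mu \<mu>) p q) \<longleftrightarrow> P_set n k i \<Gamma>\<sigma> = {}"
  proof
    assume a: "\<forall>p\<in>{1..n}. \<forall>q\<in>{1..n}. \<not> bad ?g (mu \<mu>) p q"
    have "?g (?c p) - ?g (?c q) \<noteq> 2 * k \<and> ?g (?c p) - ?g (?c q) \<noteq> - 2 * k"
      if "p \<in> {1..n}" "q \<in> {1..n}" "p \<le> i \<longleftrightarrow> q \<le> i" for p q
    proof -
      have "\<not> bad ?g (mu \<mu>) (?c p) (?c q)" using a im that(1,2) by blast
      then show ?thesis unfolding bad_def using mu_eq[OF that(1,2)] that(3) by blast
    qed
    then show "P_set n k i \<Gamma>\<sigma> = {}" unfolding P by blast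
  next
    assume "P_set n k i \<Gamma>\<sigma> = {}"
    then have a: "?g (?c p) - ?g (?c q) \<noteq> 2 * k \<and> ?g (?c p) - ?g (?c q) \<noteq> - 2 * k"
      if "p \<in> {1..n}" "q \<in> {1..n}" "p < q" "p \<le> i \<longleftrightarrow> q \<le> i" for p q
      unfolding P using that by blast
    have less: "\<not> bad ?g (mu \<mu>) (?c p) (?c q)" if "p \<in> {1..n}" "q \<in> {1..n}" "p < q" for p q
      unfolding bad_def mu_eq[OF that(1,2)] using a[OF that] by blast
    have nb: "\<not> bad ?g (mu \<mu>) (?c p) (?c q)" if "p \<in> {1..n}" "q \<in> {1..n}" for p q
    proof -
      consider "p < q" | "q < p" | "p = q" by linarith
      then show ?thesis
      proof cases
        case 1
        then show ?thesis by (rule less[OF that])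
      next
        case 2
        then show ?thesis using less[OF that(2,1)] bad_sym by blast
      next
        case 3
        then show ?thesis using k by (simp add: bad_def)
      qed
    qed
    show "\<forall>p\<in>{1..n}. \<forall>q\<in>{1..n}. \<not> bad ?g (mu \<mu>) p q"
    proof (intro ballI)
      fix p q assume pq: "p \<in> {1..n}" "q \<in> {1..n}"
      have "inv_into UNIV ?c p \<in> {1..n}" "inv_into UNIV ?c q \<in> {1..n}"
        using pq permutes_in_image[OF permutes_inv[OF c]] by blast+
      from nb[OF this] show "\<not> bad ?g (mu \<mu>) p q" unfolding permutes_inverses(1)[OF c] .
    qed
  qed
  have "n > 0" using n2 by simp
  have sw: "(\<exists>w. swaps w \<and> (\<forall>j\<in>{1..n}. ?g (w j) = ?g j)) \<longleftrightarrow>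
      (\<exists>w. w permutes {1..n} \<and> (\<forall>j\<in>{1..n}. ?g (w j) = ?g j \<and> mu \<mu> (w j) = - mu \<mu> j))"
    unfolding swaps_def by blast
  show "simple_module (H_D n k) (principal_series n k \<Gamma> (restrict \<mu> (U_D n))) \<longleftrightarrow>
      P_set n k i \<Gamma>\<sigma> = {} \<and> \<not> (\<exists>w. swaps w \<and> (\<forall>j\<in>{1..n}. ?g (w j) = ?g j))"
    unfolding simple_principal_series_iff[OF \<Gamma> \<mu>] sw P'[symmetric]
    by (rule irred_iff[OF k \<open>n > 0\<close> mu_sq[OF \<mu>]])
  assume ni: "n = 2 * i"
  have orb: "act_tau n i \<Gamma>\<sigma> \<in> (\<lambda>w. act_dual n w \<Gamma>\<sigma>) ` Weyl n (R_sub n i) \<longleftrightarrow>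
      (\<exists>h. h permutes {1..n} \<and> (\<forall>j\<in>{1..n}. ?g (?c (h j)) = ?g (?c j) \<and> (h j \<le> i \<longleftrightarrow> \<not> j \<le> i)))"
    by (rule act_tau_in_orbit_iff[OF ni]) (rule exp)
  have "mu \<mu> (?c (h j)) = - mu \<mu> (?c j) \<longleftrightarrow> (h j \<le> i \<longleftrightarrow> \<not> j \<le> i)"
    if "h permutes {1..n}" "j \<in> {1..n}" for h j
  proof -
    have "h j \<in> {1..n}" using permutes_in_image[OF that(1)] that(2) by blast
    then show ?thesis unfolding mu[OF \<open>h j \<in> {1..n}\<close>] mu[OF that(2)] by simp
  qed
  then have "(\<exists>h. h permutes {1..n} \<and> (\<forall>j\<in>{1..n}. ?g (?c (h j)) = ?g (?c j) \<and> mu \<mu> (?c (h j)) = - mu \<mu> (?c j))) \<longleftrightarrow>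
      (\<exists>h. h permutes {1..n} \<and> (\<forall>j\<in>{1..n}. ?g (?c (h j)) = ?g (?c j) \<and> (h j \<le> i \<longleftrightarrow> \<not> j \<le> i)))"
    by (metis (no_types, lifting))
  then show "act_tau n i \<Gamma>\<sigma> \<in> (\<lambda>w. act_dual n w \<Gamma>\<sigma>) ` Weyl n (R_sub n i) \<longleftrightarrow>
      (\<exists>w. swaps w \<and> (\<forall>j\<in>{1..n}. ?g (w j) = ?g j))"
    unfolding orb sw ex_permutes_conjugate[OF c, where Q = "\<lambda>a b. ?g a = ?g b \<and> mu \<mu> a = - mu \<mu> b"] by simp
qed

end

theorem mainTheorem2:
  fixes n :: nat and k :: complex and \<gamma> :: "cvec \<Rightarrow> complex" and \<mu> :: "endo \<Rightarrow> complex"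
  assumes "n \<ge> 2" and "k \<noteq> 0"
    and "\<gamma> \<in> dualVC n" and "\<mu> \<in> char_group (T_B n)"
  defines "\<mu>' \<equiv> restrict \<mu> (U_D n)"
    and "i \<equiv> card (plus_set n \<mu>)"
    and "\<gamma>\<sigma> \<equiv> act_dual n (sigma n \<mu>) \<gamma>"
  shows "(stabA n (T_B n) \<mu> = stabA n (U_D n) \<mu>' \<longrightarrow>
           (simple_module (H_D n k) (principal_series n k \<gamma> \<mu>') \<longleftrightarrow> P_set n k i \<gamma>\<sigma> = {})) \<and>
         (stabA n (T_B n) \<mu> \<noteq> stabA n (U_D n) \<mu>' \<longrightarrow>
           (\<exists>m. n = 2 * m \<and> i = m \<and>
             (simple_module (H_D n k) (principal_series n k \<gamma> \<mu>') \<longleftrightarrow>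
                P_set n k m \<gamma>\<sigma> = {} \<and>
                act_tau n m \<gamma>\<sigma> \<notin> (\<lambda>w. act_dual n w \<gamma>\<sigma>) ` Weyl n (R_sub n m))))"
proof -
  interpret hecke_algebra n k by unfold_locales (rule assms(1))
  note crit = principal_series_criterion[OF assms(2-4), folded \<mu>'_def i_def \<gamma>\<sigma>_def]
  note stab = stab_neq_iff[OF assms(4), folded \<mu>'_def]
  show ?thesis
  proof (intro conjI impI)
    \<comment> \<open>With equal stabilisers no permutation reverses all signs, so the second
      condition of the criterion holds vacuously.\<close>
    assume "stabA n (T_B n) \<mu> = stabA n (U_D n) \<mu>'"
    then show "simple_module (H_D n k) (principal_series n k \<gamma> \<mu>') \<longleftrightarrow> P_set n k i \<gamma>\<sigma> = {}"
      using stab crit(1) by blast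
  next
    assume "stabA n (T_B n) \<mu> \<noteq> stabA n (U_D n) \<mu>'"
    then obtain w where w: "w permutes {1..n}" "\<And>j. j \<in> {1..n} \<Longrightarrow> mu \<mu> (w j) = - mu \<mu> j"
      unfolding stab by blast
    have ni: "n = 2 * i" unfolding i_def by (rule sign_swap_card[OF assms(4) w])
    show "\<exists>m. n = 2 * m \<and> i = m \<and>
             (simple_module (H_D n k) (principal_series n k \<gamma> \<mu>') \<longleftrightarrow>
                P_set n k m \<gamma>\<sigma> = {} \<and>
                act_tau n m \<gamma>\<sigma> \<notin> (\<lambda>w. act_dual n w \<gamma>\<sigma>) ` Weyl n (R_sub n m))"
      by (rule exI[of _ i]) (simp only: crit(1) crit(2)[OF ni] flip: ni)
  qed
qed

end
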